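(* (Join connectivity theorem) Consider an $M$-connected map $f:A\to X$ and an $N$-connected map $g:B\to X$. Then the join $f\ast g:A\ast_X B\to X$ is $(M\ast N)$-connected.
   Context: Setting: Martin-Löf type theory with function extensionality and a univalent universe $\mathcal{U}$ closed under the usual type formers and homotopy pushouts; types (including $M,N$) are in $\mathcal{U}$. For $f:A\to X$ and $g:B\to X$, $A\ast_X B$ is the pushout of $A\xleftarrow{\pi_1}A\times_X B\xrightarrow{\pi_2}B$, where $A\times_X B=\sum_{a:A}\sum_{b:B}f(a)=g(b)$, and $f\ast g:A\ast_X B\to X$ is the map induced from $f$, $g$ and the canonical homotopy $f\circ\pi_1\sim g\circ\pi_2$. The join $M\ast N$ of types is the pushout of the projections $M\leftarrow M\times N\to N$. A type $A$ is $M$-local if the map $\lambda a.\lambda x.\,a:A\to(M\to A)$ is an equivalence. A type $A$ is $M$-connected if every $M$-local type is $A$-local; a map is $M$-connected if all of its homotopy fibers are $M$-connected. *)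

theory Defs
  imports Main
begin

section \<open>Raw syntax\<close>

text \<open>
  The statement lives in Martin-Loef type theory, not in HOL, so that theory is represented
  as a deductive system: raw terms with de Bruijn indices and inductively defined judgments.
  (A shallow embedding, in which type-theoretic functions are HOL functions, would be inconsistent
  with univalence.)

  There is one universe of small types, \<open>Univ\<close>.  The pseudo-sort \<open>Ty\<close> only serves to write the
  judgment ``\<open>A\<close> is a type'' as \<open>A : Ty\<close>; it is not itself a type, so there are neither variables
  of type \<open>Ty\<close> nor functions into \<open>Ty\<close>.

  Number of variables bound by the arguments: two in the second argument of \<open>IndSig\<close>, in the first
  of \<open>J\<close> and in the third of \<open>IndNum\<close>; one in the second argument of \<open>Pi\<close>, \<open>Lam\<close>, \<open>Sig\<close>,
  in the first argument of \<open>Pair\<close> and of every eliminator except \<open>J\<close>, in the second and third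
  argument of \<open>IndPlus\<close>, in the first four of \<open>IndPush\<close>, and in the third to sixth of \<open>PushBeta\<close>.

  Introductory forms carry just enough annotation that the type of a term is determined up to
  judgmental equality by the term and its context: \<open>Pair B a b\<close> is the pair in \<open>\<Sigma>(x:A). B\<close>,
  \<open>InL B a\<close> and \<open>InR A b\<close> are the injections into \<open>A + B\<close>, and \<open>Push f g\<close> is the homotopy pushout
  of \<open>A \<leftarrow> C \<rightarrow> B\<close> along \<open>f : C \<rightarrow> A\<close> and \<open>g : C \<rightarrow> B\<close>.
\<close>

datatype tm =
    Var nat
  | Univ
  | Ty
  | Pi tm tm | Lam tm tm | App tm tm
  | Sig tm tm | Pair tm tm tm | IndSig tm tm tm
  | Eq tm tm tm | Refl tm | J tm tm tm
  | Emp | IndEmp tm tm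
  | One | Star | IndOne tm tm tm
  | Plus tm tm | InL tm tm | InR tm tm | IndPlus tm tm tm tm
  | Num | Zero | Succ tm | IndNum tm tm tm tm
  | Push tm tm | PushL tm tm tm | PushR tm tm tm | Glue tm tm tm
  | IndPush tm tm tm tm tm | PushBeta tm tm tm tm tm tm tm
  | FunExt tm tm
  | Ua tm tm


section \<open>Substitution\<close>

abbreviation scons :: "'a \<Rightarrow> (nat \<Rightarrow> 'a) \<Rightarrow> nat \<Rightarrow> 'a"  (infixr \<open>\<cdot>\<close> 75)
  where "a \<cdot> \<sigma> \<equiv> case_nat a \<sigma>"

definition upr :: "(nat \<Rightarrow> nat) \<Rightarrow> nat \<Rightarrow> nat"
  where "upr \<xi> = 0 \<cdot> (\<lambda>n. Suc (\<xi> n))"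

primrec ren :: "tm \<Rightarrow> (nat \<Rightarrow> nat) \<Rightarrow> tm" where
  "ren (Var n) \<xi> = Var (\<xi> n)"
| "ren Univ \<xi> = Univ"
| "ren Ty \<xi> = Ty"
| "ren (Pi A B) \<xi> = Pi (ren A \<xi>) (ren B (upr \<xi>))"
| "ren (Lam A b) \<xi> = Lam (ren A \<xi>) (ren b (upr \<xi>))"
| "ren (App f a) \<xi> = App (ren f \<xi>) (ren a \<xi>)"
| "ren (Sig A B) \<xi> = Sig (ren A \<xi>) (ren B (upr \<xi>))"
| "ren (Pair B a b) \<xi> = Pair (ren B (upr \<xi>)) (ren a \<xi>) (ren b \<xi>)"
| "ren (IndSig C d p) \<xi> = IndSig (ren C (upr \<xi>)) (ren d (upr (upr \<xi>))) (ren p \<xi>)"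
| "ren (Eq A a b) \<xi> = Eq (ren A \<xi>) (ren a \<xi>) (ren b \<xi>)"
| "ren (Refl a) \<xi> = Refl (ren a \<xi>)"
| "ren (J C d p) \<xi> = J (ren C (upr (upr \<xi>))) (ren d \<xi>) (ren p \<xi>)"
| "ren Emp \<xi> = Emp"
| "ren (IndEmp C e) \<xi> = IndEmp (ren C (upr \<xi>)) (ren e \<xi>)"
| "ren One \<xi> = One"
| "ren Star \<xi> = Star"
| "ren (IndOne C d u) \<xi> = IndOne (ren C (upr \<xi>)) (ren d \<xi>) (ren u \<xi>)"
| "ren (Plus A B) \<xi> = Plus (ren A \<xi>) (ren B \<xi>)"
| "ren (InL B a) \<xi> = InL (ren B \<xi>) (ren a \<xi>)"
| "ren (InR A b) \<xi> = InR (ren A \<xi>) (ren b \<xi>)"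
| "ren (IndPlus C l r t) \<xi> =
     IndPlus (ren C (upr \<xi>)) (ren l (upr \<xi>)) (ren r (upr \<xi>)) (ren t \<xi>)"
| "ren Num \<xi> = Num"
| "ren Zero \<xi> = Zero"
| "ren (Succ n) \<xi> = Succ (ren n \<xi>)"
| "ren (IndNum C z s n) \<xi> = IndNum (ren C (upr \<xi>)) (ren z \<xi>) (ren s (upr (upr \<xi>))) (ren n \<xi>)"
| "ren (Push f g) \<xi> = Push (ren f \<xi>) (ren g \<xi>)"
| "ren (PushL f g a) \<xi> = PushL (ren f \<xi>) (ren g \<xi>) (ren a \<xi>)"
| "ren (PushR f g b) \<xi> = PushR (ren f \<xi>) (ren g \<xi>) (ren b \<xi>)"
| "ren (Glue f g c) \<xi> = Glue (ren f \<xi>) (ren g \<xi>) (ren c \<xi>)"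
| "ren (IndPush D l r q t) \<xi> =
     IndPush (ren D (upr \<xi>)) (ren l (upr \<xi>)) (ren r (upr \<xi>)) (ren q (upr \<xi>)) (ren t \<xi>)"
| "ren (PushBeta f g D l r q c) \<xi> =
     PushBeta (ren f \<xi>) (ren g \<xi>) (ren D (upr \<xi>)) (ren l (upr \<xi>)) (ren r (upr \<xi>))
       (ren q (upr \<xi>)) (ren c \<xi>)"
| "ren (FunExt f g) \<xi> = FunExt (ren f \<xi>) (ren g \<xi>)"
| "ren (Ua A B) \<xi> = Ua (ren A \<xi>) (ren B \<xi>)"

definition up :: "(nat \<Rightarrow> tm) \<Rightarrow> nat \<Rightarrow> tm"
  where "up \<sigma> = Var 0 \<cdot> (\<lambda>n. ren (\<sigma> n) Suc)"

primrec sub :: "tm \<Rightarrow> (nat \<Rightarrow> tm) \<Rightarrow> tm" where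
  "sub (Var n) \<sigma> = \<sigma> n"
| "sub Univ \<sigma> = Univ"
| "sub Ty \<sigma> = Ty"
| "sub (Pi A B) \<sigma> = Pi (sub A \<sigma>) (sub B (up \<sigma>))"
| "sub (Lam A b) \<sigma> = Lam (sub A \<sigma>) (sub b (up \<sigma>))"
| "sub (App f a) \<sigma> = App (sub f \<sigma>) (sub a \<sigma>)"
| "sub (Sig A B) \<sigma> = Sig (sub A \<sigma>) (sub B (up \<sigma>))"
| "sub (Pair B a b) \<sigma> = Pair (sub B (up \<sigma>)) (sub a \<sigma>) (sub b \<sigma>)"
| "sub (IndSig C d p) \<sigma> = IndSig (sub C (up \<sigma>)) (sub d (up (up \<sigma>))) (sub p \<sigma>)"
| "sub (Eq A a b) \<sigma> = Eq (sub A \<sigma>) (sub a \<sigma>) (sub b \<sigma>)"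
| "sub (Refl a) \<sigma> = Refl (sub a \<sigma>)"
| "sub (J C d p) \<sigma> = J (sub C (up (up \<sigma>))) (sub d \<sigma>) (sub p \<sigma>)"
| "sub Emp \<sigma> = Emp"
| "sub (IndEmp C e) \<sigma> = IndEmp (sub C (up \<sigma>)) (sub e \<sigma>)"
| "sub One \<sigma> = One"
| "sub Star \<sigma> = Star"
| "sub (IndOne C d u) \<sigma> = IndOne (sub C (up \<sigma>)) (sub d \<sigma>) (sub u \<sigma>)"
| "sub (Plus A B) \<sigma> = Plus (sub A \<sigma>) (sub B \<sigma>)"
| "sub (InL B a) \<sigma> = InL (sub B \<sigma>) (sub a \<sigma>)"
| "sub (InR A b) \<sigma> = InR (sub A \<sigma>) (sub b \<sigma>)"
| "sub (IndPlus C l r t) \<sigma> =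
     IndPlus (sub C (up \<sigma>)) (sub l (up \<sigma>)) (sub r (up \<sigma>)) (sub t \<sigma>)"
| "sub Num \<sigma> = Num"
| "sub Zero \<sigma> = Zero"
| "sub (Succ n) \<sigma> = Succ (sub n \<sigma>)"
| "sub (IndNum C z s n) \<sigma> = IndNum (sub C (up \<sigma>)) (sub z \<sigma>) (sub s (up (up \<sigma>))) (sub n \<sigma>)"
| "sub (Push f g) \<sigma> = Push (sub f \<sigma>) (sub g \<sigma>)"
| "sub (PushL f g a) \<sigma> = PushL (sub f \<sigma>) (sub g \<sigma>) (sub a \<sigma>)"
| "sub (PushR f g b) \<sigma> = PushR (sub f \<sigma>) (sub g \<sigma>) (sub b \<sigma>)"
| "sub (Glue f g c) \<sigma> = Glue (sub f \<sigma>) (sub g \<sigma>) (sub c \<sigma>)"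
| "sub (IndPush D l r q t) \<sigma> =
     IndPush (sub D (up \<sigma>)) (sub l (up \<sigma>)) (sub r (up \<sigma>)) (sub q (up \<sigma>)) (sub t \<sigma>)"
| "sub (PushBeta f g D l r q c) \<sigma> =
     PushBeta (sub f \<sigma>) (sub g \<sigma>) (sub D (up \<sigma>)) (sub l (up \<sigma>)) (sub r (up \<sigma>))
       (sub q (up \<sigma>)) (sub c \<sigma>)"
| "sub (FunExt f g) \<sigma> = FunExt (sub f \<sigma>) (sub g \<sigma>)"
| "sub (Ua A B) \<sigma> = Ua (sub A \<sigma>) (sub B \<sigma>)"

text \<open>
  \<open>wk k\<close> weakens by \<open>k\<close> fresh variables; \<open>wk1 k\<close> weakens by \<open>k\<close> fresh variables inserted directly
  below the most recent variable, for terms under one binder.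
  \<open>t\<lbrakk>a\<rbrakk>\<close> instantiates the most recent variable; in \<open>t\<lbrakk>a, b\<rbrakk>\<close> the most recent one
  is replaced by \<open>b\<close> and the one before it by \<open>a\<close>.
\<close>

definition wk :: "nat \<Rightarrow> tm \<Rightarrow> tm"
  where "wk k t = ren t (\<lambda>n. n + k)"

definition wk1 :: "nat \<Rightarrow> tm \<Rightarrow> tm"
  where "wk1 k t = ren t (0 \<cdot> (\<lambda>n. Suc (n + k)))"

definition inst :: "tm \<Rightarrow> tm \<Rightarrow> tm"  (\<open>_\<lbrakk>_\<rbrakk>\<close> [1000, 0] 1000)
  where "t\<lbrakk>a\<rbrakk> = sub t (a \<cdot> Var)"

definition inst2 :: "tm \<Rightarrow> tm \<Rightarrow> tm \<Rightarrow> tm"  (\<open>_\<lbrakk>_,/ _\<rbrakk>\<close> [1000, 0, 0] 1000)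
  where "t\<lbrakk>a, b\<rbrakk> = sub t (b \<cdot> a \<cdot> Var)"

text \<open>
  \<open>subst_at k t a\<close> replaces the most recent variable of \<open>t\<close> by a term \<open>a\<close> that lives in a context with
  \<open>k\<close> further variables in its place.
\<close>

definition subst_at :: "nat \<Rightarrow> tm \<Rightarrow> tm \<Rightarrow> tm"
  where "subst_at k t a = sub t (a \<cdot> (\<lambda>n. Var (n + k)))"


section \<open>Derived type-theoretic notions\<close>

text \<open>
  All notions of this section are defined for terms in an arbitrary context \<open>\<Gamma>\<close>.
\<close>

definition Arr :: "tm \<Rightarrow> tm \<Rightarrow> tm"
  where "Arr A B = Pi A (wk 1 B)"

definition Prod :: "tm \<Rightarrow> tm \<Rightarrow> tm"
  where "Prod A B = Sig A (wk 1 B)"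

definition idfun :: "tm \<Rightarrow> tm"
  where "idfun A = Lam A (Var 0)"

text \<open>Projections of \<open>p : \<Sigma>(x:A). B\<close>.\<close>

definition proj1 :: "tm \<Rightarrow> tm \<Rightarrow> tm"
  where "proj1 A p = IndSig (wk 1 A) (Var 1) p"

definition proj2 :: "tm \<Rightarrow> tm \<Rightarrow> tm \<Rightarrow> tm"
  where "proj2 A B p = IndSig (subst_at 1 B (proj1 (wk 1 A) (Var 0))) (Var 0) p"

subsection \<open>Paths\<close>

text \<open>Concatenation of \<open>p : x =\<^sub>A y\<close> and \<open>q : y =\<^sub>A z\<close>.\<close>

definition concat_path :: "tm \<Rightarrow> tm \<Rightarrow> tm \<Rightarrow> tm \<Rightarrow> tm"
  where "concat_path A x p q = J (Eq (wk 2 A) (wk 2 x) (Var 1)) p q"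

text \<open>Transport of \<open>u : D\<lbrakk>x\<rbrakk>\<close> along \<open>p : x = y\<close>, where \<open>D\<close> is a family in context \<open>\<Gamma>, y:A\<close>.\<close>

definition transport :: "tm \<Rightarrow> tm \<Rightarrow> tm \<Rightarrow> tm \<Rightarrow> tm"
  where "transport D x p u = App (J (Arr (wk 2 (D\<lbrakk>x\<rbrakk>)) (wk 1 D)) (idfun (D\<lbrakk>x\<rbrakk>)) p) u"

text \<open>The path \<open>transport D x p (k\<lbrakk>x\<rbrakk>) = k\<lbrakk>y\<rbrakk>\<close> for a section \<open>k : D\<close> in context \<open>\<Gamma>, y:A\<close>
  and \<open>p : x = y\<close>.\<close>

definition apd :: "tm \<Rightarrow> tm \<Rightarrow> tm \<Rightarrow> tm \<Rightarrow> tm"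
  where "apd D x k p =
    J (Eq (wk 1 D) (transport (wk1 2 D) (wk 2 x) (Var 0) (wk 2 (k\<lbrakk>x\<rbrakk>))) (wk 1 k))
      (Refl (k\<lbrakk>x\<rbrakk>)) p"

text \<open>The path \<open>transport (\<lambda>_. X) x p u = u\<close>.\<close>

definition transport_const :: "tm \<Rightarrow> tm \<Rightarrow> tm \<Rightarrow> tm \<Rightarrow> tm"
  where "transport_const X x p u =
    J (Eq (wk 2 X) (transport (wk 3 X) (wk 2 x) (Var 0) (wk 2 u)) (wk 2 u)) (Refl u) p"

subsection \<open>Equivalences\<close>

text \<open>A map \<open>f : A \<rightarrow> B\<close> is an equivalence if it has a section and a retraction.\<close>

definition sec_htpy :: "tm \<Rightarrow> tm \<Rightarrow> tm"  \<comment> \<open>family over \<open>h : B \<rightarrow> A\<close>\<close>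
  where "sec_htpy B f =
    Pi (wk 1 B) (Eq (wk 2 B) (App (wk 2 f) (App (Var 1) (Var 0))) (Var 0))"

definition ret_htpy :: "tm \<Rightarrow> tm \<Rightarrow> tm"  \<comment> \<open>family over \<open>h : B \<rightarrow> A\<close>\<close>
  where "ret_htpy A f =
    Pi (wk 1 A) (Eq (wk 2 A) (App (Var 1) (App (wk 2 f) (Var 0))) (Var 0))"

definition is_equiv :: "tm \<Rightarrow> tm \<Rightarrow> tm \<Rightarrow> tm"
  where "is_equiv A B f =
    Prod (Sig (Arr B A) (sec_htpy B f)) (Sig (Arr B A) (ret_htpy A f))"

definition Equiv :: "tm \<Rightarrow> tm \<Rightarrow> tm"
  where "Equiv A B = Sig (Arr A B) (is_equiv (wk 1 A) (wk 1 B) (Var 0))"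

definition id_equiv :: "tm \<Rightarrow> tm"
  where "id_equiv A =
    Pair (is_equiv (wk 1 A) (wk 1 A) (Var 0)) (idfun A)
      (Pair (wk 1 (Sig (Arr A A) (ret_htpy A (idfun A))))
        (Pair (sec_htpy A (idfun A)) (idfun A) (Lam A (Refl (Var 0))))
        (Pair (ret_htpy A (idfun A)) (idfun A) (Lam A (Refl (Var 0)))))"

text \<open>\<open>happly : f = g \<rightarrow> (\<Prod>(x:A). f x =\<^sub>B g x)\<close> for \<open>f, g : \<Prod>(x:A). B\<close>\<close>

definition htpy :: "tm \<Rightarrow> tm \<Rightarrow> tm \<Rightarrow> tm \<Rightarrow> tm"
  where "htpy A B f g = Pi A (Eq B (App (wk 1 f) (Var 0)) (App (wk 1 g) (Var 0)))"

definition happly :: "tm \<Rightarrow> tm \<Rightarrow> tm \<Rightarrow> tm \<Rightarrow> tm"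
  where "happly A B f g =
    Lam (Eq (Pi A B) f g)
      (J (htpy (wk 3 A) (wk1 3 B) (wk 3 f) (Var 1))
         (Lam (wk 1 A) (Refl (App (wk 2 f) (Var 0))))
         (Var 0))"

text \<open>\<open>id_to_equiv : A =\<^sub>\<U> B \<rightarrow> A \<simeq> B\<close>\<close>

definition id_to_equiv :: "tm \<Rightarrow> tm \<Rightarrow> tm"
  where "id_to_equiv A B =
    Lam (Eq Univ A B) (J (Equiv (wk 3 A) (Var 1)) (id_equiv (wk 1 A)) (Var 0))"

subsection \<open>Pushouts\<close>

text \<open>
  The type of dependent paths over \<open>glue c\<close> from \<open>l (f c)\<close> to \<open>r (g c)\<close> in the family \<open>D\<close>
  over \<open>Push f g\<close>; \<open>glue_over\<close> is this type for a generic \<open>c\<close>, in context \<open>\<Gamma>, c:C\<close>.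
\<close>

definition glue_over_at :: "tm \<Rightarrow> tm \<Rightarrow> tm \<Rightarrow> tm \<Rightarrow> tm \<Rightarrow> tm \<Rightarrow> tm"
  where "glue_over_at f g D l r c =
    Eq (D\<lbrakk>PushR f g (App g c)\<rbrakk>)
       (transport D (PushL f g (App f c)) (Glue f g c) (l\<lbrakk>App f c\<rbrakk>))
       (r\<lbrakk>App g c\<rbrakk>)"

definition glue_over :: "tm \<Rightarrow> tm \<Rightarrow> tm \<Rightarrow> tm \<Rightarrow> tm \<Rightarrow> tm"
  where "glue_over f g D l r =
    glue_over_at (wk 1 f) (wk 1 g) (wk1 1 D) (wk1 1 l) (wk1 1 r) (Var 0)"

text \<open>The path \<open>apd (IndPush D l r q) (glue c) = q c\<close>.\<close>

definition push_beta_type :: "tm \<Rightarrow> tm \<Rightarrow> tm \<Rightarrow> tm \<Rightarrow> tm \<Rightarrow> tm \<Rightarrow> tm \<Rightarrow> tm"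
  where "push_beta_type f g D l r q c =
    Eq (glue_over_at f g D l r c)
       (apd D (PushL f g (App f c))
          (IndPush (wk1 1 D) (wk1 1 l) (wk1 1 r) (wk1 1 q) (Var 0)) (Glue f g c))
       (q\<lbrakk>c\<rbrakk>)"

text \<open>
  The map \<open>Push f g \<rightarrow> X\<close> induced by \<open>h : A \<rightarrow> X\<close>, \<open>k : B \<rightarrow> X\<close> and a homotopy
  \<open>H : \<Prod>(c:C). h (f c) = k (g c)\<close>.
\<close>

definition push_map :: "tm \<Rightarrow> tm \<Rightarrow> tm \<Rightarrow> tm \<Rightarrow> tm \<Rightarrow> tm \<Rightarrow> tm"
  where "push_map X f g h k H =
    Lam (Push f g)
      (IndPush (wk 2 X) (App (wk 2 h) (Var 0)) (App (wk 2 k) (Var 0))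
        (let x = PushL (wk 2 f) (wk 2 g) (App (wk 2 f) (Var 0));
             p = Glue (wk 2 f) (wk 2 g) (Var 0);
             u = App (wk 2 h) (App (wk 2 f) (Var 0))
         in concat_path (wk 2 X) (transport (wk 3 X) x p u) (transport_const (wk 2 X) x p u)
              (App (wk 2 H) (Var 0)))
        (Var 0))"


section \<open>The type theory\<close>

text \<open>
  Contexts are lists with the most recent variable first.  In the formation rules \<open>s = Ty\<close> is the
  formation of types and \<open>s = Univ\<close> is closure of the universe.

  Weakening and substitution are rules of the system (\<open>sub_typ\<close>, \<open>sub_eq\<close>, \<open>sub_cong\<close>), in the
  form of closure under simultaneous substitutions \<open>\<Delta> \<turnstile> \<sigma> : \<Gamma>\<close>; the type of \<open>\<sigma> i\<close> is \<open>\<Gamma> ! i\<close> under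
  the part of \<open>\<sigma>\<close> that concerns the variables older than \<open>i\<close>.
  Congruence rules are given for the constructors that bind a variable or take a type which
  need not be small as an argument; for the other constructors congruence is an instance
  of \<open>sub_cong\<close>.
\<close>

inductive
  valid_ctx :: "tm list \<Rightarrow> bool"  (\<open>_ \<turnstile> \<^bold>\<surd>\<close> [51] 50) and
  has_type :: "tm list \<Rightarrow> tm \<Rightarrow> tm \<Rightarrow> bool"  (\<open>_ \<turnstile> _ \<^bold>: _\<close> [51, 51, 51] 50) and
  jdg_eq :: "tm list \<Rightarrow> tm \<Rightarrow> tm \<Rightarrow> tm \<Rightarrow> bool"  (\<open>_ \<turnstile> _ \<approx> _ \<^bold>: _\<close> [51, 51, 51, 51] 50)
where
  \<comment> \<open>contexts and structural rules\<close>
  ctx_nil: "[] \<turnstile> \<^bold>\<surd>"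
| ctx_cons: "\<Gamma> \<turnstile> A \<^bold>: Ty \<Longrightarrow> A # \<Gamma> \<turnstile> \<^bold>\<surd>"
| var: "\<Gamma> \<turnstile> \<^bold>\<surd> \<Longrightarrow> i < length \<Gamma> \<Longrightarrow> \<Gamma> \<turnstile> Var i \<^bold>: wk (Suc i) (\<Gamma> ! i)"
| sub_typ: "\<Delta> \<turnstile> \<^bold>\<surd> \<Longrightarrow> \<forall>i<length \<Gamma>. \<Delta> \<turnstile> \<sigma> i \<^bold>: sub (\<Gamma> ! i) (\<lambda>n. \<sigma> (n + Suc i)) \<Longrightarrow>
    \<Gamma> \<turnstile> a \<^bold>: A \<Longrightarrow> \<Delta> \<turnstile> sub a \<sigma> \<^bold>: sub A \<sigma>"
| sub_eq: "\<Delta> \<turnstile> \<^bold>\<surd> \<Longrightarrow> \<forall>i<length \<Gamma>. \<Delta> \<turnstile> \<sigma> i \<^bold>: sub (\<Gamma> ! i) (\<lambda>n. \<sigma> (n + Suc i)) \<Longrightarrow>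
    \<Gamma> \<turnstile> a \<approx> b \<^bold>: A \<Longrightarrow> \<Delta> \<turnstile> sub a \<sigma> \<approx> sub b \<sigma> \<^bold>: sub A \<sigma>"
| sub_cong: "\<Delta> \<turnstile> \<^bold>\<surd> \<Longrightarrow> \<forall>i<length \<Gamma>. \<Delta> \<turnstile> \<sigma> i \<approx> \<tau> i \<^bold>: sub (\<Gamma> ! i) (\<lambda>n. \<sigma> (n + Suc i)) \<Longrightarrow>
    \<Gamma> \<turnstile> a \<^bold>: A \<Longrightarrow> \<Delta> \<turnstile> sub a \<sigma> \<approx> sub a \<tau> \<^bold>: sub A \<sigma>"
| eq_refl: "\<Gamma> \<turnstile> a \<^bold>: A \<Longrightarrow> \<Gamma> \<turnstile> a \<approx> a \<^bold>: A"
| eq_sym: "\<Gamma> \<turnstile> a \<approx> b \<^bold>: A \<Longrightarrow> \<Gamma> \<turnstile> b \<approx> a \<^bold>: A"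
| eq_trans: "\<Gamma> \<turnstile> a \<approx> b \<^bold>: A \<Longrightarrow> \<Gamma> \<turnstile> b \<approx> c \<^bold>: A \<Longrightarrow> \<Gamma> \<turnstile> a \<approx> c \<^bold>: A"
| conv: "\<Gamma> \<turnstile> a \<^bold>: A \<Longrightarrow> \<Gamma> \<turnstile> A \<approx> B \<^bold>: Ty \<Longrightarrow> \<Gamma> \<turnstile> a \<^bold>: B"
| eq_conv: "\<Gamma> \<turnstile> a \<approx> b \<^bold>: A \<Longrightarrow> \<Gamma> \<turnstile> A \<approx> B \<^bold>: Ty \<Longrightarrow> \<Gamma> \<turnstile> a \<approx> b \<^bold>: B"
  \<comment> \<open>the universe\<close>
| univ_form: "\<Gamma> \<turnstile> \<^bold>\<surd> \<Longrightarrow> \<Gamma> \<turnstile> Univ \<^bold>: Ty"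
| small: "\<Gamma> \<turnstile> A \<^bold>: Univ \<Longrightarrow> \<Gamma> \<turnstile> A \<^bold>: Ty"
| eq_small: "\<Gamma> \<turnstile> A \<approx> B \<^bold>: Univ \<Longrightarrow> \<Gamma> \<turnstile> A \<approx> B \<^bold>: Ty"
  \<comment> \<open>dependent products\<close>
| pi_form: "s \<in> {Univ, Ty} \<Longrightarrow> \<Gamma> \<turnstile> A \<^bold>: s \<Longrightarrow> A # \<Gamma> \<turnstile> B \<^bold>: s \<Longrightarrow> \<Gamma> \<turnstile> Pi A B \<^bold>: s"
| pi_cong: "s \<in> {Univ, Ty} \<Longrightarrow> \<Gamma> \<turnstile> A \<approx> A' \<^bold>: s \<Longrightarrow> A # \<Gamma> \<turnstile> B \<approx> B' \<^bold>: s \<Longrightarrow>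
    \<Gamma> \<turnstile> Pi A B \<approx> Pi A' B' \<^bold>: s"
| lam: "A # \<Gamma> \<turnstile> B \<^bold>: Ty \<Longrightarrow> A # \<Gamma> \<turnstile> b \<^bold>: B \<Longrightarrow> \<Gamma> \<turnstile> Lam A b \<^bold>: Pi A B"
| lam_cong: "\<Gamma> \<turnstile> A \<approx> A' \<^bold>: Ty \<Longrightarrow> A # \<Gamma> \<turnstile> B \<^bold>: Ty \<Longrightarrow> A # \<Gamma> \<turnstile> b \<approx> b' \<^bold>: B \<Longrightarrow>
    \<Gamma> \<turnstile> Lam A b \<approx> Lam A' b' \<^bold>: Pi A B"
| app: "\<Gamma> \<turnstile> f \<^bold>: Pi A B \<Longrightarrow> \<Gamma> \<turnstile> a \<^bold>: A \<Longrightarrow> \<Gamma> \<turnstile> App f a \<^bold>: B\<lbrakk>a\<rbrakk>"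
| pi_beta: "A # \<Gamma> \<turnstile> B \<^bold>: Ty \<Longrightarrow> A # \<Gamma> \<turnstile> b \<^bold>: B \<Longrightarrow> \<Gamma> \<turnstile> a \<^bold>: A \<Longrightarrow>
    \<Gamma> \<turnstile> App (Lam A b) a \<approx> b\<lbrakk>a\<rbrakk> \<^bold>: B\<lbrakk>a\<rbrakk>"
| pi_eta: "\<Gamma> \<turnstile> f \<^bold>: Pi A B \<Longrightarrow> \<Gamma> \<turnstile> f \<approx> Lam A (App (wk 1 f) (Var 0)) \<^bold>: Pi A B"
  \<comment> \<open>dependent sums\<close>
| sig_form: "s \<in> {Univ, Ty} \<Longrightarrow> \<Gamma> \<turnstile> A \<^bold>: s \<Longrightarrow> A # \<Gamma> \<turnstile> B \<^bold>: s \<Longrightarrow> \<Gamma> \<turnstile> Sig A B \<^bold>: s"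
| sig_cong: "s \<in> {Univ, Ty} \<Longrightarrow> \<Gamma> \<turnstile> A \<approx> A' \<^bold>: s \<Longrightarrow> A # \<Gamma> \<turnstile> B \<approx> B' \<^bold>: s \<Longrightarrow>
    \<Gamma> \<turnstile> Sig A B \<approx> Sig A' B' \<^bold>: s"
| pair: "A # \<Gamma> \<turnstile> B \<^bold>: Ty \<Longrightarrow> \<Gamma> \<turnstile> a \<^bold>: A \<Longrightarrow> \<Gamma> \<turnstile> b \<^bold>: B\<lbrakk>a\<rbrakk> \<Longrightarrow> \<Gamma> \<turnstile> Pair B a b \<^bold>: Sig A B"
| pair_cong: "A # \<Gamma> \<turnstile> B \<approx> B' \<^bold>: Ty \<Longrightarrow> \<Gamma> \<turnstile> a \<approx> a' \<^bold>: A \<Longrightarrow> \<Gamma> \<turnstile> b \<approx> b' \<^bold>: B\<lbrakk>a\<rbrakk> \<Longrightarrow>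
    \<Gamma> \<turnstile> Pair B a b \<approx> Pair B' a' b' \<^bold>: Sig A B"
| sig_ind: "Sig A B # \<Gamma> \<turnstile> C \<^bold>: Ty \<Longrightarrow>
    B # A # \<Gamma> \<turnstile> d \<^bold>: subst_at 2 C (Pair (wk1 2 B) (Var 1) (Var 0)) \<Longrightarrow>
    \<Gamma> \<turnstile> p \<^bold>: Sig A B \<Longrightarrow> \<Gamma> \<turnstile> IndSig C d p \<^bold>: C\<lbrakk>p\<rbrakk>"
| sig_ind_cong: "Sig A B # \<Gamma> \<turnstile> C \<approx> C' \<^bold>: Ty \<Longrightarrow>
    B # A # \<Gamma> \<turnstile> d \<approx> d' \<^bold>: subst_at 2 C (Pair (wk1 2 B) (Var 1) (Var 0)) \<Longrightarrow>
    \<Gamma> \<turnstile> p \<approx> p' \<^bold>: Sig A B \<Longrightarrow> \<Gamma> \<turnstile> IndSig C d p \<approx> IndSig C' d' p' \<^bold>: C\<lbrakk>p\<rbrakk>"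
| sig_beta: "Sig A B # \<Gamma> \<turnstile> C \<^bold>: Ty \<Longrightarrow>
    B # A # \<Gamma> \<turnstile> d \<^bold>: subst_at 2 C (Pair (wk1 2 B) (Var 1) (Var 0)) \<Longrightarrow>
    \<Gamma> \<turnstile> a \<^bold>: A \<Longrightarrow> \<Gamma> \<turnstile> b \<^bold>: B\<lbrakk>a\<rbrakk> \<Longrightarrow>
    \<Gamma> \<turnstile> IndSig C d (Pair B a b) \<approx> d\<lbrakk>a, b\<rbrakk> \<^bold>: C\<lbrakk>Pair B a b\<rbrakk>"
  \<comment> \<open>identity types\<close>
| id_form: "s \<in> {Univ, Ty} \<Longrightarrow> \<Gamma> \<turnstile> A \<^bold>: s \<Longrightarrow> \<Gamma> \<turnstile> a \<^bold>: A \<Longrightarrow> \<Gamma> \<turnstile> b \<^bold>: A \<Longrightarrow> \<Gamma> \<turnstile> Eq A a b \<^bold>: s"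
| id_cong: "s \<in> {Univ, Ty} \<Longrightarrow> \<Gamma> \<turnstile> A \<approx> A' \<^bold>: s \<Longrightarrow> \<Gamma> \<turnstile> a \<approx> a' \<^bold>: A \<Longrightarrow> \<Gamma> \<turnstile> b \<approx> b' \<^bold>: A \<Longrightarrow>
    \<Gamma> \<turnstile> Eq A a b \<approx> Eq A' a' b' \<^bold>: s"
| refl: "\<Gamma> \<turnstile> A \<^bold>: Ty \<Longrightarrow> \<Gamma> \<turnstile> a \<^bold>: A \<Longrightarrow> \<Gamma> \<turnstile> Refl a \<^bold>: Eq A a a"
| id_ind: "\<Gamma> \<turnstile> a \<^bold>: A \<Longrightarrow> Eq (wk 1 A) (wk 1 a) (Var 0) # A # \<Gamma> \<turnstile> C \<^bold>: Ty \<Longrightarrow>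
    \<Gamma> \<turnstile> d \<^bold>: C\<lbrakk>a, Refl a\<rbrakk> \<Longrightarrow> \<Gamma> \<turnstile> b \<^bold>: A \<Longrightarrow> \<Gamma> \<turnstile> p \<^bold>: Eq A a b \<Longrightarrow> \<Gamma> \<turnstile> J C d p \<^bold>: C\<lbrakk>b, p\<rbrakk>"
| id_ind_cong: "\<Gamma> \<turnstile> a \<^bold>: A \<Longrightarrow> Eq (wk 1 A) (wk 1 a) (Var 0) # A # \<Gamma> \<turnstile> C \<approx> C' \<^bold>: Ty \<Longrightarrow>
    \<Gamma> \<turnstile> d \<approx> d' \<^bold>: C\<lbrakk>a, Refl a\<rbrakk> \<Longrightarrow> \<Gamma> \<turnstile> b \<^bold>: A \<Longrightarrow> \<Gamma> \<turnstile> p \<approx> p' \<^bold>: Eq A a b \<Longrightarrow>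
    \<Gamma> \<turnstile> J C d p \<approx> J C' d' p' \<^bold>: C\<lbrakk>b, p\<rbrakk>"
| id_beta: "\<Gamma> \<turnstile> a \<^bold>: A \<Longrightarrow> Eq (wk 1 A) (wk 1 a) (Var 0) # A # \<Gamma> \<turnstile> C \<^bold>: Ty \<Longrightarrow>
    \<Gamma> \<turnstile> d \<^bold>: C\<lbrakk>a, Refl a\<rbrakk> \<Longrightarrow> \<Gamma> \<turnstile> J C d (Refl a) \<approx> d \<^bold>: C\<lbrakk>a, Refl a\<rbrakk>"
  \<comment> \<open>empty type\<close>
| emp_form: "\<Gamma> \<turnstile> \<^bold>\<surd> \<Longrightarrow> \<Gamma> \<turnstile> Emp \<^bold>: Univ"
| emp_ind: "Emp # \<Gamma> \<turnstile> C \<^bold>: Ty \<Longrightarrow> \<Gamma> \<turnstile> e \<^bold>: Emp \<Longrightarrow> \<Gamma> \<turnstile> IndEmp C e \<^bold>: C\<lbrakk>e\<rbrakk>"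
| emp_ind_cong: "Emp # \<Gamma> \<turnstile> C \<approx> C' \<^bold>: Ty \<Longrightarrow> \<Gamma> \<turnstile> e \<approx> e' \<^bold>: Emp \<Longrightarrow>
    \<Gamma> \<turnstile> IndEmp C e \<approx> IndEmp C' e' \<^bold>: C\<lbrakk>e\<rbrakk>"
  \<comment> \<open>unit type\<close>
| one_form: "\<Gamma> \<turnstile> \<^bold>\<surd> \<Longrightarrow> \<Gamma> \<turnstile> One \<^bold>: Univ"
| star: "\<Gamma> \<turnstile> \<^bold>\<surd> \<Longrightarrow> \<Gamma> \<turnstile> Star \<^bold>: One"
| one_ind: "One # \<Gamma> \<turnstile> C \<^bold>: Ty \<Longrightarrow> \<Gamma> \<turnstile> d \<^bold>: C\<lbrakk>Star\<rbrakk> \<Longrightarrow> \<Gamma> \<turnstile> u \<^bold>: One \<Longrightarrow> \<Gamma> \<turnstile> IndOne C d u \<^bold>: C\<lbrakk>u\<rbrakk>"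
| one_ind_cong: "One # \<Gamma> \<turnstile> C \<approx> C' \<^bold>: Ty \<Longrightarrow> \<Gamma> \<turnstile> d \<approx> d' \<^bold>: C\<lbrakk>Star\<rbrakk> \<Longrightarrow> \<Gamma> \<turnstile> u \<approx> u' \<^bold>: One \<Longrightarrow>
    \<Gamma> \<turnstile> IndOne C d u \<approx> IndOne C' d' u' \<^bold>: C\<lbrakk>u\<rbrakk>"
| one_beta: "One # \<Gamma> \<turnstile> C \<^bold>: Ty \<Longrightarrow> \<Gamma> \<turnstile> d \<^bold>: C\<lbrakk>Star\<rbrakk> \<Longrightarrow> \<Gamma> \<turnstile> IndOne C d Star \<approx> d \<^bold>: C\<lbrakk>Star\<rbrakk>"
  \<comment> \<open>coproducts\<close>
| plus_form: "s \<in> {Univ, Ty} \<Longrightarrow> \<Gamma> \<turnstile> A \<^bold>: s \<Longrightarrow> \<Gamma> \<turnstile> B \<^bold>: s \<Longrightarrow> \<Gamma> \<turnstile> Plus A B \<^bold>: s"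
| plus_cong: "s \<in> {Univ, Ty} \<Longrightarrow> \<Gamma> \<turnstile> A \<approx> A' \<^bold>: s \<Longrightarrow> \<Gamma> \<turnstile> B \<approx> B' \<^bold>: s \<Longrightarrow>
    \<Gamma> \<turnstile> Plus A B \<approx> Plus A' B' \<^bold>: s"
| inl: "\<Gamma> \<turnstile> A \<^bold>: Ty \<Longrightarrow> \<Gamma> \<turnstile> B \<^bold>: Ty \<Longrightarrow> \<Gamma> \<turnstile> a \<^bold>: A \<Longrightarrow> \<Gamma> \<turnstile> InL B a \<^bold>: Plus A B"
| inl_cong: "\<Gamma> \<turnstile> A \<^bold>: Ty \<Longrightarrow> \<Gamma> \<turnstile> B \<approx> B' \<^bold>: Ty \<Longrightarrow> \<Gamma> \<turnstile> a \<approx> a' \<^bold>: A \<Longrightarrow>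
    \<Gamma> \<turnstile> InL B a \<approx> InL B' a' \<^bold>: Plus A B"
| inr: "\<Gamma> \<turnstile> A \<^bold>: Ty \<Longrightarrow> \<Gamma> \<turnstile> B \<^bold>: Ty \<Longrightarrow> \<Gamma> \<turnstile> b \<^bold>: B \<Longrightarrow> \<Gamma> \<turnstile> InR A b \<^bold>: Plus A B"
| inr_cong: "\<Gamma> \<turnstile> A \<approx> A' \<^bold>: Ty \<Longrightarrow> \<Gamma> \<turnstile> B \<^bold>: Ty \<Longrightarrow> \<Gamma> \<turnstile> b \<approx> b' \<^bold>: B \<Longrightarrow>
    \<Gamma> \<turnstile> InR A b \<approx> InR A' b' \<^bold>: Plus A B"
| plus_ind: "Plus A B # \<Gamma> \<turnstile> C \<^bold>: Ty \<Longrightarrow>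
    A # \<Gamma> \<turnstile> l \<^bold>: subst_at 1 C (InL (wk 1 B) (Var 0)) \<Longrightarrow> B # \<Gamma> \<turnstile> r \<^bold>: subst_at 1 C (InR (wk 1 A) (Var 0)) \<Longrightarrow>
    \<Gamma> \<turnstile> t \<^bold>: Plus A B \<Longrightarrow> \<Gamma> \<turnstile> IndPlus C l r t \<^bold>: C\<lbrakk>t\<rbrakk>"
| plus_ind_cong: "Plus A B # \<Gamma> \<turnstile> C \<approx> C' \<^bold>: Ty \<Longrightarrow>
    A # \<Gamma> \<turnstile> l \<approx> l' \<^bold>: subst_at 1 C (InL (wk 1 B) (Var 0)) \<Longrightarrow>
    B # \<Gamma> \<turnstile> r \<approx> r' \<^bold>: subst_at 1 C (InR (wk 1 A) (Var 0)) \<Longrightarrow>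
    \<Gamma> \<turnstile> t \<approx> t' \<^bold>: Plus A B \<Longrightarrow> \<Gamma> \<turnstile> IndPlus C l r t \<approx> IndPlus C' l' r' t' \<^bold>: C\<lbrakk>t\<rbrakk>"
| plus_beta_l: "Plus A B # \<Gamma> \<turnstile> C \<^bold>: Ty \<Longrightarrow>
    A # \<Gamma> \<turnstile> l \<^bold>: subst_at 1 C (InL (wk 1 B) (Var 0)) \<Longrightarrow> B # \<Gamma> \<turnstile> r \<^bold>: subst_at 1 C (InR (wk 1 A) (Var 0)) \<Longrightarrow>
    \<Gamma> \<turnstile> a \<^bold>: A \<Longrightarrow> \<Gamma> \<turnstile> IndPlus C l r (InL B a) \<approx> l\<lbrakk>a\<rbrakk> \<^bold>: C\<lbrakk>InL B a\<rbrakk>"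
| plus_beta_r: "Plus A B # \<Gamma> \<turnstile> C \<^bold>: Ty \<Longrightarrow>
    A # \<Gamma> \<turnstile> l \<^bold>: subst_at 1 C (InL (wk 1 B) (Var 0)) \<Longrightarrow> B # \<Gamma> \<turnstile> r \<^bold>: subst_at 1 C (InR (wk 1 A) (Var 0)) \<Longrightarrow>
    \<Gamma> \<turnstile> b \<^bold>: B \<Longrightarrow> \<Gamma> \<turnstile> IndPlus C l r (InR A b) \<approx> r\<lbrakk>b\<rbrakk> \<^bold>: C\<lbrakk>InR A b\<rbrakk>"
  \<comment> \<open>natural numbers\<close>
| num_form: "\<Gamma> \<turnstile> \<^bold>\<surd> \<Longrightarrow> \<Gamma> \<turnstile> Num \<^bold>: Univ"
| zero: "\<Gamma> \<turnstile> \<^bold>\<surd> \<Longrightarrow> \<Gamma> \<turnstile> Zero \<^bold>: Num"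
| succ: "\<Gamma> \<turnstile> n \<^bold>: Num \<Longrightarrow> \<Gamma> \<turnstile> Succ n \<^bold>: Num"
| num_ind: "Num # \<Gamma> \<turnstile> C \<^bold>: Ty \<Longrightarrow> \<Gamma> \<turnstile> z \<^bold>: C\<lbrakk>Zero\<rbrakk> \<Longrightarrow> C # Num # \<Gamma> \<turnstile> s \<^bold>: subst_at 2 C (Succ (Var 1)) \<Longrightarrow>
    \<Gamma> \<turnstile> n \<^bold>: Num \<Longrightarrow> \<Gamma> \<turnstile> IndNum C z s n \<^bold>: C\<lbrakk>n\<rbrakk>"
| num_ind_cong: "Num # \<Gamma> \<turnstile> C \<approx> C' \<^bold>: Ty \<Longrightarrow> \<Gamma> \<turnstile> z \<approx> z' \<^bold>: C\<lbrakk>Zero\<rbrakk> \<Longrightarrow>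
    C # Num # \<Gamma> \<turnstile> s \<approx> s' \<^bold>: subst_at 2 C (Succ (Var 1)) \<Longrightarrow> \<Gamma> \<turnstile> n \<approx> n' \<^bold>: Num \<Longrightarrow>
    \<Gamma> \<turnstile> IndNum C z s n \<approx> IndNum C' z' s' n' \<^bold>: C\<lbrakk>n\<rbrakk>"
| num_beta_0: "Num # \<Gamma> \<turnstile> C \<^bold>: Ty \<Longrightarrow> \<Gamma> \<turnstile> z \<^bold>: C\<lbrakk>Zero\<rbrakk> \<Longrightarrow>
    C # Num # \<Gamma> \<turnstile> s \<^bold>: subst_at 2 C (Succ (Var 1)) \<Longrightarrow> \<Gamma> \<turnstile> IndNum C z s Zero \<approx> z \<^bold>: C\<lbrakk>Zero\<rbrakk>"
| num_beta_S: "Num # \<Gamma> \<turnstile> C \<^bold>: Ty \<Longrightarrow> \<Gamma> \<turnstile> z \<^bold>: C\<lbrakk>Zero\<rbrakk> \<Longrightarrow>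
    C # Num # \<Gamma> \<turnstile> s \<^bold>: subst_at 2 C (Succ (Var 1)) \<Longrightarrow> \<Gamma> \<turnstile> n \<^bold>: Num \<Longrightarrow>
    \<Gamma> \<turnstile> IndNum C z s (Succ n) \<approx> s\<lbrakk>n, IndNum C z s n\<rbrakk> \<^bold>: C\<lbrakk>Succ n\<rbrakk>"
  \<comment> \<open>homotopy pushouts of small types; the computation rule on points is judgmental, the one
     on \<open>Glue\<close> is propositional\<close>
| push_form: "\<Gamma> \<turnstile> A \<^bold>: Univ \<Longrightarrow> \<Gamma> \<turnstile> B \<^bold>: Univ \<Longrightarrow> \<Gamma> \<turnstile> C \<^bold>: Univ \<Longrightarrow>
    \<Gamma> \<turnstile> f \<^bold>: Arr C A \<Longrightarrow> \<Gamma> \<turnstile> g \<^bold>: Arr C B \<Longrightarrow> \<Gamma> \<turnstile> Push f g \<^bold>: Univ"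
| push_l: "\<Gamma> \<turnstile> A \<^bold>: Univ \<Longrightarrow> \<Gamma> \<turnstile> B \<^bold>: Univ \<Longrightarrow> \<Gamma> \<turnstile> C \<^bold>: Univ \<Longrightarrow>
    \<Gamma> \<turnstile> f \<^bold>: Arr C A \<Longrightarrow> \<Gamma> \<turnstile> g \<^bold>: Arr C B \<Longrightarrow> \<Gamma> \<turnstile> a \<^bold>: A \<Longrightarrow> \<Gamma> \<turnstile> PushL f g a \<^bold>: Push f g"
| push_r: "\<Gamma> \<turnstile> A \<^bold>: Univ \<Longrightarrow> \<Gamma> \<turnstile> B \<^bold>: Univ \<Longrightarrow> \<Gamma> \<turnstile> C \<^bold>: Univ \<Longrightarrow>
    \<Gamma> \<turnstile> f \<^bold>: Arr C A \<Longrightarrow> \<Gamma> \<turnstile> g \<^bold>: Arr C B \<Longrightarrow> \<Gamma> \<turnstile> b \<^bold>: B \<Longrightarrow> \<Gamma> \<turnstile> PushR f g b \<^bold>: Push f g"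
| push_glue: "\<Gamma> \<turnstile> A \<^bold>: Univ \<Longrightarrow> \<Gamma> \<turnstile> B \<^bold>: Univ \<Longrightarrow> \<Gamma> \<turnstile> C \<^bold>: Univ \<Longrightarrow>
    \<Gamma> \<turnstile> f \<^bold>: Arr C A \<Longrightarrow> \<Gamma> \<turnstile> g \<^bold>: Arr C B \<Longrightarrow> \<Gamma> \<turnstile> c \<^bold>: C \<Longrightarrow>
    \<Gamma> \<turnstile> Glue f g c \<^bold>: Eq (Push f g) (PushL f g (App f c)) (PushR f g (App g c))"
| push_ind: "\<Gamma> \<turnstile> A \<^bold>: Univ \<Longrightarrow> \<Gamma> \<turnstile> B \<^bold>: Univ \<Longrightarrow> \<Gamma> \<turnstile> C \<^bold>: Univ \<Longrightarrow>
    \<Gamma> \<turnstile> f \<^bold>: Arr C A \<Longrightarrow> \<Gamma> \<turnstile> g \<^bold>: Arr C B \<Longrightarrow> Push f g # \<Gamma> \<turnstile> D \<^bold>: Ty \<Longrightarrow>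
    A # \<Gamma> \<turnstile> l \<^bold>: subst_at 1 D (PushL (wk 1 f) (wk 1 g) (Var 0)) \<Longrightarrow>
    B # \<Gamma> \<turnstile> r \<^bold>: subst_at 1 D (PushR (wk 1 f) (wk 1 g) (Var 0)) \<Longrightarrow>
    C # \<Gamma> \<turnstile> q \<^bold>: glue_over f g D l r \<Longrightarrow>
    \<Gamma> \<turnstile> t \<^bold>: Push f g \<Longrightarrow> \<Gamma> \<turnstile> IndPush D l r q t \<^bold>: D\<lbrakk>t\<rbrakk>"
| push_ind_cong: "\<Gamma> \<turnstile> A \<^bold>: Univ \<Longrightarrow> \<Gamma> \<turnstile> B \<^bold>: Univ \<Longrightarrow> \<Gamma> \<turnstile> C \<^bold>: Univ \<Longrightarrow>
    \<Gamma> \<turnstile> f \<^bold>: Arr C A \<Longrightarrow> \<Gamma> \<turnstile> g \<^bold>: Arr C B \<Longrightarrow> Push f g # \<Gamma> \<turnstile> D \<approx> D' \<^bold>: Ty \<Longrightarrow>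
    A # \<Gamma> \<turnstile> l \<approx> l' \<^bold>: subst_at 1 D (PushL (wk 1 f) (wk 1 g) (Var 0)) \<Longrightarrow>
    B # \<Gamma> \<turnstile> r \<approx> r' \<^bold>: subst_at 1 D (PushR (wk 1 f) (wk 1 g) (Var 0)) \<Longrightarrow>
    C # \<Gamma> \<turnstile> q \<approx> q' \<^bold>: glue_over f g D l r \<Longrightarrow>
    \<Gamma> \<turnstile> t \<approx> t' \<^bold>: Push f g \<Longrightarrow> \<Gamma> \<turnstile> IndPush D l r q t \<approx> IndPush D' l' r' q' t' \<^bold>: D\<lbrakk>t\<rbrakk>"
| push_beta_l: "\<Gamma> \<turnstile> A \<^bold>: Univ \<Longrightarrow> \<Gamma> \<turnstile> B \<^bold>: Univ \<Longrightarrow> \<Gamma> \<turnstile> C \<^bold>: Univ \<Longrightarrow>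
    \<Gamma> \<turnstile> f \<^bold>: Arr C A \<Longrightarrow> \<Gamma> \<turnstile> g \<^bold>: Arr C B \<Longrightarrow> Push f g # \<Gamma> \<turnstile> D \<^bold>: Ty \<Longrightarrow>
    A # \<Gamma> \<turnstile> l \<^bold>: subst_at 1 D (PushL (wk 1 f) (wk 1 g) (Var 0)) \<Longrightarrow>
    B # \<Gamma> \<turnstile> r \<^bold>: subst_at 1 D (PushR (wk 1 f) (wk 1 g) (Var 0)) \<Longrightarrow>
    C # \<Gamma> \<turnstile> q \<^bold>: glue_over f g D l r \<Longrightarrow>
    \<Gamma> \<turnstile> a \<^bold>: A \<Longrightarrow> \<Gamma> \<turnstile> IndPush D l r q (PushL f g a) \<approx> l\<lbrakk>a\<rbrakk> \<^bold>: D\<lbrakk>PushL f g a\<rbrakk>"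
| push_beta_r: "\<Gamma> \<turnstile> A \<^bold>: Univ \<Longrightarrow> \<Gamma> \<turnstile> B \<^bold>: Univ \<Longrightarrow> \<Gamma> \<turnstile> C \<^bold>: Univ \<Longrightarrow>
    \<Gamma> \<turnstile> f \<^bold>: Arr C A \<Longrightarrow> \<Gamma> \<turnstile> g \<^bold>: Arr C B \<Longrightarrow> Push f g # \<Gamma> \<turnstile> D \<^bold>: Ty \<Longrightarrow>
    A # \<Gamma> \<turnstile> l \<^bold>: subst_at 1 D (PushL (wk 1 f) (wk 1 g) (Var 0)) \<Longrightarrow>
    B # \<Gamma> \<turnstile> r \<^bold>: subst_at 1 D (PushR (wk 1 f) (wk 1 g) (Var 0)) \<Longrightarrow>
    C # \<Gamma> \<turnstile> q \<^bold>: glue_over f g D l r \<Longrightarrow>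
    \<Gamma> \<turnstile> b \<^bold>: B \<Longrightarrow> \<Gamma> \<turnstile> IndPush D l r q (PushR f g b) \<approx> r\<lbrakk>b\<rbrakk> \<^bold>: D\<lbrakk>PushR f g b\<rbrakk>"
| push_beta_glue: "\<Gamma> \<turnstile> A \<^bold>: Univ \<Longrightarrow> \<Gamma> \<turnstile> B \<^bold>: Univ \<Longrightarrow> \<Gamma> \<turnstile> C \<^bold>: Univ \<Longrightarrow>
    \<Gamma> \<turnstile> f \<^bold>: Arr C A \<Longrightarrow> \<Gamma> \<turnstile> g \<^bold>: Arr C B \<Longrightarrow> Push f g # \<Gamma> \<turnstile> D \<^bold>: Ty \<Longrightarrow>
    A # \<Gamma> \<turnstile> l \<^bold>: subst_at 1 D (PushL (wk 1 f) (wk 1 g) (Var 0)) \<Longrightarrow>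
    B # \<Gamma> \<turnstile> r \<^bold>: subst_at 1 D (PushR (wk 1 f) (wk 1 g) (Var 0)) \<Longrightarrow>
    C # \<Gamma> \<turnstile> q \<^bold>: glue_over f g D l r \<Longrightarrow>
    \<Gamma> \<turnstile> c \<^bold>: C \<Longrightarrow> \<Gamma> \<turnstile> PushBeta f g D l r q c \<^bold>: push_beta_type f g D l r q c"
| push_beta_glue_cong: "\<Gamma> \<turnstile> A \<^bold>: Univ \<Longrightarrow> \<Gamma> \<turnstile> B \<^bold>: Univ \<Longrightarrow> \<Gamma> \<turnstile> C \<^bold>: Univ \<Longrightarrow>
    \<Gamma> \<turnstile> f \<approx> f' \<^bold>: Arr C A \<Longrightarrow> \<Gamma> \<turnstile> g \<approx> g' \<^bold>: Arr C B \<Longrightarrow> Push f g # \<Gamma> \<turnstile> D \<approx> D' \<^bold>: Ty \<Longrightarrow>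
    A # \<Gamma> \<turnstile> l \<approx> l' \<^bold>: subst_at 1 D (PushL (wk 1 f) (wk 1 g) (Var 0)) \<Longrightarrow>
    B # \<Gamma> \<turnstile> r \<approx> r' \<^bold>: subst_at 1 D (PushR (wk 1 f) (wk 1 g) (Var 0)) \<Longrightarrow>
    C # \<Gamma> \<turnstile> q \<approx> q' \<^bold>: glue_over f g D l r \<Longrightarrow> \<Gamma> \<turnstile> c \<approx> c' \<^bold>: C \<Longrightarrow>
    \<Gamma> \<turnstile> PushBeta f g D l r q c \<approx> PushBeta f' g' D' l' r' q' c' \<^bold>: push_beta_type f g D l r q c"
  \<comment> \<open>function extensionality and univalence\<close>
| funext: "\<Gamma> \<turnstile> f \<^bold>: Pi A B \<Longrightarrow> \<Gamma> \<turnstile> g \<^bold>: Pi A B \<Longrightarrow>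
    \<Gamma> \<turnstile> FunExt f g \<^bold>: is_equiv (Eq (Pi A B) f g) (htpy A B f g) (happly A B f g)"
| univalence: "\<Gamma> \<turnstile> A \<^bold>: Univ \<Longrightarrow> \<Gamma> \<turnstile> B \<^bold>: Univ \<Longrightarrow>
    \<Gamma> \<turnstile> Ua A B \<^bold>: is_equiv (Eq Univ A B) (Equiv A B) (id_to_equiv A B)"


section \<open>Local types, connectedness and joins\<close>

definition is_local :: "tm \<Rightarrow> tm \<Rightarrow> tm"
  where "is_local M A = is_equiv A (Arr M A) (Lam A (Lam (wk 1 M) (Var 1)))"

definition is_conn :: "tm \<Rightarrow> tm \<Rightarrow> tm"
  where "is_conn M A = Pi Univ (Arr (is_local (wk 1 M) (Var 0)) (is_local (wk 1 A) (Var 0)))"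

text \<open>The homotopy fiber \<open>\<Sigma>(a:A). f a =\<^sub>X x\<close> of \<open>f : A \<rightarrow> X\<close>\<close>

definition fib :: "tm \<Rightarrow> tm \<Rightarrow> tm \<Rightarrow> tm \<Rightarrow> tm"
  where "fib A X f x = Sig A (Eq (wk 1 X) (App (wk 1 f) (Var 0)) (wk 1 x))"

definition is_conn_map :: "tm \<Rightarrow> tm \<Rightarrow> tm \<Rightarrow> tm \<Rightarrow> tm"
  where "is_conn_map M A X f = Pi X (is_conn (wk 1 M) (fib (wk 1 A) (wk 1 X) (wk 1 f) (Var 0)))"

definition join_type :: "tm \<Rightarrow> tm \<Rightarrow> tm"
  where "join_type M N =
    Push (Lam (Prod M N) (proj1 (wk 1 M) (Var 0)))
         (Lam (Prod M N) (proj2 (wk 1 M) (wk 2 N) (Var 0)))"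

text \<open>
  The pullback \<open>A \<times>\<^sub>X B = \<Sigma>(a:A). \<Sigma>(b:B). f a =\<^sub>X g b\<close>; \<open>pb_fam\<close> is the inner sum, in context
  \<open>\<Gamma>, a:A\<close>, and \<open>pb_eq\<close> the identity type, in context \<open>\<Gamma>, a:A, b:B\<close>.
\<close>

definition pb_eq :: "tm \<Rightarrow> tm \<Rightarrow> tm \<Rightarrow> tm"
  where "pb_eq X f g = Eq (wk 2 X) (App (wk 2 f) (Var 1)) (App (wk 2 g) (Var 0))"

definition pb_fam :: "tm \<Rightarrow> tm \<Rightarrow> tm \<Rightarrow> tm \<Rightarrow> tm"
  where "pb_fam B X f g = Sig (wk 1 B) (pb_eq X f g)"

definition pullback :: "tm \<Rightarrow> tm \<Rightarrow> tm \<Rightarrow> tm \<Rightarrow> tm \<Rightarrow> tm"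
  where "pullback A B X f g = Sig A (pb_fam B X f g)"

text \<open>The two projections and the second component of a point \<open>p\<close> of the pullback.\<close>

definition pb_snd :: "tm \<Rightarrow> tm \<Rightarrow> tm \<Rightarrow> tm \<Rightarrow> tm \<Rightarrow> tm \<Rightarrow> tm"
  where "pb_snd A B X f g p = proj2 A (pb_fam B X f g) p"

definition pb_proj1 :: "tm \<Rightarrow> tm \<Rightarrow> tm \<Rightarrow> tm \<Rightarrow> tm \<Rightarrow> tm"
  where "pb_proj1 A B X f g = Lam (pullback A B X f g) (proj1 (wk 1 A) (Var 0))"

definition pb_proj2 :: "tm \<Rightarrow> tm \<Rightarrow> tm \<Rightarrow> tm \<Rightarrow> tm \<Rightarrow> tm"
  where "pb_proj2 A B X f g =
    Lam (pullback A B X f g)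
      (proj1 (wk 1 B) (pb_snd (wk 1 A) (wk 1 B) (wk 1 X) (wk 1 f) (wk 1 g) (Var 0)))"

text \<open>The canonical homotopy \<open>f \<circ> \<pi>\<^sub>1 \<sim> g \<circ> \<pi>\<^sub>2\<close>; the family of the last projection is
  \<open>f (\<pi>\<^sub>1 p) = g b\<close> in context \<open>\<Gamma>, p, b:B\<close>.\<close>

definition pb_htpy :: "tm \<Rightarrow> tm \<Rightarrow> tm \<Rightarrow> tm \<Rightarrow> tm \<Rightarrow> tm"
  where "pb_htpy A B X f g =
    Lam (pullback A B X f g)
      (proj2 (wk 1 B)
        (Eq (wk 2 X) (App (wk 2 f) (proj1 (wk 2 A) (Var 1))) (App (wk 2 g) (Var 0)))
        (pb_snd (wk 1 A) (wk 1 B) (wk 1 X) (wk 1 f) (wk 1 g) (Var 0)))"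

text \<open>The join \<open>f \<star> g : A \<star>\<^sub>X B \<rightarrow> X\<close> of maps and its domain.\<close>

definition join_over :: "tm \<Rightarrow> tm \<Rightarrow> tm \<Rightarrow> tm \<Rightarrow> tm \<Rightarrow> tm"
  where "join_over A B X f g = Push (pb_proj1 A B X f g) (pb_proj2 A B X f g)"

definition join_map :: "tm \<Rightarrow> tm \<Rightarrow> tm \<Rightarrow> tm \<Rightarrow> tm \<Rightarrow> tm"
  where "join_map A B X f g =
    push_map X (pb_proj1 A B X f g) (pb_proj2 A B X f g) f g (pb_htpy A B X f g)"

end

(*
  For types P, Q and Z let T u = (SIG z. PROD p. z = u p), where u : P -> Z, and let H(P,Q) say that
  the constant maps form an equivalence from Z to the type of pairs of u : P -> Z and Q -> T u,
  that is, that Z is local for the join of P and Q. The join M*N, being a pushout, satisfies: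
  Z is (M*N)-local iff H(N,M). Moreover H(P,Q) is symmetric in P and Q, and it holds iff T u is
  Q-local for every u : P -> Z; hence Q may be replaced in H(P,Q) by any Q'
  with the property that every Q-local type is Q'-local. Over a point of X let F and G be
  the fibres of f and g. From H(N,M) one obtains in turn H(N,F), H(F,N), H(F,G) and H(G,F). Finally
  the fibre of f*g has the induction principle of the join of F and G, which suffices
  to deduce that Z is local for it.

  The theorem asks for derivations in the deductive system, and these are produced by reflection: a
  normaliser ev and an elaborator el for terms with implicit arguments are HOL functions,
  proved sound for the judgments once and then run on explicit proof terms by rewriting. A proved
  lemma enters later ones as a variable of its type; at the end all of these variables are
  discharged by a substitution.
*)
theory Submission
  imports Defs
begin

text \<open>The types T u fit the form of the hypotheses: connectedness is an implication between
  localities of small types, and locality of Z for a join turns into locality of the small types T u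
  for a single leg. This allows one leg to be exchanged at a time.

  For the judgments neither uniqueness of types nor injectivity of type formers is at hand. A
  contracted redex is therefore evaluated again and its type compared syntactically with the
  expected one, or the value carries the facts that inversion would give. Only soundness is claimed
  for evaluation and elaboration; a failing run says nothing, so bounded fuel and missing
  constructors do no harm.

  Evaluation knows beta but not eta. A cocone rebuilt from its components is thus only
  propositionally the given one, and several proof terms consist mostly of repairs by function
  extensionality. The concrete pushouts have large normal forms; for this reason most statements
  speak of a variable type whose induction and recursion principles are hypotheses.\<close>

section \<open>Substitution\<close>

text \<open>\<open>lf k c\<close> inserts \<open>k\<close> variables at position \<open>c\<close>, and \<open>sb k a\<close> substitutes \<open>a\<close> for variable \<open>k\<close>; unlike \<^const>\<open>ren\<close> and \<^const>\<open>sub\<close> they can be computed by rewriting.\<close>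

definition lf :: "nat \<Rightarrow> nat \<Rightarrow> tm \<Rightarrow> tm"
  where "lf k c t = ren t (\<lambda>n. if n < c then n else n + k)"

definition sb :: "nat \<Rightarrow> tm \<Rightarrow> tm \<Rightarrow> tm"
  where "sb k a t = sub t (\<lambda>n. if n < k then Var n else if n = k then lf k 0 a else Var (n - 1))"

lemma upr_upto: "upr (\<lambda>n. if n < c then n else n + k) = (\<lambda>n. if n < Suc c then n else n + k)"
  by (rule ext) (simp add: upr_def split: nat.split)

text \<open>The conditional is hidden in a constant so that rewriting evaluates it by the recursive
  test of \<open>index_eval\<close> instead of treating it as an \<open>if\<close>.\<close>

definition shf :: "nat \<Rightarrow> nat \<Rightarrow> nat \<Rightarrow> nat"
  where "shf k c n = (if n < c then n else n + k)"

lemma lf_simps: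
  "lf k c (Var n) = Var (shf k c n)"
  "lf k c Univ = Univ"
  "lf k c Ty = Ty"
  "lf k c (Pi A B) = Pi (lf k c A) (lf k (Suc c) B)"
  "lf k c (Lam A B) = Lam (lf k c A) (lf k (Suc c) B)"
  "lf k c (App A B) = App (lf k c A) (lf k c B)"
  "lf k c (Sig A B) = Sig (lf k c A) (lf k (Suc c) B)"
  "lf k c (Pair B a b) = Pair (lf k (Suc c) B) (lf k c a) (lf k c b)"
  "lf k c (IndSig C d p) = IndSig (lf k (Suc c) C) (lf k (Suc (Suc c)) d) (lf k c p)"
  "lf k c (Eq A a b) = Eq (lf k c A) (lf k c a) (lf k c b)"
  "lf k c (Refl a) = Refl (lf k c a)"
  "lf k c (J C d p) = J (lf k (Suc (Suc c)) C) (lf k c d) (lf k c p)"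
  "lf k c (Push f g) = Push (lf k c f) (lf k c g)"
  "lf k c (PushL f g a) = PushL (lf k c f) (lf k c g) (lf k c a)"
  "lf k c (PushR f g a) = PushR (lf k c f) (lf k c g) (lf k c a)"
  "lf k c (Glue f g a) = Glue (lf k c f) (lf k c g) (lf k c a)"
  "lf k c (IndPush D l r q t) = IndPush (lf k (Suc c) D) (lf k (Suc c) l) (lf k (Suc c) r) (lf k (Suc c) q) (lf k c t)"
  "lf k c (PushBeta f g D l r q t) =
     PushBeta (lf k c f) (lf k c g) (lf k (Suc c) D) (lf k (Suc c) l) (lf k (Suc c) r) (lf k (Suc c) q) (lf k c t)"
  "lf k c (FunExt f g) = FunExt (lf k c f) (lf k c g)"
  "lf k c (Ua A B) = Ua (lf k c A) (lf k c B)"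
  by (simp_all add: lf_def upr_upto shf_def)

lemma upr_upr: "upr \<zeta> (upr \<xi> n) = upr (\<lambda>n. \<zeta> (\<xi> n)) n"
  by (simp add: upr_def split: nat.split)

lemma ren_ren: "ren (ren t \<xi>) \<zeta> = ren t (\<lambda>n. \<zeta> (\<xi> n))"
  by (induction t arbitrary: \<xi> \<zeta>) (simp_all add: upr_upr)

text \<open>The substituted term is lifted only where its variable is reached, so passing a binder
  increments \<open>k\<close> and leaves \<open>a\<close> as it is. This is what makes the equations
  \<open>sb_simps\<close> close up.\<close>

lemma up_sb: "up (\<lambda>n. if n < k then Var n else if n = k then lf k 0 a else Var (n - 1)) =
   (\<lambda>n. if n < Suc k then Var n else if n = Suc k then lf (Suc k) 0 a else Var (n - 1))"
proof (rule ext)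
  fix n show "up (\<lambda>n. if n < k then Var n else if n = k then lf k 0 a else Var (n - 1)) n =
   (if n < Suc k then Var n else if n = Suc k then lf (Suc k) 0 a else Var (n - 1))"
    by (cases n) (auto simp: up_def lf_def ren_ren)
qed

definition vcase :: "nat \<Rightarrow> nat \<Rightarrow> tm \<Rightarrow> tm \<Rightarrow> tm \<Rightarrow> tm"
  where "vcase k n x y z = (if n < k then x else if n = k then y else z)"

lemma vcase_simps: "vcase 0 0 x y z = y" "vcase 0 (Suc n) x y z = z" "vcase (Suc k) 0 x y z = x" "vcase (Suc k) (Suc n) x y z = vcase k n x y z"
  by (simp_all add: vcase_def)

text \<open>Lifting by zero is the identity; the separate constant lets it return the term without a
  traversal.\<close>

definition lfz :: "nat \<Rightarrow> tm \<Rightarrow> tm" where "lfz k a = lf k 0 a"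

lemma ren_ident: "ren t (\<lambda>n. n) = t"
proof -
  have [simp]: "upr (\<lambda>n. n) = (\<lambda>n. n)" by (rule ext) (simp add: upr_def split: nat.split)
  show ?thesis by (induction t) simp_all
qed

lemma lfz_simps: "lfz 0 a = a" "lfz (Suc k) a = lf (Suc k) 0 a"
  by (simp_all add: lfz_def lf_def ren_ident)

lemma sb_simps:
  "sb k a (Var n) = vcase k n (Var n) (lfz k a) (Var (n - 1))"
  "sb k a Univ = Univ"
  "sb k a Ty = Ty"
  "sb k a (Pi A B) = Pi (sb k a A) (sb (Suc k) a B)"
  "sb k a (Lam A B) = Lam (sb k a A) (sb (Suc k) a B)"
  "sb k a (App A B) = App (sb k a A) (sb k a B)"
  "sb k a (Sig A B) = Sig (sb k a A) (sb (Suc k) a B)"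
  "sb k a (Pair B x y) = Pair (sb (Suc k) a B) (sb k a x) (sb k a y)"
  "sb k a (IndSig C d p) = IndSig (sb (Suc k) a C) (sb (Suc (Suc k)) a d) (sb k a p)"
  "sb k a (Eq A x y) = Eq (sb k a A) (sb k a x) (sb k a y)"
  "sb k a (Refl x) = Refl (sb k a x)"
  "sb k a (J C d p) = J (sb (Suc (Suc k)) a C) (sb k a d) (sb k a p)"
  "sb k a (Push f g) = Push (sb k a f) (sb k a g)"
  "sb k a (PushL f g x) = PushL (sb k a f) (sb k a g) (sb k a x)"
  "sb k a (PushR f g x) = PushR (sb k a f) (sb k a g) (sb k a x)"
  "sb k a (Glue f g x) = Glue (sb k a f) (sb k a g) (sb k a x)"
  "sb k a (IndPush D l r q t) = IndPush (sb (Suc k) a D) (sb (Suc k) a l) (sb (Suc k) a r) (sb (Suc k) a q) (sb k a t)"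
  by (simp_all add: sb_def up_sb vcase_def lfz_def del: diff_Suc_1)

section \<open>A type checker\<close>

datatype res = Fail | Ok tm tm

definition bnd :: "res \<Rightarrow> (tm \<Rightarrow> tm \<Rightarrow> res) \<Rightarrow> res"
  where "bnd r k = (case r of Ok t T \<Rightarrow> k t T | Fail \<Rightarrow> Fail)"

text \<open>A strict let: the congruence rule in \<open>eval_congs\<close> makes the simplifier
  evaluate \<open>x\<close> before it is copied into \<open>k\<close>.\<close>

definition llet :: "tm \<Rightarrow> (tm \<Rightarrow> res) \<Rightarrow> res"
  where "llet x k = k x"

definition guard_eq :: "tm \<Rightarrow> tm \<Rightarrow> res \<Rightarrow> res"
  where "guard_eq a b r = (if a = b then r else Fail)"

definition guard_sort :: "tm \<Rightarrow> res \<Rightarrow> res"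
  where "guard_sort s r = (if s \<in> {Univ, Ty} then r else Fail)"

text \<open>The pseudo-sort \<open>Ty\<close> is the inferred type of a large type but is not a type
  itself, so it must not become a component of a \<open>Pi\<close>, \<open>Sig\<close> or
  \<open>Eq\<close>.\<close>

fun guard_not_Ty :: "tm \<Rightarrow> res \<Rightarrow> res" where
  "guard_not_Ty Ty r = Fail"
| "guard_not_Ty _ r = r"

fun max_sort :: "tm \<Rightarrow> tm \<Rightarrow> tm" where
  "max_sort Univ Univ = Univ"
| "max_sort _ _ = Ty"

fun on_Pi :: "tm \<Rightarrow> (tm \<Rightarrow> tm \<Rightarrow> res) \<Rightarrow> res" where
  "on_Pi (Pi A B) k = k A B" | "on_Pi _ k = Fail"
fun on_Sig :: "tm \<Rightarrow> (tm \<Rightarrow> tm \<Rightarrow> res) \<Rightarrow> res" where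
  "on_Sig (Sig A B) k = k A B" | "on_Sig _ k = Fail"
fun on_Eq :: "tm \<Rightarrow> (tm \<Rightarrow> tm \<Rightarrow> tm \<Rightarrow> res) \<Rightarrow> res" where
  "on_Eq (Eq A a b) k = k A a b" | "on_Eq _ k = Fail"
fun on_Push :: "tm \<Rightarrow> (tm \<Rightarrow> tm \<Rightarrow> res) \<Rightarrow> res" where
  "on_Push (Push f g) k = k f g" | "on_Push _ k = Fail"
fun if_Lam :: "tm \<Rightarrow> (tm \<Rightarrow> res) \<Rightarrow> res \<Rightarrow> res" where
  "if_Lam (Lam A b) k r = k b" | "if_Lam _ k r = r"
fun if_Pair :: "tm \<Rightarrow> (tm \<Rightarrow> tm \<Rightarrow> res) \<Rightarrow> res \<Rightarrow> res" where
  "if_Pair (Pair B a b) k r = k a b" | "if_Pair _ k r = r"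
fun if_Refl :: "tm \<Rightarrow> res \<Rightarrow> res \<Rightarrow> res" where
  "if_Refl (Refl a) r r' = r" | "if_Refl _ r r' = r'"
fun if_Push :: "tm \<Rightarrow> (tm \<Rightarrow> res) \<Rightarrow> (tm \<Rightarrow> res) \<Rightarrow> res \<Rightarrow> res" where
  "if_Push (PushL f g a) k k' r = k a" | "if_Push (PushR f g b) k k' r = k' b" | "if_Push _ k k' r = r"

fun no_Lam :: "tm \<Rightarrow> bool" where "no_Lam (Lam A b) = False" | "no_Lam _ = True"
fun no_Pair :: "tm \<Rightarrow> bool" where "no_Pair (Pair A a b) = False" | "no_Pair _ = True"
fun no_Refl :: "tm \<Rightarrow> bool" where "no_Refl (Refl b) = False" | "no_Refl _ = True"
fun no_Push :: "tm \<Rightarrow> bool" where "no_Push (PushL f g a) = False" | "no_Push (PushR f g a) = False" | "no_Push _ = True"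

definition conj' :: "bool \<Rightarrow> bool \<Rightarrow> bool" where "conj' a b = (a \<and> b)"
definition if' :: "bool \<Rightarrow> res \<Rightarrow> res \<Rightarrow> res" where "if' b r r' = (if b then r else r')"

text \<open>A shortcut only: soundness never relies on the normality of a term that passes. The
  empty type, the unit type, coproducts and numbers count as not normal and are then rejected by
  \<open>step\<close>.\<close>

fun is_nf :: "tm \<Rightarrow> bool" where
  "is_nf (Var i) = True"
| "is_nf Univ = True"
| "is_nf Ty = True"
| "is_nf (Pi A B) = conj' (is_nf A) (is_nf B)"
| "is_nf (Lam A b) = conj' (is_nf A) (is_nf b)"
| "is_nf (App f a) = conj' (no_Lam f) (conj' (is_nf f) (is_nf a))"
| "is_nf (Sig A B) = conj' (is_nf A) (is_nf B)"
| "is_nf (Pair B a b) = conj' (is_nf B) (conj' (is_nf a) (is_nf b))"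
| "is_nf (IndSig C d p) = conj' (no_Pair p) (conj' (is_nf C) (conj' (is_nf d) (is_nf p)))"
| "is_nf (Eq A a b) = conj' (is_nf A) (conj' (is_nf a) (is_nf b))"
| "is_nf (Refl a) = is_nf a"
| "is_nf (J C d p) = conj' (no_Refl p) (conj' (is_nf C) (conj' (is_nf d) (is_nf p)))"
| "is_nf (Push f g) = conj' (is_nf f) (is_nf g)"
| "is_nf (PushL f g a) = conj' (is_nf f) (conj' (is_nf g) (is_nf a))"
| "is_nf (PushR f g a) = conj' (is_nf f) (conj' (is_nf g) (is_nf a))"
| "is_nf (Glue f g a) = conj' (is_nf f) (conj' (is_nf g) (is_nf a))"
| "is_nf (IndPush D l r q t) = conj' (no_Push t) (conj' (is_nf D) (conj' (is_nf l) (conj' (is_nf r) (conj' (is_nf q) (is_nf t)))))"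
| "is_nf (FunExt f g) = conj' (is_nf f) (is_nf g)"
| "is_nf (PushBeta f g D l r q t) = conj' (is_nf f) (conj' (is_nf g) (conj' (is_nf D) (conj' (is_nf l) (conj' (is_nf r) (conj' (is_nf q) (is_nf t))))))"
| "is_nf (Ua f g) = conj' (is_nf f) (is_nf g)"
| "is_nf _ = False"

fun look :: "tm list \<Rightarrow> nat \<Rightarrow> (tm \<Rightarrow> res) \<Rightarrow> res" where
  "look [] i k = Fail"
| "look (A # \<Gamma>) 0 k = k A"
| "look (A # \<Gamma>) (Suc i) k = look \<Gamma> i k"

type_synonym checker = "tm list \<Rightarrow> tm \<Rightarrow> res"

definition eval_ty :: "checker \<Rightarrow> tm list \<Rightarrow> tm \<Rightarrow> (tm \<Rightarrow> res) \<Rightarrow> res"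
  where "eval_ty e \<Gamma> T k = bnd (e \<Gamma> T) (\<lambda>T' s. guard_sort s (k T'))"

definition eval_nf :: "checker \<Rightarrow> tm list \<Rightarrow> tm \<Rightarrow> (tm \<Rightarrow> res) \<Rightarrow> res"
  where "eval_nf e \<Gamma> T k = if' (is_nf T) (k T) (eval_ty e \<Gamma> T k)"

definition norm_tm :: "checker \<Rightarrow> tm list \<Rightarrow> tm \<Rightarrow> tm \<Rightarrow> (tm \<Rightarrow> res) \<Rightarrow> res"
  where "norm_tm e \<Gamma> A t k = if' (is_nf t) (k t) (bnd (e \<Gamma> t) (\<lambda>t A'. guard_eq A' A (k t)))"

text \<open>The argument is known to be a type already, so its normal parts are passed through
  unchecked and only the remaining ones are evaluated.\<close>

fun norm_ty :: "checker \<Rightarrow> tm list \<Rightarrow> tm \<Rightarrow> (tm \<Rightarrow> res) \<Rightarrow> res" where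
  "norm_ty e \<Gamma> (Pi A B) k = if' (is_nf (Pi A B)) (k (Pi A B)) (norm_ty e \<Gamma> A (\<lambda>A. norm_ty e (A # \<Gamma>) B (\<lambda>B. k (Pi A B))))"
| "norm_ty e \<Gamma> (Sig A B) k = if' (is_nf (Sig A B)) (k (Sig A B)) (norm_ty e \<Gamma> A (\<lambda>A. norm_ty e (A # \<Gamma>) B (\<lambda>B. k (Sig A B))))"
| "norm_ty e \<Gamma> (Eq A a b) k = if' (is_nf (Eq A a b)) (k (Eq A a b))
     (norm_ty e \<Gamma> A (\<lambda>A. norm_tm e \<Gamma> A a (\<lambda>a. norm_tm e \<Gamma> A b (\<lambda>b. k (Eq A a b)))))"
| "norm_ty e \<Gamma> T k = eval_nf e \<Gamma> T k"

fun if_proj :: "tm \<Rightarrow> res \<Rightarrow> res \<Rightarrow> res \<Rightarrow> res" where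
  "if_proj (Var 0) r1 r2 r = r2"
| "if_proj (Var (Suc 0)) r1 r2 r = r1"
| "if_proj _ r1 r2 r = r"

text \<open>The maps must be normal already. The vertices are read off their function types:
  \<open>Univ\<close> is a dummy put in place of the bound variable, and the comparison with the
  lifted result ensures that the codomain did not depend on it.\<close>

definition check_push :: "checker \<Rightarrow> tm list \<Rightarrow> tm \<Rightarrow> tm \<Rightarrow> (tm \<Rightarrow> tm \<Rightarrow> tm \<Rightarrow> res) \<Rightarrow> res"
  where "check_push e \<Gamma> f g k =
    bnd (e \<Gamma> f) (\<lambda>f' F. guard_eq f' f (on_Pi F (\<lambda>C A1.
    bnd (e \<Gamma> g) (\<lambda>g' G. guard_eq g' g (on_Pi G (\<lambda>C' B1. guard_eq C C' (
    llet (sb 0 Univ A1) (\<lambda>A. llet (lf (Suc 0) 0 A) (\<lambda>A2. guard_eq A1 A2 (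
    llet (sb 0 Univ B1) (\<lambda>B. llet (lf (Suc 0) 0 B) (\<lambda>B2. guard_eq B1 B2 (
    bnd (e \<Gamma> A) (\<lambda>A' s. guard_eq s Univ (bnd (e \<Gamma> B) (\<lambda>B' s. guard_eq s Univ (bnd (e \<Gamma> C) (\<lambda>C' s. guard_eq s Univ (
    k A B C)))))))))))))))))))"

text \<open>\<open>step e \<Gamma> t = Ok t' T\<close> yields a normal form \<open>t'\<close> of \<open>t\<close> together with its normalised type, where \<open>e\<close> evaluates with less fuel; \<open>Ok T Univ\<close> and \<open>Ok T Ty\<close> are the answers for types. \<^const>\<open>proj1\<close> and \<^const>\<open>proj2\<close> are special cases since the general rule for \<^const>\<open>IndSig\<close> would evaluate their motives.\<close>

fun step :: "checker \<Rightarrow> checker" where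
  "step e \<Gamma> (Var i) = look \<Gamma> i (\<lambda>A. llet (lf (Suc i) 0 A) (\<lambda>T. norm_ty e \<Gamma> T (\<lambda>T. Ok (Var i) T)))"
| "step e \<Gamma> Univ = Ok Univ Ty"
| "step e \<Gamma> (Pi A B) = bnd (e \<Gamma> A) (\<lambda>A s. guard_sort s (bnd (e (A # \<Gamma>) B) (\<lambda>B s'. guard_sort s' (llet (max_sort s s') (Ok (Pi A B))))))"
| "step e \<Gamma> (Sig A B) = bnd (e \<Gamma> A) (\<lambda>A s. guard_sort s (bnd (e (A # \<Gamma>) B) (\<lambda>B s'. guard_sort s' (llet (max_sort s s') (Ok (Sig A B))))))"
| "step e \<Gamma> (Lam A b) = bnd (e \<Gamma> A) (\<lambda>A s. guard_sort s (bnd (e (A # \<Gamma>) b) (\<lambda>b B. guard_not_Ty B (Ok (Lam A b) (Pi A B)))))"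
| "step e \<Gamma> (App f a) = bnd (e \<Gamma> f) (\<lambda>f F. on_Pi F (\<lambda>A B. bnd (e \<Gamma> a) (\<lambda>a A'. guard_eq A' A (
     llet (sb 0 a B) (\<lambda>T. norm_ty e \<Gamma> T (\<lambda>T.
       if_Lam f (\<lambda>b. llet (sb 0 a b) (\<lambda>u. bnd (e \<Gamma> u) (\<lambda>v T'. guard_eq T' T (Ok v T)))) (Ok (App f a) T)))))))"
| "step e \<Gamma> (Pair B a b) = bnd (e \<Gamma> a) (\<lambda>a A. guard_not_Ty A (bnd (e (A # \<Gamma>) B) (\<lambda>B s. guard_sort s (bnd (e \<Gamma> b) (\<lambda>b S.
     llet (sb 0 a B) (\<lambda>T. norm_ty e \<Gamma> T (\<lambda>T. guard_eq S T (Ok (Pair B a b) (Sig A B)))))))))"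
| "step e \<Gamma> (IndSig C d p) = bnd (e \<Gamma> p) (\<lambda>p S. on_Sig S (\<lambda>A B. if_proj d
     (eval_nf e (S # \<Gamma>) C (\<lambda>C. llet (wk 1 A) (\<lambda>C'. guard_eq C C' (if_Pair p (\<lambda>a b. Ok a A) (Ok (IndSig C d p) A)))))
     (eval_nf e (S # \<Gamma>) C (\<lambda>C. llet (subst_at 1 B (proj1 (wk 1 A) (Var 0))) (\<lambda>C'. guard_eq C C' (if_Pair p
       (\<lambda>a b. llet (sb 0 a B) (\<lambda>T. norm_ty e \<Gamma> T (\<lambda>T. bnd (e \<Gamma> b) (\<lambda>b T'. guard_eq T' T (Ok b T)))))
       (llet (proj1 A p) (\<lambda>a. llet (sb 0 a B) (\<lambda>T. norm_ty e \<Gamma> T (\<lambda>T. Ok (IndSig C d p) T))))))))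
     (bnd (e (S # \<Gamma>) C) (\<lambda>C s. guard_sort s (
     bnd (e (B # A # \<Gamma>) d) (\<lambda>d D. llet (subst_at 2 C (Pair (wk1 2 B) (Var 1) (Var 0))) (\<lambda>T. norm_ty e (B # A # \<Gamma>) T (\<lambda>T. guard_eq D T (
     llet (sb 0 p C) (\<lambda>T. norm_ty e \<Gamma> T (\<lambda>T.
       if_Pair p (\<lambda>a b. llet (d\<lbrakk>a, b\<rbrakk>) (\<lambda>u. bnd (e \<Gamma> u) (\<lambda>v T'. guard_eq T' T (Ok v T)))) (Ok (IndSig C d p) T))))))))))))"
| "step e \<Gamma> (Eq A a b) = bnd (e \<Gamma> A) (\<lambda>A s. guard_sort s (bnd (e \<Gamma> a) (\<lambda>a A'. guard_eq A' A (bnd (e \<Gamma> b) (\<lambda>b A'. guard_eq A' A (Ok (Eq A a b) s))))))"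
| "step e \<Gamma> (Refl a) = bnd (e \<Gamma> a) (\<lambda>a A. guard_not_Ty A (Ok (Refl a) (Eq A a a)))"
| "step e \<Gamma> (J C d p) = bnd (e \<Gamma> p) (\<lambda>p S. on_Eq S (\<lambda>A a b. llet (Eq (wk 1 A) (wk 1 a) (Var 0)) (\<lambda>E. bnd (e (E # A # \<Gamma>) C) (\<lambda>C s. guard_sort s (
     bnd (e \<Gamma> d) (\<lambda>d D. llet (C\<lbrakk>a, Refl a\<rbrakk>) (\<lambda>T. norm_ty e \<Gamma> T (\<lambda>T. guard_eq D T (
     if_Refl p (Ok d D) (llet (C\<lbrakk>b, p\<rbrakk>) (\<lambda>T. norm_ty e \<Gamma> T (\<lambda>T. Ok (J C d p) T))))))))))))"
| "step e \<Gamma> (Push f g) = check_push e \<Gamma> f g (\<lambda>A B C. Ok (Push f g) Univ)"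
| "step e \<Gamma> (PushL f g a) = check_push e \<Gamma> f g (\<lambda>A B C. bnd (e \<Gamma> a) (\<lambda>a A'. guard_eq A' A (Ok (PushL f g a) (Push f g))))"
| "step e \<Gamma> (PushR f g a) = check_push e \<Gamma> f g (\<lambda>A B C. bnd (e \<Gamma> a) (\<lambda>a A'. guard_eq A' B (Ok (PushR f g a) (Push f g))))"
| "step e \<Gamma> (Glue f g c) = check_push e \<Gamma> f g (\<lambda>A B C. bnd (e \<Gamma> c) (\<lambda>c C'. guard_eq C' C (
     eval_ty e \<Gamma> (Eq (Push f g) (PushL f g (App f c)) (PushR f g (App g c))) (\<lambda>T. Ok (Glue f g c) T))))"
| "step e \<Gamma> (IndPush D l r q t) = bnd (e \<Gamma> t) (\<lambda>t S. on_Push S (\<lambda>f g. check_push e \<Gamma> f g (\<lambda>A B C.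
     bnd (e (S # \<Gamma>) D) (\<lambda>D s. guard_sort s (
     bnd (e (A # \<Gamma>) l) (\<lambda>l L. llet (subst_at 1 D (PushL (wk 1 f) (wk 1 g) (Var 0))) (\<lambda>T. norm_ty e (A # \<Gamma>) T (\<lambda>T. guard_eq L T (
     bnd (e (B # \<Gamma>) r) (\<lambda>r R. llet (subst_at 1 D (PushR (wk 1 f) (wk 1 g) (Var 0))) (\<lambda>T. norm_ty e (B # \<Gamma>) T (\<lambda>T. guard_eq R T (
     bnd (e (C # \<Gamma>) q) (\<lambda>q Q. llet (glue_over f g D l r) (\<lambda>T. eval_ty e (C # \<Gamma>) T (\<lambda>T. guard_eq Q T (
     llet (sb 0 t D) (\<lambda>T. norm_ty e \<Gamma> T (\<lambda>T.
       if_Push t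
        (\<lambda>a. bnd (e \<Gamma> a) (\<lambda>a' A'. guard_eq A' A (llet (sb 0 a l) (\<lambda>u. bnd (e \<Gamma> u) (\<lambda>v T'. guard_eq T' T (Ok v T))))))
        (\<lambda>a. bnd (e \<Gamma> a) (\<lambda>a' A'. guard_eq A' B (llet (sb 0 a r) (\<lambda>u. bnd (e \<Gamma> u) (\<lambda>v T'. guard_eq T' T (Ok v T))))))
        (Ok (IndPush D l r q t) T))))))))))))))))))))"
| "step e \<Gamma> _ = Fail"

primrec eval :: "nat \<Rightarrow> checker" where
  "eval 0 = (\<lambda>_ _. Fail)"
| "eval (Suc n) = step (eval n)"

text \<open>A reduct is not a subterm, hence the recursion on fuel. Every amount is sound, and a
  depth of 50 suffices for all terms evaluated below.\<close>

definition ev :: checker where "ev = eval 50"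

section \<open>Elaboration\<close>

text \<open>In \<open>el p \<Gamma> m\<close> the expected type is \<open>m\<close>, if any, and must be normal. \<open>PLamP\<close> and \<open>PLamJ\<close> are abstractions by cases over a pair and over a based path, \<open>PHave\<close> and \<open>PObt\<close> introduce an intermediate result and the components of a pair.\<close>

datatype pre =
    PVar nat | PTm tm | PPi pre pre | PSig pre pre | PEq pre pre pre
  | PLam pre | PApp pre pre | PPair pre pre | PRefl | PFst pre | PSnd pre
  | PLamP pre | PLamJ pre | PJ pre pre pre | PHave pre pre | PObt pre pre | PAnn pre pre
  | PFunExt pre pre | PUa pre pre
  | PInl pre pre | PInr pre pre | PGlue pre pre
  | PIndPush pre pre pre pre pre | PPushBeta pre pre pre pre pre pre

text \<open>Here synthesis meets checking: the expected type is normal, so the synthesised one is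
  normalised before the syntactic comparison.\<close>

definition infer :: "tm option \<Rightarrow> tm list \<Rightarrow> tm \<Rightarrow> tm \<Rightarrow> res"
  where "infer m \<Gamma> t T = (case m of None \<Rightarrow> Ok t T | Some T' \<Rightarrow> norm_ty ev \<Gamma> T (\<lambda>T. guard_eq T T' (Ok t T')))"

definition on_Some :: "tm option \<Rightarrow> (tm \<Rightarrow> res) \<Rightarrow> res"
  where "on_Some m k = (case m of None \<Rightarrow> Fail | Some T \<Rightarrow> k T)"

type_synonym elab = "tm list \<Rightarrow> tm option \<Rightarrow> res"

definition elab_ty :: "elab \<Rightarrow> tm list \<Rightarrow> (tm \<Rightarrow> tm \<Rightarrow> res) \<Rightarrow> res"
  where "elab_ty p \<Gamma> k = bnd (p \<Gamma> None) (\<lambda>A s. guard_sort s (if' (is_nf A) (k A s) (bnd (ev \<Gamma> A) (\<lambda>A s. guard_sort s (k A s)))))"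

text \<open>A type that is visibly a function type is split without evaluation of its codomain,
  which keeps the application of a lemma with a long statement cheap.\<close>

fun head_Pi :: "tm list \<Rightarrow> tm \<Rightarrow> (tm \<Rightarrow> tm \<Rightarrow> res) \<Rightarrow> res" where
  "head_Pi \<Gamma> (Pi A B) k = k A B"
| "head_Pi \<Gamma> T k = eval_ty ev \<Gamma> T (\<lambda>T. on_Pi T k)"

primrec el :: "pre \<Rightarrow> elab" where
  "el (PVar i) = (\<lambda>\<Gamma> m. look \<Gamma> i (\<lambda>A. llet (lf (Suc i) 0 A) (\<lambda>T. infer m \<Gamma> (Var i) T)))"
| "el (PTm t) = (\<lambda>\<Gamma> m. llet t (\<lambda>t. bnd (ev \<Gamma> t) (\<lambda>t T. infer m \<Gamma> t T)))"
| "el (PPi A B) = (\<lambda>\<Gamma> m. elab_ty (el A) \<Gamma> (\<lambda>A s. elab_ty (el B) (A # \<Gamma>) (\<lambda>B s'. llet (max_sort s s') (infer m \<Gamma> (Pi A B)))))"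
| "el (PSig A B) = (\<lambda>\<Gamma> m. elab_ty (el A) \<Gamma> (\<lambda>A s. elab_ty (el B) (A # \<Gamma>) (\<lambda>B s'. llet (max_sort s s') (infer m \<Gamma> (Sig A B)))))"
| "el (PEq A a b) = (\<lambda>\<Gamma> m. elab_ty (el A) \<Gamma> (\<lambda>A s. bnd (el a \<Gamma> (Some A)) (\<lambda>a _. bnd (el b \<Gamma> (Some A)) (\<lambda>b _.
     norm_tm ev \<Gamma> A a (\<lambda>a. norm_tm ev \<Gamma> A b (\<lambda>b. infer m \<Gamma> (Eq A a b) s))))))"
| "el (PLam b) = (\<lambda>\<Gamma> m. on_Some m (\<lambda>T. on_Pi T (\<lambda>A B. bnd (el b (A # \<Gamma>) (Some B)) (\<lambda>b _. Ok (Lam A b) T))))"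
| "el (PApp f a) = (\<lambda>\<Gamma> m. bnd (el f \<Gamma> None) (\<lambda>f F. head_Pi \<Gamma> F (\<lambda>A B. norm_ty ev \<Gamma> A (\<lambda>A. bnd (el a \<Gamma> (Some A)) (\<lambda>a _.
     llet (sb 0 a B) (\<lambda>T. infer m \<Gamma> (App f a) T))))))"
| "el (PPair a b) = (\<lambda>\<Gamma> m. on_Some m (\<lambda>T. on_Sig T (\<lambda>A B. bnd (el a \<Gamma> (Some A)) (\<lambda>a _.
     llet (sb 0 a B) (\<lambda>S. norm_ty ev \<Gamma> S (\<lambda>S. bnd (el b \<Gamma> (Some S)) (\<lambda>b _. Ok (Pair B a b) T)))))))"
| "el PRefl = (\<lambda>\<Gamma> m. on_Some m (\<lambda>T. on_Eq T (\<lambda>A a b. guard_eq a b (Ok (Refl a) T))))"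
| "el (PFst p) = (\<lambda>\<Gamma> m. bnd (el p \<Gamma> None) (\<lambda>p T. norm_ty ev \<Gamma> T (\<lambda>T. on_Sig T (\<lambda>A B. llet (proj1 A p) (\<lambda>t. infer m \<Gamma> t A)))))"
| "el (PSnd p) = (\<lambda>\<Gamma> m. bnd (el p \<Gamma> None) (\<lambda>p T. norm_ty ev \<Gamma> T (\<lambda>T. on_Sig T (\<lambda>A B.
     llet (proj1 A p) (\<lambda>a. llet (proj2 A B p) (\<lambda>t. llet (sb 0 a B) (\<lambda>T. infer m \<Gamma> t T)))))))"
| "el (PLamP d) = (\<lambda>\<Gamma> m. on_Some m (\<lambda>T. on_Pi T (\<lambda>S C. on_Sig S (\<lambda>A B.
     llet (subst_at 2 C (Pair (wk1 2 B) (Var 1) (Var 0))) (\<lambda>D. norm_ty ev (B # A # \<Gamma>) D (\<lambda>D.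
     bnd (el d (B # A # \<Gamma>) (Some D)) (\<lambda>d _. llet (Lam S (IndSig (wk1 1 C) (lf (Suc 0) (Suc (Suc 0)) d) (Var 0))) (\<lambda>t. Ok t T))))))))"
| "el (PLamJ d) = (\<lambda>\<Gamma> m. on_Some m (\<lambda>T. on_Pi T (\<lambda>A F. on_Pi F (\<lambda>E C. on_Eq E (\<lambda>A1 a1 b1.
     llet (sb 0 Univ a1) (\<lambda>a. llet (Eq (wk 1 A) (wk 1 a) (Var 0)) (\<lambda>E'. guard_eq E E' (bnd (ev \<Gamma> a) (\<lambda>a' A'. guard_eq A' A (
     llet (C\<lbrakk>a, Refl a\<rbrakk>) (\<lambda>D. norm_ty ev \<Gamma> D (\<lambda>D. bnd (el d \<Gamma> (Some D)) (\<lambda>d _.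
     llet (Lam A (Lam E (J (lf (Suc (Suc 0)) (Suc (Suc 0)) C) (wk 2 d) (Var 0)))) (\<lambda>t. Ok t T))))))))))))))"
| "el (PJ C d p) = (\<lambda>\<Gamma> m. bnd (el p \<Gamma> None) (\<lambda>p S. norm_ty ev \<Gamma> S (\<lambda>S. on_Eq S (\<lambda>A a b.
     llet (Eq (wk 1 A) (wk 1 a) (Var 0)) (\<lambda>E. elab_ty (el C) (E # A # \<Gamma>) (\<lambda>C _.
     llet (C\<lbrakk>a, Refl a\<rbrakk>) (\<lambda>D. norm_ty ev \<Gamma> D (\<lambda>D. bnd (el d \<Gamma> (Some D)) (\<lambda>d _.
     llet (C\<lbrakk>b, p\<rbrakk>) (\<lambda>T. infer m \<Gamma> (J C d p) T))))))))))"
| "el (PHave p b) = (\<lambda>\<Gamma> m. on_Some m (\<lambda>T. bnd (el p \<Gamma> None) (\<lambda>p P. norm_ty ev \<Gamma> P (\<lambda>P. guard_not_Ty P (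
     llet (wk 1 T) (\<lambda>T'. bnd (el b (P # \<Gamma>) (Some T')) (\<lambda>b _. Ok (App (Lam P b) p) T)))))))"
| "el (PObt p d) = (\<lambda>\<Gamma> m. on_Some m (\<lambda>T. bnd (el p \<Gamma> None) (\<lambda>p P. norm_ty ev \<Gamma> P (\<lambda>P. on_Sig P (\<lambda>A B.
     llet (wk 2 T) (\<lambda>T'. bnd (el d (B # A # \<Gamma>) (Some T')) (\<lambda>d _. llet (wk 1 T) (\<lambda>C. Ok (IndSig C d p) T))))))))"
| "el (PAnn p T) = (\<lambda>\<Gamma> m. elab_ty (el T) \<Gamma> (\<lambda>T _. bnd (el p \<Gamma> (Some T)) (\<lambda>t _. infer m \<Gamma> t T)))"
| "el (PFunExt f g) = (\<lambda>\<Gamma> m. bnd (el f \<Gamma> None) (\<lambda>f F. norm_ty ev \<Gamma> F (\<lambda>F. on_Pi F (\<lambda>A B. bnd (el g \<Gamma> (Some F)) (\<lambda>g _.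
     llet (is_equiv (Eq F f g) (htpy A B f g) (happly A B f g)) (\<lambda>T. eval_ty ev \<Gamma> T (\<lambda>T. infer m \<Gamma> (FunExt f g) T)))))))"
| "el (PUa A B) = (\<lambda>\<Gamma> m. bnd (el A \<Gamma> (Some Univ)) (\<lambda>A _. bnd (el B \<Gamma> (Some Univ)) (\<lambda>B _.
     llet (is_equiv (Eq Univ A B) (Equiv A B) (id_to_equiv A B)) (\<lambda>T. eval_ty ev \<Gamma> T (\<lambda>T. infer m \<Gamma> (Ua A B) T)))))"
| "el (PInl Y a) = (\<lambda>\<Gamma> m. elab_ty (el Y) \<Gamma> (\<lambda>Y _. on_Push Y (\<lambda>f g. check_push ev \<Gamma> f g (\<lambda>A B C. bnd (el a \<Gamma> (Some A)) (\<lambda>a _.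
     infer m \<Gamma> (PushL f g a) Y)))))"
| "el (PInr Y a) = (\<lambda>\<Gamma> m. elab_ty (el Y) \<Gamma> (\<lambda>Y _. on_Push Y (\<lambda>f g. check_push ev \<Gamma> f g (\<lambda>A B C. bnd (el a \<Gamma> (Some B)) (\<lambda>a _.
     infer m \<Gamma> (PushR f g a) Y)))))"
| "el (PGlue Y c) = (\<lambda>\<Gamma> m. elab_ty (el Y) \<Gamma> (\<lambda>Y _. on_Push Y (\<lambda>f g. check_push ev \<Gamma> f g (\<lambda>A B C. bnd (el c \<Gamma> (Some C)) (\<lambda>c _.
     eval_ty ev \<Gamma> (Eq Y (PushL f g (App f c)) (PushR f g (App g c))) (\<lambda>T. infer m \<Gamma> (Glue f g c) T))))))"
| "el (PIndPush D l r q t) = (\<lambda>\<Gamma> m. bnd (el t \<Gamma> None) (\<lambda>t S. norm_ty ev \<Gamma> S (\<lambda>S. on_Push S (\<lambda>f g. check_push ev \<Gamma> f g (\<lambda>A B C.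
     elab_ty (el D) (S # \<Gamma>) (\<lambda>D _.
     llet (subst_at 1 D (PushL (wk 1 f) (wk 1 g) (Var 0))) (\<lambda>L. norm_ty ev (A # \<Gamma>) L (\<lambda>L. bnd (el l (A # \<Gamma>) (Some L)) (\<lambda>l _.
     llet (subst_at 1 D (PushR (wk 1 f) (wk 1 g) (Var 0))) (\<lambda>R. norm_ty ev (B # \<Gamma>) R (\<lambda>R. bnd (el r (B # \<Gamma>) (Some R)) (\<lambda>r _.
     llet (glue_over f g D l r) (\<lambda>Q. eval_ty ev (C # \<Gamma>) Q (\<lambda>Q. bnd (el q (C # \<Gamma>) (Some Q)) (\<lambda>q _.
     llet (sb 0 t D) (\<lambda>T. infer m \<Gamma> (IndPush D l r q t) T))))))))))))))))"
| "el (PPushBeta D l r q c Y) = (\<lambda>\<Gamma> m. elab_ty (el Y) \<Gamma> (\<lambda>S _. on_Push S (\<lambda>f g. check_push ev \<Gamma> f g (\<lambda>A B C.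
     elab_ty (el D) (S # \<Gamma>) (\<lambda>D _.
     llet (subst_at 1 D (PushL (wk 1 f) (wk 1 g) (Var 0))) (\<lambda>L. norm_ty ev (A # \<Gamma>) L (\<lambda>L. bnd (el l (A # \<Gamma>) (Some L)) (\<lambda>l _.
     llet (subst_at 1 D (PushR (wk 1 f) (wk 1 g) (Var 0))) (\<lambda>R. norm_ty ev (B # \<Gamma>) R (\<lambda>R. bnd (el r (B # \<Gamma>) (Some R)) (\<lambda>r _.
     llet (glue_over f g D l r) (\<lambda>Q. eval_ty ev (C # \<Gamma>) Q (\<lambda>Q. bnd (el q (C # \<Gamma>) (Some Q)) (\<lambda>q _.
     bnd (el c \<Gamma> (Some C)) (\<lambda>c _.
     llet (push_beta_type f g D l r q c) (\<lambda>T. eval_ty ev \<Gamma> T (\<lambda>T. infer m \<Gamma> (PushBeta f g D l r q c) T)))))))))))))))))"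

definition is_Ok :: "res \<Rightarrow> bool" where "is_Ok r = (\<exists>t T. r = Ok t T)"

section \<open>Symbolic evaluation\<close>

definition sbe :: "nat \<Rightarrow> tm \<Rightarrow> tm \<Rightarrow> tm" where "sbe = sb"

section \<open>Composition of renamings and substitutions\<close>

lemma sub_Var: "sub t Var = t"
proof -
  have [simp]: "up Var = Var" by (rule ext) (simp add: up_def split: nat.split)
  show ?thesis by (induction t) simp_all
qed

lemma up_Var_ren: "up (\<lambda>n. Var (\<xi> n)) = (\<lambda>n. Var (upr \<xi> n))"
  by (rule ext) (simp add: up_def upr_def split: nat.split)

lemma ren_as_sub: "ren t \<xi> = sub t (\<lambda>n. Var (\<xi> n))"
  by (induction t arbitrary: \<xi>) (simp_all add: up_Var_ren)

lemma up_upr: "up \<sigma> (upr \<xi> n) = up (\<lambda>n. \<sigma> (\<xi> n)) n"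
  by (simp add: up_def upr_def split: nat.split)

lemma sub_ren: "sub (ren t \<xi>) \<sigma> = sub t (\<lambda>n. \<sigma> (\<xi> n))"
  by (induction t arbitrary: \<xi> \<sigma>) (simp_all add: up_upr)

lemma ren_up: "ren (up \<sigma> n) (upr \<xi>) = up (\<lambda>n. ren (\<sigma> n) \<xi>) n"
  by (simp add: up_def upr_def ren_ren split: nat.split)

lemma ren_sub: "ren (sub t \<sigma>) \<xi> = sub t (\<lambda>n. ren (\<sigma> n) \<xi>)"
  by (induction t arbitrary: \<xi> \<sigma>) (simp_all add: ren_up)

lemma sub_up: "sub (up \<sigma> n) (up \<tau>) = up (\<lambda>n. sub (\<sigma> n) \<tau>) n"
  by (simp add: up_def sub_ren ren_sub split: nat.split)

lemma sub_sub: "sub (sub t \<sigma>) \<tau> = sub t (\<lambda>n. sub (\<sigma> n) \<tau>)"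
  by (induction t arbitrary: \<sigma> \<tau>) (simp_all add: sub_up)

lemma wk_lf: "wk k t = lf k 0 t"
  by (simp add: wk_def lf_def)

lemma wk1_lf: "wk1 k t = lf k (Suc 0) t"
  unfolding wk1_def lf_def by (rule arg_cong[where f = "ren t"]) (auto split: nat.split)

lemma inst_sb: "t\<lbrakk>a\<rbrakk> = sb 0 a t"
  unfolding inst_def sb_def by (rule arg_cong[where f = "sub t"]) (auto simp: lf_def ren_ident split: nat.split)

lemma subst_at_sb: "subst_at k t a = sb 0 a (lf k (Suc 0) t)"
  unfolding subst_at_def sb_def lf_def sub_ren
  by (rule arg_cong[where f = "sub t"]) (auto simp: ren_ident split: nat.split)

lemma inst2_sb: "t\<lbrakk>a, b\<rbrakk> = sb 0 a (sb 0 (lf (Suc 0) 0 b) t)"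
  unfolding inst2_def sb_def sub_sub
  by (rule arg_cong[where f = "sub t"]) (auto simp: lf_def ren_ident sub_ren sub_Var split: nat.split)

section \<open>Structural properties of the type theory\<close>

lemma ctx_consD: "A # \<Gamma> \<turnstile> \<^bold>\<surd> \<Longrightarrow> \<Gamma> \<turnstile> A \<^bold>: Ty"
  by (erule valid_ctx.cases) auto

text \<open>All suffixes are claimed at once because a premise under a binder lives in the extended
  context, whose suffix at \<open>Suc n\<close> is the one wanted.\<close>

lemma
  shows drop_valid_ctx: "\<Gamma> \<turnstile> \<^bold>\<surd> \<Longrightarrow> \<forall>n. drop n \<Gamma> \<turnstile> \<^bold>\<surd>"
    and drop_has_type: "\<Gamma> \<turnstile> a \<^bold>: A \<Longrightarrow> \<forall>n. drop n \<Gamma> \<turnstile> \<^bold>\<surd>"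
    and "\<Gamma> \<turnstile> a \<approx> b \<^bold>: A \<Longrightarrow> \<forall>n. drop n \<Gamma> \<turnstile> \<^bold>\<surd>"
proof (induction rule: valid_ctx_has_type_jdg_eq.inducts)
  case ctx_nil then show ?case by (simp add: valid_ctx_has_type_jdg_eq.ctx_nil)
next
  case (ctx_cons \<Gamma> A)
  show ?case
  proof
    fix n show "drop n (A # \<Gamma>) \<turnstile> \<^bold>\<surd>"
      using ctx_cons valid_ctx_has_type_jdg_eq.ctx_cons by (cases n) auto
  qed
qed (auto dest: spec[of _ "Suc _"])

lemma typed_ctx: "\<Gamma> \<turnstile> a \<^bold>: A \<Longrightarrow> \<Gamma> \<turnstile> \<^bold>\<surd>"
  using drop_has_type[of \<Gamma> a A] by (metis drop0)

lemma ctx_tl: "A # \<Gamma> \<turnstile> \<^bold>\<surd> \<Longrightarrow> \<Gamma> \<turnstile> \<^bold>\<surd>"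
  by (blast dest: ctx_consD typed_ctx)

definition wsub :: "tm list \<Rightarrow> (nat \<Rightarrow> tm) \<Rightarrow> tm list \<Rightarrow> bool"
  where "wsub \<Delta> \<sigma> \<Gamma> \<longleftrightarrow> \<Delta> \<turnstile> \<^bold>\<surd> \<and> (\<forall>i<length \<Gamma>. \<Delta> \<turnstile> \<sigma> i \<^bold>: sub (\<Gamma> ! i) (\<lambda>n. \<sigma> (n + Suc i)))"

lemma sub_typ': "wsub \<Delta> \<sigma> \<Gamma> \<Longrightarrow> \<Gamma> \<turnstile> a \<^bold>: A \<Longrightarrow> \<Delta> \<turnstile> sub a \<sigma> \<^bold>: sub A \<sigma>"
  unfolding wsub_def by (blast intro: sub_typ)

lemma sub_Ty: "wsub \<Delta> \<sigma> \<Gamma> \<Longrightarrow> \<Gamma> \<turnstile> A \<^bold>: Ty \<Longrightarrow> \<Delta> \<turnstile> sub A \<sigma> \<^bold>: Ty"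
  using sub_typ'[of \<Delta> \<sigma> \<Gamma> A Ty] by simp

lemma sub_eq': "wsub \<Delta> \<sigma> \<Gamma> \<Longrightarrow> \<Gamma> \<turnstile> a \<approx> b \<^bold>: A \<Longrightarrow> \<Delta> \<turnstile> sub a \<sigma> \<approx> sub b \<sigma> \<^bold>: sub A \<sigma>"
  unfolding wsub_def by (blast intro: sub_eq)

lemma wsub_cons: "wsub \<Delta> \<sigma> \<Gamma> \<Longrightarrow> \<Delta> \<turnstile> a \<^bold>: sub A \<sigma> \<Longrightarrow> wsub \<Delta> (a \<cdot> \<sigma>) (A # \<Gamma>)"
  unfolding wsub_def by (auto simp: nth_Cons split: nat.split)

lemma wk_sub: "wk k t = sub t (\<lambda>n. Var (n + k))"
  by (simp add: wk_def ren_as_sub)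

lemma wsub_Var: "\<Gamma> \<turnstile> \<^bold>\<surd> \<Longrightarrow> wsub \<Gamma> Var \<Gamma>"
  unfolding wsub_def using var[of \<Gamma>] by (auto simp: wk_sub)

lemma wsub_shift: "wsub \<Delta> \<sigma> \<Gamma> \<Longrightarrow> C # \<Delta> \<turnstile> \<^bold>\<surd> \<Longrightarrow> wsub (C # \<Delta>) (\<lambda>n. wk 1 (\<sigma> n)) \<Gamma>"
proof -
  assume s: "wsub \<Delta> \<sigma> \<Gamma>" and C: "C # \<Delta> \<turnstile> \<^bold>\<surd>"
  have "wsub (C # \<Delta>) (\<lambda>n. Var (n + 1)) \<Delta>"
    unfolding wsub_def
  proof (intro conjI allI impI)
    fix i assume "i < length \<Delta>"
    then have "C # \<Delta> \<turnstile> Var (Suc i) \<^bold>: wk (Suc (Suc i)) ((C # \<Delta>) ! Suc i)" using var[OF C, of "Suc i"] by simp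
    then show "C # \<Delta> \<turnstile> Var (i + 1) \<^bold>: sub (\<Delta> ! i) (\<lambda>n. Var (n + Suc i + 1))"
      by (simp add: wk_sub)
  qed (rule C)
  note w = sub_typ'[OF this]
  show ?thesis unfolding wsub_def
  proof (intro conjI allI impI)
    fix i assume "i < length \<Gamma>"
    then have "\<Delta> \<turnstile> \<sigma> i \<^bold>: sub (\<Gamma> ! i) (\<lambda>n. \<sigma> (n + Suc i))" using s by (simp add: wsub_def)
    from w[OF this] show "C # \<Delta> \<turnstile> wk 1 (\<sigma> i) \<^bold>: sub (\<Gamma> ! i) (\<lambda>n. wk 1 (\<sigma> (n + Suc i)))"
      by (simp add: wk_sub sub_sub)
  qed (rule C)
qed

lemma wsub_wk: "\<Gamma> \<turnstile> \<^bold>\<surd> \<Longrightarrow> C # \<Gamma> \<turnstile> \<^bold>\<surd> \<Longrightarrow> wsub (C # \<Gamma>) (\<lambda>n. Var (n + 1)) \<Gamma>"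
  using wsub_shift[OF wsub_Var] by (simp add: wk_def)

lemma wk1_typ: "\<Gamma> \<turnstile> a \<^bold>: A \<Longrightarrow> \<Gamma> \<turnstile> C \<^bold>: Ty \<Longrightarrow> C # \<Gamma> \<turnstile> wk 1 a \<^bold>: wk 1 A"
  unfolding wk_sub by (rule sub_typ'[OF wsub_wk]) (auto intro: ctx_cons typed_ctx)

lemma wk1_Ty: "\<Gamma> \<turnstile> A \<^bold>: Ty \<Longrightarrow> \<Gamma> \<turnstile> C \<^bold>: Ty \<Longrightarrow> C # \<Gamma> \<turnstile> wk 1 A \<^bold>: Ty"
  using wk1_typ[of \<Gamma> A Ty C] by (simp add: wk_def)

lemma wk1_eq: "\<Gamma> \<turnstile> a \<approx> b \<^bold>: A \<Longrightarrow> \<Gamma> \<turnstile> C \<^bold>: Ty \<Longrightarrow> C # \<Gamma> \<turnstile> wk 1 a \<approx> wk 1 b \<^bold>: wk 1 A"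
  unfolding wk_sub by (rule sub_eq'[OF wsub_wk]) (auto intro: ctx_cons typed_ctx)

lemma var0: "A # \<Gamma> \<turnstile> \<^bold>\<surd> \<Longrightarrow> A # \<Gamma> \<turnstile> Var 0 \<^bold>: wk 1 A"
  using var[of "A # \<Gamma>" 0] by simp

lemma var1: "B # A # \<Gamma> \<turnstile> \<^bold>\<surd> \<Longrightarrow> B # A # \<Gamma> \<turnstile> Var 1 \<^bold>: wk 2 A"
  using var[of "B # A # \<Gamma>" 1] by (simp add: numeral_2_eq_2)

lemma wsub_inst: "\<Gamma> \<turnstile> a \<^bold>: A \<Longrightarrow> wsub \<Gamma> (a \<cdot> Var) (A # \<Gamma>)"
  by (rule wsub_cons[OF wsub_Var]) (auto intro: typed_ctx simp: sub_Var)

lemma inst_typ: "A # \<Gamma> \<turnstile> b \<^bold>: B \<Longrightarrow> \<Gamma> \<turnstile> a \<^bold>: A \<Longrightarrow> \<Gamma> \<turnstile> b\<lbrakk>a\<rbrakk> \<^bold>: B\<lbrakk>a\<rbrakk>"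
  unfolding inst_def by (rule sub_typ'[OF wsub_inst])

lemma inst_Ty: "A # \<Gamma> \<turnstile> B \<^bold>: Ty \<Longrightarrow> \<Gamma> \<turnstile> a \<^bold>: A \<Longrightarrow> \<Gamma> \<turnstile> B\<lbrakk>a\<rbrakk> \<^bold>: Ty"
  using inst_typ[of A \<Gamma> B Ty a] by (simp add: inst_def)

lemma inst_eq: "A # \<Gamma> \<turnstile> b \<approx> c \<^bold>: B \<Longrightarrow> \<Gamma> \<turnstile> a \<^bold>: A \<Longrightarrow> \<Gamma> \<turnstile> b\<lbrakk>a\<rbrakk> \<approx> c\<lbrakk>a\<rbrakk> \<^bold>: B\<lbrakk>a\<rbrakk>"
  unfolding inst_def by (rule sub_eq'[OF wsub_inst])

lemma sub_cong': "wsub \<Delta> \<sigma> \<Gamma> \<Longrightarrow> (\<And>i. i < length \<Gamma> \<Longrightarrow> \<Delta> \<turnstile> \<sigma> i \<approx> \<tau> i \<^bold>: sub (\<Gamma> ! i) (\<lambda>n. \<sigma> (n + Suc i))) \<Longrightarrow>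
    \<Gamma> \<turnstile> a \<^bold>: A \<Longrightarrow> \<Delta> \<turnstile> sub a \<sigma> \<approx> sub a \<tau> \<^bold>: sub A \<sigma>"
  unfolding wsub_def by (rule sub_cong) auto

lemma inst_cong: "A # \<Gamma> \<turnstile> b \<^bold>: B \<Longrightarrow> \<Gamma> \<turnstile> a \<^bold>: A \<Longrightarrow> \<Gamma> \<turnstile> a \<approx> a' \<^bold>: A \<Longrightarrow> \<Gamma> \<turnstile> b\<lbrakk>a\<rbrakk> \<approx> b\<lbrakk>a'\<rbrakk> \<^bold>: B\<lbrakk>a\<rbrakk>"
  unfolding inst_def
proof (rule sub_cong'[OF wsub_inst])
  fix i assume "\<Gamma> \<turnstile> a \<^bold>: A" "\<Gamma> \<turnstile> a \<approx> a' \<^bold>: A" "i < length (A # \<Gamma>)"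
  then show "\<Gamma> \<turnstile> (a \<cdot> Var) i \<approx> (a' \<cdot> Var) i \<^bold>: sub ((A # \<Gamma>) ! i) (\<lambda>n. (a \<cdot> Var) (n + Suc i))"
    using var[of \<Gamma>] by (auto simp: sub_Var wk_sub nth_Cons intro: eq_refl typed_ctx split: nat.split)
qed

lemma inst_Ty_cong: "A # \<Gamma> \<turnstile> B \<^bold>: Ty \<Longrightarrow> \<Gamma> \<turnstile> a \<^bold>: A \<Longrightarrow> \<Gamma> \<turnstile> a \<approx> a' \<^bold>: A \<Longrightarrow> \<Gamma> \<turnstile> B\<lbrakk>a\<rbrakk> \<approx> B\<lbrakk>a'\<rbrakk> \<^bold>: Ty"
  using inst_cong[of A \<Gamma> B Ty a a'] by (simp add: inst_def)

lemma wsub_inst2: "\<Gamma> \<turnstile> a \<^bold>: A \<Longrightarrow> \<Gamma> \<turnstile> b \<^bold>: B\<lbrakk>a\<rbrakk> \<Longrightarrow> wsub \<Gamma> (b \<cdot> a \<cdot> Var) (B # A # \<Gamma>)"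
  by (intro wsub_cons[OF wsub_inst]) (auto simp: inst_def)

lemma inst2_typ: "B # A # \<Gamma> \<turnstile> c \<^bold>: C \<Longrightarrow> \<Gamma> \<turnstile> a \<^bold>: A \<Longrightarrow> \<Gamma> \<turnstile> b \<^bold>: B\<lbrakk>a\<rbrakk> \<Longrightarrow> \<Gamma> \<turnstile> c\<lbrakk>a, b\<rbrakk> \<^bold>: C\<lbrakk>a, b\<rbrakk>"
  unfolding inst2_def by (rule sub_typ'[OF wsub_inst2])

lemma inst2_Ty: "B # A # \<Gamma> \<turnstile> C \<^bold>: Ty \<Longrightarrow> \<Gamma> \<turnstile> a \<^bold>: A \<Longrightarrow> \<Gamma> \<turnstile> b \<^bold>: B\<lbrakk>a\<rbrakk> \<Longrightarrow> \<Gamma> \<turnstile> C\<lbrakk>a, b\<rbrakk> \<^bold>: Ty"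
  using inst2_typ[of B A \<Gamma> C Ty a b] by (simp add: inst2_def)

lemma inst2_eq: "B # A # \<Gamma> \<turnstile> c \<approx> d \<^bold>: C \<Longrightarrow> \<Gamma> \<turnstile> a \<^bold>: A \<Longrightarrow> \<Gamma> \<turnstile> b \<^bold>: B\<lbrakk>a\<rbrakk> \<Longrightarrow> \<Gamma> \<turnstile> c\<lbrakk>a, b\<rbrakk> \<approx> d\<lbrakk>a, b\<rbrakk> \<^bold>: C\<lbrakk>a, b\<rbrakk>"
  unfolding inst2_def by (rule sub_eq'[OF wsub_inst2])

lemma inst2_Ty_cong: "B # A # \<Gamma> \<turnstile> C \<^bold>: Ty \<Longrightarrow> \<Gamma> \<turnstile> a \<^bold>: A \<Longrightarrow> \<Gamma> \<turnstile> b \<^bold>: B\<lbrakk>a\<rbrakk> \<Longrightarrow> \<Gamma> \<turnstile> b \<approx> b' \<^bold>: B\<lbrakk>a\<rbrakk> \<Longrightarrow>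
    \<Gamma> \<turnstile> C\<lbrakk>a, b\<rbrakk> \<approx> C\<lbrakk>a, b'\<rbrakk> \<^bold>: Ty"
proof -
  assume C: "B # A # \<Gamma> \<turnstile> C \<^bold>: Ty" and a: "\<Gamma> \<turnstile> a \<^bold>: A" and b: "\<Gamma> \<turnstile> b \<^bold>: B\<lbrakk>a\<rbrakk>" and bb: "\<Gamma> \<turnstile> b \<approx> b' \<^bold>: B\<lbrakk>a\<rbrakk>"
  have "\<Gamma> \<turnstile> sub C (b \<cdot> a \<cdot> Var) \<approx> sub C (b' \<cdot> a \<cdot> Var) \<^bold>: sub Ty (b \<cdot> a \<cdot> Var)"
  proof (rule sub_cong'[OF wsub_inst2[OF a b] _ C])
    fix i assume "i < length (B # A # \<Gamma>)"
    then show "\<Gamma> \<turnstile> (b \<cdot> a \<cdot> Var) i \<approx> (b' \<cdot> a \<cdot> Var) i \<^bold>: sub ((B # A # \<Gamma>) ! i) (\<lambda>n. (b \<cdot> a \<cdot> Var) (n + Suc i))"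
      using var[of \<Gamma>] a bb by (auto simp: sub_Var wk_sub nth_Cons inst_def[symmetric] intro: eq_refl typed_ctx split: nat.split)
  qed
  then show ?thesis by (simp add: inst2_def)
qed

text \<open>Replacing a type of the context by an equal one is the identity substitution, whose
  component at the changed variable is typed by conversion.\<close>

lemma ctx_conv:
  assumes A: "\<Gamma> \<turnstile> A \<^bold>: Ty" and AA: "\<Gamma> \<turnstile> A \<approx> A' \<^bold>: Ty"
  shows "wsub (A # \<Gamma>) Var (A' # \<Gamma>)"
proof -
  have c: "A # \<Gamma> \<turnstile> \<^bold>\<surd>" using A by (rule ctx_cons)
  have "wsub (A # \<Gamma>) (Var 0 \<cdot> (\<lambda>n. Var (n + 1))) (A' # \<Gamma>)"
  proof (rule wsub_cons)
    show "wsub (A # \<Gamma>) (\<lambda>n. Var (n + 1)) \<Gamma>" using A c by (intro wsub_wk) (auto intro: typed_ctx)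
    have "A # \<Gamma> \<turnstile> wk 1 A \<approx> wk 1 A' \<^bold>: Ty" using wk1_eq[OF AA A] by (simp add: wk_def)
    then show "A # \<Gamma> \<turnstile> Var 0 \<^bold>: sub A' (\<lambda>n. Var (n + 1))" using var0[OF c] conv by (simp add: wk_sub)
  qed
  moreover have "(Var 0 \<cdot> (\<lambda>n. Var (n + 1))) = Var" by (rule ext) (simp split: nat.split)
  ultimately show ?thesis by simp
qed

lemma ctx_conv_typ: "A' # \<Gamma> \<turnstile> b \<^bold>: B \<Longrightarrow> \<Gamma> \<turnstile> A \<^bold>: Ty \<Longrightarrow> \<Gamma> \<turnstile> A \<approx> A' \<^bold>: Ty \<Longrightarrow> A # \<Gamma> \<turnstile> b \<^bold>: B"
  using sub_typ'[OF ctx_conv] by (simp add: sub_Var)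

lemma ctx_conv_eq: "A' # \<Gamma> \<turnstile> b \<approx> c \<^bold>: B \<Longrightarrow> \<Gamma> \<turnstile> A \<^bold>: Ty \<Longrightarrow> \<Gamma> \<turnstile> A \<approx> A' \<^bold>: Ty \<Longrightarrow> A # \<Gamma> \<turnstile> b \<approx> c \<^bold>: B"
  using sub_eq'[OF ctx_conv] by (simp add: sub_Var)

lemma up_typ:
  assumes w: "wsub \<Delta> \<sigma> \<Gamma>" and A: "\<Gamma> \<turnstile> A \<^bold>: Ty" and B: "A # \<Gamma> \<turnstile> B \<^bold>: Ty"
  shows "sub A \<sigma> # \<Delta> \<turnstile> sub B (up \<sigma>) \<^bold>: Ty"
proof -
  have A': "\<Delta> \<turnstile> sub A \<sigma> \<^bold>: Ty" using sub_typ'[OF w A] by simp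
  then have c: "sub A \<sigma> # \<Delta> \<turnstile> \<^bold>\<surd>" by (rule ctx_cons)
  have "wsub (sub A \<sigma> # \<Delta>) (Var 0 \<cdot> (\<lambda>n. wk 1 (\<sigma> n))) (A # \<Gamma>)"
    by (rule wsub_cons[OF wsub_shift[OF w c]]) (use var0[OF c] in \<open>simp add: wk_sub sub_sub\<close>)
  moreover have "(Var 0 \<cdot> (\<lambda>n. wk 1 (\<sigma> n))) = up \<sigma>" by (rule ext) (simp add: up_def wk_def split: nat.split)
  ultimately show ?thesis using sub_typ'[OF _ B] by fastforce
qed

text \<open>Conversion changes the type and not the term, so apart from substitution these terms
  arise only from their own formation rules or the variable rule. Since substitution is a rule of
  the system, its case carries the argument.\<close>

lemma type_inversion:
  "\<Gamma> \<turnstile> t \<^bold>: T \<Longrightarrow> t \<noteq> Ty \<and> (\<forall>i. t = Var i \<longrightarrow> i < length \<Gamma>) \<and>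
    (\<forall>A B. t = Pi A B \<or> t = Sig A B \<longrightarrow> \<Gamma> \<turnstile> A \<^bold>: Ty \<and> A # \<Gamma> \<turnstile> B \<^bold>: Ty) \<and>
    (\<forall>A a b. t = Eq A a b \<longrightarrow> \<Gamma> \<turnstile> A \<^bold>: Ty \<and> \<Gamma> \<turnstile> a \<^bold>: A \<and> \<Gamma> \<turnstile> b \<^bold>: A)"
proof (induction rule: valid_ctx_has_type_jdg_eq.inducts(2)[where ?P1.0 = "\<lambda>_. True" and ?P3.0 = "\<lambda>_ _ _ _. True"])
  case (sub_typ \<Delta> \<Gamma> \<sigma> a A)
  have w: "wsub \<Delta> \<sigma> \<Gamma>" using sub_typ by (simp add: wsub_def)
  show ?case
  proof (cases a)
    \<comment> \<open>The instance of a variable can have any shape; its own typing is a premise of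
      the rule and comes with an induction hypothesis.\<close>
    case (Var i)
    then show ?thesis using sub_typ by auto
  next
    case (Pi A1 B1)
    then have "\<Gamma> \<turnstile> A1 \<^bold>: Ty" "A1 # \<Gamma> \<turnstile> B1 \<^bold>: Ty" using sub_typ by auto
    then show ?thesis using Pi up_typ[OF w] sub_Ty[OF w] by auto
  next
    case (Sig A1 B1)
    then have "\<Gamma> \<turnstile> A1 \<^bold>: Ty" "A1 # \<Gamma> \<turnstile> B1 \<^bold>: Ty" using sub_typ by auto
    then show ?thesis using Sig up_typ[OF w] sub_Ty[OF w] by auto
  next
    case (Eq A1 a1 b1)
    then have "\<Gamma> \<turnstile> A1 \<^bold>: Ty" "\<Gamma> \<turnstile> a1 \<^bold>: A1" "\<Gamma> \<turnstile> b1 \<^bold>: A1" using sub_typ by auto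
    then show ?thesis using Eq sub_typ'[OF w] sub_Ty[OF w] by auto
  qed (use sub_typ in auto)
qed (simp_all, auto intro: small)

lemma not_Ty: "\<not> \<Gamma> \<turnstile> Ty \<^bold>: T"
  using type_inversion by blast

section \<open>Soundness of the type checker\<close>

declare One_nat_def [simp del] Suc_eq_plus1 [symmetric, simp]

lemma scons_1 [simp]: "(a \<cdot> \<sigma>) 1 = \<sigma> 0"
  by (simp add: One_nat_def)

fun canonical :: "tm list \<Rightarrow> tm \<Rightarrow> tm \<Rightarrow> bool" where
  "canonical \<Gamma> (Lam A b) T = (\<exists>B. T = Pi A B \<and> A # \<Gamma> \<turnstile> b \<^bold>: B)"
| "canonical \<Gamma> (Pair B a b) T = (\<exists>A. T = Sig A B \<and> \<Gamma> \<turnstile> a \<^bold>: A \<and> \<Gamma> \<turnstile> b \<^bold>: B\<lbrakk>a\<rbrakk> \<and> canonical \<Gamma> a A)"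
| "canonical \<Gamma> (Refl a) T = (\<exists>A. T = Eq A a a)"
| "canonical \<Gamma> (PushL f g a) T = (T = Push f g)"
| "canonical \<Gamma> (PushR f g b) T = (T = Push f g)"
| "canonical \<Gamma> _ T = True"

text \<open>The equations of \<^const>\<open>canonical\<close> record what is needed to reduce an eliminator applied to \<open>t\<close>, as injectivity of type formers is not available.\<close>

definition conv_to :: "tm list \<Rightarrow> tm \<Rightarrow> tm \<Rightarrow> tm \<Rightarrow> bool"
  where "conv_to \<Gamma> t t' T \<longleftrightarrow> \<Gamma> \<turnstile> t \<^bold>: T \<and> \<Gamma> \<turnstile> t' \<^bold>: T \<and> \<Gamma> \<turnstile> t \<approx> t' \<^bold>: T \<and> (T = Ty \<or> \<Gamma> \<turnstile> T \<^bold>: Ty)"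

definition sound :: "checker \<Rightarrow> bool"
  where "sound e \<longleftrightarrow> (\<forall>\<Gamma> t t' T. \<Gamma> \<turnstile> \<^bold>\<surd> \<longrightarrow> e \<Gamma> t = Ok t' T \<longrightarrow> conv_to \<Gamma> t t' T \<and> canonical \<Gamma> t' T)"

lemma soundD: "sound e \<Longrightarrow> e \<Gamma> t = Ok t' T \<Longrightarrow> \<Gamma> \<turnstile> \<^bold>\<surd> \<Longrightarrow> conv_to \<Gamma> t t' T \<and> canonical \<Gamma> t' T"
  by (simp add: sound_def)

subsection \<open>Inversion of the control combinators\<close>

lemma bnd_Ok: "bnd r k = Ok t T \<longleftrightarrow> (\<exists>u U. r = Ok u U \<and> k u U = Ok t T)"
  by (cases r) (simp_all add: bnd_def)
lemma guard_eq_Ok: "guard_eq a b r = Ok t T \<longleftrightarrow> a = b \<and> r = Ok t T"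
  by (simp add: guard_eq_def)
lemma guard_sort_Ok: "guard_sort s r = Ok t T \<longleftrightarrow> s \<in> {Univ, Ty} \<and> r = Ok t T"
  by (simp add: guard_sort_def)
lemma guard_not_Ty_Ok: "guard_not_Ty A r = Ok t T \<longleftrightarrow> A \<noteq> Ty \<and> r = Ok t T"
  by (cases A) simp_all
lemma on_Pi_Ok: "on_Pi F k = Ok t T \<longleftrightarrow> (\<exists>A B. F = Pi A B \<and> k A B = Ok t T)"
  by (cases F) simp_all
lemma on_Sig_Ok: "on_Sig F k = Ok t T \<longleftrightarrow> (\<exists>A B. F = Sig A B \<and> k A B = Ok t T)"
  by (cases F) simp_all
lemma on_Eq_Ok: "on_Eq F k = Ok t T \<longleftrightarrow> (\<exists>A a b. F = Eq A a b \<and> k A a b = Ok t T)"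
  by (cases F) simp_all
lemma on_Push_Ok: "on_Push F k = Ok t T \<longleftrightarrow> (\<exists>f g. F = Push f g \<and> k f g = Ok t T)"
  by (cases F) simp_all
lemma if_Lam_Ok: "if_Lam f k r = Ok t T \<longleftrightarrow> (\<exists>A b. f = Lam A b \<and> k b = Ok t T) \<or> (\<forall>A b. f \<noteq> Lam A b) \<and> r = Ok t T"
  by (cases f) simp_all
lemma if_Pair_Ok: "if_Pair p k r = Ok t T \<longleftrightarrow> (\<exists>B a b. p = Pair B a b \<and> k a b = Ok t T) \<or> (\<forall>B a b. p \<noteq> Pair B a b) \<and> r = Ok t T"
  by (cases p) simp_all
lemma if_Refl_Ok: "if_Refl p r r' = Ok t T \<longleftrightarrow> (\<exists>a. p = Refl a) \<and> r = Ok t T \<or> (\<forall>a. p \<noteq> Refl a) \<and> r' = Ok t T"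
  by (cases p) simp_all
lemma if_Push_Ok: "if_Push p k k' r = Ok t T \<longleftrightarrow> (\<exists>f g a. p = PushL f g a \<and> k a = Ok t T) \<or> (\<exists>f g a. p = PushR f g a \<and> k' a = Ok t T) \<or>
    (\<forall>f g a. p \<noteq> PushL f g a \<and> p \<noteq> PushR f g a) \<and> r = Ok t T"
  by (cases p) simp_all
lemma if_proj_Ok: "if_proj d r1 r2 r = Ok t T \<longleftrightarrow> d = Var 1 \<and> r1 = Ok t T \<or> d = Var 0 \<and> r2 = Ok t T \<or> d \<noteq> Var 0 \<and> d \<noteq> Var 1 \<and> r = Ok t T"
  by (cases d; simp; rename_tac i; case_tac i; simp; rename_tac j; case_tac j; simp)
lemma if'_Ok: "if' b r r' = Ok t T \<longleftrightarrow> (b \<and> r = Ok t T) \<or> (\<not> b \<and> r' = Ok t T)"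
  by (simp add: if'_def)
lemma llet_Ok: "llet x k = Ok t T \<longleftrightarrow> k x = Ok t T"
  by (simp add: llet_def)

lemma look_Ok: "look \<Gamma> i k = Ok t T \<Longrightarrow> i < length \<Gamma> \<and> k (\<Gamma> ! i) = Ok t T"
  by (induction \<Gamma> i k rule: look.induct) auto

lemmas control_Ok = bnd_Ok guard_eq_Ok guard_sort_Ok guard_not_Ty_Ok on_Pi_Ok on_Sig_Ok on_Eq_Ok on_Push_Ok llet_Ok

subsection \<open>Congruence rules\<close>

lemma conv_toD: assumes "conv_to \<Gamma> t t' T" shows "\<Gamma> \<turnstile> t \<^bold>: T" "\<Gamma> \<turnstile> t' \<^bold>: T" "\<Gamma> \<turnstile> t \<approx> t' \<^bold>: T" "T \<noteq> Ty \<Longrightarrow> \<Gamma> \<turnstile> T \<^bold>: Ty"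
  using assms by (auto simp: conv_to_def)

lemma conv_toI: "\<Gamma> \<turnstile> t \<^bold>: T \<Longrightarrow> \<Gamma> \<turnstile> t' \<^bold>: T \<Longrightarrow> \<Gamma> \<turnstile> t \<approx> t' \<^bold>: T \<Longrightarrow> T = Ty \<or> \<Gamma> \<turnstile> T \<^bold>: Ty \<Longrightarrow> conv_to \<Gamma> t t' T"
  by (simp add: conv_to_def)

lemma conv_to_refl: "\<Gamma> \<turnstile> t \<^bold>: T \<Longrightarrow> T = Ty \<or> \<Gamma> \<turnstile> T \<^bold>: Ty \<Longrightarrow> conv_to \<Gamma> t t T"
  by (auto intro: conv_toI eq_refl)

lemma conv_to_trans: "conv_to \<Gamma> t u T \<Longrightarrow> conv_to \<Gamma> u v T \<Longrightarrow> conv_to \<Gamma> t v T"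
  unfolding conv_to_def by (blast intro: eq_trans)

lemma conv_to_conv: "conv_to \<Gamma> t t' T \<Longrightarrow> conv_to \<Gamma> T T' Ty \<Longrightarrow> conv_to \<Gamma> t t' T'"
  unfolding conv_to_def by (blast intro: conv eq_conv)

lemma conv_to_conv_sym: "conv_to \<Gamma> t t' T' \<Longrightarrow> conv_to \<Gamma> T T' Ty \<Longrightarrow> conv_to \<Gamma> t t' T"
  unfolding conv_to_def by (blast intro: conv eq_conv eq_sym)

lemma conv_to_sort: "conv_to \<Gamma> A A' s \<Longrightarrow> s \<in> {Univ, Ty} \<Longrightarrow> conv_to \<Gamma> A A' Ty"
  by (auto simp: conv_to_def intro: small eq_small)

lemma conv_to_max_sort: "conv_to \<Gamma> A A' s \<Longrightarrow> s \<in> {Univ, Ty} \<Longrightarrow> s' \<in> {Univ, Ty} \<Longrightarrow> conv_to \<Gamma> A A' (max_sort s s') \<and> conv_to \<Gamma> A A' (max_sort s' s)"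
  by (auto simp: conv_to_def intro: small eq_small)

lemma max_sort_sort: "s \<in> {Univ, Ty} \<Longrightarrow> s' \<in> {Univ, Ty} \<Longrightarrow> max_sort s s' \<in> {Univ, Ty}"
  by auto

lemma sort_wf: "\<Gamma> \<turnstile> \<^bold>\<surd> \<Longrightarrow> s \<in> {Univ, Ty} \<Longrightarrow> s = Ty \<or> \<Gamma> \<turnstile> s \<^bold>: Ty"
  by (auto intro: univ_form)

text \<open>A body is evaluated under the normalised domain, whereas the rules type the original
  body under the original domain.\<close>

lemma ctx_conv_conv_to: "conv_to (A' # \<Gamma>) b b' B \<Longrightarrow> conv_to \<Gamma> A A' Ty \<Longrightarrow> conv_to (A # \<Gamma>) b b' B"
  unfolding conv_to_def by (blast intro: ctx_conv_typ ctx_conv_eq)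

lemma conv_to_ctx: "conv_to \<Gamma> A A' Ty \<Longrightarrow> A' # \<Gamma> \<turnstile> \<^bold>\<surd>"
  by (auto simp: conv_to_def intro: ctx_cons)

lemma conv_to_Pi: "s \<in> {Univ, Ty} \<Longrightarrow> conv_to \<Gamma> A A' s \<Longrightarrow> conv_to (A' # \<Gamma>) B B' s \<Longrightarrow> conv_to \<Gamma> (Pi A B) (Pi A' B') s"
proof -
  assume s: "s \<in> {Univ, Ty}" and A: "conv_to \<Gamma> A A' s" and B: "conv_to (A' # \<Gamma>) B B' s"
  have B': "conv_to (A # \<Gamma>) B B' s" by (rule ctx_conv_conv_to[OF B conv_to_sort[OF A s]])
  have "\<Gamma> \<turnstile> \<^bold>\<surd>" using A by (auto simp: conv_to_def intro: typed_ctx)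
  then show ?thesis
    by (intro conv_toI pi_form[OF s] pi_cong[OF s] sort_wf s) (use A B B' in \<open>auto dest: conv_toD\<close>)
qed

lemma conv_to_Sig: "s \<in> {Univ, Ty} \<Longrightarrow> conv_to \<Gamma> A A' s \<Longrightarrow> conv_to (A' # \<Gamma>) B B' s \<Longrightarrow> conv_to \<Gamma> (Sig A B) (Sig A' B') s"
proof -
  assume s: "s \<in> {Univ, Ty}" and A: "conv_to \<Gamma> A A' s" and B: "conv_to (A' # \<Gamma>) B B' s"
  have B': "conv_to (A # \<Gamma>) B B' s" by (rule ctx_conv_conv_to[OF B conv_to_sort[OF A s]])
  have "\<Gamma> \<turnstile> \<^bold>\<surd>" using A by (auto simp: conv_to_def intro: typed_ctx)
  then show ?thesis
    by (intro conv_toI sig_form[OF s] sig_cong[OF s] sort_wf s) (use A B B' in \<open>auto dest: conv_toD\<close>)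
qed

lemma conv_to_Eq: "s \<in> {Univ, Ty} \<Longrightarrow> conv_to \<Gamma> A A' s \<Longrightarrow> conv_to \<Gamma> a a' A' \<Longrightarrow> conv_to \<Gamma> b b' A' \<Longrightarrow> conv_to \<Gamma> (Eq A a b) (Eq A' a' b') s"
proof -
  assume s: "s \<in> {Univ, Ty}" and A: "conv_to \<Gamma> A A' s" and a: "conv_to \<Gamma> a a' A'" and b: "conv_to \<Gamma> b b' A'"
  have a': "conv_to \<Gamma> a a' A" and b': "conv_to \<Gamma> b b' A"
    using conv_to_conv_sym[OF a conv_to_sort[OF A s]] conv_to_conv_sym[OF b conv_to_sort[OF A s]] by auto
  have "\<Gamma> \<turnstile> \<^bold>\<surd>" using A by (auto simp: conv_to_def intro: typed_ctx)
  then show ?thesis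
    by (intro conv_toI id_form[OF s] id_cong[OF s] sort_wf s) (use A a b a' b' in \<open>auto dest: conv_toD\<close>)
qed

lemma conv_to_Lam: "conv_to \<Gamma> A A' Ty \<Longrightarrow> conv_to (A' # \<Gamma>) b b' B \<Longrightarrow> B \<noteq> Ty \<Longrightarrow> conv_to \<Gamma> (Lam A b) (Lam A' b') (Pi A' B)"
proof -
  assume A: "conv_to \<Gamma> A A' Ty" and b: "conv_to (A' # \<Gamma>) b b' B" and B: "B \<noteq> Ty"
  have BT: "A' # \<Gamma> \<turnstile> B \<^bold>: Ty" using b B by (auto simp: conv_to_def)
  have b1: "conv_to (A # \<Gamma>) b b' B" by (rule ctx_conv_conv_to[OF b A])
  have BT1: "A # \<Gamma> \<turnstile> B \<^bold>: Ty" using b1 B by (auto simp: conv_to_def)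
  have PP: "\<Gamma> \<turnstile> Pi A B \<approx> Pi A' B \<^bold>: Ty" using A BT1 by (intro pi_cong) (auto simp: conv_to_def intro: eq_refl)
  have P: "\<Gamma> \<turnstile> Pi A' B \<^bold>: Ty" using A BT by (intro pi_form) (auto simp: conv_to_def)
  show ?thesis
  proof (rule conv_toI)
    show "\<Gamma> \<turnstile> Lam A b \<^bold>: Pi A' B" using b1 BT1 by (intro conv[OF lam PP]) (auto simp: conv_to_def)
    show "\<Gamma> \<turnstile> Lam A' b' \<^bold>: Pi A' B" using b BT by (intro lam) (auto simp: conv_to_def)
    show "\<Gamma> \<turnstile> Lam A b \<approx> Lam A' b' \<^bold>: Pi A' B" using A b1 BT1 by (intro eq_conv[OF lam_cong PP]) (auto simp: conv_to_def)
  qed (use P in simp)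
qed

text \<open>Application has no congruence rule of its own. It is an instance of the generic
  application of one variable to another, and \<open>sub_cong\<close> is used with two judgmentally
  equal substitutions for function and argument.\<close>

lemma app_cong: 
  assumes f: "\<Gamma> \<turnstile> f \<^bold>: Pi A B" "\<Gamma> \<turnstile> f \<approx> f' \<^bold>: Pi A B" and a: "\<Gamma> \<turnstile> a \<^bold>: A" "\<Gamma> \<turnstile> a \<approx> a' \<^bold>: A"
    and P: "\<Gamma> \<turnstile> Pi A B \<^bold>: Ty"
  shows "\<Gamma> \<turnstile> App f a \<approx> App f' a' \<^bold>: B\<lbrakk>a\<rbrakk>"
proof -
  have A: "\<Gamma> \<turnstile> A \<^bold>: Ty" using type_inversion[OF P] by auto
  let ?\<Delta> = "wk 1 A # Pi A B # \<Gamma>"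
  have A1: "Pi A B # \<Gamma> \<turnstile> wk 1 A \<^bold>: Ty" by (rule wk1_Ty[OF A P])
  have c: "?\<Delta> \<turnstile> \<^bold>\<surd>" by (rule ctx_cons[OF A1])
  have "?\<Delta> \<turnstile> Var 1 \<^bold>: wk 2 (Pi A B)" by (rule var1[OF c])
  moreover have "?\<Delta> \<turnstile> Var 0 \<^bold>: wk 2 A" using var0[OF c] by (simp add: wk_def ren_ren)
  ultimately have ap: "?\<Delta> \<turnstile> App (Var 1) (Var 0) \<^bold>: (ren B (upr (\<lambda>n. n + 2)))\<lbrakk>Var 0\<rbrakk>"
    by (intro app[where A = "wk 2 A"]) (simp_all add: wk_def)
  have w: "wsub \<Gamma> (a \<cdot> f \<cdot> Var) ?\<Delta>"
    by (rule wsub_inst2[where A = "Pi A B" and B = "wk 1 A"]) (use f a in \<open>simp_all add: inst_def wk_sub sub_sub sub_Var\<close>)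
  have "\<Gamma> \<turnstile> sub (App (Var 1) (Var 0)) (a \<cdot> f \<cdot> Var) \<approx> sub (App (Var 1) (Var 0)) (a' \<cdot> f' \<cdot> Var) \<^bold>: sub ((ren B (upr (\<lambda>n. n + 2)))\<lbrakk>Var 0\<rbrakk>) (a \<cdot> f \<cdot> Var)"
  proof (rule sub_cong'[OF w _ ap])
    fix i assume "i < length ?\<Delta>"
    then show "\<Gamma> \<turnstile> (a \<cdot> f \<cdot> Var) i \<approx> (a' \<cdot> f' \<cdot> Var) i \<^bold>: sub (?\<Delta> ! i) (\<lambda>n. (a \<cdot> f \<cdot> Var) (n + Suc i))"
      using var[of \<Gamma>] f a by (auto simp: sub_Var wk_sub sub_sub nth_Cons intro: eq_refl typed_ctx split: nat.split)
  qed
  moreover have "sub ((ren B (upr (\<lambda>n. n + 2)))\<lbrakk>Var 0\<rbrakk>) (a \<cdot> f \<cdot> Var) = B\<lbrakk>a\<rbrakk>"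
    unfolding inst_def sub_sub sub_ren by (rule arg_cong[where f = "sub B"]) (auto simp: upr_def split: nat.split)
  ultimately show ?thesis by simp
qed

lemma conv_to_App: "conv_to \<Gamma> f f' (Pi A B) \<Longrightarrow> conv_to \<Gamma> a a' A \<Longrightarrow> conv_to \<Gamma> (App f a) (App f' a') (B\<lbrakk>a'\<rbrakk>)"
proof -
  assume f: "conv_to \<Gamma> f f' (Pi A B)" and a: "conv_to \<Gamma> a a' A"
  have P: "\<Gamma> \<turnstile> Pi A B \<^bold>: Ty" using f by (auto simp: conv_to_def)
  then have B: "A # \<Gamma> \<turnstile> B \<^bold>: Ty" using type_inversion[OF P] by auto
  have BB: "\<Gamma> \<turnstile> B\<lbrakk>a\<rbrakk> \<approx> B\<lbrakk>a'\<rbrakk> \<^bold>: Ty" using a by (intro inst_Ty_cong[OF B]) (auto simp: conv_to_def)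
  show ?thesis
  proof (rule conv_toI)
    show "\<Gamma> \<turnstile> App f a \<^bold>: B\<lbrakk>a'\<rbrakk>" using f a by (intro conv[OF app[of _ _ A] BB]) (auto simp: conv_to_def)
    show "\<Gamma> \<turnstile> App f' a' \<^bold>: B\<lbrakk>a'\<rbrakk>" using f a by (intro app[of _ _ A]) (auto simp: conv_to_def)
    show "\<Gamma> \<turnstile> App f a \<approx> App f' a' \<^bold>: B\<lbrakk>a'\<rbrakk>" using f a P by (intro eq_conv[OF app_cong[of _ _ A] BB]) (auto simp: conv_to_def)
    show "B\<lbrakk>a'\<rbrakk> = Ty \<or> \<Gamma> \<turnstile> B\<lbrakk>a'\<rbrakk> \<^bold>: Ty" using a inst_Ty[OF B] by (auto simp: conv_to_def)
  qed
qed

lemma conv_to_beta: "A # \<Gamma> \<turnstile> B \<^bold>: Ty \<Longrightarrow> A # \<Gamma> \<turnstile> b \<^bold>: B \<Longrightarrow> \<Gamma> \<turnstile> a \<^bold>: A \<Longrightarrow> conv_to \<Gamma> (App (Lam A b) a) (b\<lbrakk>a\<rbrakk>) (B\<lbrakk>a\<rbrakk>)"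
  by (rule conv_toI) (auto intro: pi_beta inst_typ inst_Ty app[OF lam])

lemma conv_to_Pair:
  assumes a: "conv_to \<Gamma> a a' A" and A: "A \<noteq> Ty" and B: "conv_to (A # \<Gamma>) B B' Ty" and b: "conv_to \<Gamma> b b' (B'\<lbrakk>a'\<rbrakk>)"
  shows "conv_to \<Gamma> (Pair B a b) (Pair B' a' b') (Sig A B')"
proof -
  have AT: "\<Gamma> \<turnstile> A \<^bold>: Ty" using a A by (auto simp: conv_to_def)
  have at: "\<Gamma> \<turnstile> a \<^bold>: A" "\<Gamma> \<turnstile> a' \<^bold>: A" "\<Gamma> \<turnstile> a \<approx> a' \<^bold>: A" and Bt: "A # \<Gamma> \<turnstile> B \<^bold>: Ty" "A # \<Gamma> \<turnstile> B' \<^bold>: Ty" "A # \<Gamma> \<turnstile> B \<approx> B' \<^bold>: Ty"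
    using a B by (auto simp: conv_to_def)
  have BB: "conv_to \<Gamma> (B\<lbrakk>a\<rbrakk>) (B'\<lbrakk>a'\<rbrakk>) Ty"
  proof (rule conv_toI)
    have "\<Gamma> \<turnstile> B\<lbrakk>a\<rbrakk> \<approx> B'\<lbrakk>a\<rbrakk> \<^bold>: Ty" using inst_eq[OF Bt(3) at(1)] by (simp add: inst_def)
    then show "\<Gamma> \<turnstile> B\<lbrakk>a\<rbrakk> \<approx> B'\<lbrakk>a'\<rbrakk> \<^bold>: Ty" by (rule eq_trans) (rule inst_Ty_cong[OF Bt(2) at(1,3)])
  qed (use inst_Ty Bt at in auto)
  have b1: "conv_to \<Gamma> b b' (B\<lbrakk>a\<rbrakk>)" by (rule conv_to_conv_sym[OF b BB])
  have S: "\<Gamma> \<turnstile> Sig A B \<approx> Sig A B' \<^bold>: Ty" using AT Bt by (intro sig_cong) (auto intro: eq_refl)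
  show ?thesis
  proof (rule conv_toI)
    show "\<Gamma> \<turnstile> Pair B a b \<^bold>: Sig A B'" using b1 at Bt by (intro conv[OF pair S]) (auto simp: conv_to_def)
    show "\<Gamma> \<turnstile> Pair B' a' b' \<^bold>: Sig A B'" using b at Bt by (intro pair) (auto simp: conv_to_def)
    show "\<Gamma> \<turnstile> Pair B a b \<approx> Pair B' a' b' \<^bold>: Sig A B'" using b1 at Bt by (intro eq_conv[OF pair_cong S]) (auto simp: conv_to_def)
    show "Sig A B' = Ty \<or> \<Gamma> \<turnstile> Sig A B' \<^bold>: Ty" using AT Bt by (auto intro: sig_form)
  qed
qed

lemma conv_to_inst: "conv_to (A # \<Gamma>) C C' Ty \<Longrightarrow> conv_to \<Gamma> p p' A \<Longrightarrow> conv_to \<Gamma> (C\<lbrakk>p\<rbrakk>) (C'\<lbrakk>p'\<rbrakk>) Ty"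
proof (rule conv_toI)
  assume C: "conv_to (A # \<Gamma>) C C' Ty" and p: "conv_to \<Gamma> p p' A"
  have "\<Gamma> \<turnstile> C\<lbrakk>p\<rbrakk> \<approx> C'\<lbrakk>p\<rbrakk> \<^bold>: Ty" using inst_eq[of A \<Gamma> C C' Ty p] C p by (auto simp: inst_def conv_to_def)
  then show "\<Gamma> \<turnstile> C\<lbrakk>p\<rbrakk> \<approx> C'\<lbrakk>p'\<rbrakk> \<^bold>: Ty" by (rule eq_trans) (use C p inst_Ty_cong in \<open>auto simp: conv_to_def\<close>)
qed (auto simp: conv_to_def intro: inst_Ty)

lemma conv_to_sub: "wsub \<Delta> \<sigma> \<Gamma> \<Longrightarrow> conv_to \<Gamma> t t' T \<Longrightarrow> conv_to \<Delta> (sub t \<sigma>) (sub t' \<sigma>) (sub T \<sigma>)"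
  unfolding conv_to_def by (auto intro: sub_typ' sub_eq' sub_Ty)

lemma conv_to_wk: "conv_to \<Gamma> t t' T \<Longrightarrow> C # \<Gamma> \<turnstile> \<^bold>\<surd> \<Longrightarrow> conv_to (C # \<Gamma>) (wk 1 t) (wk 1 t') (wk 1 T)"
  unfolding wk_sub by (rule conv_to_sub[OF wsub_wk]) (auto intro: ctx_tl)

lemma conv_to_Arr: "conv_to \<Gamma> A A' Ty \<Longrightarrow> conv_to \<Gamma> B B' Ty \<Longrightarrow> conv_to \<Gamma> (Arr A B) (Arr A' B') Ty"
  unfolding Arr_def
proof (rule conv_to_Pi)
  assume A: "conv_to \<Gamma> A A' Ty" and B: "conv_to \<Gamma> B B' Ty"
  from conv_to_wk[OF B conv_to_ctx[OF A]] show "conv_to (A' # \<Gamma>) (wk 1 B) (wk 1 B') Ty" by (simp add: wk_def)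
qed auto

text \<open>With \<open>t\<close> a constructor applied to a variable this yields congruence for
  \<open>Refl\<close>, \<open>PushL\<close>, \<open>PushR\<close> and \<open>Glue\<close>, which
  have no congruence rules of their own.\<close>

lemma conv_to_inst_cong: "A # \<Gamma> \<turnstile> t \<^bold>: T \<Longrightarrow> T = Ty \<or> A # \<Gamma> \<turnstile> T \<^bold>: Ty \<Longrightarrow> conv_to \<Gamma> a a' A \<Longrightarrow> conv_to \<Gamma> (t\<lbrakk>a\<rbrakk>) (t\<lbrakk>a'\<rbrakk>) (T\<lbrakk>a'\<rbrakk>)"
proof -
  assume t: "A # \<Gamma> \<turnstile> t \<^bold>: T" and T: "T = Ty \<or> A # \<Gamma> \<turnstile> T \<^bold>: Ty" and a: "conv_to \<Gamma> a a' A"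
  have at: "\<Gamma> \<turnstile> a \<^bold>: A" "\<Gamma> \<turnstile> a' \<^bold>: A" "\<Gamma> \<turnstile> a \<approx> a' \<^bold>: A" using a by (auto simp: conv_to_def)
  show ?thesis
  proof (cases "T = Ty")
    case True
    then show ?thesis using inst_typ[OF t] inst_cong[OF t at(1,3)] at by (intro conv_toI) (auto simp: inst_def[of Ty])
  next
    case False
    then have T: "A # \<Gamma> \<turnstile> T \<^bold>: Ty" using T by simp
    have TT: "conv_to \<Gamma> (T\<lbrakk>a\<rbrakk>) (T\<lbrakk>a'\<rbrakk>) Ty" using T at by (intro conv_toI inst_Ty_cong) (auto intro: inst_Ty)
    show ?thesis
      by (rule conv_to_conv[OF conv_toI TT]) (use t at T TT in \<open>auto intro: inst_typ inst_cong inst_Ty conv eq_sym dest: conv_toD(3)\<close>)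
  qed
qed

lemma wsub_up: "wsub \<Delta> \<sigma> \<Gamma> \<Longrightarrow> \<Gamma> \<turnstile> A \<^bold>: Ty \<Longrightarrow> wsub (sub A \<sigma> # \<Delta>) (up \<sigma>) (A # \<Gamma>)"
proof -
  assume w: "wsub \<Delta> \<sigma> \<Gamma>" and A: "\<Gamma> \<turnstile> A \<^bold>: Ty"
  have c: "sub A \<sigma> # \<Delta> \<turnstile> \<^bold>\<surd>" using sub_Ty[OF w A] by (rule ctx_cons)
  have "wsub (sub A \<sigma> # \<Delta>) (Var 0 \<cdot> (\<lambda>n. wk 1 (\<sigma> n))) (A # \<Gamma>)"
    by (rule wsub_cons[OF wsub_shift[OF w c]]) (use var0[OF c] in \<open>simp add: wk_sub sub_sub\<close>)
  moreover have "(Var 0 \<cdot> (\<lambda>n. wk 1 (\<sigma> n))) = up \<sigma>" by (rule ext) (simp add: up_def wk_def split: nat.split)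
  ultimately show ?thesis by simp
qed

lemma wsub_shift1: "A # \<Gamma> \<turnstile> \<^bold>\<surd> \<Longrightarrow> wsub (A # \<Gamma>) (\<lambda>n. Var (Suc n)) \<Gamma>"
  using wsub_wk[of \<Gamma> A] by (auto intro: ctx_tl)

lemma wsub_shift2: "B # A # \<Gamma> \<turnstile> \<^bold>\<surd> \<Longrightarrow> wsub (B # A # \<Gamma>) (\<lambda>n. Var (Suc (Suc n))) \<Gamma>"
  using wsub_shift[OF wsub_shift1, of A \<Gamma> B] by (auto intro: ctx_tl simp: wk_def)

lemma sub_wk2: "sub (wk 2 A) (b \<cdot> a \<cdot> \<sigma>) = sub A \<sigma>"
  by (simp add: wk_def sub_ren)

lemma sub_wk1: "sub (wk 1 A) (a \<cdot> \<sigma>) = sub A \<sigma>" "sub (wk (Suc 0) A) (a \<cdot> \<sigma>) = sub A \<sigma>"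
  by (simp_all add: wk_def sub_ren)

lemma up_shift: "wk1 k t = sub t (up (\<lambda>n. Var (n + k)))"
  unfolding wk1_def ren_as_sub by (rule arg_cong[where f = "sub t"]) (auto simp: up_def split: nat.split)

subsection \<open>Dependent sums\<close>

abbreviation "gpair B \<equiv> Pair (wk1 2 B) (Var 1) (Var 0)"

lemma wsub_gpair: assumes A: "\<Gamma> \<turnstile> A \<^bold>: Ty" and B: "A # \<Gamma> \<turnstile> B \<^bold>: Ty"
  shows "wsub (B # A # \<Gamma>) (gpair B \<cdot> (\<lambda>n. Var (n + 2))) (Sig A B # \<Gamma>)"
proof (rule wsub_cons)
  have c: "B # A # \<Gamma> \<turnstile> \<^bold>\<surd>" using B by (rule ctx_cons)
  show w: "wsub (B # A # \<Gamma>) (\<lambda>n. Var (n + 2)) \<Gamma>" using wsub_shift2[OF c] by simp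
  have "wk 2 A # B # A # \<Gamma> \<turnstile> wk1 2 B \<^bold>: Ty"
    using up_typ[OF w A B] by (simp add: up_shift wk_sub)
  moreover have "B # A # \<Gamma> \<turnstile> Var 1 \<^bold>: wk 2 A" by (rule var1[OF c])
  moreover have "(wk1 2 B)\<lbrakk>Var 1\<rbrakk> = wk 1 B"
    unfolding inst_def wk1_def sub_ren wk_sub by (rule arg_cong[where f = "sub B"]) (auto split: nat.split)
  ultimately have "B # A # \<Gamma> \<turnstile> gpair B \<^bold>: Sig (wk 2 A) (wk1 2 B)"
    using var0[OF c] by (intro pair) simp_all
  then show "B # A # \<Gamma> \<turnstile> gpair B \<^bold>: sub (Sig A B) (\<lambda>n. Var (n + 2))" by (simp add: wk_sub up_shift)
qed

lemma gpair_inst2: "(subst_at 2 C (gpair B))\<lbrakk>a, b\<rbrakk> = C\<lbrakk>Pair B a b\<rbrakk>"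
  unfolding subst_at_def inst2_def inst_def sub_sub
proof (rule arg_cong[where f = "sub C"], rule ext)
  fix n
  have "sub (wk1 2 B) (up (b \<cdot> a \<cdot> Var)) = B"
  proof -
    have "sub (wk1 2 B) (up (b \<cdot> a \<cdot> Var)) = sub B Var"
      unfolding wk1_def sub_ren by (rule arg_cong[where f = "sub B"]) (auto simp: up_def split: nat.split)
    then show ?thesis by (simp add: sub_Var)
  qed
  then show "sub ((gpair B \<cdot> (\<lambda>n. Var (n + 2))) n) (b \<cdot> a \<cdot> Var) = (Pair B a b \<cdot> Var) n"
    by (simp split: nat.split)
qed

text \<open>Evaluation types the case at \<open>D\<close>, the normal form of what the normalised
  motive \<open>C'\<close> demands; the rule wants it at the original motive. The proof moves along
  both conversions, and once more for the result.\<close>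

lemma conv_to_IndSig:
  assumes S: "\<Gamma> \<turnstile> A \<^bold>: Ty" "A # \<Gamma> \<turnstile> B \<^bold>: Ty"
    and C: "conv_to (Sig A B # \<Gamma>) C C' Ty" and d: "conv_to (B # A # \<Gamma>) d d' D"
    and D: "conv_to (B # A # \<Gamma>) (subst_at 2 C' (gpair B)) D Ty" and p: "conv_to \<Gamma> p p' (Sig A B)"
  shows "conv_to \<Gamma> (IndSig C d p) (IndSig C' d' p') (C'\<lbrakk>p'\<rbrakk>)"
proof -
  note w = wsub_gpair[OF S]
  have d': "conv_to (B # A # \<Gamma>) d d' (subst_at 2 C' (gpair B))" by (rule conv_to_conv_sym[OF d D])
  have CC: "conv_to (B # A # \<Gamma>) (subst_at 2 C (gpair B)) (subst_at 2 C' (gpair B)) Ty"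
    using conv_to_sub[OF w C] by (simp add: subst_at_def)
  have d'': "conv_to (B # A # \<Gamma>) d d' (subst_at 2 C (gpair B))" by (rule conv_to_conv_sym[OF d' CC])
  have CI: "conv_to \<Gamma> (C\<lbrakk>p\<rbrakk>) (C'\<lbrakk>p'\<rbrakk>) Ty" by (rule conv_to_inst[OF C p])
  show ?thesis
  proof (rule conv_to_conv[OF _ CI], rule conv_toI)
    show "\<Gamma> \<turnstile> IndSig C d p \<^bold>: C\<lbrakk>p\<rbrakk>" using C d'' p by (intro sig_ind) (auto dest: conv_toD)
    show "\<Gamma> \<turnstile> IndSig C d p \<approx> IndSig C' d' p' \<^bold>: C\<lbrakk>p\<rbrakk>" using C d'' p by (intro sig_ind_cong) (auto dest: conv_toD)
    have "\<Gamma> \<turnstile> IndSig C' d' p' \<^bold>: C'\<lbrakk>p'\<rbrakk>" using C d' p by (intro sig_ind) (auto dest: conv_toD)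
    then show "\<Gamma> \<turnstile> IndSig C' d' p' \<^bold>: C\<lbrakk>p\<rbrakk>" using CI by (auto intro: conv eq_sym dest: conv_toD)
  qed (use CI in \<open>auto dest: conv_toD\<close>)
qed

lemma conv_to_IndSig_beta:
  assumes C: "Sig A B # \<Gamma> \<turnstile> C \<^bold>: Ty" and d: "B # A # \<Gamma> \<turnstile> d \<^bold>: subst_at 2 C (gpair B)" and a: "\<Gamma> \<turnstile> a \<^bold>: A" and b: "\<Gamma> \<turnstile> b \<^bold>: B\<lbrakk>a\<rbrakk>"
    and p: "\<Gamma> \<turnstile> Pair B a b \<^bold>: Sig A B"
  shows "conv_to \<Gamma> (IndSig C d (Pair B a b)) (d\<lbrakk>a, b\<rbrakk>) (C\<lbrakk>Pair B a b\<rbrakk>)"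
proof (rule conv_toI)
  show "\<Gamma> \<turnstile> IndSig C d (Pair B a b) \<^bold>: C\<lbrakk>Pair B a b\<rbrakk>" by (rule sig_ind[OF C d p])
  show "\<Gamma> \<turnstile> IndSig C d (Pair B a b) \<approx> d\<lbrakk>a, b\<rbrakk> \<^bold>: C\<lbrakk>Pair B a b\<rbrakk>" by (rule sig_beta[OF C d a b])
  show "\<Gamma> \<turnstile> d\<lbrakk>a, b\<rbrakk> \<^bold>: C\<lbrakk>Pair B a b\<rbrakk>" using inst2_typ[OF d a b] by (simp add: gpair_inst2)
qed (use inst_Ty[OF C p] in simp)

lemma subst_at_wk1: "subst_at k (wk 1 A) a = wk k A"
  unfolding subst_at_def wk_def sub_ren ren_as_sub[of A "\<lambda>n. n + k"] by (rule arg_cong[where f = "sub A"]) auto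

lemma wk1_inst: "(wk 1 A)\<lbrakk>a\<rbrakk> = A" "(wk (Suc 0) A)\<lbrakk>a\<rbrakk> = A"
  by (simp_all add: inst_def wk_def sub_ren sub_Var)

lemma conv_to_proj1:
  assumes S: "\<Gamma> \<turnstile> A \<^bold>: Ty" "A # \<Gamma> \<turnstile> B \<^bold>: Ty" and C: "conv_to (Sig A B # \<Gamma>) C (wk 1 A) Ty" and p: "conv_to \<Gamma> p p' (Sig A B)"
  shows "conv_to \<Gamma> (IndSig C (Var 1) p) (IndSig (wk 1 A) (Var 1) p') A"
proof -
  have c: "B # A # \<Gamma> \<turnstile> \<^bold>\<surd>" by (rule ctx_cons[OF S(2)])
  have T: "B # A # \<Gamma> \<turnstile> wk 2 A \<^bold>: Ty" using sub_Ty[OF wsub_shift2[OF c] S(1)] by (simp add: wk_sub)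
  have "conv_to \<Gamma> (IndSig C (Var 1) p) (IndSig (wk 1 A) (Var 1) p') ((wk 1 A)\<lbrakk>p'\<rbrakk>)"
    by (rule conv_to_IndSig[OF S C conv_to_refl[OF var1[OF c]] _ p])
      (use T in \<open>auto simp: subst_at_wk1 intro: conv_to_refl\<close>)
  then show ?thesis by (simp add: wk1_inst)
qed

lemma proj1_typ: "\<Gamma> \<turnstile> A \<^bold>: Ty \<Longrightarrow> A # \<Gamma> \<turnstile> B \<^bold>: Ty \<Longrightarrow> \<Gamma> \<turnstile> p \<^bold>: Sig A B \<Longrightarrow> \<Gamma> \<turnstile> proj1 A p \<^bold>: A"
  unfolding proj1_def
  by (rule conv_toD(1)[OF conv_to_proj1[of _ _ B _ _ p]]) (auto intro!: conv_to_refl wk1_Ty sig_form)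

lemma conv_to_proj1_beta:
  assumes S: "\<Gamma> \<turnstile> A \<^bold>: Ty" "A # \<Gamma> \<turnstile> B \<^bold>: Ty" and a: "\<Gamma> \<turnstile> a \<^bold>: A" and b: "\<Gamma> \<turnstile> b \<^bold>: B\<lbrakk>a\<rbrakk>"
  shows "conv_to \<Gamma> (proj1 A (Pair B a b)) a A"
proof -
  have c: "B # A # \<Gamma> \<turnstile> \<^bold>\<surd>" by (rule ctx_cons[OF S(2)])
  have "conv_to \<Gamma> (IndSig (wk 1 A) (Var 1) (Pair B a b)) ((Var 1)\<lbrakk>a, b\<rbrakk>) ((wk 1 A)\<lbrakk>Pair B a b\<rbrakk>)"
    using var1[OF c] S a b by (intro conv_to_IndSig_beta) (auto intro!: wk1_Ty sig_form pair simp: subst_at_wk1)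
  then show ?thesis by (simp add: wk1_inst proj1_def inst2_def)
qed

abbreviation "fam2 A B \<equiv> subst_at 1 B (proj1 (wk 1 A) (Var 0))"

lemma subst_at1_typ: "A # \<Gamma> \<turnstile> t \<^bold>: T \<Longrightarrow> S # \<Gamma> \<turnstile> a \<^bold>: wk 1 A \<Longrightarrow> S # \<Gamma> \<turnstile> subst_at 1 t a \<^bold>: subst_at 1 T a"
  using sub_typ'[OF wsub_cons[OF wsub_shift1, of S \<Gamma> a A]] by (auto intro: typed_ctx simp: wk_sub subst_at_def)

lemma subst_at1_Ty: "A # \<Gamma> \<turnstile> B \<^bold>: Ty \<Longrightarrow> S # \<Gamma> \<turnstile> a \<^bold>: wk 1 A \<Longrightarrow> S # \<Gamma> \<turnstile> subst_at 1 B a \<^bold>: Ty"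
  using subst_at1_typ[of A \<Gamma> B Ty] by (simp add: subst_at_def)

lemma fam2_Ty:
  assumes S: "\<Gamma> \<turnstile> A \<^bold>: Ty" "A # \<Gamma> \<turnstile> B \<^bold>: Ty"
  shows "Sig A B # \<Gamma> \<turnstile> fam2 A B \<^bold>: Ty"
proof (rule subst_at1_Ty[OF S(2)])
  have ST: "\<Gamma> \<turnstile> Sig A B \<^bold>: Ty" using S by (auto intro: sig_form)
  have c: "Sig A B # \<Gamma> \<turnstile> \<^bold>\<surd>" by (rule ctx_cons[OF ST])
  have "wk 1 A # Sig A B # \<Gamma> \<turnstile> wk1 1 B \<^bold>: Ty"
    using up_typ[OF wsub_shift1[OF c] S] by (simp add: up_shift wk_sub)
  moreover have "Sig A B # \<Gamma> \<turnstile> Var 0 \<^bold>: Sig (wk 1 A) (wk1 1 B)"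
    using var0[OF c] by (simp add: up_shift wk_sub)
  ultimately show "Sig A B # \<Gamma> \<turnstile> proj1 (wk 1 A) (Var 0) \<^bold>: wk 1 A"
    using wk1_Ty[OF S(1) ST] by (intro proj1_typ)
qed

lemma fam2_inst: "(fam2 A B)\<lbrakk>p\<rbrakk> = B\<lbrakk>proj1 A p\<rbrakk>"
proof -
  have "sub (proj1 (wk 1 A) (Var 0)) (p \<cdot> Var) = proj1 A p"
  proof -
    have "sub (wk 1 (wk 1 A)) (up (p \<cdot> Var)) = wk 1 A" 
      unfolding wk_sub sub_sub by (rule arg_cong[where f = "sub A"]) (auto simp: up_def)
    then show ?thesis by (simp add: proj1_def up_def)
  qed
  then show ?thesis unfolding inst_def subst_at_def sub_sub
    by (intro arg_cong[where f = "sub B"]) (auto split: nat.split)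
qed

text \<open>At a generic pair the motive of the second projection becomes \<open>B\<close> at the
  first projection of this pair. It has to be beta-reduced before the last variable is seen to be a
  correct case.\<close>

lemma fam2_gpair:
  assumes S: "\<Gamma> \<turnstile> A \<^bold>: Ty" "A # \<Gamma> \<turnstile> B \<^bold>: Ty"
  shows "conv_to (B # A # \<Gamma>) (subst_at 2 (fam2 A B) (gpair B)) (wk 1 B) Ty"
proof -
  let ?\<Delta> = "B # A # \<Gamma>" and ?g = "proj1 (wk 2 A) (gpair B)"
  have c: "?\<Delta> \<turnstile> \<^bold>\<surd>" by (rule ctx_cons[OF S(2)])
  have w: "wsub ?\<Delta> (\<lambda>n. Var (Suc (Suc n))) \<Gamma>" by (rule wsub_shift2[OF c])
  have T: "?\<Delta> \<turnstile> wk 2 A \<^bold>: Ty" "wk 2 A # ?\<Delta> \<turnstile> wk1 2 B \<^bold>: Ty"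
    using sub_Ty[OF w S(1)] up_typ[OF w S] by (simp_all add: wk_sub up_shift)
  have "(wk1 2 B)\<lbrakk>Var 1\<rbrakk> = wk 1 B"
    unfolding inst_def wk1_def sub_ren wk_sub by (rule arg_cong[where f = "sub B"]) (auto split: nat.split)
  then have g: "conv_to ?\<Delta> ?g (Var 1) (wk 2 A)"
    using var0[OF c] var1[OF c] by (intro conv_to_proj1_beta T) simp_all
  have 1: "subst_at 2 (fam2 A B) (gpair B) = sub B (?g \<cdot> (\<lambda>n. Var (Suc (Suc n))))"
  proof -
    have "sub (wk 1 (wk 1 A)) (up (gpair B \<cdot> (\<lambda>n. Var (n + 2)))) = wk 1 (wk 2 A)"
      unfolding wk_sub sub_sub by (rule arg_cong[where f = "sub A"]) (auto simp: up_def)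
    then have "sub (proj1 (wk 1 A) (Var 0)) (gpair B \<cdot> (\<lambda>n. Var (n + 2))) = ?g"
      by (simp add: proj1_def up_def)
    then show ?thesis unfolding subst_at_def sub_sub
      by (intro arg_cong[where f = "sub B"]) (auto split: nat.split)
  qed
  have 2: "wk 1 B = sub B (Var 1 \<cdot> (\<lambda>n. Var (Suc (Suc n))))"
    unfolding wk_sub by (rule arg_cong[where f = "sub B"]) (auto split: nat.split)
  have wg: "wsub ?\<Delta> (?g \<cdot> (\<lambda>n. Var (Suc (Suc n)))) (A # \<Gamma>)" "wsub ?\<Delta> (Var 1 \<cdot> (\<lambda>n. Var (Suc (Suc n)))) (A # \<Gamma>)"
    using conv_toD(1,2)[OF g] by (auto intro!: wsub_cons w simp: wk_sub)
  have "?\<Delta> \<turnstile> sub B (?g \<cdot> (\<lambda>n. Var (Suc (Suc n)))) \<approx> sub B (Var 1 \<cdot> (\<lambda>n. Var (Suc (Suc n)))) \<^bold>: sub Ty (?g \<cdot> (\<lambda>n. Var (Suc (Suc n))))"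
  proof (rule sub_cong'[OF wg(1) _ S(2)])
    fix i assume "i < length (A # \<Gamma>)"
    then show "?\<Delta> \<turnstile> (?g \<cdot> (\<lambda>n. Var (Suc (Suc n)))) i \<approx> (Var 1 \<cdot> (\<lambda>n. Var (Suc (Suc n)))) i \<^bold>:
      sub ((A # \<Gamma>) ! i) (\<lambda>n. (?g \<cdot> (\<lambda>n. Var (Suc (Suc n)))) (n + Suc i))"
      using g w by (auto simp: wk_sub nth_Cons wsub_def conv_to_def intro: eq_refl split: nat.split)
  qed
  then show ?thesis unfolding 1 2
    using sub_Ty[OF wg(1) S(2)] sub_Ty[OF wg(2) S(2)] by (intro conv_toI) simp_all
qed

lemma conv_to_proj2:
  assumes S: "\<Gamma> \<turnstile> A \<^bold>: Ty" "A # \<Gamma> \<turnstile> B \<^bold>: Ty" and C: "conv_to (Sig A B # \<Gamma>) C (fam2 A B) Ty" and p: "conv_to \<Gamma> p p' (Sig A B)"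
  shows "conv_to \<Gamma> (IndSig C (Var 0) p) (IndSig (fam2 A B) (Var 0) p') (B\<lbrakk>proj1 A p'\<rbrakk>)"
proof -
  have c: "B # A # \<Gamma> \<turnstile> \<^bold>\<surd>" by (rule ctx_cons[OF S(2)])
  have "conv_to \<Gamma> (IndSig C (Var 0) p) (IndSig (fam2 A B) (Var 0) p') ((fam2 A B)\<lbrakk>p'\<rbrakk>)"
    by (rule conv_to_IndSig[OF S C conv_to_refl[OF var0[OF c]] fam2_gpair[OF S] p]) (use conv_toD(2)[OF fam2_gpair[OF S]] in simp)
  then show ?thesis by (simp add: fam2_inst)
qed

lemma proj2_typ: "\<Gamma> \<turnstile> A \<^bold>: Ty \<Longrightarrow> A # \<Gamma> \<turnstile> B \<^bold>: Ty \<Longrightarrow> \<Gamma> \<turnstile> p \<^bold>: Sig A B \<Longrightarrow> \<Gamma> \<turnstile> proj2 A B p \<^bold>: B\<lbrakk>proj1 A p\<rbrakk>"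
  unfolding proj2_def
  by (rule conv_toD(1)[OF conv_to_proj2[of _ _ B _ _ p]]) (auto intro!: conv_to_refl fam2_Ty sig_form)

lemma conv_to_proj2_beta:
  assumes S: "\<Gamma> \<turnstile> A \<^bold>: Ty" "A # \<Gamma> \<turnstile> B \<^bold>: Ty" and a: "\<Gamma> \<turnstile> a \<^bold>: A" and b: "\<Gamma> \<turnstile> b \<^bold>: B\<lbrakk>a\<rbrakk>"
  shows "conv_to \<Gamma> (IndSig (fam2 A B) (Var 0) (Pair B a b)) b (B\<lbrakk>a\<rbrakk>)"
proof -
  have c: "B # A # \<Gamma> \<turnstile> \<^bold>\<surd>" by (rule ctx_cons[OF S(2)])
  have 0: "B # A # \<Gamma> \<turnstile> Var 0 \<^bold>: subst_at 2 (fam2 A B) (gpair B)"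
    using var0[OF c] conv_toD(3)[OF fam2_gpair[OF S]] by (auto intro: conv eq_sym)
  have "conv_to \<Gamma> (IndSig (fam2 A B) (Var 0) (Pair B a b)) ((Var 0)\<lbrakk>a, b\<rbrakk>) ((fam2 A B)\<lbrakk>Pair B a b\<rbrakk>)"
    by (rule conv_to_IndSig_beta[OF fam2_Ty[OF S] 0 a b pair[OF S(2) a b]])
  moreover have "conv_to \<Gamma> (B\<lbrakk>proj1 A (Pair B a b)\<rbrakk>) (B\<lbrakk>a\<rbrakk>) Ty"
    using conv_to_inst[OF conv_to_refl conv_to_proj1_beta[OF S a b]] S by auto
  ultimately show ?thesis using conv_to_conv by (auto simp: fam2_inst inst2_def)
qed

subsection \<open>Identity types\<close>

abbreviation "path_fam A a \<equiv> Eq (wk 1 A) (wk 1 a) (Var 0)"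

lemma path_fam_Ty: "\<Gamma> \<turnstile> A \<^bold>: Ty \<Longrightarrow> \<Gamma> \<turnstile> a \<^bold>: A \<Longrightarrow> A # \<Gamma> \<turnstile> path_fam A a \<^bold>: Ty"
  by (intro id_form wk1_Ty wk1_typ var0 ctx_cons) auto

lemma path_fam_inst: "(path_fam A a)\<lbrakk>b\<rbrakk> = Eq A a b"
  by (simp add: inst_def wk_def sub_ren sub_Var)

lemma conv_to_inst2:
  assumes C: "conv_to (E # A # \<Gamma>) C C' Ty" and a: "\<Gamma> \<turnstile> a \<^bold>: A" and p: "conv_to \<Gamma> p p' (E\<lbrakk>a\<rbrakk>)"
  shows "conv_to \<Gamma> (C\<lbrakk>a, p\<rbrakk>) (C'\<lbrakk>a, p'\<rbrakk>) Ty"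
proof (rule conv_toI)
  have pt: "\<Gamma> \<turnstile> p \<^bold>: E\<lbrakk>a\<rbrakk>" "\<Gamma> \<turnstile> p' \<^bold>: E\<lbrakk>a\<rbrakk>" "\<Gamma> \<turnstile> p \<approx> p' \<^bold>: E\<lbrakk>a\<rbrakk>" using p by (auto simp: conv_to_def)
  have Ct: "E # A # \<Gamma> \<turnstile> C \<^bold>: Ty" "E # A # \<Gamma> \<turnstile> C' \<^bold>: Ty" "E # A # \<Gamma> \<turnstile> C \<approx> C' \<^bold>: Ty" using C by (auto simp: conv_to_def)
  have "\<Gamma> \<turnstile> C\<lbrakk>a, p\<rbrakk> \<approx> C'\<lbrakk>a, p\<rbrakk> \<^bold>: Ty" using inst2_eq[OF Ct(3) a pt(1)] by (simp add: inst2_def[of Ty])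
  then show "\<Gamma> \<turnstile> C\<lbrakk>a, p\<rbrakk> \<approx> C'\<lbrakk>a, p'\<rbrakk> \<^bold>: Ty" by (rule eq_trans) (rule inst2_Ty_cong[OF Ct(2) a pt(1,3)])
  show "\<Gamma> \<turnstile> C\<lbrakk>a, p\<rbrakk> \<^bold>: Ty" "\<Gamma> \<turnstile> C'\<lbrakk>a, p'\<rbrakk> \<^bold>: Ty" using inst2_Ty Ct a pt by auto
qed simp

lemma conv_to_J:
  assumes a: "\<Gamma> \<turnstile> a \<^bold>: A" and A: "\<Gamma> \<turnstile> A \<^bold>: Ty" and b: "\<Gamma> \<turnstile> b \<^bold>: A"
    and C: "conv_to (path_fam A a # A # \<Gamma>) C C' Ty" and d: "conv_to \<Gamma> d d' D"
    and D: "conv_to \<Gamma> (C'\<lbrakk>a, Refl a\<rbrakk>) D Ty" and p: "conv_to \<Gamma> p p' (Eq A a b)"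
  shows "conv_to \<Gamma> (J C d p) (J C' d' p') (C'\<lbrakk>b, p'\<rbrakk>)"
proof -
  have r: "\<Gamma> \<turnstile> Refl a \<^bold>: Eq A a a" by (rule refl[OF A a])
  have d': "conv_to \<Gamma> d d' (C'\<lbrakk>a, Refl a\<rbrakk>)" by (rule conv_to_conv_sym[OF d D])
  have CC: "conv_to \<Gamma> (C\<lbrakk>a, Refl a\<rbrakk>) (C'\<lbrakk>a, Refl a\<rbrakk>) Ty"
    by (rule conv_to_inst2[OF C a conv_to_refl]) (use r A a in \<open>auto simp: path_fam_inst intro: id_form\<close>)
  have d'': "conv_to \<Gamma> d d' (C\<lbrakk>a, Refl a\<rbrakk>)" by (rule conv_to_conv_sym[OF d' CC])
  have CI: "conv_to \<Gamma> (C\<lbrakk>b, p\<rbrakk>) (C'\<lbrakk>b, p'\<rbrakk>) Ty" by (rule conv_to_inst2[OF C b]) (use p in \<open>simp add: path_fam_inst\<close>)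
  show ?thesis
  proof (rule conv_to_conv[OF _ CI], rule conv_toI)
    show "\<Gamma> \<turnstile> J C d p \<^bold>: C\<lbrakk>b, p\<rbrakk>" using C d'' p by (intro id_ind[OF a _ _ b]) (auto dest: conv_toD)
    show "\<Gamma> \<turnstile> J C d p \<approx> J C' d' p' \<^bold>: C\<lbrakk>b, p\<rbrakk>" using C d'' p by (intro id_ind_cong[OF a _ _ b]) (auto dest: conv_toD)
    have "\<Gamma> \<turnstile> J C' d' p' \<^bold>: C'\<lbrakk>b, p'\<rbrakk>" using C d' p by (intro id_ind[OF a _ _ b]) (auto dest: conv_toD)
    then show "\<Gamma> \<turnstile> J C' d' p' \<^bold>: C\<lbrakk>b, p\<rbrakk>" using CI by (auto intro: conv eq_sym dest: conv_toD)
  qed (use CI in \<open>auto dest: conv_toD\<close>)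
qed

lemma conv_to_J_beta:
  assumes a: "\<Gamma> \<turnstile> a \<^bold>: A" and A: "\<Gamma> \<turnstile> A \<^bold>: Ty" and C: "path_fam A a # A # \<Gamma> \<turnstile> C \<^bold>: Ty" and d: "\<Gamma> \<turnstile> d \<^bold>: C\<lbrakk>a, Refl a\<rbrakk>"
  shows "conv_to \<Gamma> (J C d (Refl a)) d (C\<lbrakk>a, Refl a\<rbrakk>)"
proof -
  have r: "\<Gamma> \<turnstile> Refl a \<^bold>: Eq A a a" by (rule refl[OF A a])
  have "\<Gamma> \<turnstile> C\<lbrakk>a, Refl a\<rbrakk> \<^bold>: Ty" by (rule inst2_Ty[OF C a]) (use r in \<open>simp add: path_fam_inst\<close>)
  then show ?thesis using id_ind[OF a C d a r] id_beta[OF a C d] d by (intro conv_toI) auto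
qed

lemma conv_to_Refl: "conv_to \<Gamma> a a' A \<Longrightarrow> A \<noteq> Ty \<Longrightarrow> conv_to \<Gamma> (Refl a) (Refl a') (Eq A a' a')"
proof -
  assume a: "conv_to \<Gamma> a a' A" and A: "A \<noteq> Ty"
  have AT: "\<Gamma> \<turnstile> A \<^bold>: Ty" using a A by (auto simp: conv_to_def)
  have c: "A # \<Gamma> \<turnstile> \<^bold>\<surd>" by (rule ctx_cons[OF AT])
  have "conv_to \<Gamma> ((Refl (Var 0))\<lbrakk>a\<rbrakk>) ((Refl (Var 0))\<lbrakk>a'\<rbrakk>) ((Eq (wk 1 A) (Var 0) (Var 0))\<lbrakk>a'\<rbrakk>)"
    by (rule conv_to_inst_cong[OF refl _ a]) (use wk1_Ty[OF AT AT] var0[OF c] in \<open>auto intro: id_form\<close>)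
  then show ?thesis by (simp add: inst_def wk_def sub_ren sub_Var)
qed

subsection \<open>Pushouts\<close>

definition is_span :: "tm list \<Rightarrow> tm \<Rightarrow> tm \<Rightarrow> tm \<Rightarrow> tm \<Rightarrow> tm \<Rightarrow> bool"
  where "is_span \<Gamma> A B C f g \<longleftrightarrow> \<Gamma> \<turnstile> A \<^bold>: Univ \<and> \<Gamma> \<turnstile> B \<^bold>: Univ \<and> \<Gamma> \<turnstile> C \<^bold>: Univ \<and> \<Gamma> \<turnstile> f \<^bold>: Arr C A \<and> \<Gamma> \<turnstile> g \<^bold>: Arr C B"

lemma sub_Arr: "sub (Arr A B) \<sigma> = Arr (sub A \<sigma>) (sub B \<sigma>)"
  by (simp add: Arr_def wk_sub sub_sub up_def ren_as_sub)

lemma span_sub: "is_span \<Gamma> A B C f g \<Longrightarrow> wsub \<Delta> \<sigma> \<Gamma> \<Longrightarrow> is_span \<Delta> (sub A \<sigma>) (sub B \<sigma>) (sub C \<sigma>) (sub f \<sigma>) (sub g \<sigma>)"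
  unfolding is_span_def by (auto dest: sub_typ' simp: sub_Arr)

lemma span_wk: "is_span \<Gamma> A B C f g \<Longrightarrow> E # \<Gamma> \<turnstile> \<^bold>\<surd> \<Longrightarrow> is_span (E # \<Gamma>) (wk 1 A) (wk 1 B) (wk 1 C) (wk 1 f) (wk 1 g)"
  unfolding wk_sub by (rule span_sub) (use wsub_shift1 in auto)

lemma spanD:
  assumes "is_span \<Gamma> A B C f g"
  shows "\<Gamma> \<turnstile> A \<^bold>: Univ" "\<Gamma> \<turnstile> B \<^bold>: Univ" "\<Gamma> \<turnstile> C \<^bold>: Univ" "\<Gamma> \<turnstile> f \<^bold>: Arr C A" "\<Gamma> \<turnstile> g \<^bold>: Arr C B"
    "\<Gamma> \<turnstile> Push f g \<^bold>: Univ" "\<Gamma> \<turnstile> Push f g \<^bold>: Ty" "Push f g # \<Gamma> \<turnstile> \<^bold>\<surd>" "A # \<Gamma> \<turnstile> \<^bold>\<surd>" "B # \<Gamma> \<turnstile> \<^bold>\<surd>" "C # \<Gamma> \<turnstile> \<^bold>\<surd>"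
  using assms push_form[of \<Gamma> A B C f g] by (auto simp: is_span_def intro: small ctx_cons)

lemma span_app: assumes "is_span \<Gamma> A B C f g" "\<Gamma> \<turnstile> c \<^bold>: C"
  shows "\<Gamma> \<turnstile> App f c \<^bold>: A" "\<Gamma> \<turnstile> App g c \<^bold>: B"
  using app[OF _ assms(2), of f "wk 1 A"] app[OF _ assms(2), of g "wk 1 B"] spanD[OF assms(1)] by (auto simp: Arr_def wk1_inst)

lemma span_points:
  assumes s: "is_span \<Gamma> A B C f g"
  shows "\<Gamma> \<turnstile> a \<^bold>: A \<Longrightarrow> \<Gamma> \<turnstile> PushL f g a \<^bold>: Push f g" "\<Gamma> \<turnstile> b \<^bold>: B \<Longrightarrow> \<Gamma> \<turnstile> PushR f g b \<^bold>: Push f g"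
    "\<Gamma> \<turnstile> c \<^bold>: C \<Longrightarrow> \<Gamma> \<turnstile> Glue f g c \<^bold>: Eq (Push f g) (PushL f g (App f c)) (PushR f g (App g c))"
  using push_l[OF spanD(1-5)[OF s]] push_r[OF spanD(1-5)[OF s]] push_glue[OF spanD(1-5)[OF s]] by auto

lemma conv_to_PushL: assumes s: "is_span \<Gamma> A B C f g" and a: "conv_to \<Gamma> a a' A" 
  shows "conv_to \<Gamma> (PushL f g a) (PushL f g a') (Push f g)"
proof -
  have "A # \<Gamma> \<turnstile> PushL (wk 1 f) (wk 1 g) (Var 0) \<^bold>: Push (wk 1 f) (wk 1 g)"
    by (rule span_points(1)[OF span_wk[OF s]]) (use spanD[OF s] var0 in auto)
  from conv_to_inst_cong[OF this _ a] show ?thesis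
    using spanD(6)[OF span_wk[OF s spanD(9)[OF s]]] by (auto simp: inst_def wk_def sub_ren sub_Var intro: small)
qed

lemma conv_to_PushR: assumes s: "is_span \<Gamma> A B C f g" and a: "conv_to \<Gamma> a a' B" 
  shows "conv_to \<Gamma> (PushR f g a) (PushR f g a') (Push f g)"
proof -
  have "B # \<Gamma> \<turnstile> PushR (wk 1 f) (wk 1 g) (Var 0) \<^bold>: Push (wk 1 f) (wk 1 g)"
    by (rule span_points(2)[OF span_wk[OF s]]) (use spanD[OF s] var0 in auto)
  from conv_to_inst_cong[OF this _ a] show ?thesis
    using spanD(6)[OF span_wk[OF s spanD(10)[OF s]]] by (auto simp: inst_def wk_def sub_ren sub_Var intro: small)
qed

abbreviation "glue_type f g c \<equiv> Eq (Push f g) (PushL f g (App f c)) (PushR f g (App g c))"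

lemma glue_type_Univ: "is_span \<Gamma> A B C f g \<Longrightarrow> \<Gamma> \<turnstile> c \<^bold>: C \<Longrightarrow> \<Gamma> \<turnstile> glue_type f g c \<^bold>: Univ"
  by (intro id_form span_points span_app) (auto dest: spanD)

lemma conv_to_Glue: assumes s: "is_span \<Gamma> A B C f g" and a: "conv_to \<Gamma> a a' C" 
  shows "conv_to \<Gamma> (Glue f g a) (Glue f g a') (glue_type f g a')"
proof -
  have s': "is_span (C # \<Gamma>) (wk 1 A) (wk 1 B) (wk 1 C) (wk 1 f) (wk 1 g)" by (rule span_wk[OF s spanD(11)[OF s]])
  have v: "C # \<Gamma> \<turnstile> Var 0 \<^bold>: wk 1 C" by (rule var0[OF spanD(11)[OF s]])
  from conv_to_inst_cong[OF span_points(3)[OF s' v] _ a] show ?thesis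
    using glue_type_Univ[OF s' v] by (auto simp: inst_def wk_def sub_ren sub_Var intro: small)
qed

lemma conv_to_idfun: "conv_to \<Gamma> A A' Ty \<Longrightarrow> conv_to \<Gamma> (idfun A) (idfun A') (Arr A' A')"
proof -
  assume A: "conv_to \<Gamma> A A' Ty"
  have c: "A' # \<Gamma> \<turnstile> \<^bold>\<surd>" by (rule conv_to_ctx[OF A])
  have T: "A' # \<Gamma> \<turnstile> wk 1 A' \<^bold>: Ty" using A by (intro wk1_Ty) (auto dest: conv_toD)
  have "wk 1 A' \<noteq> Ty" 
  proof
    assume "wk 1 A' = Ty"
    then have "A' = Ty" by (cases A') (auto simp: wk_def)
    then have "\<Gamma> \<turnstile> Ty \<^bold>: Ty" using conv_toD(2)[OF A] by simp
    then show False by (simp add: not_Ty)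
  qed
  then show ?thesis unfolding idfun_def Arr_def
    by (intro conv_to_Lam[OF A] conv_to_refl var0[OF c]) (use T in auto)
qed

text \<open>The type of a glueing case contains a transport in the motive, so it changes when the
  motive and the point cases are normalised. This shows the change to be a judgmental
  equality.\<close>

lemma conv_to_transport:
  assumes P: "\<Gamma> \<turnstile> P \<^bold>: Ty" and D: "conv_to (P # \<Gamma>) D D' Ty" and x: "\<Gamma> \<turnstile> x \<^bold>: P" and y: "\<Gamma> \<turnstile> y \<^bold>: P" and p: "\<Gamma> \<turnstile> p \<^bold>: Eq P x y"
    and u: "conv_to \<Gamma> u u' (D\<lbrakk>x\<rbrakk>)"
  shows "conv_to \<Gamma> (transport D x p u) (transport D' x p u') (D'\<lbrakk>y\<rbrakk>)"
proof -
  let ?E = "path_fam P x"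
  have ET: "P # \<Gamma> \<turnstile> ?E \<^bold>: Ty" by (rule path_fam_Ty[OF P x])
  have c: "?E # P # \<Gamma> \<turnstile> \<^bold>\<surd>" by (rule ctx_cons[OF ET])
  have D1: "conv_to (?E # P # \<Gamma>) (wk 1 D) (wk 1 D') Ty" using conv_to_wk[OF D c] by (simp add: wk_def)
  have Dx: "conv_to \<Gamma> (D\<lbrakk>x\<rbrakk>) (D'\<lbrakk>x\<rbrakk>) Ty" "conv_to \<Gamma> (D\<lbrakk>y\<rbrakk>) (D'\<lbrakk>y\<rbrakk>) Ty"
    using x y by (auto intro!: conv_to_inst[OF D] conv_to_refl P)
  have D2: "conv_to (?E # P # \<Gamma>) (wk 2 (D\<lbrakk>x\<rbrakk>)) (wk 2 (D'\<lbrakk>x\<rbrakk>)) Ty"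
    using conv_to_sub[OF wsub_shift2[OF c] Dx(1)] by (simp add: wk_sub)
  note C = conv_to_Arr[OF D2 D1]
  have i: "(Arr (wk 2 (D'\<lbrakk>x\<rbrakk>)) (wk 1 D'))\<lbrakk>z, q\<rbrakk> = Arr (D'\<lbrakk>x\<rbrakk>) (D'\<lbrakk>z\<rbrakk>)" for z q
    unfolding inst2_def sub_Arr sub_wk2 sub_wk1 by (simp add: inst_def sub_Var)
  have A: "conv_to \<Gamma> (Arr (D'\<lbrakk>x\<rbrakk>) (D'\<lbrakk>x\<rbrakk>)) (Arr (D'\<lbrakk>x\<rbrakk>) (D'\<lbrakk>x\<rbrakk>)) Ty"
    using conv_toD(2)[OF Dx(1)] by (intro conv_to_Arr conv_to_refl) auto
  have "conv_to \<Gamma> (J (Arr (wk 2 (D\<lbrakk>x\<rbrakk>)) (wk 1 D)) (idfun (D\<lbrakk>x\<rbrakk>)) p) (J (Arr (wk 2 (D'\<lbrakk>x\<rbrakk>)) (wk 1 D')) (idfun (D'\<lbrakk>x\<rbrakk>)) p)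
      ((Arr (wk 2 (D'\<lbrakk>x\<rbrakk>)) (wk 1 D'))\<lbrakk>y, p\<rbrakk>)"
    by (rule conv_to_J[OF x P y C conv_to_idfun[OF Dx(1)]])
      (use A p P x y in \<open>auto simp: i intro: conv_to_refl id_form\<close>)
  then have "conv_to \<Gamma> (J (Arr (wk 2 (D\<lbrakk>x\<rbrakk>)) (wk 1 D)) (idfun (D\<lbrakk>x\<rbrakk>)) p) (J (Arr (wk 2 (D'\<lbrakk>x\<rbrakk>)) (wk 1 D')) (idfun (D'\<lbrakk>x\<rbrakk>)) p)
      (Pi (D'\<lbrakk>x\<rbrakk>) (wk 1 (D'\<lbrakk>y\<rbrakk>)))" unfolding i by (simp add: Arr_def)
  from conv_to_App[OF this conv_to_conv[OF u Dx(1)]] show ?thesis by (simp add: transport_def wk1_inst)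
qed

lemma inst_subst_at1: "(subst_at 1 D t)\<lbrakk>a\<rbrakk> = D\<lbrakk>t\<lbrakk>a\<rbrakk>\<rbrakk>"
  unfolding inst_def subst_at_def sub_sub by (rule arg_cong[where f = "sub D"]) (auto split: nat.split)

abbreviation "onL f g D \<equiv> subst_at 1 D (PushL (wk 1 f) (wk 1 g) (Var 0))"
abbreviation "onR f g D \<equiv> subst_at 1 D (PushR (wk 1 f) (wk 1 g) (Var 0))"

lemma onL_inst: "(onL f g D)\<lbrakk>a\<rbrakk> = D\<lbrakk>PushL f g a\<rbrakk>" and onR_inst: "(onR f g D)\<lbrakk>a\<rbrakk> = D\<lbrakk>PushR f g a\<rbrakk>"
  by (simp_all add: inst_subst_at1) (simp_all add: inst_def wk_def sub_ren sub_Var)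

lemma conv_to_glue_over_at:
  assumes s: "is_span \<Gamma> A B C f g" and D: "conv_to (Push f g # \<Gamma>) D D' Ty"
    and l: "conv_to (A # \<Gamma>) l l' (onL f g D)" and r: "conv_to (B # \<Gamma>) r r' (onR f g D)" and c: "\<Gamma> \<turnstile> c \<^bold>: C"
  shows "conv_to \<Gamma> (glue_over_at f g D l r c) (glue_over_at f g D' l' r' c) Ty"
  unfolding glue_over_at_def
proof (rule conv_to_Eq)
  note ap = span_app[OF s c] and P = spanD(7)[OF s]
  note pt = span_points(1)[OF s ap(1)] span_points(2)[OF s ap(2)] span_points(3)[OF s c]
  show D2: "conv_to \<Gamma> (D\<lbrakk>PushR f g (App g c)\<rbrakk>) (D'\<lbrakk>PushR f g (App g c)\<rbrakk>) Ty"
    by (rule conv_to_inst[OF D conv_to_refl]) (use pt P in auto)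
  have "conv_to \<Gamma> (l\<lbrakk>App f c\<rbrakk>) (l'\<lbrakk>App f c\<rbrakk>) ((onL f g D)\<lbrakk>App f c\<rbrakk>)"
    using conv_to_sub[OF wsub_inst[OF ap(1)] l] by (simp add: inst_def)
  then have l': "conv_to \<Gamma> (l\<lbrakk>App f c\<rbrakk>) (l'\<lbrakk>App f c\<rbrakk>) (D\<lbrakk>PushL f g (App f c)\<rbrakk>)" by (simp add: onL_inst)
  show "conv_to \<Gamma> (transport D (PushL f g (App f c)) (Glue f g c) (l\<lbrakk>App f c\<rbrakk>))
     (transport D' (PushL f g (App f c)) (Glue f g c) (l'\<lbrakk>App f c\<rbrakk>)) (D'\<lbrakk>PushR f g (App g c)\<rbrakk>)"
    by (rule conv_to_transport[OF P D pt l'])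
  have "conv_to \<Gamma> (r\<lbrakk>App g c\<rbrakk>) (r'\<lbrakk>App g c\<rbrakk>) ((onR f g D)\<lbrakk>App g c\<rbrakk>)"
    using conv_to_sub[OF wsub_inst[OF ap(2)] r] by (simp add: inst_def)
  then show "conv_to \<Gamma> (r\<lbrakk>App g c\<rbrakk>) (r'\<lbrakk>App g c\<rbrakk>) (D'\<lbrakk>PushR f g (App g c)\<rbrakk>)"
    using conv_to_conv[OF _ D2] by (simp add: onR_inst)
qed simp

lemma subst_at1_up: "sub (subst_at 1 D t) (up \<sigma>) = subst_at 1 (sub D (up \<sigma>)) (sub t (up \<sigma>))"
  unfolding subst_at_def sub_sub by (rule arg_cong[where f = "sub D"]) (auto simp: up_def ren_as_sub sub_sub sub_ren split: nat.split)

lemma onL_up: "sub (onL f g D) (up \<sigma>) = onL (sub f \<sigma>) (sub g \<sigma>) (sub D (up \<sigma>))"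
  and onR_up: "sub (onR f g D) (up \<sigma>) = onR (sub f \<sigma>) (sub g \<sigma>) (sub D (up \<sigma>))"
  by (simp_all add: subst_at1_up) (simp_all add: up_def wk_def sub_ren ren_sub)

lemma conv_to_glue_over:
  assumes s: "is_span \<Gamma> A B C f g" and D: "conv_to (Push f g # \<Gamma>) D D' Ty"
    and l: "conv_to (A # \<Gamma>) l l' (onL f g D)" and r: "conv_to (B # \<Gamma>) r r' (onR f g D)"
  shows "conv_to (C # \<Gamma>) (glue_over f g D l r) (glue_over f g D' l' r') Ty"
  unfolding glue_over_def
proof (rule conv_to_glue_over_at[OF span_wk[OF s spanD(11)[OF s]]])
  have w: "wsub (C # \<Gamma>) (\<lambda>n. Var (n + 1)) \<Gamma>" using wsub_shift1[OF spanD(11)[OF s]] by simp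
  show "C # \<Gamma> \<turnstile> Var 0 \<^bold>: wk 1 C" by (rule var0[OF spanD(11)[OF s]])
  show "conv_to (Push (wk 1 f) (wk 1 g) # C # \<Gamma>) (wk1 1 D) (wk1 1 D') Ty"
    using conv_to_sub[OF wsub_up[OF w spanD(7)[OF s]] D] by (simp add: up_shift wk_sub)
  show "conv_to (wk 1 A # C # \<Gamma>) (wk1 1 l) (wk1 1 l') (onL (wk 1 f) (wk 1 g) (wk1 1 D))"
    using conv_to_sub[OF wsub_up[OF w small[OF spanD(1)[OF s]]] l] onL_up[of D f g "\<lambda>n. Var (n + 1)"] by (simp add: up_shift wk_sub)
  show "conv_to (wk 1 B # C # \<Gamma>) (wk1 1 r) (wk1 1 r') (onR (wk 1 f) (wk 1 g) (wk1 1 D))"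
    using conv_to_sub[OF wsub_up[OF w small[OF spanD(2)[OF s]]] r] onR_up[of D f g "\<lambda>n. Var (n + 1)"] by (simp add: up_shift wk_sub)
qed

lemma onL_conv: "is_span \<Gamma> A B C f g \<Longrightarrow> conv_to (Push f g # \<Gamma>) D D' Ty \<Longrightarrow> conv_to (A # \<Gamma>) (onL f g D) (onL f g D') Ty"
  and onR_conv: "is_span \<Gamma> A B C f g \<Longrightarrow> conv_to (Push f g # \<Gamma>) D D' Ty \<Longrightarrow> conv_to (B # \<Gamma>) (onR f g D) (onR f g D') Ty"
proof -
  assume s: "is_span \<Gamma> A B C f g" and D: "conv_to (Push f g # \<Gamma>) D D' Ty"
  have w: "wsub (E # \<Gamma>) (t \<cdot> (\<lambda>n. Var (Suc n))) (Push f g # \<Gamma>)" if "E # \<Gamma> \<turnstile> t \<^bold>: Push (wk 1 f) (wk 1 g)" for E t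
    using that wsub_shift1[of E \<Gamma>] by (intro wsub_cons) (auto intro: typed_ctx simp: wk_sub)
  have "A # \<Gamma> \<turnstile> PushL (wk 1 f) (wk 1 g) (Var 0) \<^bold>: Push (wk 1 f) (wk 1 g)"
    "B # \<Gamma> \<turnstile> PushR (wk 1 f) (wk 1 g) (Var 0) \<^bold>: Push (wk 1 f) (wk 1 g)"
    using var0 spanD[OF s] by (auto intro: span_points[OF span_wk[OF s]])
  note this[THEN w, THEN conv_to_sub, OF D]
  then show "conv_to (A # \<Gamma>) (onL f g D) (onL f g D') Ty" "conv_to (B # \<Gamma>) (onR f g D) (onR f g D') Ty"
    by (simp_all add: subst_at_def)
qed

lemma conv_to_IndPush:
  assumes s: "is_span \<Gamma> A B C f g" and D: "conv_to (Push f g # \<Gamma>) D D' Ty"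
    and l: "conv_to (A # \<Gamma>) l l' L" "conv_to (A # \<Gamma>) (onL f g D') L Ty"
    and r: "conv_to (B # \<Gamma>) r r' R" "conv_to (B # \<Gamma>) (onR f g D') R Ty"
    and q: "conv_to (C # \<Gamma>) q q' Q" "conv_to (C # \<Gamma>) (glue_over f g D' l' r') Q Ty" and t: "conv_to \<Gamma> t t' (Push f g)"
  shows "conv_to \<Gamma> (IndPush D l r q t) (IndPush D' l' r' q' t') (D'\<lbrakk>t'\<rbrakk>)"
proof -
  note T = spanD(1-5)[OF s]
  have l': "conv_to (A # \<Gamma>) l l' (onL f g D')" and r': "conv_to (B # \<Gamma>) r r' (onR f g D')" and q': "conv_to (C # \<Gamma>) q q' (glue_over f g D' l' r')"
    using conv_to_conv_sym l r q by blast+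
  have l'': "conv_to (A # \<Gamma>) l l' (onL f g D)" and r'': "conv_to (B # \<Gamma>) r r' (onR f g D)"
    using conv_to_conv_sym[OF l' onL_conv[OF s D]] conv_to_conv_sym[OF r' onR_conv[OF s D]] by auto
  have q'': "conv_to (C # \<Gamma>) q q' (glue_over f g D l r)" by (rule conv_to_conv_sym[OF q' conv_to_glue_over[OF s D l'' r'']])
  have DI: "conv_to \<Gamma> (D\<lbrakk>t\<rbrakk>) (D'\<lbrakk>t'\<rbrakk>) Ty" by (rule conv_to_inst[OF D t])
  show ?thesis
  proof (rule conv_to_conv[OF _ DI], rule conv_toI)
    show "\<Gamma> \<turnstile> IndPush D l r q t \<^bold>: D\<lbrakk>t\<rbrakk>" using D l'' r'' q'' t by (intro push_ind[OF T]) (auto dest: conv_toD)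
    show "\<Gamma> \<turnstile> IndPush D l r q t \<approx> IndPush D' l' r' q' t' \<^bold>: D\<lbrakk>t\<rbrakk>" using D l'' r'' q'' t by (intro push_ind_cong[OF T]) (auto dest: conv_toD)
    have "\<Gamma> \<turnstile> IndPush D' l' r' q' t' \<^bold>: D'\<lbrakk>t'\<rbrakk>" using D l' r' q' t by (intro push_ind[OF T]) (auto dest: conv_toD)
    then show "\<Gamma> \<turnstile> IndPush D' l' r' q' t' \<^bold>: D\<lbrakk>t\<rbrakk>" using DI by (auto intro: conv eq_sym dest: conv_toD)
  qed (use DI in \<open>auto dest: conv_toD\<close>)
qed

lemma conv_to_IndPush_beta:
  assumes s: "is_span \<Gamma> A B C f g" and D: "Push f g # \<Gamma> \<turnstile> D \<^bold>: Ty"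
    and l: "A # \<Gamma> \<turnstile> l \<^bold>: onL f g D" and r: "B # \<Gamma> \<turnstile> r \<^bold>: onR f g D" and q: "C # \<Gamma> \<turnstile> q \<^bold>: glue_over f g D l r"
  shows "\<Gamma> \<turnstile> a \<^bold>: A \<Longrightarrow> conv_to \<Gamma> (IndPush D l r q (PushL f g a)) (l\<lbrakk>a\<rbrakk>) (D\<lbrakk>PushL f g a\<rbrakk>)"
    "\<Gamma> \<turnstile> b \<^bold>: B \<Longrightarrow> conv_to \<Gamma> (IndPush D l r q (PushR f g b)) (r\<lbrakk>b\<rbrakk>) (D\<lbrakk>PushR f g b\<rbrakk>)"
proof -
  note T = spanD(1-5)[OF s]
  assume a: "\<Gamma> \<turnstile> a \<^bold>: A"
  note p = span_points(1)[OF s a]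
  show "conv_to \<Gamma> (IndPush D l r q (PushL f g a)) (l\<lbrakk>a\<rbrakk>) (D\<lbrakk>PushL f g a\<rbrakk>)"
    using push_ind[OF T D l r q p] push_beta_l[OF T D l r q a] inst_typ[OF l a] inst_Ty[OF D p] by (intro conv_toI) (auto simp: onL_inst)
next
  note T = spanD(1-5)[OF s]
  assume b: "\<Gamma> \<turnstile> b \<^bold>: B"
  note p = span_points(2)[OF s b]
  show "conv_to \<Gamma> (IndPush D l r q (PushR f g b)) (r\<lbrakk>b\<rbrakk>) (D\<lbrakk>PushR f g b\<rbrakk>)"
    using push_ind[OF T D l r q p] push_beta_r[OF T D l r q b] inst_typ[OF r b] inst_Ty[OF D p] by (intro conv_toI) (auto simp: onR_inst)
qed

subsection \<open>Soundness of normalisation\<close>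

lemma eval_ty_Ok: "eval_ty e \<Gamma> T k = Ok t U \<Longrightarrow> sound e \<Longrightarrow> \<Gamma> \<turnstile> \<^bold>\<surd> \<Longrightarrow> \<exists>T'. conv_to \<Gamma> T T' Ty \<and> k T' = Ok t U"
  unfolding eval_ty_def by (simp only: control_Ok) (blast dest: soundD intro: conv_to_sort)

lemma eval_nf_Ok: "eval_nf e \<Gamma> T k = Ok t U \<Longrightarrow> sound e \<Longrightarrow> \<Gamma> \<turnstile> \<^bold>\<surd> \<Longrightarrow> \<exists>T'. (T' = T \<or> conv_to \<Gamma> T T' Ty) \<and> k T' = Ok t U"
  unfolding eval_nf_def if'_Ok by (blast dest: eval_ty_Ok)

lemma norm_tm_Ok:
  assumes "norm_tm e \<Gamma> A a k = Ok t U" "sound e" "\<Gamma> \<turnstile> a \<^bold>: A0" "conv_to \<Gamma> A0 A Ty"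
  shows "\<exists>a'. conv_to \<Gamma> a a' A \<and> k a' = Ok t U"
proof (cases "is_nf a")
  case True
  have "\<Gamma> \<turnstile> a \<^bold>: A" using assms(3,4) by (auto intro: conv dest: conv_toD)
  then have "conv_to \<Gamma> a a A" using assms(4) by (auto intro: conv_to_refl dest: conv_toD)
  then show ?thesis using assms(1) True by (auto simp: norm_tm_def if'_def)
next
  case False
  then show ?thesis using assms(1,2) typed_ctx[OF assms(3)] by (auto simp: norm_tm_def if'_def control_Ok dest: soundD)
qed

text \<open>Descending into a type requires its parts to be well formed, which is what
  \<open>type_inversion\<close> provides for \<open>Pi\<close>, \<open>Sig\<close> and
  \<open>Eq\<close>. Every other type is evaluated as a whole.\<close>

lemma norm_ty_Ok: "norm_ty e \<Gamma> T k = Ok t U \<Longrightarrow> sound e \<Longrightarrow> \<Gamma> \<turnstile> T \<^bold>: Ty \<Longrightarrow> \<exists>T'. conv_to \<Gamma> T T' Ty \<and> k T' = Ok t U"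
proof (induction T arbitrary: \<Gamma> k)
  case (Pi A B)
  have T: "\<Gamma> \<turnstile> A \<^bold>: Ty" "A # \<Gamma> \<turnstile> B \<^bold>: Ty" using type_inversion[OF Pi.prems(3)] by auto
  show ?case
  proof (cases "is_nf (Pi A B)")
    case True
    then show ?thesis using Pi.prems conv_to_refl[OF Pi.prems(3)] by (auto simp only: norm_ty.simps if'_def if_True)
  next
    case False
    then have "norm_ty e \<Gamma> A (\<lambda>A. norm_ty e (A # \<Gamma>) B (\<lambda>B. k (Pi A B))) = Ok t U" using Pi.prems by (simp only: norm_ty.simps if'_def if_False)
    from Pi.IH(1)[OF this Pi.prems(2) T(1)] obtain A' where A': "conv_to \<Gamma> A A' Ty" "norm_ty e (A' # \<Gamma>) B (\<lambda>B. k (Pi A' B)) = Ok t U" by blast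
    have "A' # \<Gamma> \<turnstile> B \<^bold>: Ty" using A' T by (intro ctx_conv_typ[OF T(2)]) (auto intro: eq_sym dest: conv_toD)
    from Pi.IH(2)[OF A'(2) Pi.prems(2) this] show ?thesis using conv_to_Pi[OF _ A'(1)] by auto
  qed
next
  case (Sig A B)
  have T: "\<Gamma> \<turnstile> A \<^bold>: Ty" "A # \<Gamma> \<turnstile> B \<^bold>: Ty" using type_inversion[OF Sig.prems(3)] by auto
  show ?case
  proof (cases "is_nf (Sig A B)")
    case True
    then show ?thesis using Sig.prems conv_to_refl[OF Sig.prems(3)] by (auto simp only: norm_ty.simps if'_def if_True)
  next
    case False
    then have "norm_ty e \<Gamma> A (\<lambda>A. norm_ty e (A # \<Gamma>) B (\<lambda>B. k (Sig A B))) = Ok t U" using Sig.prems by (simp only: norm_ty.simps if'_def if_False)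
    from Sig.IH(1)[OF this Sig.prems(2) T(1)] obtain A' where A': "conv_to \<Gamma> A A' Ty" "norm_ty e (A' # \<Gamma>) B (\<lambda>B. k (Sig A' B)) = Ok t U" by blast
    have "A' # \<Gamma> \<turnstile> B \<^bold>: Ty" using A' T by (intro ctx_conv_typ[OF T(2)]) (auto intro: eq_sym dest: conv_toD)
    from Sig.IH(2)[OF A'(2) Sig.prems(2) this] show ?thesis using conv_to_Sig[OF _ A'(1)] by auto
  qed
next
  case (Eq A a b)
  have T: "\<Gamma> \<turnstile> A \<^bold>: Ty" "\<Gamma> \<turnstile> a \<^bold>: A" "\<Gamma> \<turnstile> b \<^bold>: A" using type_inversion[OF Eq.prems(3)] by auto
  show ?case
  proof (cases "is_nf (Eq A a b)")
    case True
    then show ?thesis using Eq.prems conv_to_refl[OF Eq.prems(3)] by (auto simp only: norm_ty.simps if'_def if_True)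
  next
    case False
    then have "norm_ty e \<Gamma> A (\<lambda>A. norm_tm e \<Gamma> A a (\<lambda>a. norm_tm e \<Gamma> A b (\<lambda>b. k (Eq A a b)))) = Ok t U" using Eq.prems by (simp only: norm_ty.simps if'_def if_False)
    from Eq.IH(1)[OF this Eq.prems(2) T(1)] obtain A' where A': "conv_to \<Gamma> A A' Ty"
      "norm_tm e \<Gamma> A' a (\<lambda>a. norm_tm e \<Gamma> A' b (\<lambda>b. k (Eq A' a b))) = Ok t U" by blast
    from norm_tm_Ok[OF A'(2) Eq.prems(2) T(2) A'(1)] obtain a' where a': "conv_to \<Gamma> a a' A'" "norm_tm e \<Gamma> A' b (\<lambda>b. k (Eq A' a' b)) = Ok t U" by blast
    from norm_tm_Ok[OF a'(2) Eq.prems(2) T(3) A'(1)] obtain b' where "conv_to \<Gamma> b b' A'" "k (Eq A' a' b') = Ok t U" by blast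
    then show ?thesis using conv_to_Eq[OF _ A'(1) a'(1)] by blast
  qed
qed (auto simp only: norm_ty.simps dest: eval_nf_Ok intro: typed_ctx conv_to_refl dest!: eval_nf_Ok[OF _ _ typed_ctx])

lemma check_push_Ok:
  assumes h: "check_push e \<Gamma> f g k = Ok t T" and e: "sound e" and c: "\<Gamma> \<turnstile> \<^bold>\<surd>"
  shows "\<exists>A B C. is_span \<Gamma> A B C f g \<and> k A B C = Ok t T"
proof -
  from h obtain C A1 B1 A' B' C' where f: "e \<Gamma> f = Ok f (Pi C A1)" and g: "e \<Gamma> g = Ok g (Pi C B1)"
    and A1: "A1 = lf (Suc 0) 0 (sb 0 Univ A1)" and B1: "B1 = lf (Suc 0) 0 (sb 0 Univ B1)"
    and T: "e \<Gamma> (sb 0 Univ A1) = Ok A' Univ" "e \<Gamma> (sb 0 Univ B1) = Ok B' Univ" "e \<Gamma> C = Ok C' Univ"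
    and k: "k (sb 0 Univ A1) (sb 0 Univ B1) C = Ok t T"
    unfolding check_push_def by (auto simp only: control_Ok)
  \<comment> \<open>A term that is the lift of its own instance does not mention the variable, so
    the two function types are non-dependent.\<close>
  have "A1 = wk 1 (sb 0 Univ A1)" "B1 = wk 1 (sb 0 Univ B1)" using A1 B1 by (simp_all add: wk_lf One_nat_def)
  then have "Pi C A1 = Arr C (sb 0 Univ A1)" "Pi C B1 = Arr C (sb 0 Univ B1)" unfolding Arr_def by simp_all
  then have "is_span \<Gamma> (sb 0 Univ A1) (sb 0 Univ B1) C f g"
    unfolding is_span_def using soundD[OF e f c] soundD[OF e g c] soundD[OF e T(1) c] soundD[OF e T(2) c] soundD[OF e T(3) c]
    by (simp add: conv_to_def)
  then show ?thesis using k by blast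
qed

lemma conv_to_Pi_inv: "conv_to \<Gamma> f f' (Pi A B) \<Longrightarrow> \<Gamma> \<turnstile> A \<^bold>: Ty \<and> A # \<Gamma> \<turnstile> B \<^bold>: Ty"
  by (drule conv_toD(4), simp, drule type_inversion) simp

lemma conv_to_Sig_inv: "conv_to \<Gamma> f f' (Sig A B) \<Longrightarrow> \<Gamma> \<turnstile> A \<^bold>: Ty \<and> A # \<Gamma> \<turnstile> B \<^bold>: Ty"
  by (drule conv_toD(4), simp, drule type_inversion) simp

lemma conv_to_Eq_inv: "conv_to \<Gamma> f f' (Eq A a b) \<Longrightarrow> \<Gamma> \<turnstile> A \<^bold>: Ty \<and> \<Gamma> \<turnstile> a \<^bold>: A \<and> \<Gamma> \<turnstile> b \<^bold>: A"
  by (drule conv_toD(4), simp, drule type_inversion) simp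

lemma var_Ty: "\<Gamma> \<turnstile> \<^bold>\<surd> \<Longrightarrow> i < length \<Gamma> \<Longrightarrow> \<Gamma> \<turnstile> wk (Suc i) (\<Gamma> ! i) \<^bold>: Ty"
proof (induction \<Gamma> arbitrary: i)
  case (Cons A \<Gamma>)
  show ?case
  proof (cases i)
    case 0
    then show ?thesis using wk1_Ty[OF ctx_consD ctx_consD, OF Cons.prems(1) Cons.prems(1)] by (simp add: wk_def)
  next
    case (Suc j)
    then have "\<Gamma> \<turnstile> wk (Suc j) (\<Gamma> ! j) \<^bold>: Ty" using Cons by (auto intro: ctx_tl)
    from wk1_Ty[OF this ctx_consD[OF Cons.prems(1)]] show ?thesis using Suc by (simp add: wk_def ren_ren)
  qed
qed simp

text \<open>The reduct \<open>u\<close> comes with the type of the redex, while \<open>e\<close>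
  infers a type for it independently; they meet in the common normal form \<open>T\<close>.\<close>

lemma sound_beta:
  assumes "conv_to \<Gamma> t u T0" "conv_to \<Gamma> T0 T Ty" "sound e" "e \<Gamma> u = Ok v T"
  shows "conv_to \<Gamma> t v T \<and> canonical \<Gamma> v T"
proof -
  have "\<Gamma> \<turnstile> \<^bold>\<surd>" using assms(1) by (auto intro: typed_ctx dest: conv_toD)
  then show ?thesis using assms conv_to_conv conv_to_trans soundD by blast
qed

lemma sound_step_Lam:
  assumes e: "sound e" and c: "\<Gamma> \<turnstile> \<^bold>\<surd>" and h: "step e \<Gamma> (Lam A b) = Ok t' T"
  shows "conv_to \<Gamma> (Lam A b) t' T \<and> canonical \<Gamma> t' T"
proof -
  from h obtain A' s b' B where A: "e \<Gamma> A = Ok A' s" and s: "s \<in> {Univ, Ty}" and b: "e (A' # \<Gamma>) b = Ok b' B" and B: "B \<noteq> Ty" and t: "t' = Lam A' b'" "T = Pi A' B"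
    by (auto simp only: step.simps control_Ok res.inject)
  have A': "conv_to \<Gamma> A A' Ty" using soundD[OF e A c] conv_to_sort s by blast
  have b': "conv_to (A' # \<Gamma>) b b' B" using soundD[OF e b conv_to_ctx[OF A']] by blast
  show ?thesis unfolding t using conv_to_Lam[OF A' b' B] conv_toD(2)[OF b'] by simp
qed

lemma sound_step_App:
  assumes e: "sound e" and c: "\<Gamma> \<turnstile> \<^bold>\<surd>" and h: "step e \<Gamma> (App f a) = Ok t' T"
  shows "conv_to \<Gamma> (App f a) t' T \<and> canonical \<Gamma> t' T"
proof -
  from h obtain f' A B a' where f: "e \<Gamma> f = Ok f' (Pi A B)" and a: "e \<Gamma> a = Ok a' A"
    and n: "norm_ty e \<Gamma> (sb 0 a' B) (\<lambda>T. if_Lam f' (\<lambda>b. llet (sb 0 a' b) (\<lambda>u. bnd (e \<Gamma> u) (\<lambda>v T'. guard_eq T' T (Ok v T)))) (Ok (App f' a') T)) = Ok t' T"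
    by (simp only: step.simps control_Ok) blast
  have f': "conv_to \<Gamma> f f' (Pi A B)" "canonical \<Gamma> f' (Pi A B)" and a': "conv_to \<Gamma> a a' A" using soundD[OF e f c] soundD[OF e a c] by auto
  have P: "\<Gamma> \<turnstile> A \<^bold>: Ty" "A # \<Gamma> \<turnstile> B \<^bold>: Ty" using conv_to_Pi_inv[OF f'(1)] by auto
  have ap: "conv_to \<Gamma> (App f a) (App f' a') (B\<lbrakk>a'\<rbrakk>)" by (rule conv_to_App[OF f'(1) a'])
  have "\<Gamma> \<turnstile> sb 0 a' B \<^bold>: Ty" using inst_Ty[OF P(2) conv_toD(2)[OF a']] by (simp add: inst_sb)
  from norm_ty_Ok[OF n e this] obtain T' where T': "conv_to \<Gamma> (B\<lbrakk>a'\<rbrakk>) T' Ty"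
    and k: "if_Lam f' (\<lambda>b. llet (sb 0 a' b) (\<lambda>u. bnd (e \<Gamma> u) (\<lambda>v T''. guard_eq T'' T' (Ok v T')))) (Ok (App f' a') T') = Ok t' T"
    by (auto simp: inst_sb)
  show ?thesis
  proof (cases "\<exists>A b. f' = Lam A b")
    case True
    then obtain A0 b where fL: "f' = Lam A0 b" by blast
    \<comment> \<open>By \<open>canonical\<close> the abstraction carries exactly this domain and a
      body typed in this codomain; inverting its typing would give them only up to an equality of
      \<open>Pi\<close> types.\<close>
    then have b: "A # \<Gamma> \<turnstile> b \<^bold>: B" "A0 = A" using f'(2) by auto
    have v: "e \<Gamma> (sb 0 a' b) = Ok t' T'" "T' = T" using k fL by (auto simp: control_Ok)
    have "conv_to \<Gamma> (App f a) (b\<lbrakk>a'\<rbrakk>) (B\<lbrakk>a'\<rbrakk>)"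
      using ap conv_to_beta[OF P(2) b(1) conv_toD(2)[OF a']] fL b(2) by (auto intro: conv_to_trans)
    from sound_beta[OF this T' e] v show ?thesis by (simp add: inst_sb)
  next
    case False
    then have "t' = App f' a'" "T = T'" using k by (auto simp: if_Lam_Ok)
    then show ?thesis using conv_to_conv[OF ap T'] by simp
  qed
qed

lemma sound_step_Pair:
  assumes e: "sound e" and c: "\<Gamma> \<turnstile> \<^bold>\<surd>" and h: "step e \<Gamma> (Pair B a b) = Ok t' T"
  shows "conv_to \<Gamma> (Pair B a b) t' T \<and> canonical \<Gamma> t' T"
proof -
  from h obtain a' A B' s b' S where a: "e \<Gamma> a = Ok a' A" and A: "A \<noteq> Ty" and B: "e (A # \<Gamma>) B = Ok B' s" and s: "s \<in> {Univ, Ty}" and b: "e \<Gamma> b = Ok b' S"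
    and n: "norm_ty e \<Gamma> (sb 0 a' B') (\<lambda>T. guard_eq S T (Ok (Pair B' a' b') (Sig A B'))) = Ok t' T"
    by (simp only: step.simps control_Ok) blast
  have a': "conv_to \<Gamma> a a' A" "canonical \<Gamma> a' A" using soundD[OF e a c] by auto
  have AT: "\<Gamma> \<turnstile> A \<^bold>: Ty" using a' A by (auto dest: conv_toD)
  have B': "conv_to (A # \<Gamma>) B B' Ty" using soundD[OF e B ctx_cons[OF AT]] conv_to_sort s by blast
  have "\<Gamma> \<turnstile> sb 0 a' B' \<^bold>: Ty" using inst_Ty[OF conv_toD(2)[OF B'] conv_toD(2)[OF a'(1)]] by (simp add: inst_sb)
  from norm_ty_Ok[OF n e this] obtain T' where T': "conv_to \<Gamma> (B'\<lbrakk>a'\<rbrakk>) T' Ty" and k: "guard_eq S T' (Ok (Pair B' a' b') (Sig A B')) = Ok t' T"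
    by (auto simp: inst_sb)
  then have t: "S = T'" "t' = Pair B' a' b'" "T = Sig A B'" by (auto simp: control_Ok)
  have b': "conv_to \<Gamma> b b' (B'\<lbrakk>a'\<rbrakk>)" using conv_to_conv_sym[OF _ T'] soundD[OF e b c] t by auto
  show ?thesis unfolding t using conv_to_Pair[OF a'(1) A B' b'] conv_toD(2)[OF a'(1)] conv_toD(2)[OF b'] a'(2) by simp
qed

lemma sound_step_IndSig:
  assumes e: "sound e" and c: "\<Gamma> \<turnstile> \<^bold>\<surd>" and h: "step e \<Gamma> (IndSig C d p) = Ok t' T"
  shows "conv_to \<Gamma> (IndSig C d p) t' T \<and> canonical \<Gamma> t' T"
proof -
  from h obtain p' A B where p: "e \<Gamma> p = Ok p' (Sig A B)" 
    and k: "if_proj d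
     (eval_nf e (Sig A B # \<Gamma>) C (\<lambda>C. llet (wk 1 A) (\<lambda>C'. guard_eq C C' (if_Pair p' (\<lambda>a b. Ok a A) (Ok (IndSig C d p') A)))))
     (eval_nf e (Sig A B # \<Gamma>) C (\<lambda>C. llet (fam2 A B) (\<lambda>C'. guard_eq C C' (if_Pair p'
       (\<lambda>a b. llet (sb 0 a B) (\<lambda>T. norm_ty e \<Gamma> T (\<lambda>T. bnd (e \<Gamma> b) (\<lambda>b T'. guard_eq T' T (Ok b T)))))
       (llet (proj1 A p') (\<lambda>a. llet (sb 0 a B) (\<lambda>T. norm_ty e \<Gamma> T (\<lambda>T. Ok (IndSig C d p') T))))))))
     (bnd (e (Sig A B # \<Gamma>) C) (\<lambda>C s. guard_sort s (
     bnd (e (B # A # \<Gamma>) d) (\<lambda>d D. llet (subst_at 2 C (gpair B)) (\<lambda>T. norm_ty e (B # A # \<Gamma>) T (\<lambda>T. guard_eq D T (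
     llet (sb 0 p' C) (\<lambda>T. norm_ty e \<Gamma> T (\<lambda>T.
       if_Pair p' (\<lambda>a b. llet (d\<lbrakk>a, b\<rbrakk>) (\<lambda>u. bnd (e \<Gamma> u) (\<lambda>v T'. guard_eq T' T (Ok v T)))) (Ok (IndSig C d p') T)))))))))) = Ok t' T"
    unfolding step.simps by (simp only: bnd_Ok on_Sig_Ok) blast
  have p': "conv_to \<Gamma> p p' (Sig A B)" "canonical \<Gamma> p' (Sig A B)" using soundD[OF e p c] by auto
  note pt = conv_toD(2)[OF p'(1)]
  have S: "\<Gamma> \<turnstile> A \<^bold>: Ty" "A # \<Gamma> \<turnstile> B \<^bold>: Ty" using conv_to_Sig_inv[OF p'(1)] by auto
  have cS: "Sig A B # \<Gamma> \<turnstile> \<^bold>\<surd>" using S by (intro ctx_cons sig_form) auto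
  have cB: "B # A # \<Gamma> \<turnstile> \<^bold>\<surd>" by (rule ctx_cons[OF S(2)])
  have pair: "\<Gamma> \<turnstile> a \<^bold>: A" "\<Gamma> \<turnstile> b \<^bold>: B\<lbrakk>a\<rbrakk>" "canonical \<Gamma> a A" "B0 = B" if "p' = Pair B0 a b" for B0 a b
    using p'(2) that by auto
  consider (proj1) "d = Var 1" "eval_nf e (Sig A B # \<Gamma>) C (\<lambda>C. llet (wk 1 A) (\<lambda>C'. guard_eq C C' (if_Pair p' (\<lambda>a b. Ok a A) (Ok (IndSig C d p') A)))) = Ok t' T"
    | (proj2) "d = Var 0" "eval_nf e (Sig A B # \<Gamma>) C (\<lambda>C. llet (fam2 A B) (\<lambda>C'. guard_eq C C' (if_Pair p'
       (\<lambda>a b. llet (sb 0 a B) (\<lambda>T. norm_ty e \<Gamma> T (\<lambda>T. bnd (e \<Gamma> b) (\<lambda>b T'. guard_eq T' T (Ok b T)))))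
       (llet (proj1 A p') (\<lambda>a. llet (sb 0 a B) (\<lambda>T. norm_ty e \<Gamma> T (\<lambda>T. Ok (IndSig C d p') T))))))) = Ok t' T"
    | (ind) C' s d' D where "e (Sig A B # \<Gamma>) C = Ok C' s" "s \<in> {Univ, Ty}" "e (B # A # \<Gamma>) d = Ok d' D"
       "norm_ty e (B # A # \<Gamma>) (subst_at 2 C' (gpair B)) (\<lambda>T. guard_eq D T (norm_ty e \<Gamma> (sb 0 p' C') (\<lambda>T.
         if_Pair p' (\<lambda>a b. llet (d'\<lbrakk>a, b\<rbrakk>) (\<lambda>u. bnd (e \<Gamma> u) (\<lambda>v T'. guard_eq T' T (Ok v T)))) (Ok (IndSig C' d' p') T)))) = Ok t' T"
    using k unfolding if_proj_Ok by (auto simp only: control_Ok llet_def)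
  then show ?thesis
  proof cases
    case proj1
    from eval_nf_Ok[OF proj1(2) e cS] obtain C' where C': "C' = C \<or> conv_to (Sig A B # \<Gamma>) C C' Ty" "C' = wk 1 A"
      and k: "if_Pair p' (\<lambda>a b. Ok a A) (Ok (IndSig C' d p') A) = Ok t' T" by (auto simp: control_Ok)
    have C: "conv_to (Sig A B # \<Gamma>) C (wk 1 A) Ty"
      using C' wk1_Ty[OF S(1) ctx_consD[OF cS]] by (auto intro: conv_to_refl)
    note P = conv_to_proj1[OF S C p'(1)]
    show ?thesis
    proof (cases "\<exists>B a b. p' = Pair B a b")
      case True
      then obtain B0 a b where pp: "p' = Pair B0 a b" by blast
      have "t' = a" "T = A" using k pp by auto
      then show ?thesis using pair[OF pp] pp P conv_to_proj1_beta[OF S pair(1,2)[OF pp]] proj1(1)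
        by (auto simp: proj1_def intro: conv_to_trans)
    next
      case False
      then have "t' = IndSig C' d p'" "T = A" using k by (auto simp: if_Pair_Ok)
      then show ?thesis using P C'(2) proj1(1) by simp
    qed
  next
    case proj2
    from eval_nf_Ok[OF proj2(2) e cS] obtain C' where C': "C' = C \<or> conv_to (Sig A B # \<Gamma>) C C' Ty" "C' = fam2 A B"
      and k: "if_Pair p' (\<lambda>a b. norm_ty e \<Gamma> (sb 0 a B) (\<lambda>T. bnd (e \<Gamma> b) (\<lambda>b T'. guard_eq T' T (Ok b T))))
       (norm_ty e \<Gamma> (sb 0 (proj1 A p') B) (\<lambda>T. Ok (IndSig C' d p') T)) = Ok t' T" by (auto simp: guard_eq_Ok llet_def)
    have C: "conv_to (Sig A B # \<Gamma>) C (fam2 A B) Ty"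
      using C' fam2_Ty[OF S] by (auto intro: conv_to_refl)
    note P = conv_to_proj2[OF S C p'(1)]
    show ?thesis
    proof (cases "\<exists>B a b. p' = Pair B a b")
      case True
      then obtain B0 a b where pp: "p' = Pair B0 a b" by blast
      note ab = pair[OF pp]
      have n: "norm_ty e \<Gamma> (sb 0 a B) (\<lambda>T. bnd (e \<Gamma> b) (\<lambda>b T'. guard_eq T' T (Ok b T))) = Ok t' T" using k pp by simp
      have BT: "\<Gamma> \<turnstile> B\<lbrakk>a\<rbrakk> \<^bold>: Ty" by (rule inst_Ty[OF S(2) ab(1)])
      from norm_ty_Ok[OF n e] BT obtain T' where T': "conv_to \<Gamma> (B\<lbrakk>a\<rbrakk>) T' Ty" "e \<Gamma> b = Ok t' T'" "T = T'" by (auto simp: inst_sb control_Ok)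
      have BB: "conv_to \<Gamma> (B\<lbrakk>proj1 A p'\<rbrakk>) (B\<lbrakk>a\<rbrakk>) Ty"
        using conv_to_inst[OF conv_to_refl[OF S(2)] conv_to_proj1_beta[OF S ab(1,2)]] pp ab(4) by simp
      have "conv_to \<Gamma> (IndSig C d p) b (B\<lbrakk>a\<rbrakk>)"
        using conv_to_trans[OF conv_to_conv[OF P BB]] conv_to_proj2_beta[OF S ab(1,2)] pp ab(4) proj2(1) by simp
      from sound_beta[OF this T'(1) e] T' show ?thesis by simp
    next
      case False
      then have n: "norm_ty e \<Gamma> (sb 0 (proj1 A p') B) (\<lambda>T. Ok (IndSig C' d p') T) = Ok t' T" using k by (auto simp: if_Pair_Ok)
      have "\<Gamma> \<turnstile> B\<lbrakk>proj1 A p'\<rbrakk> \<^bold>: Ty" by (rule inst_Ty[OF S(2) proj1_typ[OF S pt]])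
      with norm_ty_Ok[OF n e] obtain T' where T': "conv_to \<Gamma> (B\<lbrakk>proj1 A p'\<rbrakk>) T' Ty" "t' = IndSig C' d p'" "T = T'" by (auto simp: inst_sb)
      then show ?thesis using conv_to_conv[OF P T'(1)] C'(2) proj2(1) by simp
    qed
  next
    case ind
    have C': "conv_to (Sig A B # \<Gamma>) C C' Ty" using soundD[OF e ind(1) cS] conv_to_sort ind(2) by blast
    have d': "conv_to (B # A # \<Gamma>) d d' D" using soundD[OF e ind(3) cB] by blast
    have "B # A # \<Gamma> \<turnstile> subst_at 2 C' (gpair B) \<^bold>: Ty"
      using sub_Ty[OF wsub_gpair[OF S] conv_toD(2)[OF C']] by (simp add: subst_at_def)
    from norm_ty_Ok[OF ind(4) e this] obtain D' where D': "conv_to (B # A # \<Gamma>) (subst_at 2 C' (gpair B)) D' Ty" "D = D'"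
      and n: "norm_ty e \<Gamma> (sb 0 p' C') (\<lambda>T. if_Pair p' (\<lambda>a b. llet (d'\<lbrakk>a, b\<rbrakk>) (\<lambda>u. bnd (e \<Gamma> u) (\<lambda>v T'. guard_eq T' T (Ok v T)))) (Ok (IndSig C' d' p') T)) = Ok t' T"
      by (auto simp: guard_eq_Ok)
    note P = conv_to_IndSig[OF S C' d' _ p'(1), unfolded D'(2), OF D'(1)]
    have "\<Gamma> \<turnstile> C'\<lbrakk>p'\<rbrakk> \<^bold>: Ty" by (rule inst_Ty[OF conv_toD(2)[OF C'] pt])
    with norm_ty_Ok[OF n e] obtain T' where T': "conv_to \<Gamma> (C'\<lbrakk>p'\<rbrakk>) T' Ty"
      and k: "if_Pair p' (\<lambda>a b. llet (d'\<lbrakk>a, b\<rbrakk>) (\<lambda>u. bnd (e \<Gamma> u) (\<lambda>v T''. guard_eq T'' T' (Ok v T')))) (Ok (IndSig C' d' p') T') = Ok t' T"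
      by (auto simp: inst_sb)
    show ?thesis
    proof (cases "\<exists>B a b. p' = Pair B a b")
      case True
      then obtain B0 a b where pp: "p' = Pair B0 a b" by blast
      note ab = pair[OF pp]
      have v: "e \<Gamma> (d'\<lbrakk>a, b\<rbrakk>) = Ok t' T'" "T' = T" using k pp by (auto simp: control_Ok)
      have dt: "B # A # \<Gamma> \<turnstile> d' \<^bold>: subst_at 2 C' (gpair B)" using conv_to_conv_sym[OF d'[unfolded D'(2)] D'(1)] by (auto dest: conv_toD)
      have "conv_to \<Gamma> (IndSig C d p) (d'\<lbrakk>a, b\<rbrakk>) (C'\<lbrakk>p'\<rbrakk>)"
        using conv_to_trans[OF P] conv_to_IndSig_beta[OF conv_toD(2)[OF C'] dt ab(1,2)] pp pt ab(4) by simp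
      from sound_beta[OF this T' e] v show ?thesis by simp
    next
      case False
      then have "t' = IndSig C' d' p'" "T = T'" using k by (auto simp: if_Pair_Ok)
      then show ?thesis using conv_to_conv[OF P T'] by simp
    qed
  qed
qed

lemma sound_step_J:
  assumes e: "sound e" and c: "\<Gamma> \<turnstile> \<^bold>\<surd>" and h: "step e \<Gamma> (J C d p) = Ok t' T"
  shows "conv_to \<Gamma> (J C d p) t' T \<and> canonical \<Gamma> t' T"
proof -
  from h obtain p' A a b C' s d' D where p: "e \<Gamma> p = Ok p' (Eq A a b)" and C: "e (path_fam A a # A # \<Gamma>) C = Ok C' s" and s: "s \<in> {Univ, Ty}"
    and d: "e \<Gamma> d = Ok d' D" and n: "norm_ty e \<Gamma> (C'\<lbrakk>a, Refl a\<rbrakk>) (\<lambda>T. guard_eq D T (if_Refl p' (Ok d' D) (llet (C'\<lbrakk>b, p'\<rbrakk>) (\<lambda>T. norm_ty e \<Gamma> T (\<lambda>T. Ok (J C' d' p') T))))) = Ok t' T"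
    by (simp only: step.simps control_Ok) blast
  have p': "conv_to \<Gamma> p p' (Eq A a b)" "canonical \<Gamma> p' (Eq A a b)" using soundD[OF e p c] by auto
  have A: "\<Gamma> \<turnstile> A \<^bold>: Ty" and a: "\<Gamma> \<turnstile> a \<^bold>: A" and b: "\<Gamma> \<turnstile> b \<^bold>: A" using conv_to_Eq_inv[OF p'(1)] by auto
  have C': "conv_to (path_fam A a # A # \<Gamma>) C C' Ty" using soundD[OF e C ctx_cons[OF path_fam_Ty[OF A a]]] conv_to_sort s by blast
  have d': "conv_to \<Gamma> d d' D" "canonical \<Gamma> d' D" using soundD[OF e d c] by auto
  have "\<Gamma> \<turnstile> C'\<lbrakk>a, Refl a\<rbrakk> \<^bold>: Ty" by (rule inst2_Ty[OF conv_toD(2)[OF C'] a]) (use refl[OF A a] in \<open>simp add: path_fam_inst\<close>)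
  from norm_ty_Ok[OF n e this] obtain D' where D': "conv_to \<Gamma> (C'\<lbrakk>a, Refl a\<rbrakk>) D' Ty" "D = D'"
    and k: "if_Refl p' (Ok d' D) (norm_ty e \<Gamma> (C'\<lbrakk>b, p'\<rbrakk>) (\<lambda>T. Ok (J C' d' p') T)) = Ok t' T"
    by (auto simp: guard_eq_Ok llet_def)
  note P = conv_to_J[OF a A b C' d'(1) _ p'(1), unfolded D'(2), OF D'(1)]
  show ?thesis
  proof (cases "\<exists>a. p' = Refl a")
    case True
    \<comment> \<open>By \<open>canonical\<close> both end points are syntactically the argument of
      \<open>Refl\<close>, so the motive at the end point is the motive at \<open>a\<close>.\<close>
    then have eqs: "p' = Refl a" "b = a" using p'(2) by auto
    then have t: "t' = d'" "T = D" using k by auto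
    have "\<Gamma> \<turnstile> d' \<^bold>: C'\<lbrakk>a, Refl a\<rbrakk>" using conv_to_conv_sym[OF d'(1)[unfolded D'(2)] D'(1)] by (auto dest: conv_toD)
    from conv_to_J_beta[OF a A conv_toD(2)[OF C'] this] have "conv_to \<Gamma> (J C d p) d' (C'\<lbrakk>a, Refl a\<rbrakk>)"
      using conv_to_trans P eqs by simp
    then show ?thesis using conv_to_conv D' d'(2) t by auto
  next
    case False
    then have n: "norm_ty e \<Gamma> (C'\<lbrakk>b, p'\<rbrakk>) (\<lambda>T. Ok (J C' d' p') T) = Ok t' T" using k by (auto simp: if_Refl_Ok)
    have "\<Gamma> \<turnstile> C'\<lbrakk>b, p'\<rbrakk> \<^bold>: Ty" by (rule inst2_Ty[OF conv_toD(2)[OF C'] b]) (use conv_toD(2)[OF p'(1)] in \<open>simp add: path_fam_inst\<close>)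
    from norm_ty_Ok[OF n e this] show ?thesis using conv_to_conv[OF P] by auto
  qed
qed

lemma sound_step_IndPush:
  assumes e: "sound e" and c: "\<Gamma> \<turnstile> \<^bold>\<surd>" and h: "step e \<Gamma> (IndPush D l r q t) = Ok t' T"
  shows "conv_to \<Gamma> (IndPush D l r q t) t' T \<and> canonical \<Gamma> t' T"
proof -
  let ?K = "\<lambda>A B D' l' r' q' t0. norm_ty e \<Gamma> (sb 0 t0 D') (\<lambda>T.
       if_Push t0
        (\<lambda>a. bnd (e \<Gamma> a) (\<lambda>a' A'. guard_eq A' A (llet (sb 0 a l') (\<lambda>u. bnd (e \<Gamma> u) (\<lambda>v T'. guard_eq T' T (Ok v T))))))
        (\<lambda>a. bnd (e \<Gamma> a) (\<lambda>a' A'. guard_eq A' B (llet (sb 0 a r') (\<lambda>u. bnd (e \<Gamma> u) (\<lambda>v T'. guard_eq T' T (Ok v T))))))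
        (Ok (IndPush D' l' r' q' t0) T))"
  from h obtain t0 f g where t: "e \<Gamma> t = Ok t0 (Push f g)" and cp: "check_push e \<Gamma> f g (\<lambda>A B C.
     bnd (e (Push f g # \<Gamma>) D) (\<lambda>D s. guard_sort s (
     bnd (e (A # \<Gamma>) l) (\<lambda>l L. llet (onL f g D) (\<lambda>T. norm_ty e (A # \<Gamma>) T (\<lambda>T. guard_eq L T (
     bnd (e (B # \<Gamma>) r) (\<lambda>r R. llet (onR f g D) (\<lambda>T. norm_ty e (B # \<Gamma>) T (\<lambda>T. guard_eq R T (
     bnd (e (C # \<Gamma>) q) (\<lambda>q Q. llet (glue_over f g D l r) (\<lambda>T. eval_ty e (C # \<Gamma>) T (\<lambda>T. guard_eq Q T (
     llet (sb 0 t0 D) (\<lambda>T. norm_ty e \<Gamma> T (\<lambda>T.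
       if_Push t0
        (\<lambda>a. bnd (e \<Gamma> a) (\<lambda>a' A'. guard_eq A' A (llet (sb 0 a l) (\<lambda>u. bnd (e \<Gamma> u) (\<lambda>v T'. guard_eq T' T (Ok v T))))))
        (\<lambda>a. bnd (e \<Gamma> a) (\<lambda>a' A'. guard_eq A' B (llet (sb 0 a r) (\<lambda>u. bnd (e \<Gamma> u) (\<lambda>v T'. guard_eq T' T (Ok v T))))))
        (Ok (IndPush D l r q t0) T)))))))))))))))))) = Ok t' T"
    unfolding step.simps by (simp only: bnd_Ok on_Push_Ok) blast
  have t0: "conv_to \<Gamma> t t0 (Push f g)" "canonical \<Gamma> t0 (Push f g)" using soundD[OF e t c] by auto
  note K = check_push_Ok[OF cp e c, unfolded control_Ok]
  from K obtain A B C D' s l' L where s: "is_span \<Gamma> A B C f g"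
    and D: "e (Push f g # \<Gamma>) D = Ok D' s" "s \<in> {Univ, Ty}" and l: "e (A # \<Gamma>) l = Ok l' L"
    and n: "norm_ty e (A # \<Gamma>) (onL f g D') (\<lambda>T. guard_eq L T (
     bnd (e (B # \<Gamma>) r) (\<lambda>r R. llet (onR f g D') (\<lambda>T. norm_ty e (B # \<Gamma>) T (\<lambda>T. guard_eq R T (
     bnd (e (C # \<Gamma>) q) (\<lambda>q Q. llet (glue_over f g D' l' r) (\<lambda>T. eval_ty e (C # \<Gamma>) T (\<lambda>T. guard_eq Q T (
       ?K A B D' l' r q t0)))))))))) = Ok t' T"
    unfolding llet_def by blast
  have D': "conv_to (Push f g # \<Gamma>) D D' Ty" using soundD[OF e D(1) spanD(8)[OF s]] conv_to_sort D(2) by blast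
  have l': "conv_to (A # \<Gamma>) l l' L" using soundD[OF e l spanD(9)[OF s]] by blast
  from norm_ty_Ok[OF n e] conv_toD(2)[OF onL_conv[OF s D']] obtain r' R where L: "conv_to (A # \<Gamma>) (onL f g D') L Ty"
    and r: "e (B # \<Gamma>) r = Ok r' R" and n: "norm_ty e (B # \<Gamma>) (onR f g D') (\<lambda>T. guard_eq R T (
     bnd (e (C # \<Gamma>) q) (\<lambda>q Q. llet (glue_over f g D' l' r') (\<lambda>T. eval_ty e (C # \<Gamma>) T (\<lambda>T. guard_eq Q T (
       ?K A B D' l' r' q t0)))))) = Ok t' T"
    unfolding control_Ok llet_def by blast
  have r': "conv_to (B # \<Gamma>) r r' R" using soundD[OF e r spanD(10)[OF s]] by blast
  from norm_ty_Ok[OF n e] conv_toD(2)[OF onR_conv[OF s D']] obtain q' Q where R: "conv_to (B # \<Gamma>) (onR f g D') R Ty"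
    and q: "e (C # \<Gamma>) q = Ok q' Q" and n: "eval_ty e (C # \<Gamma>) (glue_over f g D' l' r') (\<lambda>T. guard_eq Q T (?K A B D' l' r' q' t0)) = Ok t' T"
    unfolding control_Ok llet_def by blast
  have q': "conv_to (C # \<Gamma>) q q' Q" using soundD[OF e q spanD(11)[OF s]] by blast
  from eval_ty_Ok[OF n e spanD(11)[OF s]] have Q: "conv_to (C # \<Gamma>) (glue_over f g D' l' r') Q Ty" and n: "?K A B D' l' r' q' t0 = Ok t' T"
    by (auto simp only: control_Ok)
  note P = conv_to_IndPush[OF s D' l' L r' R q' Q t0(1)]
  have lt: "A # \<Gamma> \<turnstile> l' \<^bold>: onL f g D'" and rt: "B # \<Gamma> \<turnstile> r' \<^bold>: onR f g D'" and qt: "C # \<Gamma> \<turnstile> q' \<^bold>: glue_over f g D' l' r'"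
    using conv_to_conv_sym[OF l' L] conv_to_conv_sym[OF r' R] conv_to_conv_sym[OF q' Q] by (auto dest: conv_toD)
  note beta = conv_to_IndPush_beta[OF s conv_toD(2)[OF D'] lt rt qt]
  have "\<Gamma> \<turnstile> D'\<lbrakk>t0\<rbrakk> \<^bold>: Ty" by (rule inst_Ty[OF conv_toD(2)[OF D'] conv_toD(2)[OF t0(1)]])
  with norm_ty_Ok[OF n e] obtain T' where T': "conv_to \<Gamma> (D'\<lbrakk>t0\<rbrakk>) T' Ty" and k: "if_Push t0
        (\<lambda>a. bnd (e \<Gamma> a) (\<lambda>a' A'. guard_eq A' A (llet (sb 0 a l') (\<lambda>u. bnd (e \<Gamma> u) (\<lambda>v T''. guard_eq T'' T' (Ok v T'))))))
        (\<lambda>a. bnd (e \<Gamma> a) (\<lambda>a' A'. guard_eq A' B (llet (sb 0 a r') (\<lambda>u. bnd (e \<Gamma> u) (\<lambda>v T''. guard_eq T'' T' (Ok v T'))))))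
        (Ok (IndPush D' l' r' q' t0) T') = Ok t' T" unfolding inst_sb by blast
  consider (l) a a' where "t0 = PushL f g a" "e \<Gamma> a = Ok a' A" "e \<Gamma> (sb 0 a l') = Ok t' T'" "T = T'"
    | (r) a a' where "t0 = PushR f g a" "e \<Gamma> a = Ok a' B" "e \<Gamma> (sb 0 a r') = Ok t' T'" "T = T'"
    | (neutral) "t' = IndPush D' l' r' q' t0" "T = T'" "\<forall>f g a. t0 \<noteq> PushL f g a \<and> t0 \<noteq> PushR f g a"
    using k t0(2) unfolding if_Push_Ok by (auto simp: control_Ok)
  then show ?thesis
  proof cases
    case l
    \<comment> \<open>The typing of the argument cannot be recovered from that of
      \<open>PushL f g a\<close>; this is why \<open>step\<close> evaluates \<open>a\<close> again
      and inspects its type.\<close>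
    have "\<Gamma> \<turnstile> a \<^bold>: A" using soundD[OF e l(2) c] by (auto dest: conv_toD)
    from sound_beta[OF conv_to_trans[OF P] T' e] beta(1)[OF this] l show ?thesis by (simp add: inst_sb)
  next
    case r
    have "\<Gamma> \<turnstile> a \<^bold>: B" using soundD[OF e r(2) c] by (auto dest: conv_toD)
    from sound_beta[OF conv_to_trans[OF P] T' e] beta(2)[OF this] r show ?thesis by (simp add: inst_sb)
  next
    case neutral
    then show ?thesis using conv_to_conv[OF P T'] by simp
  qed
qed

lemma sound_step_form:
  assumes e: "sound e" and c: "\<Gamma> \<turnstile> \<^bold>\<surd>"
  shows "step e \<Gamma> (Pi A B) = Ok t' T \<Longrightarrow> conv_to \<Gamma> (Pi A B) t' T \<and> canonical \<Gamma> t' T"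
    and "step e \<Gamma> (Sig A B) = Ok t' T \<Longrightarrow> conv_to \<Gamma> (Sig A B) t' T \<and> canonical \<Gamma> t' T"
    and "step e \<Gamma> (Eq A a b) = Ok t' T \<Longrightarrow> conv_to \<Gamma> (Eq A a b) t' T \<and> canonical \<Gamma> t' T"
proof -
  assume "step e \<Gamma> (Pi A B) = Ok t' T"
  then obtain A' s B' s' where A: "e \<Gamma> A = Ok A' s" and s: "s \<in> {Univ, Ty}" and B: "e (A' # \<Gamma>) B = Ok B' s'" "s' \<in> {Univ, Ty}" and t: "t' = Pi A' B'" "T = max_sort s s'"
    by (auto simp only: step.simps control_Ok res.inject)
  have A': "conv_to \<Gamma> A A' s" using soundD[OF e A c] by blast
  have B': "conv_to (A' # \<Gamma>) B B' s'" using soundD[OF e B(1) conv_to_ctx[OF conv_to_sort[OF A' s]]] by blast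
  show "conv_to \<Gamma> (Pi A B) t' T \<and> canonical \<Gamma> t' T" unfolding t
    using conv_to_Pi[OF max_sort_sort[OF s B(2)]] conv_to_max_sort[OF A' s B(2)] conv_to_max_sort[OF B' B(2) s] by simp
next
  assume "step e \<Gamma> (Sig A B) = Ok t' T"
  then obtain A' s B' s' where A: "e \<Gamma> A = Ok A' s" and s: "s \<in> {Univ, Ty}" and B: "e (A' # \<Gamma>) B = Ok B' s'" "s' \<in> {Univ, Ty}" and t: "t' = Sig A' B'" "T = max_sort s s'"
    by (auto simp only: step.simps control_Ok res.inject)
  have A': "conv_to \<Gamma> A A' s" using soundD[OF e A c] by blast
  have B': "conv_to (A' # \<Gamma>) B B' s'" using soundD[OF e B(1) conv_to_ctx[OF conv_to_sort[OF A' s]]] by blast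
  show "conv_to \<Gamma> (Sig A B) t' T \<and> canonical \<Gamma> t' T" unfolding t
    using conv_to_Sig[OF max_sort_sort[OF s B(2)]] conv_to_max_sort[OF A' s B(2)] conv_to_max_sort[OF B' B(2) s] by simp
next
  assume "step e \<Gamma> (Eq A a b) = Ok t' T"
  then obtain A' a' b' where A: "e \<Gamma> A = Ok A' T" and s: "T \<in> {Univ, Ty}" and a: "e \<Gamma> a = Ok a' A'" and b: "e \<Gamma> b = Ok b' A'" and t: "t' = Eq A' a' b'"
    by (auto simp only: step.simps control_Ok res.inject)
  show "conv_to \<Gamma> (Eq A a b) t' T \<and> canonical \<Gamma> t' T" unfolding t
    using conv_to_Eq[OF s] soundD[OF e A c] soundD[OF e a c] soundD[OF e b c] by simp
qed

lemma sound_step_intro: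
  assumes e: "sound e" and c: "\<Gamma> \<turnstile> \<^bold>\<surd>"
  shows "step e \<Gamma> (Var i) = Ok t' T \<Longrightarrow> conv_to \<Gamma> (Var i) t' T \<and> canonical \<Gamma> t' T"
    and "step e \<Gamma> (Refl a) = Ok t' T \<Longrightarrow> conv_to \<Gamma> (Refl a) t' T \<and> canonical \<Gamma> t' T"
    and "step e \<Gamma> (Push f g) = Ok t' T \<Longrightarrow> conv_to \<Gamma> (Push f g) t' T \<and> canonical \<Gamma> t' T"
    and "step e \<Gamma> (PushL f g a) = Ok t' T \<Longrightarrow> conv_to \<Gamma> (PushL f g a) t' T \<and> canonical \<Gamma> t' T"
    and "step e \<Gamma> (PushR f g a) = Ok t' T \<Longrightarrow> conv_to \<Gamma> (PushR f g a) t' T \<and> canonical \<Gamma> t' T"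
    and "step e \<Gamma> (Glue f g a) = Ok t' T \<Longrightarrow> conv_to \<Gamma> (Glue f g a) t' T \<and> canonical \<Gamma> t' T"
proof -
  assume "step e \<Gamma> (Var i) = Ok t' T"
  then have i: "i < length \<Gamma>" and n: "norm_ty e \<Gamma> (wk (Suc i) (\<Gamma> ! i)) (Ok (Var i)) = Ok t' T"
    by (auto simp: wk_lf llet_def dest: look_Ok)
  from norm_ty_Ok[OF n e var_Ty[OF c i]] show "conv_to \<Gamma> (Var i) t' T \<and> canonical \<Gamma> t' T"
    using conv_to_conv[OF conv_to_refl[OF var[OF c i]]] var_Ty[OF c i] by auto
next
  assume "step e \<Gamma> (Refl a) = Ok t' T"
  then obtain a' A where "e \<Gamma> a = Ok a' A" "A \<noteq> Ty" "t' = Refl a'" "T = Eq A a' a'" by (auto simp: control_Ok)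
  then show "conv_to \<Gamma> (Refl a) t' T \<and> canonical \<Gamma> t' T" using soundD[OF e _ c] conv_to_Refl by auto
next
  assume "step e \<Gamma> (Push f g) = Ok t' T"
  then show "conv_to \<Gamma> (Push f g) t' T \<and> canonical \<Gamma> t' T"
    using c by (auto dest!: check_push_Ok[OF _ e c] spanD(6) intro: conv_to_refl univ_form)
next
  assume "step e \<Gamma> (PushL f g a) = Ok t' T"
  then show "conv_to \<Gamma> (PushL f g a) t' T \<and> canonical \<Gamma> t' T"
    by (auto dest!: check_push_Ok[OF _ e c] simp: control_Ok intro!: conv_to_PushL dest: soundD[OF e _ c])
next
  assume "step e \<Gamma> (PushR f g a) = Ok t' T"
  then show "conv_to \<Gamma> (PushR f g a) t' T \<and> canonical \<Gamma> t' T"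
    by (auto dest!: check_push_Ok[OF _ e c] simp: control_Ok intro!: conv_to_PushR dest: soundD[OF e _ c])
next
  assume "step e \<Gamma> (Glue f g a) = Ok t' T"
  then obtain A B C a' where s: "is_span \<Gamma> A B C f g" and a: "e \<Gamma> a = Ok a' C" and n: "eval_ty e \<Gamma> (glue_type f g a') (Ok (Glue f g a')) = Ok t' T"
    by (auto dest!: check_push_Ok[OF _ e c] simp: control_Ok)
  have "conv_to \<Gamma> a a' C" using soundD[OF e a c] by blast
  from conv_to_Glue[OF s this] show "conv_to \<Gamma> (Glue f g a) t' T \<and> canonical \<Gamma> t' T"
    using eval_ty_Ok[OF n e c] conv_to_conv by auto
qed

lemma sound_step: "sound e \<Longrightarrow> sound (step e)"
  unfolding sound_def[of "step e"]
proof (intro allI impI)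
  fix \<Gamma> t t' T
  assume e: "sound e" and c: "\<Gamma> \<turnstile> \<^bold>\<surd>" and h: "step e \<Gamma> t = Ok t' T"
  show "conv_to \<Gamma> t t' T \<and> canonical \<Gamma> t' T"
  proof (cases t)
    case (Var i) then show ?thesis using h sound_step_intro(1)[OF e c] by blast
  next
    case (Refl a) then show ?thesis using h sound_step_intro(2)[OF e c] by blast
  next
    case (Push f g) then show ?thesis using h sound_step_intro(3)[OF e c] by blast
  next
    case (PushL f g a) then show ?thesis using h sound_step_intro(4)[OF e c] by blast
  next
    case (PushR f g a) then show ?thesis using h sound_step_intro(5)[OF e c] by blast
  next
    case (Glue f g a) then show ?thesis using h sound_step_intro(6)[OF e c] by blast
  next
    case (Pi A B) then show ?thesis using h sound_step_form(1)[OF e c] by blast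
  next
    case (Sig A B) then show ?thesis using h sound_step_form(2)[OF e c] by blast
  next
    case (Eq A a b) then show ?thesis using h sound_step_form(3)[OF e c] by blast
  next
    case (Lam A b) then show ?thesis using h sound_step_Lam[OF e c] by blast
  next
    case (App f a) then show ?thesis using h sound_step_App[OF e c] by blast
  next
    case (Pair B a b) then show ?thesis using h sound_step_Pair[OF e c] by blast
  next
    case (IndSig C d p) then show ?thesis using h sound_step_IndSig[OF e c] by blast
  next
    case (J C d p) then show ?thesis using h sound_step_J[OF e c] by blast
  next
    case (IndPush D l r q u) then show ?thesis using h sound_step_IndPush[OF e c] by blast
  next
    case Univ then show ?thesis using h c by (auto intro: conv_to_refl univ_form)
  qed (use h in auto)
qed

lemma sound_eval: "sound (eval n)"
  by (induction n) (simp add: sound_def, simp add: sound_step)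

lemma sound_ev: "sound ev"
  unfolding ev_def by (rule sound_eval)

section \<open>Soundness of elaboration\<close>

text \<open>Normality of the goal affects only the success of elaboration; soundness speaks of
  well-formed goals.\<close>

definition goal_ok :: "tm list \<Rightarrow> tm option \<Rightarrow> bool"
  where "goal_ok \<Gamma> m \<longleftrightarrow> (\<forall>S. m = Some S \<longrightarrow> \<Gamma> \<turnstile> S \<^bold>: Ty)"

definition result_ok :: "tm list \<Rightarrow> tm option \<Rightarrow> tm \<Rightarrow> tm \<Rightarrow> bool"
  where "result_ok \<Gamma> m t T \<longleftrightarrow> \<Gamma> \<turnstile> t \<^bold>: T \<and> (T = Ty \<or> \<Gamma> \<turnstile> T \<^bold>: Ty) \<and> (\<forall>S. m = Some S \<longrightarrow> T = S)"

definition el_sound :: "elab \<Rightarrow> bool"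
  where "el_sound p \<longleftrightarrow> (\<forall>\<Gamma> m t T. \<Gamma> \<turnstile> \<^bold>\<surd> \<longrightarrow> goal_ok \<Gamma> m \<longrightarrow> p \<Gamma> m = Ok t T \<longrightarrow> result_ok \<Gamma> m t T)"

lemma el_soundI: "(\<And>\<Gamma> m t T. \<Gamma> \<turnstile> \<^bold>\<surd> \<Longrightarrow> goal_ok \<Gamma> m \<Longrightarrow> p \<Gamma> m = Ok t T \<Longrightarrow> result_ok \<Gamma> m t T) \<Longrightarrow> el_sound p"
  by (simp add: el_sound_def)

lemma el_soundD: "el_sound p \<Longrightarrow> p \<Gamma> m = Ok t T \<Longrightarrow> \<Gamma> \<turnstile> \<^bold>\<surd> \<Longrightarrow> goal_ok \<Gamma> m \<Longrightarrow> result_ok \<Gamma> m t T"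
  by (simp add: el_sound_def)

lemma el_synth: "el_sound p \<Longrightarrow> p \<Gamma> None = Ok t T \<Longrightarrow> \<Gamma> \<turnstile> \<^bold>\<surd> \<Longrightarrow> \<Gamma> \<turnstile> t \<^bold>: T \<and> (T = Ty \<or> \<Gamma> \<turnstile> T \<^bold>: Ty)"
  using el_soundD[of p \<Gamma> None t T] by (simp add: goal_ok_def result_ok_def)

lemma el_check: "el_sound p \<Longrightarrow> p \<Gamma> (Some S) = Ok t T \<Longrightarrow> \<Gamma> \<turnstile> S \<^bold>: Ty \<Longrightarrow> \<Gamma> \<turnstile> t \<^bold>: S \<and> T = S"
  using el_soundD[of p \<Gamma> "Some S" t T] typed_ctx[of \<Gamma> S Ty] by (auto simp: goal_ok_def result_ok_def)

lemma norm_ty_Ok': "norm_ty ev \<Gamma> T k = Ok t U \<Longrightarrow> T = Ty \<or> \<Gamma> \<turnstile> T \<^bold>: Ty \<Longrightarrow> \<exists>T'. k T' = Ok t U \<and> (T = Ty \<and> T' = Ty \<or> conv_to \<Gamma> T T' Ty)"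
  by (cases "T = Ty") (auto simp: eval_nf_def if'_def dest: norm_ty_Ok[OF _ sound_ev])

lemma infer_Ok: "infer m \<Gamma> t T = Ok t' T' \<Longrightarrow> \<Gamma> \<turnstile> t \<^bold>: T \<Longrightarrow> T = Ty \<or> \<Gamma> \<turnstile> T \<^bold>: Ty \<Longrightarrow> goal_ok \<Gamma> m \<Longrightarrow> result_ok \<Gamma> m t' T'"
proof (cases m)
  case (Some S)
  assume h: "infer m \<Gamma> t T = Ok t' T'" "\<Gamma> \<turnstile> t \<^bold>: T" "T = Ty \<or> \<Gamma> \<turnstile> T \<^bold>: Ty" "goal_ok \<Gamma> m"
  have S: "\<Gamma> \<turnstile> S \<^bold>: Ty" using h Some by (simp add: goal_ok_def)
  have "norm_ty ev \<Gamma> T (\<lambda>T. guard_eq T S (Ok t S)) = Ok t' T'" using h(1) Some by (simp add: infer_def)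
  from norm_ty_Ok'[OF this h(3)] have "t' = t" "T' = S" "T = Ty \<and> S = Ty \<or> conv_to \<Gamma> T S Ty" by (auto simp: control_Ok)
  then show ?thesis using S h Some not_Ty by (auto simp: result_ok_def intro: conv dest: conv_toD)
qed (auto simp: infer_def result_ok_def)

lemma on_Some_Ok: "on_Some m k = Ok t T \<longleftrightarrow> (\<exists>S. m = Some S \<and> k S = Ok t T)"
  by (cases m) (simp_all add: on_Some_def)

lemma check_ok: "goal_ok \<Gamma> (Some S) \<Longrightarrow> \<Gamma> \<turnstile> t \<^bold>: S \<Longrightarrow> result_ok \<Gamma> (Some S) t S"
  by (simp add: goal_ok_def result_ok_def)

lemma elab_ty_Ok:
  assumes "elab_ty p \<Gamma> k = Ok t T" "el_sound p" "\<Gamma> \<turnstile> \<^bold>\<surd>"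
  shows "\<exists>A s. \<Gamma> \<turnstile> A \<^bold>: s \<and> s \<in> {Univ, Ty} \<and> \<Gamma> \<turnstile> A \<^bold>: Ty \<and> k A s = Ok t T"
proof -
  from assms(1) obtain A s where A: "p \<Gamma> None = Ok A s" and s: "s \<in> {Univ, Ty}"
    and k: "if' (is_nf A) (k A s) (bnd (ev \<Gamma> A) (\<lambda>A s. guard_sort s (k A s))) = Ok t T"
    unfolding elab_ty_def control_Ok by blast
  have As: "\<Gamma> \<turnstile> A \<^bold>: s" "\<Gamma> \<turnstile> A \<^bold>: Ty" using el_synth[OF assms(2) A assms(3)] s by (auto intro: small)
  from k consider "k A s = Ok t T" | A' s' where "ev \<Gamma> A = Ok A' s'" "s' \<in> {Univ, Ty}" "k A' s' = Ok t T"
    unfolding if'_Ok control_Ok by blast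
  then show ?thesis
  proof cases
    case 1
    then show ?thesis using As s by blast
  next
    case 2
    have "\<Gamma> \<turnstile> A' \<^bold>: s'" "\<Gamma> \<turnstile> A' \<^bold>: Ty" using soundD[OF sound_ev 2(1) assms(3)] 2(2) by (auto intro: small dest: conv_toD)
    then show ?thesis using 2 by blast
  qed
qed

lemma Pi_inv: "\<Gamma> \<turnstile> Pi A B \<^bold>: T \<Longrightarrow> \<Gamma> \<turnstile> A \<^bold>: Ty \<and> A # \<Gamma> \<turnstile> B \<^bold>: Ty"
  and Sig_inv: "\<Gamma> \<turnstile> Sig A B \<^bold>: T \<Longrightarrow> \<Gamma> \<turnstile> A \<^bold>: Ty \<and> A # \<Gamma> \<turnstile> B \<^bold>: Ty"
  and Eq_inv: "\<Gamma> \<turnstile> Eq A a b \<^bold>: T \<Longrightarrow> \<Gamma> \<turnstile> A \<^bold>: Ty \<and> \<Gamma> \<turnstile> a \<^bold>: A \<and> \<Gamma> \<turnstile> b \<^bold>: A"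
  by (drule type_inversion, simp)+

lemma goal_okD: "goal_ok \<Gamma> (Some S) \<Longrightarrow> \<Gamma> \<turnstile> S \<^bold>: Ty"
  by (simp add: goal_ok_def)

lemma max_sort_typ: "\<Gamma> \<turnstile> A \<^bold>: s \<Longrightarrow> s \<in> {Univ, Ty} \<Longrightarrow> s' \<in> {Univ, Ty} \<Longrightarrow> \<Gamma> \<turnstile> A \<^bold>: max_sort s s' \<and> \<Gamma> \<turnstile> A \<^bold>: max_sort s' s"
  by (auto intro: small)

lemma el_sound_types:
  assumes A: "el_sound (el A)" and B: "el_sound (el B)" and C: "el_sound (el C)"
  shows "el_sound (el (PPi A B))" "el_sound (el (PSig A B))" "el_sound (el (PEq A B C))"
proof -
  show "el_sound (el (PPi A B))"
  proof (rule el_soundI)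
    fix \<Gamma> m t T assume c: "\<Gamma> \<turnstile> \<^bold>\<surd>" and g: "goal_ok \<Gamma> m" and h: "el (PPi A B) \<Gamma> m = Ok t T"
    from elab_ty_Ok[OF _ A c] h obtain A' s where A': "\<Gamma> \<turnstile> A' \<^bold>: s" "s \<in> {Univ, Ty}" "\<Gamma> \<turnstile> A' \<^bold>: Ty"
      and k: "elab_ty (el B) (A' # \<Gamma>) (\<lambda>B s'. llet (max_sort s s') (infer m \<Gamma> (Pi A' B))) = Ok t T" unfolding el.simps by blast
    from elab_ty_Ok[OF k B ctx_cons[OF A'(3)]] obtain B' s' where B': "A' # \<Gamma> \<turnstile> B' \<^bold>: s'" "s' \<in> {Univ, Ty}"
      and k: "infer m \<Gamma> (Pi A' B') (max_sort s s') = Ok t T" unfolding llet_def by blast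
    note m = max_sort_sort[OF A'(2) B'(2)]
    show "result_ok \<Gamma> m t T"
      by (rule infer_Ok[OF k pi_form[OF m] sort_wf[OF c m] g]) (use max_sort_typ[OF A'(1,2) B'(2)] max_sort_typ[OF B'(1,2) A'(2)] in auto)
  qed
next
  show "el_sound (el (PSig A B))"
  proof (rule el_soundI)
    fix \<Gamma> m t T assume c: "\<Gamma> \<turnstile> \<^bold>\<surd>" and g: "goal_ok \<Gamma> m" and h: "el (PSig A B) \<Gamma> m = Ok t T"
    from elab_ty_Ok[OF _ A c] h obtain A' s where A': "\<Gamma> \<turnstile> A' \<^bold>: s" "s \<in> {Univ, Ty}" "\<Gamma> \<turnstile> A' \<^bold>: Ty"
      and k: "elab_ty (el B) (A' # \<Gamma>) (\<lambda>B s'. llet (max_sort s s') (infer m \<Gamma> (Sig A' B))) = Ok t T" unfolding el.simps by blast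
    from elab_ty_Ok[OF k B ctx_cons[OF A'(3)]] obtain B' s' where B': "A' # \<Gamma> \<turnstile> B' \<^bold>: s'" "s' \<in> {Univ, Ty}"
      and k: "infer m \<Gamma> (Sig A' B') (max_sort s s') = Ok t T" unfolding llet_def by blast
    note m = max_sort_sort[OF A'(2) B'(2)]
    show "result_ok \<Gamma> m t T"
      by (rule infer_Ok[OF k sig_form[OF m] sort_wf[OF c m] g]) (use max_sort_typ[OF A'(1,2) B'(2)] max_sort_typ[OF B'(1,2) A'(2)] in auto)
  qed
next
  show "el_sound (el (PEq A B C))"
  proof (rule el_soundI)
    fix \<Gamma> m t T assume c: "\<Gamma> \<turnstile> \<^bold>\<surd>" and g: "goal_ok \<Gamma> m" and h: "el (PEq A B C) \<Gamma> m = Ok t T"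
    from elab_ty_Ok[OF _ A c] h obtain A' s where A': "\<Gamma> \<turnstile> A' \<^bold>: s" "s \<in> {Univ, Ty}" "\<Gamma> \<turnstile> A' \<^bold>: Ty"
      and k: "bnd (el B \<Gamma> (Some A')) (\<lambda>a _. bnd (el C \<Gamma> (Some A')) (\<lambda>b _.
        norm_tm ev \<Gamma> A' a (\<lambda>a. norm_tm ev \<Gamma> A' b (\<lambda>b. infer m \<Gamma> (Eq A' a b) s)))) = Ok t T" unfolding el.simps by blast
    then obtain a b Ta Tb where a: "el B \<Gamma> (Some A') = Ok a Ta" and b: "el C \<Gamma> (Some A') = Ok b Tb"
      and k: "norm_tm ev \<Gamma> A' a (\<lambda>a. norm_tm ev \<Gamma> A' b (\<lambda>b. infer m \<Gamma> (Eq A' a b) s)) = Ok t T" unfolding control_Ok by blast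
    have ab: "\<Gamma> \<turnstile> a \<^bold>: A'" "\<Gamma> \<turnstile> b \<^bold>: A'" using el_check[OF B a A'(3)] el_check[OF C b A'(3)] by auto
    have r: "conv_to \<Gamma> A' A' Ty" using A' by (intro conv_to_refl) auto
    from norm_tm_Ok[OF k sound_ev ab(1) r] obtain a' where a': "conv_to \<Gamma> a a' A'" "norm_tm ev \<Gamma> A' b (\<lambda>b. infer m \<Gamma> (Eq A' a' b) s) = Ok t T" by blast
    from norm_tm_Ok[OF a'(2) sound_ev ab(2) r] obtain b' where b': "conv_to \<Gamma> b b' A'" "infer m \<Gamma> (Eq A' a' b') s = Ok t T" by blast
    show "result_ok \<Gamma> m t T"
      by (rule infer_Ok[OF b'(2) id_form[OF A'(2,1)] sort_wf[OF c A'(2)] g]) (use a' b' in \<open>auto dest: conv_toD\<close>)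
  qed
qed

lemma el_sound_leaf: "el_sound (el (PVar i))" "el_sound (el (PTm t0))" "el_sound (el PRefl)"
proof -
  show "el_sound (el (PVar i))"
    by (rule el_soundI) (auto simp: llet_def wk_lf[symmetric] dest!: look_Ok intro!: infer_Ok var var_Ty)
  show "el_sound (el (PTm t0))"
  proof (rule el_soundI)
    fix \<Gamma> m t T assume c: "\<Gamma> \<turnstile> \<^bold>\<surd>" and g: "goal_ok \<Gamma> m" and h: "el (PTm t0) \<Gamma> m = Ok t T"
    then obtain t' T' where "ev \<Gamma> t0 = Ok t' T'" "infer m \<Gamma> t' T' = Ok t T" by (auto simp: control_Ok)
    then show "result_ok \<Gamma> m t T" using soundD[OF sound_ev _ c, of t0 t' T'] g by (auto intro: infer_Ok simp: conv_to_def)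
  qed
  show "el_sound (el PRefl)"
  proof (rule el_soundI)
    fix \<Gamma> m t T assume c: "\<Gamma> \<turnstile> \<^bold>\<surd>" and g: "goal_ok \<Gamma> m" and h: "el PRefl \<Gamma> m = Ok t T"
    then obtain A a where m: "m = Some (Eq A a a)" "t = Refl a" "T = Eq A a a" by (auto simp: control_Ok on_Some_Ok)
    then have "\<Gamma> \<turnstile> Eq A a a \<^bold>: Ty" using g goal_okD by blast
    from Eq_inv[OF this] show "result_ok \<Gamma> m t T" using g refl unfolding m by (auto intro: check_ok)
  qed
qed

lemma el_sound_Lam: "el_sound (el b) \<Longrightarrow> el_sound (el (PLam b))"
proof (rule el_soundI)
  fix \<Gamma> m t T assume b: "el_sound (el b)" and c: "\<Gamma> \<turnstile> \<^bold>\<surd>" and g: "goal_ok \<Gamma> m" and h: "el (PLam b) \<Gamma> m = Ok t T"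
  then obtain A B b' U where m: "m = Some (Pi A B)" and b': "el b (A # \<Gamma>) (Some B) = Ok b' U" and t: "t = Lam A b'" "T = Pi A B" by (auto simp: control_Ok on_Some_Ok)
  have "\<Gamma> \<turnstile> Pi A B \<^bold>: Ty" using g m goal_okD by blast
  then have AB: "A # \<Gamma> \<turnstile> B \<^bold>: Ty" using Pi_inv by blast
  from el_check[OF b b' AB] lam[OF AB] show "result_ok \<Gamma> m t T" using g unfolding m t by (auto intro: check_ok)
qed

lemma head_Pi_Ok: "head_Pi \<Gamma> F k = Ok t T \<Longrightarrow> F = Ty \<or> \<Gamma> \<turnstile> F \<^bold>: Ty \<Longrightarrow> \<Gamma> \<turnstile> \<^bold>\<surd> \<Longrightarrow> \<exists>A B. conv_to \<Gamma> F (Pi A B) Ty \<and> k A B = Ok t T"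
proof (cases "\<exists>A B. F = Pi A B")
  case True
  then obtain A B where F: "F = Pi A B" by blast
  assume "head_Pi \<Gamma> F k = Ok t T" "F = Ty \<or> \<Gamma> \<turnstile> F \<^bold>: Ty"
  then have "k A B = Ok t T" "conv_to \<Gamma> F (Pi A B) Ty" using F by (auto intro: conv_to_refl)
  then show ?thesis by blast
next
  case False
  assume h: "head_Pi \<Gamma> F k = Ok t T" "\<Gamma> \<turnstile> \<^bold>\<surd>"
  have "head_Pi \<Gamma> F k = eval_ty ev \<Gamma> F (\<lambda>T. on_Pi T k)" using False by (cases F) auto
  then have "eval_ty ev \<Gamma> F (\<lambda>T. on_Pi T k) = Ok t T" using h(1) by simp
  from eval_ty_Ok[OF this sound_ev h(2)] show ?thesis unfolding control_Ok by blast
qed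

lemma el_sound_App: assumes f: "el_sound (el f)" and a: "el_sound (el a)" shows "el_sound (el (PApp f a))"
proof (rule el_soundI)
  fix \<Gamma> m t T assume c: "\<Gamma> \<turnstile> \<^bold>\<surd>" and g: "goal_ok \<Gamma> m" and h: "el (PApp f a) \<Gamma> m = Ok t T"
  then obtain f' F where f': "el f \<Gamma> None = Ok f' F" and k: "head_Pi \<Gamma> F (\<lambda>A B. norm_ty ev \<Gamma> A (\<lambda>A. bnd (el a \<Gamma> (Some A)) (\<lambda>a _.
     llet (sb 0 a B) (\<lambda>T. infer m \<Gamma> (App f' a) T)))) = Ok t T" unfolding el.simps control_Ok by blast
  have ft: "\<Gamma> \<turnstile> f' \<^bold>: F" "F = Ty \<or> \<Gamma> \<turnstile> F \<^bold>: Ty" using el_synth[OF f f' c] by auto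
  from head_Pi_Ok[OF k ft(2) c] obtain A B where F: "conv_to \<Gamma> F (Pi A B) Ty"
    and k: "norm_ty ev \<Gamma> A (\<lambda>A. bnd (el a \<Gamma> (Some A)) (\<lambda>a _. infer m \<Gamma> (App f' a) (sb 0 a B))) = Ok t T" unfolding llet_def by blast
  have AB: "\<Gamma> \<turnstile> A \<^bold>: Ty" "A # \<Gamma> \<turnstile> B \<^bold>: Ty" using Pi_inv[OF conv_toD(2)[OF F]] by auto
  have fP: "\<Gamma> \<turnstile> f' \<^bold>: Pi A B" using conv[OF ft(1) conv_toD(3)[OF F]] .
  from norm_ty_Ok[OF k sound_ev AB(1)] obtain A' a' U where A': "conv_to \<Gamma> A A' Ty" and a': "el a \<Gamma> (Some A') = Ok a' U"
    and k: "infer m \<Gamma> (App f' a') (B\<lbrakk>a'\<rbrakk>) = Ok t T" unfolding control_Ok inst_sb by blast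
  have "\<Gamma> \<turnstile> a' \<^bold>: A" using el_check[OF a a' conv_toD(2)[OF A']] conv_toD(3)[OF A'] by (auto intro: conv eq_sym)
  then show "result_ok \<Gamma> m t T" using infer_Ok[OF k app[OF fP] _ g] inst_Ty[OF AB(2)] by blast
qed

lemma el_sound_Pair: assumes a: "el_sound (el a)" and b: "el_sound (el b)" shows "el_sound (el (PPair a b))"
proof (rule el_soundI)
  fix \<Gamma> m t T assume c: "\<Gamma> \<turnstile> \<^bold>\<surd>" and g: "goal_ok \<Gamma> m" and h: "el (PPair a b) \<Gamma> m = Ok t T"
  then obtain A B a' U where m: "m = Some (Sig A B)" and a': "el a \<Gamma> (Some A) = Ok a' U" and k: "norm_ty ev \<Gamma> (B\<lbrakk>a'\<rbrakk>)
      (\<lambda>S. bnd (el b \<Gamma> (Some S)) (\<lambda>b _. Ok (Pair B a' b) (Sig A B))) = Ok t T" unfolding el.simps control_Ok on_Some_Ok inst_sb by blast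
  have "\<Gamma> \<turnstile> Sig A B \<^bold>: Ty" using g m goal_okD by blast
  then have AB: "\<Gamma> \<turnstile> A \<^bold>: Ty" "A # \<Gamma> \<turnstile> B \<^bold>: Ty" using Sig_inv by blast+
  have at: "\<Gamma> \<turnstile> a' \<^bold>: A" using el_check[OF a a' AB(1)] by simp
  from norm_ty_Ok[OF k sound_ev inst_Ty[OF AB(2) at]] obtain S b' U where S: "conv_to \<Gamma> (B\<lbrakk>a'\<rbrakk>) S Ty" and b': "el b \<Gamma> (Some S) = Ok b' U"
    and t: "t = Pair B a' b'" "T = Sig A B" by (auto simp: control_Ok)
  have "\<Gamma> \<turnstile> b' \<^bold>: B\<lbrakk>a'\<rbrakk>" using el_check[OF b b' conv_toD(2)[OF S]] conv_toD(3)[OF S] by (auto intro: conv eq_sym)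
  from pair[OF AB(2) at this] show "result_ok \<Gamma> m t T" using g unfolding m t by (auto intro: check_ok)
qed

lemma el_synth_norm:
  assumes "bnd (el p \<Gamma> None) (\<lambda>p T. norm_ty ev \<Gamma> T (k p)) = Ok t U" "el_sound (el p)" "\<Gamma> \<turnstile> \<^bold>\<surd>"
  shows "\<exists>p' T. k p' T = Ok t U \<and> (T = Ty \<or> \<Gamma> \<turnstile> T \<^bold>: Ty \<and> \<Gamma> \<turnstile> p' \<^bold>: T)"
proof -
  from assms(1) obtain p' T where p: "el p \<Gamma> None = Ok p' T" and n: "norm_ty ev \<Gamma> T (k p') = Ok t U" unfolding control_Ok by blast
  have pt: "\<Gamma> \<turnstile> p' \<^bold>: T" "T = Ty \<or> \<Gamma> \<turnstile> T \<^bold>: Ty" using el_synth[OF assms(2) p assms(3)] by auto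
  from norm_ty_Ok'[OF n pt(2)] obtain T' where "k p' T' = Ok t U" "T = Ty \<and> T' = Ty \<or> conv_to \<Gamma> T T' Ty" by blast
  then have "k p' T' = Ok t U" "T' = Ty \<or> \<Gamma> \<turnstile> T' \<^bold>: Ty \<and> \<Gamma> \<turnstile> p' \<^bold>: T'"
    using pt(1) by (auto intro: conv dest: conv_toD(2,3))
  then show ?thesis by blast
qed

lemma el_sound_proj: assumes p: "el_sound (el p)" shows "el_sound (el (PFst p))" "el_sound (el (PSnd p))"
proof -
  show "el_sound (el (PFst p))"
  proof (rule el_soundI)
    fix \<Gamma> m t T assume c: "\<Gamma> \<turnstile> \<^bold>\<surd>" and g: "goal_ok \<Gamma> m" and h: "el (PFst p) \<Gamma> m = Ok t T"
    from el_synth_norm[OF h[unfolded el.simps] p c] obtain p' A B where pt: "\<Gamma> \<turnstile> p' \<^bold>: Sig A B" "\<Gamma> \<turnstile> Sig A B \<^bold>: Ty"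
      and k: "infer m \<Gamma> (proj1 A p') A = Ok t T" by (auto simp: control_Ok)
    have AB: "\<Gamma> \<turnstile> A \<^bold>: Ty" "A # \<Gamma> \<turnstile> B \<^bold>: Ty" using Sig_inv[OF pt(2)] by auto
    show "result_ok \<Gamma> m t T" using infer_Ok[OF k proj1_typ[OF AB pt(1)] _ g] AB by blast
  qed
  show "el_sound (el (PSnd p))"
  proof (rule el_soundI)
    fix \<Gamma> m t T assume c: "\<Gamma> \<turnstile> \<^bold>\<surd>" and g: "goal_ok \<Gamma> m" and h: "el (PSnd p) \<Gamma> m = Ok t T"
    from el_synth_norm[OF h[unfolded el.simps] p c] obtain p' A B where pt: "\<Gamma> \<turnstile> p' \<^bold>: Sig A B" "\<Gamma> \<turnstile> Sig A B \<^bold>: Ty"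
      and k: "infer m \<Gamma> (proj2 A B p') (B\<lbrakk>proj1 A p'\<rbrakk>) = Ok t T" by (auto simp: control_Ok inst_sb)
    have AB: "\<Gamma> \<turnstile> A \<^bold>: Ty" "A # \<Gamma> \<turnstile> B \<^bold>: Ty" using Sig_inv[OF pt(2)] by auto
    show "result_ok \<Gamma> m t T" using infer_Ok[OF k proj2_typ[OF AB pt(1)] _ g] inst_Ty[OF AB(2) proj1_typ[OF AB pt(1)]] by blast
  qed
qed

lemma el_sound_Have: assumes p: "el_sound (el p)" and b: "el_sound (el b)" shows "el_sound (el (PHave p b))"
proof (rule el_soundI)
  fix \<Gamma> m t T assume c: "\<Gamma> \<turnstile> \<^bold>\<surd>" and g: "goal_ok \<Gamma> m" and h: "el (PHave p b) \<Gamma> m = Ok t T"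
  then obtain S where m: "m = Some S" and k: "bnd (el p \<Gamma> None) (\<lambda>p P. norm_ty ev \<Gamma> P (\<lambda>P. guard_not_Ty P (
     llet (wk 1 S) (\<lambda>T'. bnd (el b (P # \<Gamma>) (Some T')) (\<lambda>b _. Ok (App (Lam P b) p) S))))) = Ok t T" unfolding el.simps on_Some_Ok by blast
  have S: "\<Gamma> \<turnstile> S \<^bold>: Ty" using g m goal_okD by blast
  from el_synth_norm[OF k p c] obtain p' P b' U where P: "\<Gamma> \<turnstile> P \<^bold>: Ty" "\<Gamma> \<turnstile> p' \<^bold>: P" and b': "el b (P # \<Gamma>) (Some (wk 1 S)) = Ok b' U"
    and t: "t = App (Lam P b') p'" "T = S" by (auto simp: control_Ok)
  have ST: "P # \<Gamma> \<turnstile> wk 1 S \<^bold>: Ty" by (rule wk1_Ty[OF S P(1)])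
  have "\<Gamma> \<turnstile> App (Lam P b') p' \<^bold>: (wk 1 S)\<lbrakk>p'\<rbrakk>" using el_check[OF b b' ST] by (intro app[OF lam[OF ST] P(2)]) simp
  then show "result_ok \<Gamma> m t T" using g unfolding m t by (auto intro: check_ok simp: wk1_inst)
qed

lemma el_sound_Obt: assumes p: "el_sound (el p)" and d: "el_sound (el d)" shows "el_sound (el (PObt p d))"
proof (rule el_soundI)
  fix \<Gamma> m t T assume c: "\<Gamma> \<turnstile> \<^bold>\<surd>" and g: "goal_ok \<Gamma> m" and h: "el (PObt p d) \<Gamma> m = Ok t T"
  then obtain S where m: "m = Some S" and k: "bnd (el p \<Gamma> None) (\<lambda>p P. norm_ty ev \<Gamma> P (\<lambda>P. on_Sig P (\<lambda>A B.
     llet (wk 2 S) (\<lambda>T'. bnd (el d (B # A # \<Gamma>) (Some T')) (\<lambda>d _. llet (wk 1 S) (\<lambda>C. Ok (IndSig C d p) S)))))) = Ok t T" unfolding el.simps on_Some_Ok by blast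
  have S: "\<Gamma> \<turnstile> S \<^bold>: Ty" using g m goal_okD by blast
  from el_synth_norm[OF k p c] obtain p' A B d' U where P: "\<Gamma> \<turnstile> Sig A B \<^bold>: Ty" "\<Gamma> \<turnstile> p' \<^bold>: Sig A B" and d': "el d (B # A # \<Gamma>) (Some (wk 2 S)) = Ok d' U"
    and t: "t = IndSig (wk 1 S) d' p'" "T = S" by (auto simp: control_Ok)
  have AB: "B # A # \<Gamma> \<turnstile> \<^bold>\<surd>" using Sig_inv[OF P(1)] by (auto intro: ctx_cons)
  have "B # A # \<Gamma> \<turnstile> wk 2 S \<^bold>: Ty" using sub_Ty[OF wsub_shift2[OF AB] S] by (simp add: wk_sub)
  from el_check[OF d d' this] have "\<Gamma> \<turnstile> IndSig (wk 1 S) d' p' \<^bold>: (wk 1 S)\<lbrakk>p'\<rbrakk>"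
    by (intro sig_ind[OF wk1_Ty[OF S P(1)] _ P(2)]) (simp add: subst_at_wk1)
  then show "result_ok \<Gamma> m t T" using g unfolding m t by (auto intro: check_ok simp: wk1_inst)
qed

lemma el_sound_Ann: assumes p: "el_sound (el p)" and A: "el_sound (el A)" shows "el_sound (el (PAnn p A))"
proof (rule el_soundI)
  fix \<Gamma> m t T assume c: "\<Gamma> \<turnstile> \<^bold>\<surd>" and g: "goal_ok \<Gamma> m" and h: "el (PAnn p A) \<Gamma> m = Ok t T"
  from elab_ty_Ok[OF _ A c] h obtain A' where A': "\<Gamma> \<turnstile> A' \<^bold>: Ty" and k: "bnd (el p \<Gamma> (Some A')) (\<lambda>t _. infer m \<Gamma> t A') = Ok t T"
    unfolding el.simps by blast
  then obtain p' U where p': "el p \<Gamma> (Some A') = Ok p' U" and k: "infer m \<Gamma> p' A' = Ok t T" unfolding control_Ok by blast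
  show "result_ok \<Gamma> m t T" using infer_Ok[OF k _ _ g] el_check[OF p p' A'] A' by blast
qed

lemma el_sound_LamP: assumes d: "el_sound (el d)" shows "el_sound (el (PLamP d))"
proof (rule el_soundI)
  fix \<Gamma> m t T assume c: "\<Gamma> \<turnstile> \<^bold>\<surd>" and g: "goal_ok \<Gamma> m" and h: "el (PLamP d) \<Gamma> m = Ok t T"
  then obtain A B C where m: "m = Some (Pi (Sig A B) C)" and k: "norm_ty ev (B # A # \<Gamma>) (subst_at 2 C (gpair B)) (\<lambda>D.
     bnd (el d (B # A # \<Gamma>) (Some D)) (\<lambda>d _. Ok (Lam (Sig A B) (IndSig (wk1 1 C) (lf (Suc 0) (Suc (Suc 0)) d) (Var 0))) (Pi (Sig A B) C))) = Ok t T"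
    unfolding el.simps control_Ok on_Some_Ok llet_def by blast
  let ?S = "Sig A B"
  have P: "\<Gamma> \<turnstile> ?S \<^bold>: Ty" "?S # \<Gamma> \<turnstile> C \<^bold>: Ty" using Pi_inv goal_okD g m by blast+
  have AB: "\<Gamma> \<turnstile> A \<^bold>: Ty" "A # \<Gamma> \<turnstile> B \<^bold>: Ty" using Sig_inv[OF P(1)] by auto
  have "B # A # \<Gamma> \<turnstile> subst_at 2 C (gpair B) \<^bold>: Ty" using sub_Ty[OF wsub_gpair[OF AB] P(2)] by (simp add: subst_at_def)
  from norm_ty_Ok[OF k sound_ev this] obtain D d' U where D: "conv_to (B # A # \<Gamma>) (subst_at 2 C (gpair B)) D Ty"
    and d': "el d (B # A # \<Gamma>) (Some D) = Ok d' U" and t: "t = Lam ?S (IndSig (wk1 1 C) (lf (Suc 0) (Suc (Suc 0)) d') (Var 0))" "T = Pi ?S C"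
    by (auto simp: control_Ok)
  have dt: "B # A # \<Gamma> \<turnstile> d' \<^bold>: subst_at 2 C (gpair B)" using el_check[OF d d' conv_toD(2)[OF D]] conv_toD(3)[OF D] by (auto intro: conv eq_sym)
  have cS: "?S # \<Gamma> \<turnstile> \<^bold>\<surd>" by (rule ctx_cons[OF P(1)])
  \<comment> \<open>The eliminator stands below the new variable of type \<open>?S\<close>, so the
    motive is weakened under one binder and the case under two.\<close>
  let ?s = "\<lambda>n. Var (Suc n)"
  note w = wsub_shift1[OF cS]
  have wS: "wsub (Sig (wk 1 A) (wk1 1 B) # ?S # \<Gamma>) (up ?s) (?S # \<Gamma>)" using wsub_up[OF w P(1)] by (simp add: wk_sub up_shift)
  have wB: "wsub (wk1 1 B # wk 1 A # ?S # \<Gamma>) (up (up ?s)) (B # A # \<Gamma>)" using wsub_up[OF wsub_up[OF w AB(1)] AB(2)] by (simp add: wk_sub up_shift)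
  have C: "Sig (wk 1 A) (wk1 1 B) # ?S # \<Gamma> \<turnstile> wk1 1 C \<^bold>: Ty" using sub_Ty[OF wS P(2)] by (simp add: up_shift)
  have l: "lf (Suc 0) (Suc (Suc 0)) d' = sub d' (up (up ?s))"
    unfolding lf_def ren_as_sub by (rule arg_cong[where f = "sub d'"]) (auto simp: up_def split: nat.split)
  have pr: "sub (subst_at 2 C (gpair B)) (up (up ?s)) = subst_at 2 (wk1 1 C) (gpair (wk1 1 B))"
  proof -
    have "sub (wk1 2 B) (up (up (up ?s))) = wk1 2 (wk1 1 B)"
      unfolding wk1_def sub_ren ren_ren by (subst ren_as_sub, rule arg_cong[where f = "sub B"]) (auto simp: up_def split: nat.split)
    then have "sub (gpair B) (up (up ?s)) = gpair (wk1 1 B)" by (simp add: up_def)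
    then show ?thesis unfolding subst_at_def sub_sub wk1_def[of 1 C] sub_ren
      by (intro arg_cong[where f = "sub C"]) (auto simp: up_def split: nat.split)
  qed
  have "wk1 1 B # wk 1 A # ?S # \<Gamma> \<turnstile> lf (Suc 0) (Suc (Suc 0)) d' \<^bold>: subst_at 2 (wk1 1 C) (gpair (wk1 1 B))"
    using sub_typ'[OF wB dt] by (simp add: l pr)
  moreover have "?S # \<Gamma> \<turnstile> Var 0 \<^bold>: Sig (wk 1 A) (wk1 1 B)" using var0[OF cS] by (simp add: wk_sub up_shift)
  ultimately have "?S # \<Gamma> \<turnstile> IndSig (wk1 1 C) (lf (Suc 0) (Suc (Suc 0)) d') (Var 0) \<^bold>: (wk1 1 C)\<lbrakk>Var 0\<rbrakk>" by (rule sig_ind[OF C])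
  moreover have "(wk1 1 C)\<lbrakk>Var 0\<rbrakk> = C"
  proof -
    have "(wk1 1 C)\<lbrakk>Var 0\<rbrakk> = sub C Var" unfolding wk1_def inst_def sub_ren by (rule arg_cong[where f = "sub C"]) (auto split: nat.split)
    then show ?thesis by (simp add: sub_Var)
  qed
  ultimately show "result_ok \<Gamma> m t T" using g lam[OF P(2)] unfolding m t by (auto intro: check_ok)
qed

lemma el_sound_LamJ: assumes d: "el_sound (el d)" shows "el_sound (el (PLamJ d))"
proof (rule el_soundI)
  fix \<Gamma> m t T assume c: "\<Gamma> \<turnstile> \<^bold>\<surd>" and g: "goal_ok \<Gamma> m" and h: "el (PLamJ d) \<Gamma> m = Ok t T"
  then obtain S A B E C a1 a' A' where S: "m = Some S" "S = Pi A B" "B = Pi E C" "E = path_fam A (sb 0 Univ a1)" and a: "ev \<Gamma> (sb 0 Univ a1) = Ok a' A'" "A' = A"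
    and k: "norm_ty ev \<Gamma> (C\<lbrakk>sb 0 Univ a1, Refl (sb 0 Univ a1)\<rbrakk>) (\<lambda>D. bnd (el d \<Gamma> (Some D)) (\<lambda>d _.
     Ok (Lam A (Lam E (J (lf (Suc (Suc 0)) (Suc (Suc 0)) C) (wk 2 d) (Var 0)))) S)) = Ok t T"
    unfolding el.simps control_Ok on_Some_Ok llet_def by blast
  \<comment> \<open>The bound variable is the free end point and must not occur in the base point.
    As for function types, a dummy instance is taken, and the comparison of \<open>E\<close> with
    \<open>path_fam A a\<close> confirms it.\<close>
  define a where "a = sb 0 Univ a1"
  note m = S(1)[unfolded S(2-4), folded a_def] and a = a[folded a_def, unfolded \<open>A' = A\<close>] and k = k[unfolded S(2-4), folded a_def]
  let ?E = "path_fam A a" and ?s = "\<lambda>n. Var (Suc (Suc n))"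
  have P: "\<Gamma> \<turnstile> A \<^bold>: Ty" "A # \<Gamma> \<turnstile> Pi ?E C \<^bold>: Ty" using Pi_inv goal_okD g m by blast+
  have E: "A # \<Gamma> \<turnstile> ?E \<^bold>: Ty" "?E # A # \<Gamma> \<turnstile> C \<^bold>: Ty" using Pi_inv[OF P(2)] by auto
  have at: "\<Gamma> \<turnstile> a \<^bold>: A" using soundD[OF sound_ev a(1) c] by (auto dest: conv_toD)
  have "\<Gamma> \<turnstile> C\<lbrakk>a, Refl a\<rbrakk> \<^bold>: Ty" by (rule inst2_Ty[OF E(2) at]) (use refl[OF P(1) at] in \<open>simp add: path_fam_inst\<close>)
  from norm_ty_Ok[OF k sound_ev this] obtain D d' U where D: "conv_to \<Gamma> (C\<lbrakk>a, Refl a\<rbrakk>) D Ty" and d': "el d \<Gamma> (Some D) = Ok d' U"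
    and t: "t = Lam A (Lam ?E (J (lf (Suc (Suc 0)) (Suc (Suc 0)) C) (wk 2 d') (Var 0)))" "T = Pi A (Pi ?E C)" by (auto simp: control_Ok)
  have dt: "\<Gamma> \<turnstile> d' \<^bold>: C\<lbrakk>a, Refl a\<rbrakk>" using el_check[OF d d' conv_toD(2)[OF D]] conv_toD(3)[OF D] by (auto intro: conv eq_sym)
  let ?\<Delta> = "?E # A # \<Gamma>"
  have cE: "?\<Delta> \<turnstile> \<^bold>\<surd>" by (rule ctx_cons[OF E(1)])
  note w = wsub_shift2[OF cE]
  have l: "lf (Suc (Suc 0)) (Suc (Suc 0)) C = sub C (up (up ?s))"
    unfolding lf_def ren_as_sub by (rule arg_cong[where f = "sub C"]) (auto simp: up_def split: nat.split)
  have "sub ?E (up ?s) = path_fam (wk 2 A) (wk 2 a)"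
    unfolding wk_sub by (simp add: sub_sub up_def)
  then have "wsub (path_fam (wk 2 A) (wk 2 a) # wk 2 A # ?\<Delta>) (up (up ?s)) ?\<Delta>"
    using wsub_up[OF wsub_up[OF w P(1)] E(1)] by (simp add: wk_sub)
  from sub_Ty[OF this E(2)] have C: "path_fam (wk 2 A) (wk 2 a) # wk 2 A # ?\<Delta> \<turnstile> lf (Suc (Suc 0)) (Suc (Suc 0)) C \<^bold>: Ty" by (simp add: l)
  have i: "(lf (Suc (Suc 0)) (Suc (Suc 0)) C)\<lbrakk>x, y\<rbrakk> = sub C (y \<cdot> x \<cdot> ?s)" for x y
    unfolding l inst2_def sub_sub by (rule arg_cong[where f = "sub C"]) (auto simp: up_def split: nat.split)
  have "?\<Delta> \<turnstile> wk 2 a \<^bold>: wk 2 A" using sub_typ'[OF w at] by (simp add: wk_sub)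
  moreover have "?\<Delta> \<turnstile> wk 2 d' \<^bold>: (lf (Suc (Suc 0)) (Suc (Suc 0)) C)\<lbrakk>wk 2 a, Refl (wk 2 a)\<rbrakk>"
  proof -
    have "sub (C\<lbrakk>a, Refl a\<rbrakk>) ?s = sub C (Refl (wk 2 a) \<cdot> wk 2 a \<cdot> ?s)"
      unfolding inst2_def sub_sub by (rule arg_cong[where f = "sub C"]) (auto simp: wk_sub split: nat.split)
    then show ?thesis using sub_typ'[OF w dt] by (simp add: i wk_sub)
  qed
  moreover have "?\<Delta> \<turnstile> Var 0 \<^bold>: Eq (wk 2 A) (wk 2 a) (Var 1)" using var0[OF cE] by (simp add: wk_def ren_ren One_nat_def)
  ultimately have "?\<Delta> \<turnstile> J (lf (Suc (Suc 0)) (Suc (Suc 0)) C) (wk 2 d') (Var 0) \<^bold>: (lf (Suc (Suc 0)) (Suc (Suc 0)) C)\<lbrakk>Var 1, Var 0\<rbrakk>"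
    using id_ind C var1[OF cE] by blast
  moreover have "sub C (Var 0 \<cdot> Var 1 \<cdot> ?s) = C"
  proof -
    have "sub C (Var 0 \<cdot> Var 1 \<cdot> ?s) = sub C Var" by (rule arg_cong[where f = "sub C"]) (auto split: nat.split)
    then show ?thesis by (simp add: sub_Var)
  qed
  ultimately show "result_ok \<Gamma> m t T" using g lam[OF P(2) lam[OF E(2)]] unfolding m t i by (auto intro: check_ok)
qed

lemma el_sound_J: assumes C: "el_sound (el C)" and d: "el_sound (el d)" and p: "el_sound (el p)" shows "el_sound (el (PJ C d p))"
proof (rule el_soundI)
  fix \<Gamma> m t T assume c: "\<Gamma> \<turnstile> \<^bold>\<surd>" and g: "goal_ok \<Gamma> m" and h: "el (PJ C d p) \<Gamma> m = Ok t T"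
  from el_synth_norm[OF h[unfolded el.simps] p c] obtain p' A a b where pt: "\<Gamma> \<turnstile> p' \<^bold>: Eq A a b" "\<Gamma> \<turnstile> Eq A a b \<^bold>: Ty"
    and k: "elab_ty (el C) (path_fam A a # A # \<Gamma>) (\<lambda>C _. norm_ty ev \<Gamma> (C\<lbrakk>a, Refl a\<rbrakk>) (\<lambda>D. bnd (el d \<Gamma> (Some D)) (\<lambda>d _.
      infer m \<Gamma> (J C d p') (C\<lbrakk>b, p'\<rbrakk>)))) = Ok t T" by (auto simp: on_Eq_Ok llet_def)
  have A: "\<Gamma> \<turnstile> A \<^bold>: Ty" "\<Gamma> \<turnstile> a \<^bold>: A" "\<Gamma> \<turnstile> b \<^bold>: A" using Eq_inv[OF pt(2)] by auto
  from elab_ty_Ok[OF k C ctx_cons[OF path_fam_Ty[OF A(1,2)]]] obtain C' where C': "path_fam A a # A # \<Gamma> \<turnstile> C' \<^bold>: Ty"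
    and k: "norm_ty ev \<Gamma> (C'\<lbrakk>a, Refl a\<rbrakk>) (\<lambda>D. bnd (el d \<Gamma> (Some D)) (\<lambda>d _. infer m \<Gamma> (J C' d p') (C'\<lbrakk>b, p'\<rbrakk>))) = Ok t T" by blast
  have "\<Gamma> \<turnstile> C'\<lbrakk>a, Refl a\<rbrakk> \<^bold>: Ty" by (rule inst2_Ty[OF C' A(2)]) (use refl[OF A(1,2)] in \<open>simp add: path_fam_inst\<close>)
  from norm_ty_Ok[OF k sound_ev this] obtain D d' U where D: "conv_to \<Gamma> (C'\<lbrakk>a, Refl a\<rbrakk>) D Ty" and d': "el d \<Gamma> (Some D) = Ok d' U"
    and k: "infer m \<Gamma> (J C' d' p') (C'\<lbrakk>b, p'\<rbrakk>) = Ok t T" unfolding control_Ok by blast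
  have dt: "\<Gamma> \<turnstile> d' \<^bold>: C'\<lbrakk>a, Refl a\<rbrakk>" using el_check[OF d d' conv_toD(2)[OF D]] conv_toD(3)[OF D] by (auto intro: conv eq_sym)
  have "\<Gamma> \<turnstile> C'\<lbrakk>b, p'\<rbrakk> \<^bold>: Ty" by (rule inst2_Ty[OF C' A(3)]) (use pt in \<open>simp add: path_fam_inst\<close>)
  then show "result_ok \<Gamma> m t T" using infer_Ok[OF k id_ind[OF A(2) C' dt A(3) pt(1)] _ g] by blast
qed

lemma el_sound_FunExt: assumes f: "el_sound (el f)" and f': "el_sound (el f')" shows "el_sound (el (PFunExt f f'))"
proof (rule el_soundI)
  fix \<Gamma> m t T assume c: "\<Gamma> \<turnstile> \<^bold>\<surd>" and g: "goal_ok \<Gamma> m" and h: "el (PFunExt f f') \<Gamma> m = Ok t T"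
  from el_synth_norm[OF h[unfolded el.simps] f c] obtain f1 A B f2 U where F: "\<Gamma> \<turnstile> f1 \<^bold>: Pi A B" "\<Gamma> \<turnstile> Pi A B \<^bold>: Ty" and f2: "el f' \<Gamma> (Some (Pi A B)) = Ok f2 U"
    and k: "eval_ty ev \<Gamma> (is_equiv (Eq (Pi A B) f1 f2) (htpy A B f1 f2) (happly A B f1 f2)) (\<lambda>T. infer m \<Gamma> (FunExt f1 f2) T) = Ok t T"
    by (auto simp: control_Ok)
  from eval_ty_Ok[OF k sound_ev c] obtain T' where T': "conv_to \<Gamma> (is_equiv (Eq (Pi A B) f1 f2) (htpy A B f1 f2) (happly A B f1 f2)) T' Ty"
    and k: "infer m \<Gamma> (FunExt f1 f2) T' = Ok t T" by blast
  have "\<Gamma> \<turnstile> FunExt f1 f2 \<^bold>: T'" using el_check[OF f' f2 F(2)] by (intro conv[OF funext[OF F(1)] conv_toD(3)[OF T']]) simp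
  then show "result_ok \<Gamma> m t T" using infer_Ok[OF k _ _ g] conv_toD(2)[OF T'] by blast
qed

lemma el_sound_Ua: assumes A: "el_sound (el A)" and B: "el_sound (el B)" shows "el_sound (el (PUa A B))"
proof (rule el_soundI)
  fix \<Gamma> m t T assume c: "\<Gamma> \<turnstile> \<^bold>\<surd>" and g: "goal_ok \<Gamma> m" and h: "el (PUa A B) \<Gamma> m = Ok t T"
  then obtain A' B' U V where A': "el A \<Gamma> (Some Univ) = Ok A' U" and B': "el B \<Gamma> (Some Univ) = Ok B' V"
    and k: "eval_ty ev \<Gamma> (is_equiv (Eq Univ A' B') (Equiv A' B') (id_to_equiv A' B')) (\<lambda>T. infer m \<Gamma> (Ua A' B') T) = Ok t T"
    unfolding el.simps control_Ok by blast
  from eval_ty_Ok[OF k sound_ev c] obtain T' where T': "conv_to \<Gamma> (is_equiv (Eq Univ A' B') (Equiv A' B') (id_to_equiv A' B')) T' Ty"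
    and k: "infer m \<Gamma> (Ua A' B') T' = Ok t T" by blast
  have U: "\<Gamma> \<turnstile> Univ \<^bold>: Ty" by (rule univ_form[OF c])
  have "\<Gamma> \<turnstile> Ua A' B' \<^bold>: T'" using el_check[OF A A' U] el_check[OF B B' U] by (intro conv[OF univalence conv_toD(3)[OF T']]) auto
  then show "result_ok \<Gamma> m t T" using infer_Ok[OF k _ _ g] conv_toD(2)[OF T'] by blast
qed

lemma elab_Push_Ok:
  assumes h: "elab_ty (el Y) \<Gamma> (\<lambda>Y _. on_Push Y (\<lambda>f g. check_push ev \<Gamma> f g (k Y f g))) = Ok t T" and Y: "el_sound (el Y)" and c: "\<Gamma> \<turnstile> \<^bold>\<surd>"
  shows "\<exists>f g A B C. is_span \<Gamma> A B C f g \<and> k (Push f g) f g A B C = Ok t T"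
proof -
  from elab_ty_Ok[OF h Y c] obtain f g where "check_push ev \<Gamma> f g (k (Push f g) f g) = Ok t T" unfolding control_Ok by blast
  from check_push_Ok[OF this sound_ev c] show ?thesis by blast
qed

lemma el_sound_points: assumes Y: "el_sound (el Y)" and a: "el_sound (el a)"
  shows "el_sound (el (PInl Y a))" "el_sound (el (PInr Y a))" "el_sound (el (PGlue Y a))"
proof -
  show "el_sound (el (PInl Y a))"
  proof (rule el_soundI)
    fix \<Gamma> m t T assume c: "\<Gamma> \<turnstile> \<^bold>\<surd>" and g: "goal_ok \<Gamma> m" and h: "el (PInl Y a) \<Gamma> m = Ok t T"
    from elab_Push_Ok[OF h[unfolded el.simps] Y c] obtain f f' A B C a' U where s: "is_span \<Gamma> A B C f f'" and a': "el a \<Gamma> (Some A) = Ok a' U"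
      and k: "infer m \<Gamma> (PushL f f' a') (Push f f') = Ok t T" unfolding control_Ok by blast
    have "\<Gamma> \<turnstile> a' \<^bold>: A" using el_check[OF a a' small[OF spanD(1)[OF s]]] by simp
    then show "result_ok \<Gamma> m t T" using infer_Ok[OF k span_points(1)[OF s] _ g] spanD(7)[OF s] by blast
  qed
  show "el_sound (el (PInr Y a))"
  proof (rule el_soundI)
    fix \<Gamma> m t T assume c: "\<Gamma> \<turnstile> \<^bold>\<surd>" and g: "goal_ok \<Gamma> m" and h: "el (PInr Y a) \<Gamma> m = Ok t T"
    from elab_Push_Ok[OF h[unfolded el.simps] Y c] obtain f f' A B C a' U where s: "is_span \<Gamma> A B C f f'" and a': "el a \<Gamma> (Some B) = Ok a' U"
      and k: "infer m \<Gamma> (PushR f f' a') (Push f f') = Ok t T" unfolding control_Ok by blast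
    have "\<Gamma> \<turnstile> a' \<^bold>: B" using el_check[OF a a' small[OF spanD(2)[OF s]]] by simp
    then show "result_ok \<Gamma> m t T" using infer_Ok[OF k span_points(2)[OF s] _ g] spanD(7)[OF s] by blast
  qed
  show "el_sound (el (PGlue Y a))"
  proof (rule el_soundI)
    fix \<Gamma> m t T assume c: "\<Gamma> \<turnstile> \<^bold>\<surd>" and g: "goal_ok \<Gamma> m" and h: "el (PGlue Y a) \<Gamma> m = Ok t T"
    from elab_Push_Ok[OF h[unfolded el.simps] Y c] obtain f f' A B C a' U where s: "is_span \<Gamma> A B C f f'" and a': "el a \<Gamma> (Some C) = Ok a' U"
      and k: "eval_ty ev \<Gamma> (glue_type f f' a') (\<lambda>T. infer m \<Gamma> (Glue f f' a') T) = Ok t T" unfolding control_Ok by blast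
    have at: "\<Gamma> \<turnstile> a' \<^bold>: C" using el_check[OF a a' small[OF spanD(3)[OF s]]] by simp
    from eval_ty_Ok[OF k sound_ev c] obtain T' where T': "conv_to \<Gamma> (glue_type f f' a') T' Ty" and k: "infer m \<Gamma> (Glue f f' a') T' = Ok t T" by blast
    show "result_ok \<Gamma> m t T" using infer_Ok[OF k conv[OF span_points(3)[OF s at] conv_toD(3)[OF T']] _ g] conv_toD(2)[OF T'] by blast
  qed
qed

text \<open>The eliminator and its computation path take the same motive and cases, so these are
  checked once for both.\<close>

lemma el_push_cases:
  assumes s: "is_span \<Gamma> A B C f f'" and c: "\<Gamma> \<turnstile> \<^bold>\<surd>" and D: "el_sound (el D)" and l: "el_sound (el l)" and r: "el_sound (el r)" and q: "el_sound (el q)"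
    and h: "elab_ty (el D) (Push f f' # \<Gamma>) (\<lambda>D _.
     llet (onL f f' D) (\<lambda>L. norm_ty ev (A # \<Gamma>) L (\<lambda>L. bnd (el l (A # \<Gamma>) (Some L)) (\<lambda>l _.
     llet (onR f f' D) (\<lambda>R. norm_ty ev (B # \<Gamma>) R (\<lambda>R. bnd (el r (B # \<Gamma>) (Some R)) (\<lambda>r _.
     llet (glue_over f f' D l r) (\<lambda>Q. eval_ty ev (C # \<Gamma>) Q (\<lambda>Q. bnd (el q (C # \<Gamma>) (Some Q)) (\<lambda>q _. k D l r q)))))))))) = Ok t T"
  shows "\<exists>D l r q. Push f f' # \<Gamma> \<turnstile> D \<^bold>: Ty \<and> A # \<Gamma> \<turnstile> l \<^bold>: onL f f' D \<and> B # \<Gamma> \<turnstile> r \<^bold>: onR f f' D \<and> C # \<Gamma> \<turnstile> q \<^bold>: glue_over f f' D l r \<and> k D l r q = Ok t T"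
proof -
  from elab_ty_Ok[OF h D spanD(8)[OF s]] obtain D' where D': "Push f f' # \<Gamma> \<turnstile> D' \<^bold>: Ty" and k: "norm_ty ev (A # \<Gamma>) (onL f f' D') (\<lambda>L. bnd (el l (A # \<Gamma>) (Some L)) (\<lambda>l _.
     llet (onR f f' D') (\<lambda>R. norm_ty ev (B # \<Gamma>) R (\<lambda>R. bnd (el r (B # \<Gamma>) (Some R)) (\<lambda>r _.
     llet (glue_over f f' D' l r) (\<lambda>Q. eval_ty ev (C # \<Gamma>) Q (\<lambda>Q. bnd (el q (C # \<Gamma>) (Some Q)) (\<lambda>q _. k D' l r q)))))))) = Ok t T"
    unfolding llet_def by blast
  have DD: "conv_to (Push f f' # \<Gamma>) D' D' Ty" using D' by (auto intro: conv_to_refl)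
  from norm_ty_Ok[OF k sound_ev conv_toD(1)[OF onL_conv[OF s DD]]] obtain L l' U where L: "conv_to (A # \<Gamma>) (onL f f' D') L Ty" and l': "el l (A # \<Gamma>) (Some L) = Ok l' U"
    and k: "norm_ty ev (B # \<Gamma>) (onR f f' D') (\<lambda>R. bnd (el r (B # \<Gamma>) (Some R)) (\<lambda>r _.
     llet (glue_over f f' D' l' r) (\<lambda>Q. eval_ty ev (C # \<Gamma>) Q (\<lambda>Q. bnd (el q (C # \<Gamma>) (Some Q)) (\<lambda>q _. k D' l' r q))))) = Ok t T"
    unfolding control_Ok by blast
  have lt: "A # \<Gamma> \<turnstile> l' \<^bold>: onL f f' D'" using el_check[OF l l' conv_toD(2)[OF L]] conv_toD(3)[OF L] by (auto intro: conv eq_sym)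
  from norm_ty_Ok[OF k sound_ev conv_toD(1)[OF onR_conv[OF s DD]]] obtain R r' U where R: "conv_to (B # \<Gamma>) (onR f f' D') R Ty" and r': "el r (B # \<Gamma>) (Some R) = Ok r' U"
    and k: "eval_ty ev (C # \<Gamma>) (glue_over f f' D' l' r') (\<lambda>Q. bnd (el q (C # \<Gamma>) (Some Q)) (\<lambda>q _. k D' l' r' q)) = Ok t T"
    unfolding control_Ok by blast
  have rt: "B # \<Gamma> \<turnstile> r' \<^bold>: onR f f' D'" using el_check[OF r r' conv_toD(2)[OF R]] conv_toD(3)[OF R] by (auto intro: conv eq_sym)
  from eval_ty_Ok[OF k sound_ev spanD(11)[OF s]] obtain Q q' U where Q: "conv_to (C # \<Gamma>) (glue_over f f' D' l' r') Q Ty" and q': "el q (C # \<Gamma>) (Some Q) = Ok q' U"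
    and k: "k D' l' r' q' = Ok t T" unfolding control_Ok by blast
  have "C # \<Gamma> \<turnstile> q' \<^bold>: glue_over f f' D' l' r'" using el_check[OF q q' conv_toD(2)[OF Q]] conv_toD(3)[OF Q] by (auto intro: conv eq_sym)
  then show ?thesis using D' lt rt k by blast
qed

lemma el_sound_IndPush: assumes D: "el_sound (el D)" and l: "el_sound (el l)" and r: "el_sound (el r)" and q: "el_sound (el q)" and u: "el_sound (el u)"
  shows "el_sound (el (PIndPush D l r q u))"
proof (rule el_soundI)
  fix \<Gamma> m t T assume c: "\<Gamma> \<turnstile> \<^bold>\<surd>" and g: "goal_ok \<Gamma> m" and h: "el (PIndPush D l r q u) \<Gamma> m = Ok t T"
  note K = el_synth_norm[OF h[unfolded el.simps] u c, unfolded on_Push_Ok]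
  then obtain u' f f' where ut: "\<Gamma> \<turnstile> u' \<^bold>: Push f f'" and cp: "check_push ev \<Gamma> f f' (\<lambda>A B C.
     elab_ty (el D) (Push f f' # \<Gamma>) (\<lambda>D _.
     llet (onL f f' D) (\<lambda>L. norm_ty ev (A # \<Gamma>) L (\<lambda>L. bnd (el l (A # \<Gamma>) (Some L)) (\<lambda>l _.
     llet (onR f f' D) (\<lambda>R. norm_ty ev (B # \<Gamma>) R (\<lambda>R. bnd (el r (B # \<Gamma>) (Some R)) (\<lambda>r _.
     llet (glue_over f f' D l r) (\<lambda>Q. eval_ty ev (C # \<Gamma>) Q (\<lambda>Q. bnd (el q (C # \<Gamma>) (Some Q)) (\<lambda>q _.
     llet (sb 0 u' D) (\<lambda>T. infer m \<Gamma> (IndPush D l r q u') T)))))))))))) = Ok t T"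
    by blast
  from check_push_Ok[OF cp sound_ev c] obtain A B C where s: "is_span \<Gamma> A B C f f'" and k: "elab_ty (el D) (Push f f' # \<Gamma>) (\<lambda>D _.
     llet (onL f f' D) (\<lambda>L. norm_ty ev (A # \<Gamma>) L (\<lambda>L. bnd (el l (A # \<Gamma>) (Some L)) (\<lambda>l _.
     llet (onR f f' D) (\<lambda>R. norm_ty ev (B # \<Gamma>) R (\<lambda>R. bnd (el r (B # \<Gamma>) (Some R)) (\<lambda>r _.
     llet (glue_over f f' D l r) (\<lambda>Q. eval_ty ev (C # \<Gamma>) Q (\<lambda>Q. bnd (el q (C # \<Gamma>) (Some Q)) (\<lambda>q _.
     llet (sb 0 u' D) (\<lambda>T. infer m \<Gamma> (IndPush D l r q u') T))))))))))) = Ok t T" by blast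
  from el_push_cases[OF s c D l r q k] obtain D l r q where K: "Push f f' # \<Gamma> \<turnstile> D \<^bold>: Ty" "A # \<Gamma> \<turnstile> l \<^bold>: onL f f' D" "B # \<Gamma> \<turnstile> r \<^bold>: onR f f' D"
    "C # \<Gamma> \<turnstile> q \<^bold>: glue_over f f' D l r" and k: "infer m \<Gamma> (IndPush D l r q u') (D\<lbrakk>u'\<rbrakk>) = Ok t T" unfolding llet_def inst_sb by blast
  show "result_ok \<Gamma> m t T" using infer_Ok[OF k push_ind[OF spanD(1-5)[OF s] K ut] _ g] inst_Ty[OF K(1) ut] by blast
qed

lemma el_sound_PushBeta: assumes D: "el_sound (el D)" and l: "el_sound (el l)" and r: "el_sound (el r)" and q: "el_sound (el q)" and u: "el_sound (el u)" and Y: "el_sound (el Y)"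
  shows "el_sound (el (PPushBeta D l r q u Y))"
proof (rule el_soundI)
  fix \<Gamma> m t T assume c: "\<Gamma> \<turnstile> \<^bold>\<surd>" and g: "goal_ok \<Gamma> m" and h: "el (PPushBeta D l r q u Y) \<Gamma> m = Ok t T"
  from elab_Push_Ok[OF h[unfolded el.simps] Y c] obtain f f' A B C where s: "is_span \<Gamma> A B C f f'" and k: "elab_ty (el D) (Push f f' # \<Gamma>) (\<lambda>D _.
     llet (onL f f' D) (\<lambda>L. norm_ty ev (A # \<Gamma>) L (\<lambda>L. bnd (el l (A # \<Gamma>) (Some L)) (\<lambda>l _.
     llet (onR f f' D) (\<lambda>R. norm_ty ev (B # \<Gamma>) R (\<lambda>R. bnd (el r (B # \<Gamma>) (Some R)) (\<lambda>r _.
     llet (glue_over f f' D l r) (\<lambda>Q. eval_ty ev (C # \<Gamma>) Q (\<lambda>Q. bnd (el q (C # \<Gamma>) (Some Q)) (\<lambda>q _.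
     bnd (el u \<Gamma> (Some C)) (\<lambda>u _.
     llet (push_beta_type f f' D l r q u) (\<lambda>T. eval_ty ev \<Gamma> T (\<lambda>T. infer m \<Gamma> (PushBeta f f' D l r q u) T))))))))))))) = Ok t T" by blast
  from el_push_cases[OF s c D l r q k] obtain D l r q u' U where K: "Push f f' # \<Gamma> \<turnstile> D \<^bold>: Ty" "A # \<Gamma> \<turnstile> l \<^bold>: onL f f' D" "B # \<Gamma> \<turnstile> r \<^bold>: onR f f' D"
    "C # \<Gamma> \<turnstile> q \<^bold>: glue_over f f' D l r" and u': "el u \<Gamma> (Some C) = Ok u' U"
    and k: "eval_ty ev \<Gamma> (push_beta_type f f' D l r q u') (\<lambda>T. infer m \<Gamma> (PushBeta f f' D l r q u') T) = Ok t T" unfolding control_Ok by blast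
  have ut: "\<Gamma> \<turnstile> u' \<^bold>: C" using el_check[OF u u' small[OF spanD(3)[OF s]]] by simp
  from eval_ty_Ok[OF k sound_ev c] obtain T' where T': "conv_to \<Gamma> (push_beta_type f f' D l r q u') T' Ty" and k: "infer m \<Gamma> (PushBeta f f' D l r q u') T' = Ok t T" by blast
  show "result_ok \<Gamma> m t T" using infer_Ok[OF k conv[OF push_beta_glue[OF spanD(1-5)[OF s] K ut] conv_toD(3)[OF T']] _ g] conv_toD(2)[OF T'] by blast
qed

theorem el_sound: "el_sound (el p)"
  by (induction p) (blast intro: el_sound_leaf el_sound_types el_sound_Lam el_sound_App el_sound_Pair el_sound_proj el_sound_Have el_sound_Obt el_sound_Ann
    el_sound_LamP el_sound_LamJ el_sound_J el_sound_FunExt el_sound_Ua el_sound_points el_sound_IndPush el_sound_PushBeta)+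

section \<open>Running the checker by rewriting\<close>

declare One_nat_def [simp] Suc_eq_plus1 [symmetric, simp del] scons_1 [simp del]

text \<open>Continuations of several arguments are wrapped in \<open>Clo\<close>, because the simplifier would otherwise evaluate below the inner abstractions; the congruence rules \<open>frozen_congs\<close> keep it from evaluating the arguments of the control operators.\<close>

datatype 'a clo = Clo "tm \<Rightarrow> 'a"

primrec ap :: "'a clo \<Rightarrow> tm \<Rightarrow> 'a" where "ap (Clo f) x = f x"

definition "bndK r k = bnd r (\<lambda>t. ap (k t))"
definition "on_PiK F k = on_Pi F (\<lambda>A. ap (k A))"
definition "on_SigK F k = on_Sig F (\<lambda>A. ap (k A))"
definition "on_PushK F k = on_Push F (\<lambda>A. ap (k A))"
definition "on_EqK F k = on_Eq F (\<lambda>A a. ap (ap (k A) a))"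
definition "if_PairK t k r = if_Pair t (\<lambda>a. ap (k a)) r"
definition "check_pushK e \<Gamma> f g k = check_push e \<Gamma> f g (\<lambda>A B. ap (ap (k A) B))"
definition "elab_tyK p \<Gamma> k = elab_ty p \<Gamma> (\<lambda>A. ap (k A))"
definition "head_PiK \<Gamma> F k = head_Pi \<Gamma> F (\<lambda>A. ap (k A))"

lemmas K_defs = bndK_def on_PiK_def on_SigK_def on_PushK_def on_EqK_def if_PairK_def check_pushK_def elab_tyK_def head_PiK_def

lemma K_intros:
  "bnd r k = bndK r (\<lambda>t. Clo (k t))" "on_Pi F k = on_PiK F (\<lambda>A. Clo (k A))" "on_Sig F k = on_SigK F (\<lambda>A. Clo (k A))"
  "on_Push F k = on_PushK F (\<lambda>A. Clo (k A))" "on_Eq F k3 = on_EqK F (\<lambda>A. Clo (\<lambda>a. Clo (k3 A a)))"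
  "if_Pair t k r = if_PairK t (\<lambda>a. Clo (k a)) r" "check_push e \<Gamma> f g k3 = check_pushK e \<Gamma> f g (\<lambda>A. Clo (\<lambda>B. Clo (k3 A B)))"
  "elab_ty p \<Gamma> k = elab_tyK p \<Gamma> (\<lambda>A. Clo (k A))" "head_Pi \<Gamma> F k = head_PiK \<Gamma> F (\<lambda>A. Clo (k A))"
  by (simp_all add: K_defs ap.simps[abs_def])

definition add :: "nat \<Rightarrow> nat \<Rightarrow> nat" where "add n k = n + k"
definition tst :: "nat \<Rightarrow> nat \<Rightarrow> nat \<Rightarrow> nat \<Rightarrow> nat" where "tst c n x y = (if n < c then x else y)"

text \<open>Indices stay in unary constructor form. Adding removes up to six successors per step,
  because lifts into the growing library are long.\<close>

lemma index_eval:
  "shf k c n = tst c n n (add n k)"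
  "tst 0 n x y = y" "tst (Suc c) 0 x y = x" "tst (Suc c) (Suc n) x y = tst c n x y"
  "add n 0 = n" "add n (Suc 0) = Suc n" "add n (Suc (Suc 0)) = Suc (Suc n)" "add n (Suc (Suc (Suc 0))) = Suc (Suc (Suc n))"
  "add n (Suc (Suc (Suc (Suc 0)))) = Suc (Suc (Suc (Suc n)))" "add n (Suc (Suc (Suc (Suc (Suc 0))))) = Suc (Suc (Suc (Suc (Suc n))))"
  "add n (Suc (Suc (Suc (Suc (Suc (Suc k)))))) = add (Suc (Suc (Suc (Suc (Suc (Suc n)))))) k"
  by (simp_all add: shf_def tst_def add_def)

lemma look_eval:
  "look (A0 # \<Gamma>) 0 k = k A0"
  "look (A0 # A1 # \<Gamma>) (Suc 0) k = k A1"
  "look (A0 # A1 # A2 # \<Gamma>) (Suc (Suc 0)) k = k A2"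
  "look (A0 # A1 # A2 # A3 # \<Gamma>) (Suc (Suc (Suc 0))) k = k A3"
  "look (A0 # A1 # A2 # A3 # A4 # \<Gamma>) (Suc (Suc (Suc (Suc 0)))) k = k A4"
  "look (A0 # A1 # A2 # A3 # A4 # A5 # \<Gamma>) (Suc (Suc (Suc (Suc (Suc 0))))) k = k A5"
  "look (A0 # A1 # A2 # A3 # A4 # A5 # \<Gamma>) (Suc (Suc (Suc (Suc (Suc (Suc i)))))) k = look \<Gamma> i k"
  by simp_all

lemma frozen_congs:
  "Suc n = Suc n"
  "Clo f0 = Clo f0"
  "guard_eq a b r = guard_eq a b r" "guard_sort a r = guard_sort a r" "guard_not_Ty a r = guard_not_Ty a r"
  "on_PiK F k' = on_PiK F k'" "on_SigK F k' = on_SigK F k'" "on_EqK F k3 = on_EqK F k3" "on_PushK F k' = on_PushK F k'"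
  "if_Lam t k1 r = if_Lam t k1 r" "if_PairK t k' r = if_PairK t k' r" "if_Refl t r r' = if_Refl t r r'" "if_Push t k1 k2 r = if_Push t k1 k2 r"
 
  "look \<Gamma> i k1 = look \<Gamma> i k1" "eval_ty e \<Gamma> t k1 = eval_ty e \<Gamma> t k1" "norm_ty e \<Gamma> t k1 = norm_ty e \<Gamma> t k1" "eval_nf e \<Gamma> t k1 = eval_nf e \<Gamma> t k1" "norm_tm e \<Gamma> A t k1 = norm_tm e \<Gamma> A t k1" "if_proj t r r1 r2 = if_proj t r r1 r2"
  "check_pushK e \<Gamma> f g k3 = check_pushK e \<Gamma> f g k3" "step e \<Gamma> t = step e \<Gamma> t" "eval n \<Gamma> t = eval n \<Gamma> t" "ev \<Gamma> t = ev \<Gamma> t"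
  "infer m \<Gamma> t T = infer m \<Gamma> t T" "on_Some m k1 = on_Some m k1" "elab_tyK p \<Gamma> k' = elab_tyK p \<Gamma> k'"
  "head_PiK \<Gamma> t k' = head_PiK \<Gamma> t k'" "el p0 \<Gamma> m = el p0 \<Gamma> m" "Ok t T = Ok t T"
  by (rule HOL.refl)+

text \<open>These name the position of each control operator that is evaluated first; the
  continuations and branches wait until it is a value.\<close>

lemma eval_congs:
  "r = r' \<Longrightarrow> bndK r k = bndK r' k"
  "x = x' \<Longrightarrow> llet x k1 = llet x' k1"
  "b = b' \<Longrightarrow> if' b r1 r2 = if' b' r1 r2"
  "c1 = c2 \<Longrightarrow> ap c1 t = ap c2 t"
  by simp_all

lemma control_simps:
  "bndK (Ok t T) k = ap (k t) T" "llet x k1 = k1 x" "guard_eq a a r = r" "guard_sort Univ r = r" "guard_sort Ty r = r"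
  "if' True r1 r2 = r1" "if' False r1 r2 = r2" "conj' True b0 = b0" "conj' False b0 = False" "ap (Clo f) t = f t"
  "is_Ok (Ok t T)" "sbe k' a t = sb k' a t"
  "on_PiK (Pi A B) k = ap (k A) B" "on_SigK (Sig A B) k = ap (k A) B" "on_PushK (Push A B) k = ap (k A) B"
  "on_EqK (Eq A a b) k3 = ap (ap (k3 A) a) b"
  by (simp_all add: bnd_def llet_def guard_eq_def guard_sort_def if'_def conj'_def is_Ok_def sbe_def K_defs)

lemma infer_simps:
  "infer None \<Gamma> t T = Ok t T"
  "infer (Some T') \<Gamma> t T = norm_ty ev \<Gamma> T (\<lambda>T. guard_eq T T' (Ok t T'))"
  "on_Some (Some T) k = k T"
  by (simp_all add: infer_def on_Some_def)

lemma eval_Suc: "eval (Suc n) \<Gamma> t = step (eval n) \<Gamma> t"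
  by simp

lemma ev_eval: "ev \<Gamma> t = eval (Suc (Suc (Suc (Suc (Suc (Suc (Suc (Suc (Suc (Suc (Suc (Suc (Suc (Suc (Suc (Suc (Suc (Suc (Suc (Suc (Suc (Suc (Suc (Suc (Suc
   (Suc (Suc (Suc (Suc (Suc (Suc (Suc (Suc (Suc (Suc (Suc (Suc (Suc (Suc (Suc (Suc (Suc (Suc (Suc (Suc (Suc (Suc (Suc (Suc (Suc 0)))))))))))))))))))))))))))))))))))))))))))))))))) \<Gamma> t"
  unfolding ev_def by (rule arg_cong[where f = "\<lambda>n. eval n \<Gamma> t"]) simp

lemma subst_eval: "wk k t = lf k 0 t" "wk1 k t = lf k (Suc 0) t" "t\<lbrakk>a\<rbrakk> = sbe 0 a t"
  "subst_at k t a = sbe 0 a (lf k (Suc 0) t)" "t\<lbrakk>a, b\<rbrakk> = sbe 0 a (sbe 0 (lf (Suc 0) 0 b) t)"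
  by (simp_all add: wk_lf wk1_lf inst_sb subst_at_sb inst2_sb sbe_def)

lemma nat_eval: "Suc n - 1 = n" "Suc n - Suc 0 = n" "(2::nat) = Suc (Suc 0)" "(3::nat) = Suc (Suc (Suc 0))" "(1::nat) = Suc 0"
  by simp_all

lemmas el_eqs = el.simps[THEN fun_cong, THEN fun_cong, unfolded K_intros]
lemmas step_eqs = step.simps[unfolded K_intros]
lemmas eval_ty_eq = eval_ty_def[unfolded K_intros]
lemmas norm_tm_eq = norm_tm_def[unfolded K_intros]
lemmas check_push_eq = check_pushK_def[unfolded check_push_def K_intros]
lemmas elab_ty_eq = elab_tyK_def[unfolded elab_ty_def K_intros]
lemma head_Pi_eqs: "head_PiK \<Gamma> (Pi A B) k = ap (k A) B"
  "head_PiK \<Gamma> (App f a) k = eval_ty ev \<Gamma> (App f a) (\<lambda>T. on_PiK T k)"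
  "head_PiK \<Gamma> (IndSig C d p) k = eval_ty ev \<Gamma> (IndSig C d p) (\<lambda>T. on_PiK T k)"
  "head_PiK \<Gamma> (J C d p) k = eval_ty ev \<Gamma> (J C d p) (\<lambda>T. on_PiK T k)"
  "head_PiK \<Gamma> (IndPush D l r q t) k = eval_ty ev \<Gamma> (IndPush D l r q t) (\<lambda>T. on_PiK T k)"
  by (simp_all add: head_PiK_def on_PiK_def)
lemma if_Pair_eqs: "if_PairK (Pair B a b) k r = ap (k a) b" "if_PairK (Var i) k r = r" "if_PairK (App f a) k r = r"
  "if_PairK (IndSig C d p) k r = r" "if_PairK (J C d p) k r = r" "if_PairK (IndPush D l r' q t) k r = r"
  by (simp_all add: if_PairK_def)

lemmas check_simps = index_eval lf_simps vcase_simps lfz_simps sb_simps control_simps infer_simps el_eqs eval_Suc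
  ev_eval subst_eval nat_eval guard_not_Ty.simps max_sort.simps
  if_Lam.simps if_Refl.simps if_Push.simps no_Lam.simps no_Pair.simps no_Refl.simps no_Push.simps is_nf.simps look_eval
  eval_ty_eq eval_nf_def norm_tm_eq norm_ty.simps if_proj.simps check_push_eq step_eqs elab_ty_eq head_Pi_eqs if_Pair_eqs
  Arr_def Prod_def idfun_def proj1_def proj2_def concat_path_def transport_def apd_def transport_const_def sec_htpy_def ret_htpy_def
  is_equiv_def Equiv_def id_equiv_def htpy_def happly_def id_to_equiv_def glue_over_at_def glue_over_def push_beta_type_def
  push_map_def Let_def join_type_def pb_eq_def pb_fam_def pullback_def pb_snd_def pb_proj1_def pb_proj2_def pb_htpy_def join_over_def join_map_def

section \<open>Source syntax\<close>

text \<open>Terms with higher-order binders: a term maps the number of variables in scope to a preterm, so a variable is given by its level.\<close>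

type_synonym src = "nat \<Rightarrow> pre"

definition v :: "nat \<Rightarrow> src" where "v l n = PVar (n - Suc l)"
definition univ :: src where "univ n = PTm Univ"
definition refl :: src where "refl n = PRefl"
definition app :: "src \<Rightarrow> src \<Rightarrow> src" (infixl \<open>$\<close> 100) where "(f $ a) n = PApp (f n) (a n)"
definition pi :: "src \<Rightarrow> (src \<Rightarrow> src) \<Rightarrow> src" where "pi A B n = PPi (A n) (B (v n) (Suc n))"
definition sg :: "src \<Rightarrow> (src \<Rightarrow> src) \<Rightarrow> src" where "sg A B n = PSig (A n) (B (v n) (Suc n))"
definition eq :: "src \<Rightarrow> src \<Rightarrow> src \<Rightarrow> src" where "eq A a b n = PEq (A n) (a n) (b n)"
definition lam :: "(src \<Rightarrow> src) \<Rightarrow> src" where "lam b n = PLam (b (v n) (Suc n))"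
definition lamP :: "(src \<Rightarrow> src \<Rightarrow> src) \<Rightarrow> src" where "lamP b n = PLamP (b (v n) (v (Suc n)) (Suc (Suc n)))"
definition lamJ :: "src \<Rightarrow> src" where "lamJ b n = PLamJ (b n)"
definition pair :: "src \<Rightarrow> src \<Rightarrow> src" where "pair a b n = PPair (a n) (b n)"
definition p1 :: "src \<Rightarrow> src" where "p1 p n = PFst (p n)"
definition p2 :: "src \<Rightarrow> src" where "p2 p n = PSnd (p n)"
definition jj :: "(src \<Rightarrow> src \<Rightarrow> src) \<Rightarrow> src \<Rightarrow> src \<Rightarrow> src" where "jj C d p n = PJ (C (v n) (v (Suc n)) (Suc (Suc n))) (d n) (p n)"
definition have' :: "src \<Rightarrow> (src \<Rightarrow> src) \<Rightarrow> src" where "have' p b n = PHave (p n) (b (v n) (Suc n))"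
definition obt :: "src \<Rightarrow> (src \<Rightarrow> src \<Rightarrow> src) \<Rightarrow> src" where "obt p b n = PObt (p n) (b (v n) (v (Suc n)) (Suc (Suc n)))"
definition ann :: "src \<Rightarrow> src \<Rightarrow> src" where "ann p T n = PAnn (p n) (T n)"
definition funext' :: "src \<Rightarrow> src \<Rightarrow> src" where "funext' f g n = PFunExt (f n) (g n)"
definition ua :: "src \<Rightarrow> src \<Rightarrow> src" where "ua f g n = PUa (f n) (g n)"
definition pinl :: "src \<Rightarrow> src \<Rightarrow> src" where "pinl f g n = PInl (f n) (g n)"
definition pinr :: "src \<Rightarrow> src \<Rightarrow> src" where "pinr f g n = PInr (f n) (g n)"
definition pglue :: "src \<Rightarrow> src \<Rightarrow> src" where "pglue f g n = PGlue (f n) (g n)"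
definition indpush :: "(src \<Rightarrow> src) \<Rightarrow> (src \<Rightarrow> src) \<Rightarrow> (src \<Rightarrow> src) \<Rightarrow> (src \<Rightarrow> src) \<Rightarrow> src \<Rightarrow> src" where
  "indpush D l r q t n = PIndPush (D (v n) (Suc n)) (l (v n) (Suc n)) (r (v n) (Suc n)) (q (v n) (Suc n)) (t n)"
definition pushbeta :: "(src \<Rightarrow> src) \<Rightarrow> (src \<Rightarrow> src) \<Rightarrow> (src \<Rightarrow> src) \<Rightarrow> (src \<Rightarrow> src) \<Rightarrow> src \<Rightarrow> src \<Rightarrow> src" where
  "pushbeta D l r q t Y n = PPushBeta (D (v n) (Suc n)) (l (v n) (Suc n)) (r (v n) (Suc n)) (q (v n) (Suc n)) (t n) (Y n)"
text \<open>Source terms form pushouts and joins of variables only. Anything else is sent to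
  \<open>Ty\<close>, on which evaluation fails.\<close>

definition index :: "pre \<Rightarrow> tm" where "index p = (case p of PVar i \<Rightarrow> Var i | _ \<Rightarrow> Ty)"
definition push :: "src \<Rightarrow> src \<Rightarrow> src" where "push f g n = PTm (Push (index (f n)) (index (g n)))"
definition jtype :: "src \<Rightarrow> src \<Rightarrow> src" where "jtype f g n = PTm (join_type (index (f n)) (index (g n)))"

lemma src_nat: "Suc m - Suc n = m - n" "m - 0 = (m::nat)" "index (PVar i) = Var i"
  by (simp_all add: index_def)

lemmas src_prims = v_def univ_def refl_def app_def pi_def sg_def eq_def lam_def lamP_def lamJ_def pair_def p1_def p2_def jj_def have'_def obt_def ann_def
  funext'_def ua_def pinl_def pinr_def pglue_def indpush_def pushbeta_def push_def jtype_def src_nat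

section \<open>The join construction inside type theory\<close>

named_theorems src_defs and lift_lib

text \<open>An equation evaluated on the left only: \<open>val_cong\<close> keeps the simplifier
  from the schematic right side, and \<open>valI\<close> then instantiates it with the
  result.\<close>

definition val :: "res \<Rightarrow> res \<Rightarrow> bool" where "val r s \<longleftrightarrow> r = s"

lemma valI: "val r r" by (simp add: val_def)

lemma val_cong: "r = r' \<Longrightarrow> val r s = val r' s" by simp

definition lval :: "tm \<Rightarrow> tm \<Rightarrow> bool" where "lval a b \<longleftrightarrow> a = b"

lemma lvalI: "lval a a" by (simp add: lval_def)

lemma lval_cong: "a = a' \<Longrightarrow> lval a b = lval a' b" by simp

definition tm_of :: "res \<Rightarrow> tm" where "tm_of r = (case r of Ok t T \<Rightarrow> t | Fail \<Rightarrow> Ty)"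

lemma tm_of_Ok: "tm_of (Ok t T) = t" by (simp add: tm_of_def)

text \<open>\<open>\<Gamma> \<turnstile> \<sigma> : G\<close> exists for every \<open>\<Gamma>\<close>: all types of the telescope \<open>G\<close> have been proved.\<close>

definition inhabited :: "tm list \<Rightarrow> bool"
  where "inhabited G \<longleftrightarrow> G \<turnstile> \<^bold>\<surd> \<and> (\<forall>\<Gamma>. \<Gamma> \<turnstile> \<^bold>\<surd> \<longrightarrow> (\<exists>\<sigma>. wsub \<Gamma> \<sigma> G))"

lemma inhabited_Nil: "inhabited []"
  by (auto simp: inhabited_def wsub_def intro: ctx_nil)

text \<open>The new component is the proof term under the substitution that serves the older lemmas.
  Later proofs meet the lemma as a variable, so its proof is never unfolded by evaluation. The sort
  is \<open>Ty\<close> because statements quantify over \<open>Univ\<close>.\<close>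

lemma inhabited_Cons:
  assumes "inhabited G" "val (el s G None) (Ok T Ty)" "is_Ok (el p G (Some (tm_of (el s G None))))"
  shows "inhabited (tm_of (el s G None) # G)"
proof -
  have G: "G \<turnstile> \<^bold>\<surd>" using assms(1) by (simp add: inhabited_def)
  have e: "el s G None = Ok T Ty" using assms(2) by (simp add: val_def)
  have T: "G \<turnstile> T \<^bold>: Ty" using el_synth[OF el_sound e G] by simp
  obtain t U where "el p G (Some T) = Ok t U" using assms(3) e by (auto simp: is_Ok_def tm_of_def)
  from el_check[OF el_sound this T] have t: "G \<turnstile> t \<^bold>: T" by simp
  have "\<exists>\<sigma>. wsub \<Gamma> \<sigma> (T # G)" if "\<Gamma> \<turnstile> \<^bold>\<surd>" for \<Gamma>
  proof -
    obtain \<sigma> where \<sigma>: "wsub \<Gamma> \<sigma> G" using assms(1) \<open>\<Gamma> \<turnstile> \<^bold>\<surd>\<close> by (auto simp: inhabited_def)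
    from wsub_cons[OF \<sigma> sub_typ'[OF \<sigma> t]] show ?thesis by blast
  qed
  then show ?thesis using ctx_cons[OF T] e by (simp add: inhabited_def tm_of_def)
qed

abbreviation "lib0 \<equiv> [] :: tm list"
abbreviation "lev0 \<equiv> 0 :: nat"

definition [src_defs]: "lam2 b = lam (\<lambda>x. lam (\<lambda>y. b x y))"

definition [src_defs]: "lam3 b = lam (\<lambda>x. lam2 (\<lambda>y z. b x y z))"

definition [src_defs]: "lam4 b = lam (\<lambda>x. lam3 (\<lambda>y z w. b x y z w))"

definition arr :: "src \<Rightarrow> src \<Rightarrow> src" (infixr \<open>\<rightarrow>\<close> 20) where [src_defs]: "arr A B = pi A (\<lambda>_. B)"

definition [src_defs]: "prd A B = sg A (\<lambda>_. B)"

section \<open>Paths, equivalences and cocones\<close>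

definition [src_defs]: "path_inv A x p = jj (\<lambda>y r. eq A y x) refl p"

definition [src_defs]: "path_cat A x p q = jj (\<lambda>z r. eq A x z) p q"

definition [src_defs]: "path_ap B f x p = jj (\<lambda>y r. eq B (f x) (f y)) refl p"

definition [src_defs]: "path_tr D x p u = jj (\<lambda>y r. arr (D x) (D y)) (lam (\<lambda>z. z)) p $ u"

definition [src_defs]: "isEquiv A B f = prd (sg (arr B A) (\<lambda>h. pi B (\<lambda>y. eq B (f (h $ y)) y))) (sg (arr B A) (\<lambda>h. pi A (\<lambda>x. eq A (h $ (f x)) x)))"

definition [src_defs]: "isLocal M A = isEquiv A (arr M A) (\<lambda>a. lam (\<lambda>_. a))"

text \<open>This is T u. Its paths start at \<open>z\<close>, so by function extensionality a point
  of it is a way of making \<open>u\<close> constant.\<close>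

definition [src_defs]: "apex P Z u = sg Z (\<lambda>z. pi P (\<lambda>p. eq Z z (u p)))"

text \<open>A cocone under the join of \<open>P\<close> and \<open>Q\<close>, curried so that a
  point of \<open>Q\<close> is sent to its value together with all glueing paths from there. The
  second leg thereby is a map into the single type T u.\<close>

definition [src_defs]: "cocones P Q Z = sg (arr P Z) (\<lambda>u. arr Q (apex P Z (\<lambda>p. u $ p)))"

definition [src_defs]: "const_cocone z = pair (lam (\<lambda>_. z)) (lam (\<lambda>_. pair z (lam (\<lambda>_. refl))))"

definition [src_defs]: "join_local P Q Z = isEquiv Z (cocones P Q Z) (\<lambda>z. const_cocone z)"

section \<open>Function extensionality and induction on homotopies\<close>

definition "stm_htpy_to_path = pi univ (\<lambda>A. pi (A \<rightarrow> univ) (\<lambda>B. pi (pi A (\<lambda>x. B $ x)) (\<lambda>f. pi (pi A (\<lambda>x. B $ x)) (\<lambda>g.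
  pi A (\<lambda>x. eq (B $ x) (f $ x) (g $ x)) \<rightarrow> eq (pi A (\<lambda>x. B $ x)) f g))))"

text \<open>\<open>FunExt\<close> makes \<open>happly\<close> bi-invertible, and its section is the
  wanted map.\<close>

definition "prf_htpy_to_path = lam4 (\<lambda>A B f g. lam (\<lambda>h. p1 (p1 (funext' f g)) $ h))"

definition "T_htpy_to_path = tm_of (el (stm_htpy_to_path lev0) lib0 None)"

schematic_goal stm_htpy_to_path: "val (el (stm_htpy_to_path lev0) lib0 None) ?r"
  by (simp only: stm_htpy_to_path_def src_defs src_prims, simp only: check_simps cong: frozen_congs eval_congs val_cong) (rule valI)
lemmas T_htpy_to_path = T_htpy_to_path_def[unfolded stm_htpy_to_path[unfolded val_def] tm_of_Ok]
\<comment> \<open>The statement is closed, so every lift of it is the statement itself. Through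
  \<open>lift_lib\<close> the library context can stay folded into constants, and a statement is
  written out only when its variable is looked up.\<close>
schematic_goal lift_htpy_to_path: "lval (lf k 0 T_htpy_to_path) ?T"
  unfolding T_htpy_to_path by (simp only: check_simps cong: frozen_congs eval_congs lval_cong) (rule lvalI)
lemmas [lift_lib] = lift_htpy_to_path[unfolded lval_def]

text \<open>Only the success of elaboration is recorded: by \<open>el_sound\<close> it implies a
  derivation, and the elaborated proof term is never stored.\<close>

lemma prf_htpy_to_path: "is_Ok (el (prf_htpy_to_path lev0) lib0 (Some T_htpy_to_path))"
  unfolding T_htpy_to_path prf_htpy_to_path_def by (simp only: src_defs src_prims) (simp only: check_simps lift_lib cong: frozen_congs eval_congs)
lemmas inhabited_htpy_to_path = inhabited_Cons[OF inhabited_Nil stm_htpy_to_path prf_htpy_to_path[unfolded T_htpy_to_path_def], folded T_htpy_to_path_def]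

abbreviation "lib_htpy_to_path \<equiv> T_htpy_to_path # lib0"
abbreviation "lev_htpy_to_path \<equiv> Suc lev0"
text \<open>From here on the lemma is a variable. Its level is its position in the library and,
  unlike a de Bruijn index, does not change as the library grows.\<close>

definition [src_defs]: "htpy_to_path = v lev0"

text \<open>This is \<open>happly\<close> out of a constant map, with the same normal form, so that
  the type of \<open>FunExt\<close> fits it.\<close>

definition [src_defs]: "path_to_htpy P Z z e = jj (\<lambda>u r. pi P (\<lambda>p. eq Z z (u $ p))) (lam (\<lambda>_. refl)) e"

definition "stm_htpy_ind = pi univ (\<lambda>P. pi univ (\<lambda>Z. pi Z (\<lambda>z. pi (pi (P \<rightarrow> Z) (\<lambda>u. pi P (\<lambda>p. eq Z z (u $ p)) \<rightarrow> univ)) (\<lambda>R.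
   (R $ (lam (\<lambda>_. z)) $ (lam (\<lambda>_. refl))) \<rightarrow> pi (P \<rightarrow> Z) (\<lambda>u. pi (pi P (\<lambda>p. eq Z z (u $ p))) (\<lambda>a. R $ u $ a))))))"

text \<open>Path induction gives \<open>R\<close> at every homotopy that comes from a path. A
  general homotopy \<open>a\<close> is equal to the one induced by its path from function
  extensionality, by the homotopy of the section. Binding \<open>F\<close> turns the
  \<open>FunExt\<close> term into a variable; \<open>step\<close> has no clause for
  \<open>FunExt\<close>.\<close>

definition "prf_htpy_ind = lam4 (\<lambda>P Z z R. lam3 (\<lambda>d u a.
  have' (ann (lamJ d) (pi (P \<rightarrow> Z) (\<lambda>u. pi (eq (P \<rightarrow> Z) (lam (\<lambda>_. z)) u) (\<lambda>e. R $ u $ (path_to_htpy P Z z e))))) (\<lambda>k.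
  have' (funext' (ann (lam (\<lambda>_. z)) (P \<rightarrow> Z)) u) (\<lambda>F.
  jj (\<lambda>b r. R $ u $ b) (k $ u $ (p1 (p1 F) $ a)) (p2 (p1 F) $ a)))))"

definition "T_htpy_ind = tm_of (el (stm_htpy_ind lev_htpy_to_path) lib_htpy_to_path None)"

schematic_goal stm_htpy_ind: "val (el (stm_htpy_ind lev_htpy_to_path) lib_htpy_to_path None) ?r"
  by (simp only: stm_htpy_ind_def src_defs src_prims, simp only: check_simps cong: frozen_congs eval_congs val_cong) (rule valI)
lemmas T_htpy_ind = T_htpy_ind_def[unfolded stm_htpy_ind[unfolded val_def] tm_of_Ok]
schematic_goal lift_htpy_ind: "lval (lf k 0 T_htpy_ind) ?T"
  unfolding T_htpy_ind by (simp only: check_simps cong: frozen_congs eval_congs lval_cong) (rule lvalI)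
lemmas [lift_lib] = lift_htpy_ind[unfolded lval_def]

lemma prf_htpy_ind: "is_Ok (el (prf_htpy_ind lev_htpy_to_path) lib_htpy_to_path (Some T_htpy_ind))"
  unfolding T_htpy_ind prf_htpy_ind_def by (simp only: src_defs src_prims) (simp only: check_simps lift_lib cong: frozen_congs eval_congs)
lemmas inhabited_htpy_ind = inhabited_Cons[OF inhabited_htpy_to_path stm_htpy_ind prf_htpy_ind[unfolded T_htpy_ind_def], folded T_htpy_ind_def]

abbreviation "lib_htpy_ind \<equiv> T_htpy_ind # lib_htpy_to_path"
abbreviation "lev_htpy_ind \<equiv> Suc lev_htpy_to_path"
definition [src_defs]: "htpy_ind = v lev_htpy_to_path"

section \<open>Fibres of equivalences via univalence\<close>

definition [src_defs]: "eqv A B = sg (A \<rightarrow> B) (\<lambda>f. isEquiv A B (\<lambda>x. f $ x))"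

definition [src_defs]: "id_eqv = pair (lam (\<lambda>x. x)) (pair (pair (lam (\<lambda>x. x)) (lam (\<lambda>x. refl))) (pair (lam (\<lambda>x. x)) (lam (\<lambda>x. refl))))"

definition [src_defs]: "path_to_eqv A q = jj (\<lambda>B r. eqv A B) id_eqv q"

definition [src_defs]: "fibs_are_props A B f = pi A (\<lambda>a. pi B (\<lambda>b. pi (eq B (f a) b) (\<lambda>p. pi A (\<lambda>c. pi (eq B (f c) b) (\<lambda>q. eq (sg A (\<lambda>a. eq B (f a) b)) (pair a p) (pair c q))))))"

text \<open>By univalence it suffices to consider the identity function.\<close>

definition "stm_eqv_fibs_are_props = pi univ (\<lambda>A. pi univ (\<lambda>B. pi (A \<rightarrow> B) (\<lambda>f. isEquiv A B (\<lambda>x. f $ x) \<rightarrow> fibs_are_props A B (\<lambda>x. f $ x))))"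

text \<open>For the identity the two paths are eliminated one after the other, \<open>k1\<close> the
  first and \<open>k0\<close> the second. \<open>k2\<close> extends this along a path of types, and
  the section homotopy of univalence rewrites the equivalence of that path to
  \<open>(f, h)\<close>.\<close>

definition "prf_eqv_fibs_are_props = lam4 (\<lambda>A B f h.
  have' (ann (lam (\<lambda>c. lamJ refl)) (pi A (\<lambda>c. pi A (\<lambda>a. pi (eq A c a) (\<lambda>q. eq (sg A (\<lambda>x. eq A x a)) (pair a refl) (pair c q)))))) (\<lambda>k0.
  have' (ann (lam (\<lambda>a. lamJ (lam (\<lambda>c. lam (\<lambda>q. k0 $ c $ a $ q))))) (fibs_are_props A A (\<lambda>x. x))) (\<lambda>k1.
  have' (ann (lamJ k1) (pi univ (\<lambda>B. pi (eq univ A B) (\<lambda>q. fibs_are_props A B (\<lambda>x. p1 (path_to_eqv A q) $ x))))) (\<lambda>k2.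
  have' (ua A B) (\<lambda>F.
  jj (\<lambda>e r. fibs_are_props A B (\<lambda>x. p1 e $ x)) (k2 $ B $ (p1 (p1 F) $ (pair f h))) (p2 (p1 F) $ (pair f h)))))))"

definition "T_eqv_fibs_are_props = tm_of (el (stm_eqv_fibs_are_props lev_htpy_ind) lib_htpy_ind None)"

schematic_goal stm_eqv_fibs_are_props: "val (el (stm_eqv_fibs_are_props lev_htpy_ind) lib_htpy_ind None) ?r"
  by (simp only: stm_eqv_fibs_are_props_def src_defs src_prims, simp only: check_simps cong: frozen_congs eval_congs val_cong) (rule valI)
lemmas T_eqv_fibs_are_props = T_eqv_fibs_are_props_def[unfolded stm_eqv_fibs_are_props[unfolded val_def] tm_of_Ok]
schematic_goal lift_eqv_fibs_are_props: "lval (lf k 0 T_eqv_fibs_are_props) ?T"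
  unfolding T_eqv_fibs_are_props by (simp only: check_simps cong: frozen_congs eval_congs lval_cong) (rule lvalI)
lemmas [lift_lib] = lift_eqv_fibs_are_props[unfolded lval_def]

lemma prf_eqv_fibs_are_props: "is_Ok (el (prf_eqv_fibs_are_props lev_htpy_ind) lib_htpy_ind (Some T_eqv_fibs_are_props))"
  unfolding T_eqv_fibs_are_props prf_eqv_fibs_are_props_def by (simp only: src_defs src_prims) (simp only: check_simps lift_lib cong: frozen_congs eval_congs)
lemmas inhabited_eqv_fibs_are_props = inhabited_Cons[OF inhabited_htpy_ind stm_eqv_fibs_are_props prf_eqv_fibs_are_props[unfolded T_eqv_fibs_are_props_def], folded T_eqv_fibs_are_props_def]

abbreviation "lib_eqv_fibs_are_props \<equiv> T_eqv_fibs_are_props # lib_htpy_ind"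
abbreviation "lev_eqv_fibs_are_props \<equiv> Suc lev_htpy_ind"
definition [src_defs]: "eqv_fibs_are_props = v lev_htpy_ind"

section \<open>Locality for a join and locality of the types T u\<close>

definition [src_defs]: "apex_retr P Q Z K i s u w = K $ (i $ (pair u w)) $ (pair u w) $ (s $ (pair u w))"

definition [src_defs]: "const_fib P Q Z c = sg Z (\<lambda>z. eq (cocones P Q Z) (const_cocone z) c)"

definition [src_defs]: "const_fib_alt P Q Z c = sg (apex P Z (\<lambda>p. p1 c $ p)) (\<lambda>t. eq (Q \<rightarrow> apex P Z (\<lambda>p. p1 c $ p)) (lam (\<lambda>_. t)) (p2 c))"

text \<open>The fibre of \<^term>\<open>const_cocone\<close> over a cocone \<open>c\<close> and the fibre of the constant map \<open>T u \<rightarrow> (Q \<rightarrow> T u)\<close> over the second component of \<open>c\<close> are retracts of each other; this compares \<open>H(P,Q)\<close> with the locality of \<open>T u\<close>.\<close>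

definition "stm_const_fib_maps = pi univ (\<lambda>P. pi univ (\<lambda>Q. pi univ (\<lambda>Z. sg (pi Z (\<lambda>z. pi (cocones P Q Z) (\<lambda>c. eq (cocones P Q Z) (const_cocone z) c \<rightarrow> const_fib_alt P Q Z c)))
   (\<lambda>K. pi Z (\<lambda>z. eq (apex P Z (\<lambda>p. z)) (p1 (K $ z $ (const_cocone z) $ refl)) (pair z (lam (\<lambda>_. refl))))))))"

text \<open>\<open>L\<close> stores the value of \<open>K\<close> at \<open>refl\<close>, which
  holds by computation here but is no longer visible once \<open>K\<close> is a component of a
  library variable.\<close>

definition "prf_const_fib_maps = lam3 (\<lambda>P Q Z. pair (lam (\<lambda>z. lamJ (pair (pair z (lam (\<lambda>_. refl))) refl))) (lam (\<lambda>z. refl)))"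

definition "T_const_fib_maps = tm_of (el (stm_const_fib_maps lev_eqv_fibs_are_props) lib_eqv_fibs_are_props None)"

schematic_goal stm_const_fib_maps: "val (el (stm_const_fib_maps lev_eqv_fibs_are_props) lib_eqv_fibs_are_props None) ?r"
  by (simp only: stm_const_fib_maps_def src_defs src_prims, simp only: check_simps cong: frozen_congs eval_congs val_cong) (rule valI)
lemmas T_const_fib_maps = T_const_fib_maps_def[unfolded stm_const_fib_maps[unfolded val_def] tm_of_Ok]
schematic_goal lift_const_fib_maps: "lval (lf k 0 T_const_fib_maps) ?T"
  unfolding T_const_fib_maps by (simp only: check_simps cong: frozen_congs eval_congs lval_cong) (rule lvalI)
lemmas [lift_lib] = lift_const_fib_maps[unfolded lval_def]

lemma prf_const_fib_maps: "is_Ok (el (prf_const_fib_maps lev_eqv_fibs_are_props) lib_eqv_fibs_are_props (Some T_const_fib_maps))"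
  unfolding T_const_fib_maps prf_const_fib_maps_def by (simp only: src_defs src_prims) (simp only: check_simps lift_lib cong: frozen_congs eval_congs)
lemmas inhabited_const_fib_maps = inhabited_Cons[OF inhabited_eqv_fibs_are_props stm_const_fib_maps prf_const_fib_maps[unfolded T_const_fib_maps_def], folded T_const_fib_maps_def]

abbreviation "lib_const_fib_maps \<equiv> T_const_fib_maps # lib_eqv_fibs_are_props"
abbreviation "lev_const_fib_maps \<equiv> Suc lev_eqv_fibs_are_props"
definition [src_defs]: "const_fib_maps = v lev_eqv_fibs_are_props"

definition "stm_apex_local = pi univ (\<lambda>P. pi univ (\<lambda>Q. pi univ (\<lambda>Z. join_local P Q Z \<rightarrow> pi (P \<rightarrow> Z) (\<lambda>u. isLocal Q (apex P Z (\<lambda>p. u $ p))))))"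

text \<open>One map serves as section and as retraction: send \<open>w\<close> to the point of T u
  that \<open>K\<close> extracts from the fibre of the constant map over \<open>(u, w)\<close>. For
  the retraction \<open>htpy_ind\<close> reduces to \<open>u\<close> constant at \<open>z\<close>.
  The fibre over \<open>const_cocone z\<close> is a proposition, so the chosen point is
  \<open>(z, refl)\<close>, where \<open>L\<close> computes the answer.\<close>

definition "prf_apex_local = lam4 (\<lambda>P Q Z h. lam (\<lambda>u. obt h (\<lambda>a b. obt a (\<lambda>i s. obt (const_fib_maps $ P $ Q $ Z) (\<lambda>K L.
  pair (pair (lam (\<lambda>w. p1 (apex_retr P Q Z K i s u w))) (lam (\<lambda>w. p2 (apex_retr P Q Z K i s u w))))
   (pair (lam (\<lambda>w. p1 (apex_retr P Q Z K i s u w)))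
     (lamP (\<lambda>z a. htpy_ind $ P $ Z $ z $
       (lam2 (\<lambda>u a. eq (apex P Z (\<lambda>p. u $ p)) (p1 (apex_retr P Q Z K i s u (lam (\<lambda>_. pair z a)))) (pair z a))) $
       (path_cat (apex P Z (\<lambda>p. z)) (p1 (K $ (i $ (const_cocone z)) $ (const_cocone z) $ (s $ (const_cocone z)))) (path_ap (apex P Z (\<lambda>p. z)) (\<lambda>y. p1 (K $ (p1 y) $ (const_cocone z) $ (p2 y)))
         (ann (pair (i $ (const_cocone z)) (s $ (const_cocone z))) (const_fib P Q Z (const_cocone z)))
         (eqv_fibs_are_props $ Z $ (cocones P Q Z) $ (lam (\<lambda>z. const_cocone z)) $ h $ (i $ (const_cocone z)) $ (const_cocone z) $ (s $ (const_cocone z)) $ z $ refl)) (L $ z)) $ u $ a))))))))"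

definition "T_apex_local = tm_of (el (stm_apex_local lev_const_fib_maps) lib_const_fib_maps None)"

schematic_goal stm_apex_local: "val (el (stm_apex_local lev_const_fib_maps) lib_const_fib_maps None) ?r"
  by (simp only: stm_apex_local_def src_defs src_prims, simp only: check_simps cong: frozen_congs eval_congs val_cong) (rule valI)
lemmas T_apex_local = T_apex_local_def[unfolded stm_apex_local[unfolded val_def] tm_of_Ok]
schematic_goal lift_apex_local: "lval (lf k 0 T_apex_local) ?T"
  unfolding T_apex_local by (simp only: check_simps cong: frozen_congs eval_congs lval_cong) (rule lvalI)
lemmas [lift_lib] = lift_apex_local[unfolded lval_def]

lemma prf_apex_local: "is_Ok (el (prf_apex_local lev_const_fib_maps) lib_const_fib_maps (Some T_apex_local))"
  unfolding T_apex_local prf_apex_local_def by (simp only: src_defs src_prims) (simp only: check_simps lift_lib cong: frozen_congs eval_congs)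
lemmas inhabited_apex_local = inhabited_Cons[OF inhabited_const_fib_maps stm_apex_local prf_apex_local[unfolded T_apex_local_def], folded T_apex_local_def]

abbreviation "lib_apex_local \<equiv> T_apex_local # lib_const_fib_maps"
abbreviation "lev_apex_local \<equiv> Suc lev_const_fib_maps"
definition [src_defs]: "apex_local = v lev_const_fib_maps"

definition [src_defs]: "sL L u = p1 (p1 (L $ u))"

definition [src_defs]: "rL L u = p1 (p2 (L $ u))"

definition "stm_join_local_of_apex = pi univ (\<lambda>P. pi univ (\<lambda>Q. pi univ (\<lambda>Z. pi (P \<rightarrow> Z) (\<lambda>u. isLocal Q (apex P Z (\<lambda>p. u $ p))) \<rightarrow> join_local P Q Z)))"

text \<open>The key \<open>k\<close>: if \<open>w\<close> is constant at \<open>t\<close> up to a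
  path, then \<open>(u, w)\<close> is the constant cocone at the first component of
  \<open>t\<close>. After \<open>htpy_ind\<close> and path induction both sides are the same. The
  section of T u then gives the section here, and its retraction at a constant \<open>u\<close>,
  projected to \<open>Z\<close>, gives the other half.\<close>

definition "prf_join_local_of_apex = lam4 (\<lambda>P Q Z L.
  have' (ann (lam (\<lambda>u. lamP (\<lambda>z a. htpy_ind $ P $ Z $ z $ (lam2 (\<lambda>u a. pi (Q \<rightarrow> apex P Z (\<lambda>p. u $ p)) (\<lambda>w.
        eq (Q \<rightarrow> apex P Z (\<lambda>p. u $ p)) (lam (\<lambda>_. pair z a)) w \<rightarrow> eq (cocones P Q Z) (const_cocone z) (pair u w)))) $ (lamJ refl) $ u $ a)))
     (pi (P \<rightarrow> Z) (\<lambda>u. pi (apex P Z (\<lambda>p. u $ p)) (\<lambda>t. pi (Q \<rightarrow> apex P Z (\<lambda>p. u $ p)) (\<lambda>w.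
        eq (Q \<rightarrow> apex P Z (\<lambda>p. u $ p)) (lam (\<lambda>_. t)) w \<rightarrow> eq (cocones P Q Z) (const_cocone (p1 t)) (pair u w)))))) (\<lambda>k.
  pair (pair (lam (\<lambda>c. p1 (sL L (p1 c) $ (p2 c)))) (lamP (\<lambda>u w. k $ u $ (sL L u $ w) $ w $ (p2 (p1 (L $ u)) $ w))))
   (pair (lam (\<lambda>c. p1 (rL L (p1 c) $ (p2 c))))
     (lam (\<lambda>z. path_ap Z (\<lambda>t. p1 t) (rL L (lam (\<lambda>_. z)) $ (lam (\<lambda>_. pair z (lam (\<lambda>_. refl)))))
         (p2 (p2 (L $ (lam (\<lambda>_. z)))) $ (pair z (lam (\<lambda>_. refl)))))))))"

definition "T_join_local_of_apex = tm_of (el (stm_join_local_of_apex lev_apex_local) lib_apex_local None)"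

schematic_goal stm_join_local_of_apex: "val (el (stm_join_local_of_apex lev_apex_local) lib_apex_local None) ?r"
  by (simp only: stm_join_local_of_apex_def src_defs src_prims, simp only: check_simps cong: frozen_congs eval_congs val_cong) (rule valI)
lemmas T_join_local_of_apex = T_join_local_of_apex_def[unfolded stm_join_local_of_apex[unfolded val_def] tm_of_Ok]
schematic_goal lift_join_local_of_apex: "lval (lf k 0 T_join_local_of_apex) ?T"
  unfolding T_join_local_of_apex by (simp only: check_simps cong: frozen_congs eval_congs lval_cong) (rule lvalI)
lemmas [lift_lib] = lift_join_local_of_apex[unfolded lval_def]

lemma prf_join_local_of_apex: "is_Ok (el (prf_join_local_of_apex lev_apex_local) lib_apex_local (Some T_join_local_of_apex))"
  unfolding T_join_local_of_apex prf_join_local_of_apex_def by (simp only: src_defs src_prims) (simp only: check_simps lift_lib cong: frozen_congs eval_congs)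
lemmas inhabited_join_local_of_apex = inhabited_Cons[OF inhabited_apex_local stm_join_local_of_apex prf_join_local_of_apex[unfolded T_join_local_of_apex_def], folded T_join_local_of_apex_def]

abbreviation "lib_join_local_of_apex \<equiv> T_join_local_of_apex # lib_apex_local"
abbreviation "lev_join_local_of_apex \<equiv> Suc lev_apex_local"
definition [src_defs]: "join_local_of_apex = v lev_apex_local"

section \<open>Exchanging the two legs\<close>

definition [src_defs]: "swap_cocone Z u w = pair (lam (\<lambda>q. p1 (w $ q))) (lam (\<lambda>p. pair (u $ p) (lam (\<lambda>q. path_inv Z (p1 (w $ q)) (p2 (w $ q) $ p)))))"

definition [src_defs]: "swap_map P Q Z c = swap_cocone Z (p1 c) (p2 c)"

text \<open>Swapping twice inverts each glueing path twice; \<open>ii\<close> removes this pointwise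
  by path induction, and function extensionality collects the result.\<close>

definition [src_defs]: "swap_swap_leg P Z u = lamP (\<lambda>z a. have' (ann (lamJ refl) (pi Z (\<lambda>y. pi (eq Z z y) (\<lambda>e. eq (eq Z z y) (path_inv Z y (path_inv Z z e)) e)))) (\<lambda>ii.
      path_ap (apex P Z (\<lambda>p. u $ p)) (\<lambda>b. pair z b) (lam (\<lambda>p. path_inv Z (u $ p) (path_inv Z z (a $ p))))
       (htpy_to_path $ P $ (lam (\<lambda>p. eq Z z (u $ p))) $ (lam (\<lambda>p. path_inv Z (u $ p) (path_inv Z z (a $ p)))) $ a $ (lam (\<lambda>p. ii $ (u $ p) $ (a $ p))))))"

definition [src_defs]: "swap_leg Z u w = lam (\<lambda>q. pair (p1 (w $ q)) (lam (\<lambda>p. path_inv Z (u $ p) (path_inv Z (p1 (w $ q)) (p2 (w $ q) $ p)))))"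

text \<open>Exchanging the two legs of a cocone twice is the identity.\<close>

definition "stm_swap_swap = pi univ (\<lambda>P. pi univ (\<lambda>Q. pi univ (\<lambda>Z. pi (P \<rightarrow> Z) (\<lambda>u. pi (Q \<rightarrow> apex P Z (\<lambda>p. u $ p)) (\<lambda>w. eq (cocones P Q Z) (pair (lam (\<lambda>p. u $ p)) (swap_leg Z u w)) (pair u w))))))"

text \<open>Without eta in evaluation the first leg comes back as
  \<open>lam (\<lambda>p. u $ p)\<close>, a normal form other than \<open>u\<close>. A path between
  them comes from function extensionality with \<open>refl\<close>. It is eliminated with
  \<open>w\<close> generalised, as the type of \<open>w\<close> depends on \<open>u\<close>.\<close>

definition "prf_swap_swap = lam4 (\<lambda>P Q Z u. lam (\<lambda>w.
  have' (ann (swap_swap_leg P Z u) (pi (apex P Z (\<lambda>p. u $ p)) (\<lambda>t. eq (apex P Z (\<lambda>p. u $ p)) (pair (p1 t) (lam (\<lambda>p. path_inv Z (u $ p) (path_inv Z (p1 t) (p2 t $ p))))) t))) (\<lambda>k.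
  jj (\<lambda>v r. pi (Q \<rightarrow> apex P Z (\<lambda>p. v $ p)) (\<lambda>w. eq (cocones P Q Z) (pair (lam (\<lambda>p. v $ p)) (swap_leg Z v w)) (pair v w)))
   (lam (\<lambda>w. path_ap (cocones P Q Z) (\<lambda>x. pair (lam (\<lambda>p. u $ p)) x) (swap_leg Z u w)
      (htpy_to_path $ Q $ (lam (\<lambda>_. apex P Z (\<lambda>p. u $ p))) $ (swap_leg Z u w) $ w $ (lam (\<lambda>q. k $ (w $ q))))))
   (htpy_to_path $ P $ (lam (\<lambda>_. Z)) $ (lam (\<lambda>p. u $ p)) $ u $ (lam (\<lambda>_. refl))) $ w)))"

definition "T_swap_swap = tm_of (el (stm_swap_swap lev_join_local_of_apex) lib_join_local_of_apex None)"

schematic_goal stm_swap_swap: "val (el (stm_swap_swap lev_join_local_of_apex) lib_join_local_of_apex None) ?r"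
  by (simp only: stm_swap_swap_def src_defs src_prims, simp only: check_simps cong: frozen_congs eval_congs val_cong) (rule valI)
lemmas T_swap_swap = T_swap_swap_def[unfolded stm_swap_swap[unfolded val_def] tm_of_Ok]
schematic_goal lift_swap_swap: "lval (lf k 0 T_swap_swap) ?T"
  unfolding T_swap_swap by (simp only: check_simps cong: frozen_congs eval_congs lval_cong) (rule lvalI)
lemmas [lift_lib] = lift_swap_swap[unfolded lval_def]

lemma prf_swap_swap: "is_Ok (el (prf_swap_swap lev_join_local_of_apex) lib_join_local_of_apex (Some T_swap_swap))"
  unfolding T_swap_swap prf_swap_swap_def by (simp only: src_defs src_prims) (simp only: check_simps lift_lib cong: frozen_congs eval_congs)
lemmas inhabited_swap_swap = inhabited_Cons[OF inhabited_join_local_of_apex stm_swap_swap prf_swap_swap[unfolded T_swap_swap_def], folded T_swap_swap_def]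

abbreviation "lib_swap_swap \<equiv> T_swap_swap # lib_join_local_of_apex"
abbreviation "lev_swap_swap \<equiv> Suc lev_join_local_of_apex"
definition [src_defs]: "swap_swap = v lev_join_local_of_apex"

text \<open>The maps are packaged with their equations because they do not compute any more as
  components of a library variable. On constant cocones the equations hold by
  \<open>refl\<close>.\<close>

definition [src_defs]: "swap_data P Q Z = sg (cocones P Q Z \<rightarrow> cocones Q P Z) (\<lambda>G. sg (cocones Q P Z \<rightarrow> cocones P Q Z) (\<lambda>K. prd (pi Z (\<lambda>z. eq (cocones Q P Z) (G $ (const_cocone z)) (const_cocone z)))
   (prd (pi Z (\<lambda>z. eq (cocones P Q Z) (K $ (const_cocone z)) (const_cocone z))) (pi (cocones Q P Z) (\<lambda>c. eq (cocones Q P Z) (G $ (K $ c)) c)))))"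

definition "stm_swap_data_exists = pi univ (\<lambda>P. pi univ (\<lambda>Q. pi univ (\<lambda>Z. swap_data P Q Z)))"

definition "prf_swap_data_exists = lam3 (\<lambda>P Q Z. pair (lam (\<lambda>c. swap_map P Q Z c)) (pair (lam (\<lambda>c. swap_map Q P Z c)) (pair (lam (\<lambda>z. refl)) (pair (lam (\<lambda>z. refl)) (lamP (\<lambda>u w. swap_swap $ Q $ P $ Z $ u $ w))))))"

definition "T_swap_data_exists = tm_of (el (stm_swap_data_exists lev_swap_swap) lib_swap_swap None)"

schematic_goal stm_swap_data_exists: "val (el (stm_swap_data_exists lev_swap_swap) lib_swap_swap None) ?r"
  by (simp only: stm_swap_data_exists_def src_defs src_prims, simp only: check_simps cong: frozen_congs eval_congs val_cong) (rule valI)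
lemmas T_swap_data_exists = T_swap_data_exists_def[unfolded stm_swap_data_exists[unfolded val_def] tm_of_Ok]
schematic_goal lift_swap_data_exists: "lval (lf k 0 T_swap_data_exists) ?T"
  unfolding T_swap_data_exists by (simp only: check_simps cong: frozen_congs eval_congs lval_cong) (rule lvalI)
lemmas [lift_lib] = lift_swap_data_exists[unfolded lval_def]

lemma prf_swap_data_exists: "is_Ok (el (prf_swap_data_exists lev_swap_swap) lib_swap_swap (Some T_swap_data_exists))"
  unfolding T_swap_data_exists prf_swap_data_exists_def by (simp only: src_defs src_prims) (simp only: check_simps lift_lib cong: frozen_congs eval_congs)
lemmas inhabited_swap_data_exists = inhabited_Cons[OF inhabited_swap_swap stm_swap_data_exists prf_swap_data_exists[unfolded T_swap_data_exists_def], folded T_swap_data_exists_def]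

abbreviation "lib_swap_data_exists \<equiv> T_swap_data_exists # lib_swap_swap"
abbreviation "lev_swap_data_exists \<equiv> Suc lev_swap_swap"
definition [src_defs]: "swap_data_exists = v lev_swap_swap"

definition "stm_join_local_sym = pi univ (\<lambda>P. pi univ (\<lambda>Q. pi univ (\<lambda>Z. join_local P Q Z \<rightarrow> join_local Q P Z)))"

text \<open>Both inverses are precomposed with \<open>K\<close>. For the section, the constant
  cocone is rewritten as \<open>G\<close> of a constant cocone, the old section homotopy is applied
  under \<open>G\<close>, and \<open>G (K c) = c\<close> finishes. The retraction uses that
  \<open>K\<close> preserves constant cocones.\<close>

definition "prf_join_local_sym = lam4 (\<lambda>P Q Z h. obt h (\<lambda>a b. obt a (\<lambda>i s. obt b (\<lambda>r t. obt (swap_data_exists $ P $ Q $ Z) (\<lambda>G x. obt x (\<lambda>K y. obt y (\<lambda>Gc y. obt y (\<lambda>Kc GK.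
  pair (pair (lam (\<lambda>c. i $ (K $ c)))
    (lam (\<lambda>c. path_cat (cocones Q P Z) (const_cocone (i $ (K $ c))) (path_cat (cocones Q P Z) (const_cocone (i $ (K $ c))) (path_inv (cocones Q P Z) (G $ (const_cocone (i $ (K $ c)))) (Gc $ (i $ (K $ c))))
       (path_ap (cocones Q P Z) (\<lambda>x. G $ x) (const_cocone (i $ (K $ c))) (s $ (K $ c))))
       (GK $ c))))
   (pair (lam (\<lambda>c. r $ (K $ c))) (lam (\<lambda>z. path_cat Z (r $ (K $ (const_cocone z))) (path_ap Z (\<lambda>x. r $ x) (K $ (const_cocone z)) (Kc $ z)) (t $ z))))))))))))"

definition "T_join_local_sym = tm_of (el (stm_join_local_sym lev_swap_data_exists) lib_swap_data_exists None)"

schematic_goal stm_join_local_sym: "val (el (stm_join_local_sym lev_swap_data_exists) lib_swap_data_exists None) ?r"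
  by (simp only: stm_join_local_sym_def src_defs src_prims, simp only: check_simps cong: frozen_congs eval_congs val_cong) (rule valI)
lemmas T_join_local_sym = T_join_local_sym_def[unfolded stm_join_local_sym[unfolded val_def] tm_of_Ok]
schematic_goal lift_join_local_sym: "lval (lf k 0 T_join_local_sym) ?T"
  unfolding T_join_local_sym by (simp only: check_simps cong: frozen_congs eval_congs lval_cong) (rule lvalI)
lemmas [lift_lib] = lift_join_local_sym[unfolded lval_def]

lemma prf_join_local_sym: "is_Ok (el (prf_join_local_sym lev_swap_data_exists) lib_swap_data_exists (Some T_join_local_sym))"
  unfolding T_join_local_sym prf_join_local_sym_def by (simp only: src_defs src_prims) (simp only: check_simps lift_lib cong: frozen_congs eval_congs)
lemmas inhabited_join_local_sym = inhabited_Cons[OF inhabited_swap_data_exists stm_join_local_sym prf_join_local_sym[unfolded T_join_local_sym_def], folded T_join_local_sym_def]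

abbreviation "lib_join_local_sym \<equiv> T_join_local_sym # lib_swap_data_exists"
abbreviation "lev_join_local_sym \<equiv> Suc lev_swap_data_exists"
definition [src_defs]: "join_local_sym = v lev_swap_data_exists"

section \<open>Maps out of a type glued from two legs\<close>

definition "stm_cocone_ext = pi univ (\<lambda>P. pi univ (\<lambda>Q. pi univ (\<lambda>Z. pi Z (\<lambda>z. pi (cocones P Q Z) (\<lambda>c. eq (cocones P Q Z) (const_cocone z) c \<rightarrow>
  sg (pi P (\<lambda>p. eq Z z (p1 c $ p))) (\<lambda>a. sg (pi Q (\<lambda>q. eq Z z (p1 (p2 c $ q)))) (\<lambda>b.
    pi Q (\<lambda>q. pi P (\<lambda>p. eq (eq Z z (p1 c $ p)) (path_cat Z z (b $ q) (p2 (p2 c $ q) $ p)) (a $ p))))))))))"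

text \<open>Passing from a path of cocones to its components is plain path induction, which avoids
  describing equality in iterated sums.\<close>

definition "prf_cocone_ext = lam4 (\<lambda>P Q Z z. lamJ (pair (lam (\<lambda>_. refl)) (pair (lam (\<lambda>_. refl)) (lam2 (\<lambda>p q. refl)))))"

definition "T_cocone_ext = tm_of (el (stm_cocone_ext lev_join_local_sym) lib_join_local_sym None)"

schematic_goal stm_cocone_ext: "val (el (stm_cocone_ext lev_join_local_sym) lib_join_local_sym None) ?r"
  by (simp only: stm_cocone_ext_def src_defs src_prims, simp only: check_simps cong: frozen_congs eval_congs val_cong) (rule valI)
lemmas T_cocone_ext = T_cocone_ext_def[unfolded stm_cocone_ext[unfolded val_def] tm_of_Ok]
schematic_goal lift_cocone_ext: "lval (lf k 0 T_cocone_ext) ?T"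
  unfolding T_cocone_ext by (simp only: check_simps cong: frozen_congs eval_congs lval_cong) (rule lvalI)
lemmas [lift_lib] = lift_cocone_ext[unfolded lval_def]

lemma prf_cocone_ext: "is_Ok (el (prf_cocone_ext lev_join_local_sym) lib_join_local_sym (Some T_cocone_ext))"
  unfolding T_cocone_ext prf_cocone_ext_def by (simp only: src_defs src_prims) (simp only: check_simps lift_lib cong: frozen_congs eval_congs)
lemmas inhabited_cocone_ext = inhabited_Cons[OF inhabited_join_local_sym stm_cocone_ext prf_cocone_ext[unfolded T_cocone_ext_def], folded T_cocone_ext_def]

abbreviation "lib_cocone_ext \<equiv> T_cocone_ext # lib_join_local_sym"
abbreviation "lev_cocone_ext \<equiv> Suc lev_join_local_sym"
definition [src_defs]: "cocone_ext = v lev_join_local_sym"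

definition [src_defs]: "join_ind Y P Q l r g = pi (Y \<rightarrow> univ) (\<lambda>D. pi (pi P (\<lambda>p. D $ (l p))) (\<lambda>a. pi (pi Q (\<lambda>q. D $ (r q))) (\<lambda>b.
  pi P (\<lambda>p. pi Q (\<lambda>q. eq (D $ (r q)) (path_tr (\<lambda>y. D $ y) (l p) (g p q) (a $ p)) (b $ q))) \<rightarrow> pi Y (\<lambda>y. D $ y))))"

text \<open>The leg on \<open>Q\<close> comes first because the paths in T u start at the value of
  the second leg, and \<open>g\<close> runs from \<open>l p\<close> to \<open>r q\<close>.\<close>

definition [src_defs]: "restrict Z l r g k = pair (lam (\<lambda>q. k (r q))) (lam (\<lambda>p. pair (k (l p)) (lam (\<lambda>q. path_ap Z k (l p) (g p q)))))"

definition [src_defs]: "for_gluing Y P Q b = pi (P \<rightarrow> Y) (\<lambda>l. pi (Q \<rightarrow> Y) (\<lambda>r. pi (pi P (\<lambda>p. pi Q (\<lambda>q. eq Y (l $ p) (r $ q)))) (\<lambda>g. b (\<lambda>x. l $ x) (\<lambda>x. r $ x) (\<lambda>x y. g $ x $ y))))"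

text \<open>The equality of two maps out of a glued type is checked on the two legs and on the glueing paths; only the induction principle into small families is needed.\<close>

definition "stm_restrict_inj = pi univ (\<lambda>Y. pi univ (\<lambda>P. pi univ (\<lambda>Q. pi univ (\<lambda>Z. for_gluing Y P Q (\<lambda>l r g. join_ind Y P Q l r g \<rightarrow> pi Z (\<lambda>z. pi (Y \<rightarrow> Z) (\<lambda>k.
   eq (cocones Q P Z) (const_cocone z) (restrict Z l r g (\<lambda>y. k $ y)) \<rightarrow> eq (Y \<rightarrow> Z) (lam (\<lambda>_. z)) k)))))))"

text \<open>The motive is \<open>z = k y\<close>. The components of the given path of cocones are
  exactly the two point cases. The remaining claim compares transport in this motive with
  concatenation by the image of the glueing path; induction on that path makes both trivial.\<close>

definition "prf_restrict_inj = lam4 (\<lambda>Y P Q Z. lam4 (\<lambda>l r g W. lam3 (\<lambda>z k e.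
  obt (cocone_ext $ Q $ P $ Z $ z $ (restrict Z (\<lambda>x. l $ x) (\<lambda>x. r $ x) (\<lambda>x y. g $ x $ y) (\<lambda>y. k $ y)) $ e) (\<lambda>a x. obt x (\<lambda>b c.
  htpy_to_path $ Y $ (lam (\<lambda>_. Z)) $ (lam (\<lambda>_. z)) $ k $ (W $ (lam (\<lambda>y. eq Z z (k $ y))) $ b $ a $ (lam2 (\<lambda>p q.
    ann (lamJ (lam3 (\<lambda>b a h. h))) (pi Y (\<lambda>y. pi (eq Y (l $ p) y) (\<lambda>g. pi (eq Z z (k $ (l $ p))) (\<lambda>b. pi (eq Z z (k $ y)) (\<lambda>a.
       eq (eq Z z (k $ y)) (path_cat Z z b (path_ap Z (\<lambda>y. k $ y) (l $ p) g)) a \<rightarrow> eq (eq Z z (k $ y)) (path_tr (\<lambda>y. eq Z z (k $ y)) (l $ p) g b) a)))))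
    $ (r $ q) $ (g $ p $ q) $ (b $ p) $ (a $ q) $ (c $ p $ q)))))))))"

definition "T_restrict_inj = tm_of (el (stm_restrict_inj lev_cocone_ext) lib_cocone_ext None)"

schematic_goal stm_restrict_inj: "val (el (stm_restrict_inj lev_cocone_ext) lib_cocone_ext None) ?r"
  by (simp only: stm_restrict_inj_def src_defs src_prims, simp only: check_simps cong: frozen_congs eval_congs val_cong) (rule valI)
lemmas T_restrict_inj = T_restrict_inj_def[unfolded stm_restrict_inj[unfolded val_def] tm_of_Ok]
schematic_goal lift_restrict_inj: "lval (lf k 0 T_restrict_inj) ?T"
  unfolding T_restrict_inj by (simp only: check_simps cong: frozen_congs eval_congs lval_cong) (rule lvalI)
lemmas [lift_lib] = lift_restrict_inj[unfolded lval_def]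

lemma prf_restrict_inj: "is_Ok (el (prf_restrict_inj lev_cocone_ext) lib_cocone_ext (Some T_restrict_inj))"
  unfolding T_restrict_inj prf_restrict_inj_def by (simp only: src_defs src_prims) (simp only: check_simps lift_lib cong: frozen_congs eval_congs)
lemmas inhabited_restrict_inj = inhabited_Cons[OF inhabited_cocone_ext stm_restrict_inj prf_restrict_inj[unfolded T_restrict_inj_def], folded T_restrict_inj_def]

abbreviation "lib_restrict_inj \<equiv> T_restrict_inj # lib_cocone_ext"
abbreviation "lev_restrict_inj \<equiv> Suc lev_cocone_ext"
definition [src_defs]: "restrict_inj = v lev_cocone_ext"

definition "stm_restrict_const = pi univ (\<lambda>Y. pi univ (\<lambda>P. pi univ (\<lambda>Q. pi univ (\<lambda>Z. for_gluing Y P Q (\<lambda>l r g. pi Z (\<lambda>z.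
   eq (cocones Q P Z) (restrict Z l r g (\<lambda>y. z)) (const_cocone z)))))))"

text \<open>The image of a path under a constant map is \<open>refl\<close>, by path induction, but
  this lies below two abstractions; each costs one use of function extensionality.\<close>

definition "prf_restrict_const = lam4 (\<lambda>Y P Q Z. lam4 (\<lambda>l r g z.
  path_ap (cocones Q P Z) (\<lambda>x. pair (lam (\<lambda>_. z)) x) (lam (\<lambda>p. pair z (lam (\<lambda>q. path_ap Z (\<lambda>_. z) (l $ p) (g $ p $ q)))))
   (htpy_to_path $ P $ (lam (\<lambda>_. apex Q Z (\<lambda>_. z))) $ (lam (\<lambda>p. pair z (lam (\<lambda>q. path_ap Z (\<lambda>_. z) (l $ p) (g $ p $ q))))) $ (lam (\<lambda>_. pair z (lam (\<lambda>_. refl)))) $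
     (lam (\<lambda>p. path_ap (apex Q Z (\<lambda>_. z)) (\<lambda>b. pair z b) (lam (\<lambda>q. path_ap Z (\<lambda>_. z) (l $ p) (g $ p $ q)))
        (htpy_to_path $ Q $ (lam (\<lambda>_. eq Z z z)) $ (lam (\<lambda>q. path_ap Z (\<lambda>_. z) (l $ p) (g $ p $ q))) $ (lam (\<lambda>_. refl)) $ (lam (\<lambda>q.
          ann (lamJ refl) (pi Y (\<lambda>y. pi (eq Y (l $ p) y) (\<lambda>g. eq (eq Z z z) (path_ap Z (\<lambda>_. z) (l $ p) g) refl))) $ (r $ q) $ (g $ p $ q)))))))))"

definition "T_restrict_const = tm_of (el (stm_restrict_const lev_restrict_inj) lib_restrict_inj None)"

schematic_goal stm_restrict_const: "val (el (stm_restrict_const lev_restrict_inj) lib_restrict_inj None) ?r"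
  by (simp only: stm_restrict_const_def src_defs src_prims, simp only: check_simps cong: frozen_congs eval_congs val_cong) (rule valI)
lemmas T_restrict_const = T_restrict_const_def[unfolded stm_restrict_const[unfolded val_def] tm_of_Ok]
schematic_goal lift_restrict_const: "lval (lf k 0 T_restrict_const) ?T"
  unfolding T_restrict_const by (simp only: check_simps cong: frozen_congs eval_congs lval_cong) (rule lvalI)
lemmas [lift_lib] = lift_restrict_const[unfolded lval_def]

lemma prf_restrict_const: "is_Ok (el (prf_restrict_const lev_restrict_inj) lib_restrict_inj (Some T_restrict_const))"
  unfolding T_restrict_const prf_restrict_const_def by (simp only: src_defs src_prims) (simp only: check_simps lift_lib cong: frozen_congs eval_congs)
lemmas inhabited_restrict_const = inhabited_Cons[OF inhabited_restrict_inj stm_restrict_const prf_restrict_const[unfolded T_restrict_const_def], folded T_restrict_const_def]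

abbreviation "lib_restrict_const \<equiv> T_restrict_const # lib_restrict_inj"
abbreviation "lev_restrict_const \<equiv> Suc lev_restrict_inj"
definition [src_defs]: "restrict_const = v lev_restrict_inj"

definition "stm_local_of_join_local = pi univ (\<lambda>Y. pi univ (\<lambda>P. pi univ (\<lambda>Q. pi univ (\<lambda>Z. for_gluing Y P Q (\<lambda>l r g. join_ind Y P Q l r g \<rightarrow> join_local Q P Z \<rightarrow> isLocal Y Z)))))"

text \<open>Both inverses are precomposed with restriction. The section homotopy for cocones becomes
  one for maps by \<open>restrict_inj\<close>; the retraction needs only that restricting a constant
  map gives the constant cocone.\<close>

definition "prf_local_of_join_local = lam4 (\<lambda>Y P Q Z. lam4 (\<lambda>l r g W. lam (\<lambda>h. obt h (\<lambda>a b. obt a (\<lambda>s t. obt b (\<lambda>m n.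
  (\<lambda>ee. pair (pair (lam (\<lambda>k. s $ (ee (\<lambda>y. k $ y)))) (lam (\<lambda>k. restrict_inj $ Y $ P $ Q $ Z $ l $ r $ g $ W $ (s $ (ee (\<lambda>y. k $ y))) $ k $ (t $ (ee (\<lambda>y. k $ y))))))
    (pair (lam (\<lambda>k. m $ (ee (\<lambda>y. k $ y)))) (lam (\<lambda>z. path_cat Z (m $ (ee (\<lambda>y. z))) (path_ap Z (\<lambda>c. m $ c) (ee (\<lambda>y. z)) (restrict_const $ Y $ P $ Q $ Z $ l $ r $ g $ z)) (n $ z)))))
  (restrict Z (\<lambda>x. l $ x) (\<lambda>x. r $ x) (\<lambda>x y. g $ x $ y))))))))"

definition "T_local_of_join_local = tm_of (el (stm_local_of_join_local lev_restrict_const) lib_restrict_const None)"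

schematic_goal stm_local_of_join_local: "val (el (stm_local_of_join_local lev_restrict_const) lib_restrict_const None) ?r"
  by (simp only: stm_local_of_join_local_def src_defs src_prims, simp only: check_simps cong: frozen_congs eval_congs val_cong) (rule valI)
lemmas T_local_of_join_local = T_local_of_join_local_def[unfolded stm_local_of_join_local[unfolded val_def] tm_of_Ok]
schematic_goal lift_local_of_join_local: "lval (lf k 0 T_local_of_join_local) ?T"
  unfolding T_local_of_join_local by (simp only: check_simps cong: frozen_congs eval_congs lval_cong) (rule lvalI)
lemmas [lift_lib] = lift_local_of_join_local[unfolded lval_def]

lemma prf_local_of_join_local: "is_Ok (el (prf_local_of_join_local lev_restrict_const) lib_restrict_const (Some T_local_of_join_local))"
  unfolding T_local_of_join_local prf_local_of_join_local_def by (simp only: src_defs src_prims) (simp only: check_simps lift_lib cong: frozen_congs eval_congs)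
lemmas inhabited_local_of_join_local = inhabited_Cons[OF inhabited_restrict_const stm_local_of_join_local prf_local_of_join_local[unfolded T_local_of_join_local_def], folded T_local_of_join_local_def]

abbreviation "lib_local_of_join_local \<equiv> T_local_of_join_local # lib_restrict_const"
abbreviation "lev_local_of_join_local \<equiv> Suc lev_restrict_const"
definition [src_defs]: "local_of_join_local = v lev_restrict_const"

definition "stm_join_local_of_local = pi univ (\<lambda>Y. pi univ (\<lambda>P. pi univ (\<lambda>Q. pi univ (\<lambda>Z. for_gluing Y P Q (\<lambda>l r g. join_ind Y P Q l r g \<rightarrow>
   sg (cocones Q P Z \<rightarrow> (Y \<rightarrow> Z)) (\<lambda>R. pi (cocones Q P Z) (\<lambda>c. eq (cocones Q P Z) (restrict Z l r g (\<lambda>y. R $ c $ y)) c)) \<rightarrow> isLocal Y Z \<rightarrow> join_local Q P Z)))))"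

text \<open>Here both inverses are precomposed with the extension \<open>f\<close>. Its equation
  \<open>ff\<close> together with \<open>restrict_const\<close> turns the section homotopy for maps
  into one for cocones, and \<open>restrict_inj\<close> identifies the extension of a constant
  cocone with a constant map.\<close>

definition "prf_join_local_of_local = lam4 (\<lambda>Y P Q Z. lam4 (\<lambda>l r g W. lam2 (\<lambda>x h. obt x (\<lambda>f ff. obt h (\<lambda>a b. obt a (\<lambda>s t. obt b (\<lambda>m n.
  (\<lambda>ee. pair (pair (lam (\<lambda>c. s $ (f $ c))) (lam (\<lambda>c. path_cat (cocones Q P Z) (const_cocone (s $ (f $ c))) (path_cat (cocones Q P Z) (const_cocone (s $ (f $ c)))
      (path_inv (cocones Q P Z) (ee (\<lambda>_. s $ (f $ c))) (restrict_const $ Y $ P $ Q $ Z $ l $ r $ g $ (s $ (f $ c))))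
      (path_ap (cocones Q P Z) (\<lambda>k. ee (\<lambda>y. k $ y)) (ann (lam (\<lambda>_. s $ (f $ c))) (Y \<rightarrow> Z)) (t $ (f $ c)))) (ff $ c))))
    (pair (lam (\<lambda>c. m $ (f $ c))) (lam (\<lambda>z. path_cat Z (m $ (f $ (const_cocone z))) (path_ap Z (\<lambda>k. m $ k) (f $ (const_cocone z))
       (path_inv (Y \<rightarrow> Z) (lam (\<lambda>_. z)) (restrict_inj $ Y $ P $ Q $ Z $ l $ r $ g $ W $ z $ (f $ (const_cocone z)) $ (path_inv (cocones Q P Z) (ee (\<lambda>y. f $ (const_cocone z) $ y)) (ff $ (const_cocone z)))))) (n $ z)))))
  (restrict Z (\<lambda>x. l $ x) (\<lambda>x. r $ x) (\<lambda>x y. g $ x $ y)))))))))"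

definition "T_join_local_of_local = tm_of (el (stm_join_local_of_local lev_local_of_join_local) lib_local_of_join_local None)"

schematic_goal stm_join_local_of_local: "val (el (stm_join_local_of_local lev_local_of_join_local) lib_local_of_join_local None) ?r"
  by (simp only: stm_join_local_of_local_def src_defs src_prims, simp only: check_simps cong: frozen_congs eval_congs val_cong) (rule valI)
lemmas T_join_local_of_local = T_join_local_of_local_def[unfolded stm_join_local_of_local[unfolded val_def] tm_of_Ok]
schematic_goal lift_join_local_of_local: "lval (lf k 0 T_join_local_of_local) ?T"
  unfolding T_join_local_of_local by (simp only: check_simps cong: frozen_congs eval_congs lval_cong) (rule lvalI)
lemmas [lift_lib] = lift_join_local_of_local[unfolded lval_def]

lemma prf_join_local_of_local: "is_Ok (el (prf_join_local_of_local lev_local_of_join_local) lib_local_of_join_local (Some T_join_local_of_local))"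
  unfolding T_join_local_of_local prf_join_local_of_local_def by (simp only: src_defs src_prims) (simp only: check_simps lift_lib cong: frozen_congs eval_congs)
lemmas inhabited_join_local_of_local = inhabited_Cons[OF inhabited_local_of_join_local stm_join_local_of_local prf_join_local_of_local[unfolded T_join_local_of_local_def], folded T_join_local_of_local_def]

abbreviation "lib_join_local_of_local \<equiv> T_join_local_of_local # lib_local_of_join_local"
abbreviation "lev_join_local_of_local \<equiv> Suc lev_local_of_join_local"
definition [src_defs]: "join_local_of_local = v lev_local_of_join_local"

section \<open>Induction and recursion for homotopy pushouts\<close>

definition [src_defs]: "pushout_ind Y A B C f g l r q = pi (Y \<rightarrow> univ) (\<lambda>D. pi (pi A (\<lambda>a. D $ (l a))) (\<lambda>a. pi (pi B (\<lambda>b. D $ (r b))) (\<lambda>b.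
  pi C (\<lambda>c. eq (D $ (r (g c))) (path_tr (\<lambda>y. D $ y) (l (f c)) (q c) (a $ (f c))) (b $ (g c))) \<rightarrow> pi Y (\<lambda>y. D $ y))))"

definition [src_defs]: "for_span b = pi univ (\<lambda>A. pi univ (\<lambda>B. pi univ (\<lambda>C. pi (C \<rightarrow> A) (\<lambda>f. pi (C \<rightarrow> B) (\<lambda>g. b A B C f g)))))"

definition "stm_pushout_has_ind = for_span (\<lambda>A B C f g. pushout_ind (push f g) A B C (\<lambda>c. f $ c) (\<lambda>c. g $ c) (\<lambda>a. pinl (push f g) a) (\<lambda>b. pinr (push f g) b) (\<lambda>c. pglue (push f g) c))"

definition "prf_pushout_has_ind = lam3 (\<lambda>A B C. lam2 (\<lambda>f g. lam4 (\<lambda>D a b h. lam (\<lambda>y. indpush (\<lambda>y. D $ y) (\<lambda>x. a $ x) (\<lambda>x. b $ x) (\<lambda>c. h $ c) y))))"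

definition "T_pushout_has_ind = tm_of (el (stm_pushout_has_ind lev_join_local_of_local) lib_join_local_of_local None)"

schematic_goal stm_pushout_has_ind: "val (el (stm_pushout_has_ind lev_join_local_of_local) lib_join_local_of_local None) ?r"
  by (simp only: stm_pushout_has_ind_def src_defs src_prims, simp only: check_simps cong: frozen_congs eval_congs val_cong) (rule valI)
lemmas T_pushout_has_ind = T_pushout_has_ind_def[unfolded stm_pushout_has_ind[unfolded val_def] tm_of_Ok]
schematic_goal lift_pushout_has_ind: "lval (lf k 0 T_pushout_has_ind) ?T"
  unfolding T_pushout_has_ind by (simp only: check_simps cong: frozen_congs eval_congs lval_cong) (rule lvalI)
lemmas [lift_lib] = lift_pushout_has_ind[unfolded lval_def]

lemma prf_pushout_has_ind: "is_Ok (el (prf_pushout_has_ind lev_join_local_of_local) lib_join_local_of_local (Some T_pushout_has_ind))"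
  unfolding T_pushout_has_ind prf_pushout_has_ind_def by (simp only: src_defs src_prims) (simp only: check_simps lift_lib cong: frozen_congs eval_congs)
lemmas inhabited_pushout_has_ind = inhabited_Cons[OF inhabited_join_local_of_local stm_pushout_has_ind prf_pushout_has_ind[unfolded T_pushout_has_ind_def], folded T_pushout_has_ind_def]

abbreviation "lib_pushout_has_ind \<equiv> T_pushout_has_ind # lib_join_local_of_local"
abbreviation "lev_pushout_has_ind \<equiv> Suc lev_join_local_of_local"
definition [src_defs]: "pushout_has_ind = v lev_join_local_of_local"

definition [src_defs]: "path_tr_const Z x p u = jj (\<lambda>y r. eq Z (path_tr (\<lambda>_. Z) x r u) u) refl p"

definition [src_defs]: "path_apd Z k x p = jj (\<lambda>y r. eq Z (path_tr (\<lambda>_. Z) x r (k x)) (k y)) refl p"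

definition "stm_ap_of_apd = pi univ (\<lambda>Y. pi univ (\<lambda>Z. pi (Y \<rightarrow> Z) (\<lambda>k. pi Y (\<lambda>x. pi Y (\<lambda>y. pi (eq Y x y) (\<lambda>p. pi (eq Z (k $ x) (k $ y)) (\<lambda>h.
  eq (eq Z (path_tr (\<lambda>_. Z) x p (k $ x)) (k $ y)) (path_apd Z (\<lambda>x. k $ x) x p) (path_cat Z (path_tr (\<lambda>_. Z) x p (k $ x)) (path_tr_const Z x p (k $ x)) h) \<rightarrow>
  eq (eq Z (k $ x) (k $ y)) (path_ap Z (\<lambda>x. k $ x) x p) h)))))))"

text \<open>After induction on \<open>p\<close> all transports vanish. The hypothesis then says that
  \<open>refl\<close> equals \<open>refl\<close> followed by \<open>h\<close>, and an induction on
  \<open>h\<close> shows that the latter is \<open>h\<close>.\<close>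

definition "prf_ap_of_apd = lam4 (\<lambda>Y Z k x. lamJ (lam2 (\<lambda>h e. path_cat (eq Z (k $ x) (k $ x)) refl e
   (ann (lamJ refl) (pi Z (\<lambda>z. pi (eq Z (k $ x) z) (\<lambda>h. eq (eq Z (k $ x) z) (path_cat Z (k $ x) (ann refl (eq Z (k $ x) (k $ x))) h) h))) $ (k $ x) $ h))))"

definition "T_ap_of_apd = tm_of (el (stm_ap_of_apd lev_pushout_has_ind) lib_pushout_has_ind None)"

schematic_goal stm_ap_of_apd: "val (el (stm_ap_of_apd lev_pushout_has_ind) lib_pushout_has_ind None) ?r"
  by (simp only: stm_ap_of_apd_def src_defs src_prims, simp only: check_simps cong: frozen_congs eval_congs val_cong) (rule valI)
lemmas T_ap_of_apd = T_ap_of_apd_def[unfolded stm_ap_of_apd[unfolded val_def] tm_of_Ok]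
schematic_goal lift_ap_of_apd: "lval (lf k 0 T_ap_of_apd) ?T"
  unfolding T_ap_of_apd by (simp only: check_simps cong: frozen_congs eval_congs lval_cong) (rule lvalI)
lemmas [lift_lib] = lift_ap_of_apd[unfolded lval_def]

lemma prf_ap_of_apd: "is_Ok (el (prf_ap_of_apd lev_pushout_has_ind) lib_pushout_has_ind (Some T_ap_of_apd))"
  unfolding T_ap_of_apd prf_ap_of_apd_def by (simp only: src_defs src_prims) (simp only: check_simps lift_lib cong: frozen_congs eval_congs)
lemmas inhabited_ap_of_apd = inhabited_Cons[OF inhabited_pushout_has_ind stm_ap_of_apd prf_ap_of_apd[unfolded T_ap_of_apd_def], folded T_ap_of_apd_def]

abbreviation "lib_ap_of_apd \<equiv> T_ap_of_apd # lib_pushout_has_ind"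
abbreviation "lev_ap_of_apd \<equiv> Suc lev_pushout_has_ind"
definition [src_defs]: "ap_of_apd = v lev_pushout_has_ind"

text \<open>The recursion data are passed to a continuation, so that \<open>indpush\<close> and
  \<open>pushbeta\<close> receive literally the same terms. The glueing case corrects
  \<open>H\<close> by the path for transport in a constant family, as in
  \<open>push_map\<close>.\<close>

definition [src_defs]: "pushout_rec_with f g X h k H b = b (\<lambda>_. X) (\<lambda>a. h $ a) (\<lambda>b. k $ b)
   (\<lambda>c. path_cat X (path_tr (\<lambda>_. X) (pinl (push f g) (f $ c)) (pglue (push f g) c) (h $ (f $ c)))
      (path_tr_const X (pinl (push f g) (f $ c)) (pglue (push f g) c) (h $ (f $ c))) (H $ c))"

definition [src_defs]: "pushout_map f g X h k H y = pushout_rec_with f g X h k H (\<lambda>D l r q. indpush D l r q y)"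

definition "stm_pushout_map_glue = for_span (\<lambda>A B C f g. pi univ (\<lambda>X. pi (A \<rightarrow> X) (\<lambda>h. pi (B \<rightarrow> X) (\<lambda>k. pi (pi C (\<lambda>c. eq X (h $ (f $ c)) (k $ (g $ c)))) (\<lambda>H. pi C (\<lambda>c.
  eq (eq X (h $ (f $ c)) (k $ (g $ c))) (path_ap X (\<lambda>y. pushout_map f g X h k H y) (pinl (push f g) (f $ c)) (pglue (push f g) c)) (H $ c)))))))"

text \<open>\<open>pushbeta\<close> describes the dependent action on the glueing path in a constant
  family, which is exactly the form that \<open>ap_of_apd\<close> converts into the ordinary
  action.\<close>

definition "prf_pushout_map_glue = lam3 (\<lambda>A B C. lam2 (\<lambda>f g. lam4 (\<lambda>X h k H. lam (\<lambda>c.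
   ap_of_apd $ (push f g) $ X $ (lam (\<lambda>y. pushout_map f g X h k H y)) $ (pinl (push f g) (f $ c)) $ (pinr (push f g) (g $ c)) $ (pglue (push f g) c) $ (H $ c) $
     (pushout_rec_with f g X h k H (\<lambda>D l r q. pushbeta D l r q c (push f g)))))))"

definition "T_pushout_map_glue = tm_of (el (stm_pushout_map_glue lev_ap_of_apd) lib_ap_of_apd None)"

schematic_goal stm_pushout_map_glue: "val (el (stm_pushout_map_glue lev_ap_of_apd) lib_ap_of_apd None) ?r"
  by (simp only: stm_pushout_map_glue_def src_defs src_prims, simp only: check_simps cong: frozen_congs eval_congs val_cong) (rule valI)
lemmas T_pushout_map_glue = T_pushout_map_glue_def[unfolded stm_pushout_map_glue[unfolded val_def] tm_of_Ok]
schematic_goal lift_pushout_map_glue: "lval (lf k 0 T_pushout_map_glue) ?T"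
  unfolding T_pushout_map_glue by (simp only: check_simps cong: frozen_congs eval_congs lval_cong) (rule lvalI)
lemmas [lift_lib] = lift_pushout_map_glue[unfolded lval_def]

lemma prf_pushout_map_glue: "is_Ok (el (prf_pushout_map_glue lev_ap_of_apd) lib_ap_of_apd (Some T_pushout_map_glue))"
  unfolding T_pushout_map_glue prf_pushout_map_glue_def by (simp only: src_defs src_prims) (simp only: check_simps lift_lib cong: frozen_congs eval_congs)
lemmas inhabited_pushout_map_glue = inhabited_Cons[OF inhabited_ap_of_apd stm_pushout_map_glue prf_pushout_map_glue[unfolded T_pushout_map_glue_def], folded T_pushout_map_glue_def]

abbreviation "lib_pushout_map_glue \<equiv> T_pushout_map_glue # lib_ap_of_apd"
abbreviation "lev_pushout_map_glue \<equiv> Suc lev_ap_of_apd"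
definition [src_defs]: "pushout_map_glue = v lev_ap_of_apd"

definition [src_defs]: "span_cocones A B C f g Z = sg (A \<rightarrow> Z) (\<lambda>h. sg (B \<rightarrow> Z) (\<lambda>k. pi C (\<lambda>c. eq Z (h $ (f c)) (k $ (g c)))))"

definition [src_defs]: "pushout_rec Y A B C f g l r q = pi univ (\<lambda>Z. pi (A \<rightarrow> Z) (\<lambda>h. pi (B \<rightarrow> Z) (\<lambda>k. pi (pi C (\<lambda>c. eq Z (h $ (f c)) (k $ (g c)))) (\<lambda>H.
   sg (Y \<rightarrow> Z) (\<lambda>F. eq (span_cocones A B C f g Z) (pair (lam (\<lambda>a. F $ (l a))) (pair (lam (\<lambda>b. F $ (r b))) (lam (\<lambda>c. path_ap Z (\<lambda>y. F $ y) (l (f c)) (q c)))))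
       (pair (lam (\<lambda>a. h $ a)) (pair (lam (\<lambda>b. k $ b)) H)))))))"

definition "stm_pushout_has_rec = for_span (\<lambda>A B C f g. pushout_rec (push f g) A B C (\<lambda>c. f $ c) (\<lambda>c. g $ c) (\<lambda>a. pinl (push f g) a) (\<lambda>b. pinr (push f g) b) (\<lambda>c. pglue (push f g) c))"

text \<open>The two legs agree by computation on points, which is why they are stated eta-expanded;
  only the glueing component needs a path.\<close>

definition "prf_pushout_has_rec = lam3 (\<lambda>A B C. lam2 (\<lambda>f g. lam4 (\<lambda>Z h k H. pair (lam (\<lambda>y. pushout_map f g Z h k H y))
   (path_ap (span_cocones A B C (\<lambda>c. f $ c) (\<lambda>c. g $ c) Z) (\<lambda>x. pair (lam (\<lambda>a. h $ a)) (pair (lam (\<lambda>b. k $ b)) x)) (lam (\<lambda>c. path_ap Z (\<lambda>y. pushout_map f g Z h k H y) (pinl (push f g) (f $ c)) (pglue (push f g) c)))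
     (htpy_to_path $ C $ (lam (\<lambda>c. eq Z (h $ (f $ c)) (k $ (g $ c)))) $ (lam (\<lambda>c. path_ap Z (\<lambda>y. pushout_map f g Z h k H y) (pinl (push f g) (f $ c)) (pglue (push f g) c))) $ H $
       (lam (\<lambda>c. pushout_map_glue $ A $ B $ C $ f $ g $ Z $ h $ k $ H $ c)))))))"

definition "T_pushout_has_rec = tm_of (el (stm_pushout_has_rec lev_pushout_map_glue) lib_pushout_map_glue None)"

schematic_goal stm_pushout_has_rec: "val (el (stm_pushout_has_rec lev_pushout_map_glue) lib_pushout_map_glue None) ?r"
  by (simp only: stm_pushout_has_rec_def src_defs src_prims, simp only: check_simps cong: frozen_congs eval_congs val_cong) (rule valI)
lemmas T_pushout_has_rec = T_pushout_has_rec_def[unfolded stm_pushout_has_rec[unfolded val_def] tm_of_Ok]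
schematic_goal lift_pushout_has_rec: "lval (lf k 0 T_pushout_has_rec) ?T"
  unfolding T_pushout_has_rec by (simp only: check_simps cong: frozen_congs eval_congs lval_cong) (rule lvalI)
lemmas [lift_lib] = lift_pushout_has_rec[unfolded lval_def]

lemma prf_pushout_has_rec: "is_Ok (el (prf_pushout_has_rec lev_pushout_map_glue) lib_pushout_map_glue (Some T_pushout_has_rec))"
  unfolding T_pushout_has_rec prf_pushout_has_rec_def by (simp only: src_defs src_prims) (simp only: check_simps lift_lib cong: frozen_congs eval_congs)
lemmas inhabited_pushout_has_rec = inhabited_Cons[OF inhabited_pushout_map_glue stm_pushout_has_rec prf_pushout_has_rec[unfolded T_pushout_has_rec_def], folded T_pushout_has_rec_def]

abbreviation "lib_pushout_has_rec \<equiv> T_pushout_has_rec # lib_pushout_map_glue"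
abbreviation "lev_pushout_has_rec \<equiv> Suc lev_pushout_map_glue"
definition [src_defs]: "pushout_has_rec = v lev_pushout_map_glue"

section \<open>The join of two types as a glued type\<close>

definition [src_defs]: "for_join Y M N k = pi (M \<rightarrow> Y) (\<lambda>l. pi (N \<rightarrow> Y) (\<lambda>r. pi (pi (prd M N) (\<lambda>c. eq Y (l $ (p1 c)) (r $ (p2 c)))) (\<lambda>q.
   pushout_ind Y M N (prd M N) (\<lambda>c. p1 c) (\<lambda>c. p2 c) (\<lambda>x. l $ x) (\<lambda>x. r $ x) (\<lambda>c. q $ c) \<rightarrow> pushout_rec Y M N (prd M N) (\<lambda>c. p1 c) (\<lambda>c. p2 c) (\<lambda>x. l $ x) (\<lambda>x. r $ x) (\<lambda>c. q $ c) \<rightarrow> k l r q)))"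

definition "stm_join_has_ind = pi univ (\<lambda>Y. pi univ (\<lambda>M. pi univ (\<lambda>N. for_join Y M N (\<lambda>l r q. join_ind Y M N (\<lambda>x. l $ x) (\<lambda>x. r $ x) (\<lambda>x y. q $ (ann (pair x y) (prd M N)))))))"

definition "prf_join_has_ind = lam4 (\<lambda>Y M N l. lam4 (\<lambda>r q W R. lam4 (\<lambda>D a b h. W $ D $ a $ b $ (lamP (\<lambda>x y. h $ x $ y)))))"

definition "T_join_has_ind = tm_of (el (stm_join_has_ind lev_pushout_has_rec) lib_pushout_has_rec None)"

schematic_goal stm_join_has_ind: "val (el (stm_join_has_ind lev_pushout_has_rec) lib_pushout_has_rec None) ?r"
  by (simp only: stm_join_has_ind_def src_defs src_prims, simp only: check_simps cong: frozen_congs eval_congs val_cong) (rule valI)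
lemmas T_join_has_ind = T_join_has_ind_def[unfolded stm_join_has_ind[unfolded val_def] tm_of_Ok]
schematic_goal lift_join_has_ind: "lval (lf k 0 T_join_has_ind) ?T"
  unfolding T_join_has_ind by (simp only: check_simps cong: frozen_congs eval_congs lval_cong) (rule lvalI)
lemmas [lift_lib] = lift_join_has_ind[unfolded lval_def]

lemma prf_join_has_ind: "is_Ok (el (prf_join_has_ind lev_pushout_has_rec) lib_pushout_has_rec (Some T_join_has_ind))"
  unfolding T_join_has_ind prf_join_has_ind_def by (simp only: src_defs src_prims) (simp only: check_simps lift_lib cong: frozen_congs eval_congs)
lemmas inhabited_join_has_ind = inhabited_Cons[OF inhabited_pushout_has_rec stm_join_has_ind prf_join_has_ind[unfolded T_join_has_ind_def], folded T_join_has_ind_def]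

abbreviation "lib_join_has_ind \<equiv> T_join_has_ind # lib_pushout_has_rec"
abbreviation "lev_join_has_ind \<equiv> Suc lev_pushout_has_rec"
definition [src_defs]: "join_has_ind = v lev_pushout_has_rec"

definition [src_defs]: "join_restrict l r q Z k = restrict Z (\<lambda>x. l $ x) (\<lambda>x. r $ x) (\<lambda>x y. q $ (pair x y)) k"

text \<open>Turns a cocone under the span \<open>M \<leftarrow> M \<times> N \<rightarrow> N\<close>
  into the curried form used for H(N,M).\<close>

definition [src_defs]: "phi M x = pair (p1 (p2 x)) (lam (\<lambda>m. pair (p1 x $ m) (lam (\<lambda>n. p2 (p2 x) $ (pair m n)))))"

definition [src_defs]: "expand w = lam (\<lambda>m. pair (p1 (w $ m)) (lam (\<lambda>n. p2 (w $ m) $ n)))"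

definition [src_defs]: "eta u = lam (\<lambda>n. u $ n)"

definition [src_defs]: "join_cocone l r q M N Z k = ann (pair (lam (\<lambda>a. k $ (l $ a))) (pair (lam (\<lambda>b. k $ (r $ b))) (lam (\<lambda>c. path_ap Z (\<lambda>y. k $ y) (l $ (p1 c)) (q $ c))))) (span_cocones M N (prd M N) (\<lambda>c. p1 c) (\<lambda>c. p2 c) Z)"

definition [src_defs]: "join_solution Y l r q M N Z u w = sg (Y \<rightarrow> Z) (\<lambda>F. eq (cocones N M Z) (join_restrict l r q Z (\<lambda>y. F $ y)) (pair u w))"

definition "stm_join_has_rec = pi univ (\<lambda>Y. pi univ (\<lambda>M. pi univ (\<lambda>N. for_join Y M N (\<lambda>l r q. pi univ (\<lambda>Z.
   sg (cocones N M Z \<rightarrow> Y \<rightarrow> Z) (\<lambda>R. pi (cocones N M Z) (\<lambda>c. eq (cocones N M Z) (join_restrict l r q Z (\<lambda>y. R $ c $ y)) c)))))))"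

text \<open>Recursion and \<open>phi\<close> solve the problem up to eta. \<open>k\<close> repairs
  the pairs and functions in T u, \<open>kk\<close> uses it to replace \<open>expand w\<close> by
  \<open>w\<close>, and \<open>k3\<close> replaces \<open>eta u\<close> by \<open>u\<close>,
  generalising over \<open>w\<close> because its type mentions \<open>u\<close>.\<close>

definition "prf_join_has_rec = lam4 (\<lambda>Y M N l. lam4 (\<lambda>r q W R. lam (\<lambda>Z.
  have' (ann (lam (\<lambda>u. lamP (\<lambda>z a. path_ap (apex N Z (\<lambda>n. u $ n)) (\<lambda>b. pair z b) (eta a) (htpy_to_path $ N $ (lam (\<lambda>n. eq Z z (u $ n))) $ (eta a) $ a $ (lam (\<lambda>n. refl))))))
     (pi (N \<rightarrow> Z) (\<lambda>u. pi (apex N Z (\<lambda>n. u $ n)) (\<lambda>t. eq (apex N Z (\<lambda>n. u $ n)) (pair (p1 t) (lam (\<lambda>n. p2 t $ n))) t)))) (\<lambda>k.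
  have' (ann (lam2 (\<lambda>u w. obt (R $ Z $ (lam (\<lambda>m. p1 (w $ m))) $ u $ (lam (\<lambda>c. p2 (w $ (p1 c)) $ (p2 c)))) (\<lambda>F e. pair F
         (path_cat (cocones N M Z) (join_restrict l r q Z (\<lambda>y. F $ y))
          (path_ap (cocones N M Z) (\<lambda>x. phi M x) (join_cocone l r q M N Z F) e)
          (path_ap (cocones N M Z) (\<lambda>x. pair (eta u) x) (expand w)
             (htpy_to_path $ M $ (lam (\<lambda>_. apex N Z (\<lambda>n. u $ n))) $ (expand w) $ w $ (lam (\<lambda>m. k $ u $ (w $ m)))))))))
      (pi (N \<rightarrow> Z) (\<lambda>u. pi (M \<rightarrow> apex N Z (\<lambda>n. u $ n)) (\<lambda>w. join_solution Y l r q M N Z (eta u) w)))) (\<lambda>kk.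
  have' (ann (lam2 (\<lambda>u w. jj (\<lambda>v s. pi (M \<rightarrow> apex N Z (\<lambda>n. v $ n)) (\<lambda>w. join_solution Y l r q M N Z v w)) (kk $ u) (htpy_to_path $ N $ (lam (\<lambda>_. Z)) $ (eta u) $ u $ (lam (\<lambda>_. refl))) $ w))
      (pi (N \<rightarrow> Z) (\<lambda>u. pi (M \<rightarrow> apex N Z (\<lambda>n. u $ n)) (\<lambda>w. join_solution Y l r q M N Z u w)))) (\<lambda>k3.
  pair (lam (\<lambda>c. p1 (k3 $ (p1 c) $ (p2 c)))) (lamP (\<lambda>u w. p2 (k3 $ u $ w)))))))))"

definition "T_join_has_rec = tm_of (el (stm_join_has_rec lev_join_has_ind) lib_join_has_ind None)"

schematic_goal stm_join_has_rec: "val (el (stm_join_has_rec lev_join_has_ind) lib_join_has_ind None) ?r"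
  by (simp only: stm_join_has_rec_def src_defs src_prims, simp only: check_simps cong: frozen_congs eval_congs val_cong) (rule valI)
lemmas T_join_has_rec = T_join_has_rec_def[unfolded stm_join_has_rec[unfolded val_def] tm_of_Ok]
schematic_goal lift_join_has_rec: "lval (lf k 0 T_join_has_rec) ?T"
  unfolding T_join_has_rec by (simp only: check_simps cong: frozen_congs eval_congs lval_cong) (rule lvalI)
lemmas [lift_lib] = lift_join_has_rec[unfolded lval_def]

lemma prf_join_has_rec: "is_Ok (el (prf_join_has_rec lev_join_has_ind) lib_join_has_ind (Some T_join_has_rec))"
  unfolding T_join_has_rec prf_join_has_rec_def by (simp only: src_defs src_prims) (simp only: check_simps lift_lib cong: frozen_congs eval_congs)
lemmas inhabited_join_has_rec = inhabited_Cons[OF inhabited_join_has_ind stm_join_has_rec prf_join_has_rec[unfolded T_join_has_rec_def], folded T_join_has_rec_def]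

abbreviation "lib_join_has_rec \<equiv> T_join_has_rec # lib_join_has_ind"
abbreviation "lev_join_has_rec \<equiv> Suc lev_join_has_ind"
definition [src_defs]: "join_has_rec = v lev_join_has_ind"

section \<open>Fibres of a map out of a pushout\<close>

definition [src_defs]: "path_cat_refl X x h = jj (\<lambda>z h. eq (eq X x z) (path_cat X x (ann refl (eq X x x)) h) h) refl h"

definition [src_defs]: "fibre Y X j x = sg Y (\<lambda>y. eq X (j y) x)"

text \<open>Lifts \<open>p\<close> to the fibre over \<open>x\<close>. Eliminating \<open>s\<close>
  replaces \<open>h\<close> by the image of \<open>p\<close>, eliminating \<open>p\<close> makes
  this image \<open>refl\<close>, and what remains is the left unit law.\<close>

definition [src_defs]: "fibre_glue Y X j x y yy p h s e = jj (\<lambda>h s. eq (fibre Y X j x) (pair y (path_cat X (j y) h e)) (pair yy e))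
   (jj (\<lambda>yy p. pi (eq X (j yy) x) (\<lambda>e. eq (fibre Y X j x) (pair y (path_cat X (j y) (path_ap X j y p) e)) (pair yy e)))
      (lam (\<lambda>e. path_ap (fibre Y X j x) (\<lambda>e. pair y e) (path_cat X (j y) (ann refl (eq X (j y) (j y))) e) (path_cat_refl X (j y) e))) p $ e) s"

text \<open>Transport in the fibres of \<open>j\<close> along a path \<open>h : j y = j y'\<close> that is the image of \<open>p : y = y'\<close>, in the form needed for the glueing case of the next induction.\<close>

definition "stm_fibre_transport = pi univ (\<lambda>Y. pi univ (\<lambda>X. pi (Y \<rightarrow> X) (\<lambda>j. pi X (\<lambda>x. pi (fibre Y X (\<lambda>y. j $ y) x \<rightarrow> univ) (\<lambda>D. pi Y (\<lambda>y.
   pi Y (\<lambda>yy. pi (eq Y y yy) (\<lambda>p. pi (eq X (j $ y) (j $ yy)) (\<lambda>h. pi (eq (eq X (j $ y) (j $ yy)) (path_ap X (\<lambda>y. j $ y) y p) h) (\<lambda>s.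
   pi (pi (eq X (j $ y) x) (\<lambda>e. D $ (pair y e))) (\<lambda>l. pi (pi (eq X (j $ yy) x) (\<lambda>e. D $ (pair yy e))) (\<lambda>r.
   pi (eq X (j $ yy) x) (\<lambda>e. eq (D $ (pair yy e)) (path_tr (\<lambda>t. D $ t) (ann (pair y (path_cat X (j $ y) h e)) (fibre Y X (\<lambda>y. j $ y) x)) (fibre_glue Y X (\<lambda>y. j $ y) x y yy p h s e) (l $ (path_cat X (j $ y) h e))) (r $ e)) \<rightarrow>
   eq (pi (eq X (j $ yy) x) (\<lambda>e. D $ (pair yy e))) (path_tr (\<lambda>y. pi (eq X (j $ y) x) (\<lambda>e. D $ (pair y e))) y p l) r))))))))))))"

text \<open>With \<open>p\<close> and \<open>h\<close> trivial the claim is that \<open>l\<close>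
  and \<open>r\<close> agree. The hypothesis at \<open>e\<close> transports the value of
  \<open>l\<close> at \<open>refl\<close> followed by \<open>e\<close> along the left unit path and
  reaches \<open>r e\<close>; the same transport reaches \<open>l e\<close> by induction on the unit
  path.\<close>

definition "prf_fibre_transport = lam4 (\<lambda>Y X j x. lam2 (\<lambda>D y. lamJ (lamJ (lam3 (\<lambda>l r q. htpy_to_path $ (eq X (j $ y) x) $ (lam (\<lambda>e. D $ (pair y e))) $ l $ r $ (lam (\<lambda>e.
   (\<lambda>F e1. (\<lambda>t. path_cat (D $ (pair y e)) (l $ e) (path_inv (D $ (pair y e)) t
        (ann (lamJ refl) (pi (eq X (j $ y) x) (\<lambda>e2. pi (eq (eq X (j $ y) x) e1 e2) (\<lambda>m. eq (D $ (pair y e2)) (path_tr (\<lambda>t. D $ t) (ann (pair y e1) F) (path_ap F (\<lambda>e. pair y e) e1 m) (l $ e1)) (l $ e2)))) $ e $ (path_cat_refl X (j $ y) e))) (q $ e))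
      (path_tr (\<lambda>t. D $ t) (ann (pair y e1) F) (path_ap F (\<lambda>e. pair y e) e1 (path_cat_refl X (j $ y) e)) (l $ e1)))
   (fibre Y X (\<lambda>y. j $ y) x) (path_cat X (j $ y) (ann refl (eq X (j $ y) (j $ y))) e))))))))"

definition "T_fibre_transport = tm_of (el (stm_fibre_transport lev_join_has_rec) lib_join_has_rec None)"

schematic_goal stm_fibre_transport: "val (el (stm_fibre_transport lev_join_has_rec) lib_join_has_rec None) ?r"
  by (simp only: stm_fibre_transport_def src_defs src_prims, simp only: check_simps cong: frozen_congs eval_congs val_cong) (rule valI)
lemmas T_fibre_transport = T_fibre_transport_def[unfolded stm_fibre_transport[unfolded val_def] tm_of_Ok]
schematic_goal lift_fibre_transport: "lval (lf k 0 T_fibre_transport) ?T"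
  unfolding T_fibre_transport by (simp only: check_simps cong: frozen_congs eval_congs lval_cong) (rule lvalI)
lemmas [lift_lib] = lift_fibre_transport[unfolded lval_def]

lemma prf_fibre_transport: "is_Ok (el (prf_fibre_transport lev_join_has_rec) lib_join_has_rec (Some T_fibre_transport))"
  unfolding T_fibre_transport prf_fibre_transport_def by (simp only: src_defs src_prims) (simp only: check_simps lift_lib cong: frozen_congs eval_congs)
lemmas inhabited_fibre_transport = inhabited_Cons[OF inhabited_join_has_rec stm_fibre_transport prf_fibre_transport[unfolded T_fibre_transport_def], folded T_fibre_transport_def]

abbreviation "lib_fibre_transport \<equiv> T_fibre_transport # lib_join_has_rec"
abbreviation "lev_fibre_transport \<equiv> Suc lev_join_has_rec"
definition [src_defs]: "fibre_transport = v lev_join_has_rec"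

definition [src_defs]: "fib_of A X k x = sg A (\<lambda>a. eq X (k a) x)"

definition [src_defs]: "pullback_of A B X j l r = sg A (\<lambda>a. sg B (\<lambda>b. eq X (j (l a)) (j (r b))))"

text \<open>The maps into \<open>X\<close> are taken to be the composites of \<open>j\<close> with
  the two legs. The hypothesis \<open>s\<close> is what remains of the definition of
  \<open>j\<close> by pushout recursion: it sends each glueing path to the path stored in the point
  of the pullback.\<close>

definition [src_defs]: "for_join_over Y A B X k = pi (Y \<rightarrow> X) (\<lambda>j. pi (A \<rightarrow> Y) (\<lambda>l. pi (B \<rightarrow> Y) (\<lambda>r. pi (pi (pullback_of A B X (\<lambda>y. j $ y) (\<lambda>a. l $ a) (\<lambda>b. r $ b)) (\<lambda>c. eq Y (l $ (p1 c)) (r $ (p1 (p2 c))))) (\<lambda>q.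
   pi (pushout_ind Y A B (pullback_of A B X (\<lambda>y. j $ y) (\<lambda>a. l $ a) (\<lambda>b. r $ b)) (\<lambda>c. p1 c) (\<lambda>c. p1 (p2 c)) (\<lambda>a. l $ a) (\<lambda>b. r $ b) (\<lambda>c. q $ c)) (\<lambda>W.
   pi (pi (pullback_of A B X (\<lambda>y. j $ y) (\<lambda>a. l $ a) (\<lambda>b. r $ b)) (\<lambda>c. eq (eq X (j $ (l $ (p1 c))) (j $ (r $ (p1 (p2 c))))) (path_ap X (\<lambda>y. j $ y) (l $ (p1 c)) (q $ c)) (p2 (p2 c)))) (\<lambda>s. k j l r q s))))))"

text \<open>Once \<open>d\<close> is eliminated, \<open>e\<close> is itself a path from
  \<open>j (l a)\<close> to \<open>j (r b)\<close>, hence together with \<open>a\<close> and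
  \<open>b\<close> a point of the pullback, and its glueing path lifts to the fibre.\<close>

definition [src_defs]: "over_glue A B X Y j l r q s a b x e d = jj (\<lambda>x d. pi (eq X (j $ (l $ a)) x) (\<lambda>e. eq (fibre Y X (\<lambda>y. j $ y) x) (pair (l $ a) e) (pair (r $ b) d)))
   (lam (\<lambda>e. fibre_glue Y X (\<lambda>y. j $ y) (j $ (r $ b)) (l $ a) (r $ b) (q $ (pair a (pair b e))) e (s $ (pair a (pair b e))) (ann refl (eq X (j $ (r $ b)) (j $ (r $ b)))))) d $ e"

definition [src_defs]: "over_glue_type X j l r q x D a b c = eq (pi (eq X (j $ (r $ (p1 (p2 c)))) x) (\<lambda>e. D $ (pair (r $ (p1 (p2 c))) e)))
   (path_tr (\<lambda>y. pi (eq X (j $ y) x) (\<lambda>e. D $ (pair y e))) (l $ (p1 c)) (q $ c) (lam (\<lambda>e. a $ (pair (p1 c) e)))) (lam (\<lambda>e. b $ (pair (p1 (p2 c)) e)))"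

text \<open>Induction over the pushout with the motive \<open>\<Prod>(e : j t = x). D (t, e)\<close>.\<close>

definition "stm_fibre_join_ind = pi univ (\<lambda>Y. pi univ (\<lambda>A. pi univ (\<lambda>B. pi univ (\<lambda>X. for_join_over Y A B X (\<lambda>j l r q s. pi X (\<lambda>x.
   sg (pi (fib_of A X (\<lambda>a. j $ (l $ a)) x) (\<lambda>t. pi (fib_of B X (\<lambda>b. j $ (r $ b)) x) (\<lambda>u. eq (fibre Y X (\<lambda>y. j $ y) x) (pair (l $ (p1 t)) (p2 t)) (pair (r $ (p1 u)) (p2 u)))))
    (\<lambda>g. join_ind (fibre Y X (\<lambda>y. j $ y) x) (fib_of A X (\<lambda>a. j $ (l $ a)) x) (fib_of B X (\<lambda>b. j $ (r $ b)) x) (\<lambda>t. pair (l $ (p1 t)) (p2 t)) (\<lambda>u. pair (r $ (p1 u)) (p2 u)) (\<lambda>t u. g $ t $ u))))))))"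

text \<open>In the glueing case \<open>fibre_transport\<close> asks for an equation over the path
  \<open>fibre_glue\<close>, whereas the hypothesis \<open>S\<close> gives it over
  \<open>over_glue\<close>. Both paths agree by induction on \<open>e\<close>, since for
  \<open>e = refl\<close> they compute to the same term.\<close>

definition "prf_fibre_join_ind = lam4 (\<lambda>Y A B X. lam4 (\<lambda>j l r q. lam3 (\<lambda>W s x.
   pair (lamP (\<lambda>a e. lamP (\<lambda>b d. over_glue A B X Y j l r q s a b x e d))) (lam4 (\<lambda>D m n S.
   have' (ann (lam (\<lambda>a. lamP (\<lambda>b h. fibre_transport $ Y $ X $ j $ x $ D $ (l $ a) $ (r $ b) $ (q $ (pair a (pair b h))) $ h $ (s $ (pair a (pair b h))) $
       (lam (\<lambda>e. m $ (pair a e))) $ (lam (\<lambda>e. n $ (pair b e))) $ (lam (\<lambda>e.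
         jj (\<lambda>t z. eq (D $ (pair (r $ b) e)) (path_tr (\<lambda>y. D $ y) (ann (pair (l $ a) (path_cat X (j $ (l $ a)) h e)) (fibre Y X (\<lambda>y. j $ y) x)) t (m $ (pair a (path_cat X (j $ (l $ a)) h e)))) (n $ (pair b e)))
          (S $ (pair a (path_cat X (j $ (l $ a)) h e)) $ (pair b e))
          (ann (lamJ refl) (pi X (\<lambda>x. pi (eq X (j $ (r $ b)) x) (\<lambda>e. eq (eq (fibre Y X (\<lambda>y. j $ y) x) (pair (l $ a) (path_cat X (j $ (l $ a)) h e)) (pair (r $ b) e))
              (over_glue A B X Y j l r q s a b x (path_cat X (j $ (l $ a)) h e) e)
              (fibre_glue Y X (\<lambda>y. j $ y) x (l $ a) (r $ b) (q $ (pair a (pair b h))) h (s $ (pair a (pair b h))) e)))) $ x $ e))))))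
     (pi A (\<lambda>a. pi (sg B (\<lambda>b. eq X (j $ (l $ a)) (j $ (r $ b)))) (\<lambda>d. over_glue_type X j l r q x D m n (ann (pair a d) (pullback_of A B X (\<lambda>y. j $ y) (\<lambda>a. l $ a) (\<lambda>b. r $ b))))))) (\<lambda>k.
   lamP (\<lambda>y e. W $ (lam (\<lambda>y. pi (eq X (j $ y) x) (\<lambda>e. D $ (pair y e)))) $ (lam2 (\<lambda>a e. m $ (pair a e))) $ (lam2 (\<lambda>b e. n $ (pair b e))) $ (lamP (\<lambda>a d. k $ a $ d)) $ y $ e)))))))"

definition "T_fibre_join_ind = tm_of (el (stm_fibre_join_ind lev_fibre_transport) lib_fibre_transport None)"

schematic_goal stm_fibre_join_ind: "val (el (stm_fibre_join_ind lev_fibre_transport) lib_fibre_transport None) ?r"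
  by (simp only: stm_fibre_join_ind_def src_defs src_prims, simp only: check_simps cong: frozen_congs eval_congs val_cong) (rule valI)
lemmas T_fibre_join_ind = T_fibre_join_ind_def[unfolded stm_fibre_join_ind[unfolded val_def] tm_of_Ok]
schematic_goal lift_fibre_join_ind: "lval (lf k 0 T_fibre_join_ind) ?T"
  unfolding T_fibre_join_ind by (simp only: check_simps cong: frozen_congs eval_congs lval_cong) (rule lvalI)
lemmas [lift_lib] = lift_fibre_join_ind[unfolded lval_def]

lemma prf_fibre_join_ind: "is_Ok (el (prf_fibre_join_ind lev_fibre_transport) lib_fibre_transport (Some T_fibre_join_ind))"
  unfolding T_fibre_join_ind prf_fibre_join_ind_def by (simp only: src_defs src_prims) (simp only: check_simps lift_lib cong: frozen_congs eval_congs)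
lemmas inhabited_fibre_join_ind = inhabited_Cons[OF inhabited_fibre_transport stm_fibre_join_ind prf_fibre_join_ind[unfolded T_fibre_join_ind_def], folded T_fibre_join_ind_def]

abbreviation "lib_fibre_join_ind \<equiv> T_fibre_join_ind # lib_fibre_transport"
abbreviation "lev_fibre_join_ind \<equiv> Suc lev_fibre_transport"
definition [src_defs]: "fibre_join_ind = v lev_fibre_transport"

section \<open>Connectedness of the fibres\<close>

definition [src_defs]: "connected M P = pi univ (\<lambda>Z. isLocal M Z \<rightarrow> isLocal P Z)"

definition "stm_join_local_chain = pi univ (\<lambda>M. pi univ (\<lambda>N. pi univ (\<lambda>P. pi univ (\<lambda>Q. connected M P \<rightarrow> connected N Q \<rightarrow> pi univ (\<lambda>Z. join_local N M Z \<rightarrow> join_local Q P Z)))))"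

text \<open>\<open>a\<close> is used at T u for \<open>u\<close> defined on \<open>N\<close>, and
  \<open>b\<close> at T u for \<open>u\<close> defined on \<open>P\<close>. Only the second leg of H
  can be exchanged, hence the two uses of symmetry.\<close>

definition "prf_join_local_chain = lam4 (\<lambda>M N P Q. lam4 (\<lambda>a b Z h.
   join_local_sym $ P $ Q $ Z $ (join_local_of_apex $ P $ Q $ Z $ (lam (\<lambda>u. b $ (apex P Z (\<lambda>p. u $ p)) $ (apex_local $ P $ N $ Z $
    (join_local_sym $ N $ P $ Z $ (join_local_of_apex $ N $ P $ Z $ (lam (\<lambda>u. a $ (apex N Z (\<lambda>p. u $ p)) $ (apex_local $ N $ M $ Z $ h $ u))))) $ u))))))"

definition "T_join_local_chain = tm_of (el (stm_join_local_chain lev_fibre_join_ind) lib_fibre_join_ind None)"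

schematic_goal stm_join_local_chain: "val (el (stm_join_local_chain lev_fibre_join_ind) lib_fibre_join_ind None) ?r"
  by (simp only: stm_join_local_chain_def src_defs src_prims, simp only: check_simps cong: frozen_congs eval_congs val_cong) (rule valI)
lemmas T_join_local_chain = T_join_local_chain_def[unfolded stm_join_local_chain[unfolded val_def] tm_of_Ok]
schematic_goal lift_join_local_chain: "lval (lf k 0 T_join_local_chain) ?T"
  unfolding T_join_local_chain by (simp only: check_simps cong: frozen_congs eval_congs lval_cong) (rule lvalI)
lemmas [lift_lib] = lift_join_local_chain[unfolded lval_def]

lemma prf_join_local_chain: "is_Ok (el (prf_join_local_chain lev_fibre_join_ind) lib_fibre_join_ind (Some T_join_local_chain))"
  unfolding T_join_local_chain prf_join_local_chain_def by (simp only: src_defs src_prims) (simp only: check_simps lift_lib cong: frozen_congs eval_congs)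
lemmas inhabited_join_local_chain = inhabited_Cons[OF inhabited_fibre_join_ind stm_join_local_chain prf_join_local_chain[unfolded T_join_local_chain_def], folded T_join_local_chain_def]

abbreviation "lib_join_local_chain \<equiv> T_join_local_chain # lib_fibre_join_ind"
abbreviation "lev_join_local_chain \<equiv> Suc lev_fibre_join_ind"
definition [src_defs]: "join_local_chain = v lev_fibre_join_ind"

definition "stm_fibre_connected = pi univ (\<lambda>M. pi univ (\<lambda>N. pi univ (\<lambda>I. for_join I M N (\<lambda>jl jr jq.
   pi univ (\<lambda>Y. pi univ (\<lambda>A. pi univ (\<lambda>B. pi univ (\<lambda>X. for_join_over Y A B X (\<lambda>j l r q s.
   pi X (\<lambda>x. connected M (fib_of A X (\<lambda>a. j $ (l $ a)) x)) \<rightarrow> pi X (\<lambda>x. connected N (fib_of B X (\<lambda>b. j $ (r $ b)) x)) \<rightarrow> pi X (\<lambda>x. connected I (fibre Y X (\<lambda>y. j $ y) x)))))))))))"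

text \<open>The two joins are treated differently: for \<open>I\<close> induction and recursion turn
  locality into H(N,M), while the fibre enters only through its induction principle, which leads
  from H back to locality.\<close>

definition "prf_fibre_connected = lam4 (\<lambda>M N I jl. lam4 (\<lambda>jr jq jW jR. lam4 (\<lambda>Y A B X. lam4 (\<lambda>j l r q. lam4 (\<lambda>W s cf cg. lam3 (\<lambda>x Z h.
   obt (fibre_join_ind $ Y $ A $ B $ X $ j $ l $ r $ q $ W $ s $ x) (\<lambda>g V.
    local_of_join_local $ (fibre Y X (\<lambda>y. j $ y) x) $ (fib_of A X (\<lambda>a. j $ (l $ a)) x) $ (fib_of B X (\<lambda>b. j $ (r $ b)) x) $ Z $
      (lam (\<lambda>t. pair (l $ (p1 t)) (p2 t))) $ (lam (\<lambda>u. pair (r $ (p1 u)) (p2 u))) $ g $ V $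
      (join_local_chain $ M $ N $ (fib_of A X (\<lambda>a. j $ (l $ a)) x) $ (fib_of B X (\<lambda>b. j $ (r $ b)) x) $ (cf $ x) $ (cg $ x) $ Z $
        (join_local_of_local $ I $ M $ N $ Z $ jl $ jr $ (lam2 (\<lambda>x y. jq $ (pair x y))) $ (join_has_ind $ I $ M $ N $ jl $ jr $ jq $ jW $ jR) $ (join_has_rec $ I $ M $ N $ jl $ jr $ jq $ jW $ jR $ Z) $ h)))))))))"

definition "T_fibre_connected = tm_of (el (stm_fibre_connected lev_join_local_chain) lib_join_local_chain None)"

schematic_goal stm_fibre_connected: "val (el (stm_fibre_connected lev_join_local_chain) lib_join_local_chain None) ?r"
  by (simp only: stm_fibre_connected_def src_defs src_prims, simp only: check_simps cong: frozen_congs eval_congs val_cong) (rule valI)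
lemmas T_fibre_connected = T_fibre_connected_def[unfolded stm_fibre_connected[unfolded val_def] tm_of_Ok]
schematic_goal lift_fibre_connected: "lval (lf k 0 T_fibre_connected) ?T"
  unfolding T_fibre_connected by (simp only: check_simps cong: frozen_congs eval_congs lval_cong) (rule lvalI)
lemmas [lift_lib] = lift_fibre_connected[unfolded lval_def]

lemma prf_fibre_connected: "is_Ok (el (prf_fibre_connected lev_join_local_chain) lib_join_local_chain (Some T_fibre_connected))"
  unfolding T_fibre_connected prf_fibre_connected_def by (simp only: src_defs src_prims) (simp only: check_simps lift_lib cong: frozen_congs eval_congs)
lemmas inhabited_fibre_connected = inhabited_Cons[OF inhabited_join_local_chain stm_fibre_connected prf_fibre_connected[unfolded T_fibre_connected_def], folded T_fibre_connected_def]

abbreviation "lib_fibre_connected \<equiv> T_fibre_connected # lib_join_local_chain"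
abbreviation "lev_fibre_connected \<equiv> Suc lev_join_local_chain"
definition [src_defs]: "fibre_connected = v lev_join_local_chain"

text \<open>The map \<open>j\<close> is only required to satisfy the pushout laws up to the given paths, and \<open>f\<close>, \<open>g\<close> are the composites \<open>j \<circ> l\<close>, \<open>j \<circ> r\<close>; this avoids normalising the concrete pushout.\<close>

definition "stm_join_over_connected = pi univ (\<lambda>M. pi univ (\<lambda>N.
   pi univ (\<lambda>Y. pi univ (\<lambda>A. pi univ (\<lambda>B. pi univ (\<lambda>X. for_join_over Y A B X (\<lambda>j l r q s.
   pi X (\<lambda>x. connected M (fib_of A X (\<lambda>a. j $ (l $ a)) x)) \<rightarrow> pi X (\<lambda>x. connected N (fib_of B X (\<lambda>b. j $ (r $ b)) x)) \<rightarrow> pi X (\<lambda>x. connected (jtype M N) (fibre Y X (\<lambda>y. j $ y) x)))))))))"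

definition "prf_join_over_connected = lam2 (\<lambda>M N.
    fibre_connected $ M $ N $ (jtype M N) $ (lam (\<lambda>m. pinl (jtype M N) m)) $ (lam (\<lambda>n. pinr (jtype M N) n)) $ (lam (\<lambda>c. pglue (jtype M N) c)) $
      (pushout_has_ind $ M $ N $ (prd M N) $ (lam (\<lambda>c. p1 c)) $ (lam (\<lambda>c. p2 c))) $
      (pushout_has_rec $ M $ N $ (prd M N) $ (lam (\<lambda>c. p1 c)) $ (lam (\<lambda>c. p2 c))))"

definition "T_join_over_connected = tm_of (el (stm_join_over_connected lev_fibre_connected) lib_fibre_connected None)"

schematic_goal stm_join_over_connected: "val (el (stm_join_over_connected lev_fibre_connected) lib_fibre_connected None) ?r"
  by (simp only: stm_join_over_connected_def src_defs src_prims, simp only: check_simps cong: frozen_congs eval_congs val_cong) (rule valI)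
lemmas T_join_over_connected = T_join_over_connected_def[unfolded stm_join_over_connected[unfolded val_def] tm_of_Ok]
schematic_goal lift_join_over_connected: "lval (lf k 0 T_join_over_connected) ?T"
  unfolding T_join_over_connected by (simp only: check_simps cong: frozen_congs eval_congs lval_cong) (rule lvalI)
lemmas [lift_lib] = lift_join_over_connected[unfolded lval_def]

lemma prf_join_over_connected: "is_Ok (el (prf_join_over_connected lev_fibre_connected) lib_fibre_connected (Some T_join_over_connected))"
  unfolding T_join_over_connected prf_join_over_connected_def by (simp only: src_defs src_prims) (simp only: check_simps lift_lib cong: frozen_congs eval_congs)
lemmas inhabited_join_over_connected = inhabited_Cons[OF inhabited_fibre_connected stm_join_over_connected prf_join_over_connected[unfolded T_join_over_connected_def], folded T_join_over_connected_def]

abbreviation "lib_join_over_connected \<equiv> T_join_over_connected # lib_fibre_connected"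
abbreviation "lev_join_over_connected \<equiv> Suc lev_fibre_connected"
definition [src_defs]: "join_over_connected = v lev_fibre_connected"
section \<open>Pushout data in the language of the theorem\<close>

text \<open>These are the hypotheses of \<open>for_join_over\<close> as terms in arbitrary
  arguments. They evaluate to the normal forms of the source versions, and a substitution can be
  pushed into the arguments, which instantiates a derivation about variables at arbitrary
  terms.\<close>

definition glue_htpy :: "tm \<Rightarrow> tm \<Rightarrow> tm \<Rightarrow> tm \<Rightarrow> tm \<Rightarrow> tm \<Rightarrow> tm"
  where "glue_htpy Y C f g l r =
    Pi C (Eq (wk 1 Y) (App (wk 1 l) (App (wk 1 f) (Var 0))) (App (wk 1 r) (App (wk 1 g) (Var 0))))"

definition small_ind :: "tm \<Rightarrow> tm \<Rightarrow> tm \<Rightarrow> tm \<Rightarrow> tm \<Rightarrow> tm \<Rightarrow> tm \<Rightarrow> tm \<Rightarrow> tm \<Rightarrow> tm"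
  where "small_ind Y A B C f g l r q =
    Pi (Arr Y Univ)
      (Pi (Pi (wk 1 A) (App (Var 1) (App (wk 2 l) (Var 0))))
        (Pi (Pi (wk 2 B) (App (Var 2) (App (wk 3 r) (Var 0))))
          (Pi (Pi (wk 3 C)
                (Eq (App (Var 3) (App (wk 4 r) (App (wk 4 g) (Var 0))))
                  (transport (App (Var 4) (Var 0)) (App (wk 4 l) (App (wk 4 f) (Var 0))) (App (wk 4 q) (Var 0))
                    (App (Var 2) (App (wk 4 f) (Var 0))))
                  (App (Var 1) (App (wk 4 g) (Var 0)))))
            (Pi (wk 4 Y) (App (Var 4) (Var 0))))))"

definition ap_path :: "tm \<Rightarrow> tm \<Rightarrow> tm \<Rightarrow> tm \<Rightarrow> tm"
  where "ap_path B f x p = J (Eq (wk 2 B) (App (wk 2 f) (wk 2 x)) (App (wk 2 f) (Var 1))) (Refl (App f x)) p"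

definition glue_comp :: "tm \<Rightarrow> tm \<Rightarrow> tm \<Rightarrow> tm \<Rightarrow> tm \<Rightarrow> tm \<Rightarrow> tm \<Rightarrow> tm \<Rightarrow> tm \<Rightarrow> tm"
  where "glue_comp X C f g l r q j H =
    Pi C (Eq (Eq (wk 1 X) (App (wk 1 j) (App (wk 1 l) (App (wk 1 f) (Var 0)))) (App (wk 1 j) (App (wk 1 r) (App (wk 1 g) (Var 0)))))
      (ap_path (wk 1 X) (wk 1 j) (App (wk 1 l) (App (wk 1 f) (Var 0))) (App (wk 1 q) (Var 0)))
      (App (wk 1 H) (Var 0)))"

definition comp_map :: "tm \<Rightarrow> tm \<Rightarrow> tm \<Rightarrow> tm"
  where "comp_map A j l = Lam A (App (wk 1 j) (App (wk 1 l) (Var 0)))"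

definition inl_map :: "tm \<Rightarrow> tm \<Rightarrow> tm \<Rightarrow> tm" where "inl_map A f g = Lam A (PushL (wk 1 f) (wk 1 g) (Var 0))"
definition inr_map :: "tm \<Rightarrow> tm \<Rightarrow> tm \<Rightarrow> tm" where "inr_map B f g = Lam B (PushR (wk 1 f) (wk 1 g) (Var 0))"
definition glue_map :: "tm \<Rightarrow> tm \<Rightarrow> tm \<Rightarrow> tm" where "glue_map C f g = Lam C (Glue (wk 1 f) (wk 1 g) (Var 0))"

abbreviation "pb_glue A B X f g Y l r \<equiv> glue_htpy Y (pullback A B X f g) (pb_proj1 A B X f g) (pb_proj2 A B X f g) l r"
abbreviation "pb_ind A B X f g Y l r q \<equiv> small_ind Y A B (pullback A B X f g) (pb_proj1 A B X f g) (pb_proj2 A B X f g) l r q"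
abbreviation "pb_comp A B X f g l r q j H \<equiv> glue_comp X (pullback A B X f g) (pb_proj1 A B X f g) (pb_proj2 A B X f g) l r q j H"

lemmas lit_defs = glue_htpy_def small_ind_def ap_path_def glue_comp_def comp_map_def inl_map_def inr_map_def glue_map_def
  is_local_def is_conn_def fib_def is_conn_map_def

subsection \<open>Substitution\<close>

text \<open>Beyond its first \<open>k\<close> variables, the \<open>k\<close>-fold lift of a
  substitution is the substitution weakened by \<open>k\<close>, and a term weakened by
  \<open>k\<close> mentions only those.\<close>

lemma sub_wk_iter: "sub (wk k t) ((up ^^ k) \<sigma>) = wk k (sub t \<sigma>)"
proof -
  have "(up ^^ k) \<sigma> (n + k) = wk k (\<sigma> n)" for n
    by (induction k) (simp_all add: up_def wk_def ren_ident ren_ren)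
  then show ?thesis by (simp add: wk_def sub_ren ren_sub)
qed

lemma sub_wk:
  "sub (wk 1 t) (up \<sigma>) = wk 1 (sub t \<sigma>)" "sub (wk (Suc 0) t) (up \<sigma>) = wk (Suc 0) (sub t \<sigma>)"
  "sub (wk 2 t) (up (up \<sigma>)) = wk 2 (sub t \<sigma>)"
  "sub (wk 3 t) (up (up (up \<sigma>))) = wk 3 (sub t \<sigma>)" "sub (wk 4 t) (up (up (up (up \<sigma>)))) = wk 4 (sub t \<sigma>)"
  using sub_wk_iter[of 1 t \<sigma>] sub_wk_iter[of 2 t \<sigma>] sub_wk_iter[of 3 t \<sigma>] sub_wk_iter[of 4 t \<sigma>]
  by (simp_all add: eval_nat_numeral)

lemma up_simps: "up \<sigma> 0 = Var 0" "up \<sigma> (Suc n) = wk 1 (\<sigma> n)"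
  by (simp_all add: up_def wk_def)

lemma up_num: "up \<sigma> 1 = wk 1 (\<sigma> 0)" "up \<sigma> 2 = wk 1 (\<sigma> 1)" "up \<sigma> 3 = wk 1 (\<sigma> 2)" "up \<sigma> 4 = wk 1 (\<sigma> 3)"
  by (simp_all add: eval_nat_numeral up_simps)

lemma wk_Var: "wk k (Var n) = Var (n + k)"
  by (simp add: wk_def)

lemma sub_inst: "sub (t\<lbrakk>a\<rbrakk>) \<sigma> = (sub t (up \<sigma>))\<lbrakk>sub a \<sigma>\<rbrakk>"
  unfolding inst_def sub_sub by (rule arg_cong[where f = "sub t"]) (auto simp: up_def sub_ren sub_Var split: nat.split)

lemmas sub_up_simps = up_simps up_num wk_Var sub_wk

lemma sub_transport: "sub (transport D x p u) \<sigma> = transport (sub D (up \<sigma>)) (sub x \<sigma>) (sub p \<sigma>) (sub u \<sigma>)"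
proof -
  have "sub (wk 1 D) (up (up \<sigma>)) = wk 1 (sub D (up \<sigma>))" by (rule sub_wk)
  then show ?thesis by (simp add: transport_def idfun_def sub_Arr sub_inst sub_up_simps)
qed

lemma sub_proj1: "sub (proj1 A p) \<sigma> = proj1 (sub A \<sigma>) (sub p \<sigma>)"
  by (simp add: proj1_def sub_up_simps)

lemma sub_proj2: "sub (proj2 A B p) \<sigma> = proj2 (sub A \<sigma>) (sub B (up \<sigma>)) (sub p \<sigma>)"
  unfolding proj2_def by (simp add: subst_at1_up[unfolded One_nat_def] sub_proj1 sub_up_simps)

lemma sub_pb_fam: "sub (pb_fam B X f g) (up \<sigma>) = pb_fam (sub B \<sigma>) (sub X \<sigma>) (sub f \<sigma>) (sub g \<sigma>)"
  by (simp add: pb_fam_def pb_eq_def sub_up_simps)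

lemma sub_pullback: "sub (pullback A B X f g) \<sigma> = pullback (sub A \<sigma>) (sub B \<sigma>) (sub X \<sigma>) (sub f \<sigma>) (sub g \<sigma>)"
  by (simp add: pullback_def sub_pb_fam)

lemma sub_pb_snd: "sub (pb_snd A B X f g p) \<sigma> = pb_snd (sub A \<sigma>) (sub B \<sigma>) (sub X \<sigma>) (sub f \<sigma>) (sub g \<sigma>) (sub p \<sigma>)"
  by (simp add: pb_snd_def sub_proj2 sub_pb_fam)

lemma sub_pb: "sub (pb_proj1 A B X f g) \<sigma> = pb_proj1 (sub A \<sigma>) (sub B \<sigma>) (sub X \<sigma>) (sub f \<sigma>) (sub g \<sigma>)"
  "sub (pb_proj2 A B X f g) \<sigma> = pb_proj2 (sub A \<sigma>) (sub B \<sigma>) (sub X \<sigma>) (sub f \<sigma>) (sub g \<sigma>)"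
  "sub (pb_htpy A B X f g) \<sigma> = pb_htpy (sub A \<sigma>) (sub B \<sigma>) (sub X \<sigma>) (sub f \<sigma>) (sub g \<sigma>)"
  by (simp_all add: pb_proj1_def pb_proj2_def pb_htpy_def sub_pullback sub_proj1 sub_proj2 sub_pb_snd sub_up_simps)

lemma sub_is_equiv: "sub (is_equiv A B f) \<sigma> = is_equiv (sub A \<sigma>) (sub B \<sigma>) (sub f \<sigma>)"
  by (simp add: is_equiv_def sec_htpy_def ret_htpy_def Prod_def sub_Arr sub_up_simps)

lemma sub_is_conn_map: "sub (is_conn_map M A X f) \<sigma> = is_conn_map (sub M \<sigma>) (sub A \<sigma>) (sub X \<sigma>) (sub f \<sigma>)"
  by (simp add: is_conn_map_def is_conn_def is_local_def fib_def sub_is_equiv sub_Arr sub_up_simps)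

lemma sub_join_type: "sub (join_type M N) \<sigma> = join_type (sub M \<sigma>) (sub N \<sigma>)"
  by (simp add: join_type_def Prod_def sub_proj1 sub_proj2 sub_up_simps)

lemma sub_push_map: "sub (push_map X f g h k H) \<sigma> = push_map (sub X \<sigma>) (sub f \<sigma>) (sub g \<sigma>) (sub h \<sigma>) (sub k \<sigma>) (sub H \<sigma>)"
  by (simp add: push_map_def Let_def concat_path_def transport_const_def sub_transport sub_up_simps)

lemma sub_lit:
  "sub (glue_htpy Y C f g l r) \<sigma> = glue_htpy (sub Y \<sigma>) (sub C \<sigma>) (sub f \<sigma>) (sub g \<sigma>) (sub l \<sigma>) (sub r \<sigma>)"
  "sub (small_ind Y A B C f g l r q) \<sigma> = small_ind (sub Y \<sigma>) (sub A \<sigma>) (sub B \<sigma>) (sub C \<sigma>) (sub f \<sigma>) (sub g \<sigma>) (sub l \<sigma>) (sub r \<sigma>) (sub q \<sigma>)"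
  "sub (glue_comp X C f g l r q j H) \<sigma> = glue_comp (sub X \<sigma>) (sub C \<sigma>) (sub f \<sigma>) (sub g \<sigma>) (sub l \<sigma>) (sub r \<sigma>) (sub q \<sigma>) (sub j \<sigma>) (sub H \<sigma>)"
  "sub (comp_map A j l) \<sigma> = comp_map (sub A \<sigma>) (sub j \<sigma>) (sub l \<sigma>)"
  "sub (inl_map A f g) \<sigma> = inl_map (sub A \<sigma>) (sub f \<sigma>) (sub g \<sigma>)"
  "sub (inr_map A f g) \<sigma> = inr_map (sub A \<sigma>) (sub f \<sigma>) (sub g \<sigma>)"
  "sub (glue_map A f g) \<sigma> = glue_map (sub A \<sigma>) (sub f \<sigma>) (sub g \<sigma>)"
  by (simp_all add: glue_htpy_def small_ind_def glue_comp_def ap_path_def comp_map_def inl_map_def inr_map_def glue_map_def sub_transport sub_Arr sub_up_simps)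
    (simp add: eval_nat_numeral)

lemma numeral_Suc: "(4::nat) = Suc (Suc (Suc (Suc 0)))" "(5::nat) = Suc (Suc (Suc (Suc (Suc 0))))" "(6::nat) = Suc (Suc (Suc (Suc (Suc (Suc 0)))))"
  "(7::nat) = Suc (Suc (Suc (Suc (Suc (Suc (Suc 0))))))" "(8::nat) = Suc (Suc (Suc (Suc (Suc (Suc (Suc (Suc 0)))))))"
  "(9::nat) = Suc (Suc (Suc (Suc (Suc (Suc (Suc (Suc (Suc 0))))))))" "(10::nat) = Suc (Suc (Suc (Suc (Suc (Suc (Suc (Suc (Suc (Suc 0)))))))))"
  "(11::nat) = Suc (Suc (Suc (Suc (Suc (Suc (Suc (Suc (Suc (Suc (Suc 0))))))))))" "(12::nat) = Suc (Suc (Suc (Suc (Suc (Suc (Suc (Suc (Suc (Suc (Suc (Suc 0)))))))))))"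
  "(13::nat) = Suc (Suc (Suc (Suc (Suc (Suc (Suc (Suc (Suc (Suc (Suc (Suc (Suc 0))))))))))))"
  "(14::nat) = Suc (Suc (Suc (Suc (Suc (Suc (Suc (Suc (Suc (Suc (Suc (Suc (Suc (Suc 0)))))))))))))"
  by simp_all

lemma add_num: "0 + n = n" "1 + n = Suc n" "2 + n = Suc (Suc n)" "3 + n = Suc (Suc (Suc n))" "4 + n = Suc (Suc (Suc (Suc n)))"
  "Suc m + n = Suc (m + n)" for n :: nat
  by simp_all

lemmas sub_simps = sub_lit sub_pullback sub_pb sub_is_conn_map sub_join_type sub_push_map sub_Arr numeral_Suc numeral_2_eq_2 numeral_3_eq_3

subsection \<open>Judgments by evaluation\<close>

fun sort_ok :: "res \<Rightarrow> bool" where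
  "sort_ok (Ok T Univ) = True" | "sort_ok (Ok T Ty) = True" | "sort_ok _ = False"

lemma is_type_eval: "sort_ok (llet T (ev \<Gamma>)) \<Longrightarrow> \<Gamma> \<turnstile> \<^bold>\<surd> \<Longrightarrow> \<Gamma> \<turnstile> T \<^bold>: Ty"
proof (cases "ev \<Gamma> T")
  case (Ok N s)
  assume "sort_ok (llet T (ev \<Gamma>))" and c: "\<Gamma> \<turnstile> \<^bold>\<surd>"
  then have "s = Univ \<or> s = Ty" using Ok by (cases s) (auto simp: llet_def)
  then show ?thesis using soundD[OF sound_ev Ok c] by (auto intro: small dest: conv_toD)
qed (simp add: llet_def)

lemma ctx_eval: "sort_ok (llet T (ev \<Gamma>)) \<Longrightarrow> \<Gamma> \<turnstile> \<^bold>\<surd> \<Longrightarrow> T # \<Gamma> \<turnstile> \<^bold>\<surd>"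
  by (rule ctx_cons[OF is_type_eval])

fun has_nf :: "res \<Rightarrow> res \<Rightarrow> bool" where
  "has_nf (Ok t T) (Ok N Univ) = (T = N)" | "has_nf (Ok t T) (Ok N Ty) = (T = N)" | "has_nf _ _ = False"

lemma has_type_eval: "has_nf (llet t (ev \<Gamma>)) (llet T (ev \<Gamma>)) \<Longrightarrow> \<Gamma> \<turnstile> \<^bold>\<surd> \<Longrightarrow> \<Gamma> \<turnstile> t \<^bold>: T"
proof -
  assume "has_nf (llet t (ev \<Gamma>)) (llet T (ev \<Gamma>))" and c: "\<Gamma> \<turnstile> \<^bold>\<surd>"
  then obtain N T' s where t: "ev \<Gamma> t = Ok N T'" and T: "ev \<Gamma> T = Ok T' s" "s = Univ \<or> s = Ty"
    unfolding llet_def by (cases "(ev \<Gamma> t, ev \<Gamma> T)" rule: has_nf.cases) auto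
  have "conv_to \<Gamma> T T' Ty" using soundD[OF sound_ev T(1) c] T(2) conv_to_sort by blast
  then show ?thesis using soundD[OF sound_ev t c] by (auto intro: conv eq_sym dest: conv_toD)
qed

fun same_nf :: "res \<Rightarrow> res \<Rightarrow> res \<Rightarrow> bool" where
  "same_nf (Ok t T) (Ok u U) (Ok N s) = (t = u \<and> has_nf (Ok t T) (Ok N s) \<and> T = U)" | "same_nf _ _ _ = False"

lemma conv_eval: "same_nf (llet t (ev \<Gamma>)) (llet u (ev \<Gamma>)) (llet T (ev \<Gamma>)) \<Longrightarrow> \<Gamma> \<turnstile> \<^bold>\<surd> \<Longrightarrow> \<Gamma> \<turnstile> t \<approx> u \<^bold>: T"
proof -
  assume "same_nf (llet t (ev \<Gamma>)) (llet u (ev \<Gamma>)) (llet T (ev \<Gamma>))" and c: "\<Gamma> \<turnstile> \<^bold>\<surd>"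
  then obtain N T' s where t: "ev \<Gamma> t = Ok N T'" and u: "ev \<Gamma> u = Ok N T'" and T: "ev \<Gamma> T = Ok T' s" and n: "has_nf (Ok N T') (Ok T' s)"
    unfolding llet_def by (cases "(ev \<Gamma> t, ev \<Gamma> u, ev \<Gamma> T)" rule: same_nf.cases) (auto elim: has_nf.elims)
  have s: "s = Univ \<or> s = Ty" using n by (cases s) auto
  have "conv_to \<Gamma> T T' Ty" using soundD[OF sound_ev T(1) c] s conv_to_sort by blast
  then have "\<Gamma> \<turnstile> T' \<approx> T \<^bold>: Ty" by (auto intro: eq_sym dest: conv_toD)
  moreover have "\<Gamma> \<turnstile> t \<approx> u \<^bold>: T'" using soundD[OF sound_ev t c] soundD[OF sound_ev u c] by (auto intro: eq_trans eq_sym dest: conv_toD)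
  ultimately show ?thesis by (rule eq_conv[rotated])
qed

fun proves :: "res \<Rightarrow> (tm \<Rightarrow> res) \<Rightarrow> bool" where
  "proves (Ok N Univ) p = is_Ok (p N)" | "proves (Ok N Ty) p = is_Ok (p N)" | "proves _ _ = False"

text \<open>The elaborator expects a normal goal, so the proof is found at the normal form of
  \<open>T\<close> and moved back by conversion.\<close>

lemma inhabited_eval: "proves (llet T (ev \<Gamma>)) (\<lambda>N. el p \<Gamma> (Some N)) \<Longrightarrow> \<Gamma> \<turnstile> \<^bold>\<surd> \<Longrightarrow> \<exists>t. \<Gamma> \<turnstile> t \<^bold>: T"
proof -
  assume "proves (llet T (ev \<Gamma>)) (\<lambda>N. el p \<Gamma> (Some N))" and c: "\<Gamma> \<turnstile> \<^bold>\<surd>"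
  then obtain N s t U where T: "ev \<Gamma> T = Ok N s" "s = Univ \<or> s = Ty" and p: "el p \<Gamma> (Some N) = Ok t U"
    unfolding llet_def by (cases "(ev \<Gamma> T, \<lambda>N. el p \<Gamma> (Some N))" rule: proves.cases) (auto simp: is_Ok_def)
  have N: "conv_to \<Gamma> T N Ty" using soundD[OF sound_ev T(1) c] T(2) conv_to_sort by blast
  from el_check[OF el_sound p conv_toD(2)[OF N]] show ?thesis using conv_toD(3)[OF N] by (blast intro: conv eq_sym)
qed

lemma judgment_congs:
  "r = r' \<Longrightarrow> sort_ok r = sort_ok r'" "r = r' \<Longrightarrow> s = s' \<Longrightarrow> has_nf r s = has_nf r' s'"
  "r = r' \<Longrightarrow> s = s' \<Longrightarrow> q = q' \<Longrightarrow> same_nf r s q = same_nf r' s' q'" "r = r' \<Longrightarrow> proves r p = proves r' p"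
  by simp_all

lemma judgment_simps: "sort_ok (Ok T Univ)" "sort_ok (Ok T Ty)" "has_nf (Ok t T) (Ok T Univ)" "has_nf (Ok t T) (Ok T Ty)"
  "same_nf (Ok t T) (Ok t T) (Ok T Univ)" "same_nf (Ok t T) (Ok t T) (Ok T Ty)"
  "proves (Ok N Univ) p = is_Ok (p N)" "proves (Ok N Ty) p = is_Ok (p N)"
  by simp_all

lemmas judgment_eval = judgment_simps lit_defs check_simps lift_lib

lemmas judgment_eval_congs = judgment_congs frozen_congs eval_congs

subsection \<open>The generic pushout\<close>

lemma lib_ctx: "lib_join_over_connected \<turnstile> \<^bold>\<surd>"
  using inhabited_join_over_connected by (simp add: inhabited_def)

text \<open>Counts the variables of a context above the library, the oldest one being 0.\<close>

abbreviation (input) "lv k \<equiv> v (k + lev_join_over_connected)"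

abbreviation "span_ctx \<equiv> Arr (Var 1) (Var 2) # Arr (Var 0) (Var 2) # Univ # Univ # Univ # lib_join_over_connected"

lemma span_ctx: "span_ctx \<turnstile> \<^bold>\<surd>"
  by (rule lib_ctx | rule ctx_eval, simp only: numeral_Suc judgment_eval cong: judgment_eval_congs)+

lemma span_ctx_maps:
  "span_ctx \<turnstile> inl_map (Var 4) (Var 1) (Var 0) \<^bold>: Arr (Var 4) (Push (Var 1) (Var 0))"
  "span_ctx \<turnstile> inr_map (Var 3) (Var 1) (Var 0) \<^bold>: Arr (Var 3) (Push (Var 1) (Var 0))"
  "span_ctx \<turnstile> glue_map (Var 2) (Var 1) (Var 0) \<^bold>: glue_htpy (Push (Var 1) (Var 0)) (Var 2) (Var 1) (Var 0)
     (inl_map (Var 4) (Var 1) (Var 0)) (inr_map (Var 3) (Var 1) (Var 0))"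
  by (rule has_type_eval[OF _ span_ctx], simp only: numeral_Suc judgment_eval cong: judgment_eval_congs)+

lemma span_ctx_ind: "\<exists>t. span_ctx \<turnstile> t \<^bold>: small_ind (Push (Var 1) (Var 0)) (Var 4) (Var 3) (Var 2) (Var 1) (Var 0)
    (inl_map (Var 4) (Var 1) (Var 0)) (inr_map (Var 3) (Var 1) (Var 0)) (glue_map (Var 2) (Var 1) (Var 0))"
  by (rule inhabited_eval[OF _ span_ctx, where p = "(pushout_has_ind $ lv 0 $ lv 1 $ lv 2 $ lv 3 $ lv 4) (5 + lev_join_over_connected)"])
    (simp only: src_defs src_prims numeral_Suc add_num, simp only: numeral_Suc judgment_eval cong: judgment_eval_congs)

abbreviation "cocone_ctx \<equiv> glue_htpy (Var 2) (Var 5) (Var 4) (Var 3) (Var 1) (Var 0) # Arr (Var 5) (Var 1) # Arr (Var 5) (Var 0) # Univ # span_ctx"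

abbreviation "cocone_map \<equiv> push_map (Var 3) (Var 5) (Var 4) (Var 2) (Var 1) (Var 0)"

lemma cocone_ctx: "cocone_ctx \<turnstile> \<^bold>\<surd>"
  by (rule span_ctx | rule ctx_eval, simp only: numeral_Suc judgment_eval cong: judgment_eval_congs)+

lemma cocone_ctx_map: "cocone_ctx \<turnstile> cocone_map \<^bold>: Arr (Push (Var 5) (Var 4)) (Var 3)"
  by (rule has_type_eval[OF _ cocone_ctx]) (simp only: numeral_Suc judgment_eval cong: judgment_eval_congs)

text \<open>The point rules of the pushout are judgmental, so evaluation reduces each composite to
  an eta-expanded leg. The right sides are written as the expansions in \<open>pi_eta\<close>, which
  later removes them.\<close>

lemma cocone_ctx_points:
  "cocone_ctx \<turnstile> comp_map (Var 8) cocone_map (inl_map (Var 8) (Var 5) (Var 4)) \<approx> Lam (Var 8) (App (wk 1 (Var 2)) (Var 0)) \<^bold>: Arr (Var 8) (Var 3)"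
  "cocone_ctx \<turnstile> comp_map (Var 7) cocone_map (inr_map (Var 7) (Var 5) (Var 4)) \<approx> Lam (Var 7) (App (wk 1 (Var 1)) (Var 0)) \<^bold>: Arr (Var 7) (Var 3)"
  by (rule conv_eval[OF _ cocone_ctx], simp only: numeral_Suc judgment_eval cong: judgment_eval_congs)+

lemma cocone_ctx_comp: "\<exists>t. cocone_ctx \<turnstile> t \<^bold>: glue_comp (Var 3) (Var 6) (Var 5) (Var 4)
    (inl_map (Var 8) (Var 5) (Var 4)) (inr_map (Var 7) (Var 5) (Var 4)) (glue_map (Var 6) (Var 5) (Var 4)) cocone_map (Var 0)"
  by (rule inhabited_eval[OF _ cocone_ctx, where p = "(pushout_map_glue $ lv 0 $ lv 1 $ lv 2 $ lv 3 $ lv 4 $ lv 5 $ lv 6 $ lv 7 $ lv 8) (9 + lev_join_over_connected)"])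
    (simp only: src_defs src_prims numeral_Suc add_num, simp only: numeral_Suc judgment_eval cong: judgment_eval_congs)

abbreviation (input) "six_ctx \<equiv> Univ # Univ # Univ # Univ # Univ # Univ # lib_join_over_connected"

abbreviation (input) "map_ctx \<equiv> Arr (Var 4) (Var 2) # Arr (Var 4) (Var 1) # Arr (Var 0) (Var 1) # six_ctx"

lemma map_ctx: "map_ctx \<turnstile> \<^bold>\<surd>"
  by (rule lib_ctx | rule ctx_eval, simp only: numeral_Suc judgment_eval cong: judgment_eval_congs)+

abbreviation (input) "main_ctx \<equiv>
  is_conn_map (Var 11) (Var 9) (Var 8) (comp_map (Var 9) (Var 6) (Var 4)) #
  is_conn_map (Var 11) (Var 9) (Var 7) (comp_map (Var 9) (Var 5) (Var 4)) #
  pb_comp (Var 8) (Var 7) (Var 6) (comp_map (Var 8) (Var 4) (Var 3)) (comp_map (Var 7) (Var 4) (Var 2)) (Var 3) (Var 2) (Var 1) (Var 4)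
    (pb_htpy (Var 8) (Var 7) (Var 6) (comp_map (Var 8) (Var 4) (Var 3)) (comp_map (Var 7) (Var 4) (Var 2))) #
  pb_ind (Var 7) (Var 6) (Var 5) (comp_map (Var 7) (Var 3) (Var 2)) (comp_map (Var 6) (Var 3) (Var 1)) (Var 4) (Var 2) (Var 1) (Var 0) #
  pb_glue (Var 6) (Var 5) (Var 4) (comp_map (Var 6) (Var 2) (Var 1)) (comp_map (Var 5) (Var 2) (Var 0)) (Var 3) (Var 1) (Var 0) #
  map_ctx"

lemma main_ctx: "main_ctx \<turnstile> \<^bold>\<surd>"
  by (rule map_ctx | rule ctx_eval, simp only: numeral_Suc judgment_eval cong: judgment_eval_congs)+

text \<open>In the context the type \<open>Y\<close> stands after \<open>X\<close>, while the lemma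
  takes it right after \<open>M\<close> and \<open>N\<close>; hence the position of
  \<open>lv 5\<close>.\<close>

lemma main_ctx_conn: "\<exists>t. main_ctx \<turnstile> t \<^bold>: is_conn_map (join_type (Var 13) (Var 12)) (Var 8) (Var 9) (Var 7)"
  by (rule inhabited_eval[OF _ main_ctx, where p =
      "(join_over_connected $ lv 0 $ lv 1 $ lv 5 $ lv 2 $ lv 3 $ lv 4 $ lv 6 $ lv 7 $ lv 8 $ lv 9 $ lv 10 $ lv 11 $ lv 12 $ lv 13) (14 + lev_join_over_connected)"])
    (simp only: src_defs src_prims numeral_Suc add_num, simp only: numeral_Suc judgment_eval cong: judgment_eval_congs)

abbreviation (input) "pb_ctx \<equiv> Arr (Var 2) (Var 1) # Arr (Var 2) (Var 0) # Univ # Univ # Univ # lib_join_over_connected"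

lemma pb_ctx: "pb_ctx \<turnstile> \<^bold>\<surd>"
  by (rule lib_ctx | rule ctx_eval, simp only: numeral_Suc judgment_eval cong: judgment_eval_congs)+

lemma pb_ctx_typ:
  "pb_ctx \<turnstile> pullback (Var 4) (Var 3) (Var 2) (Var 1) (Var 0) \<^bold>: Univ"
  "pb_ctx \<turnstile> pb_proj1 (Var 4) (Var 3) (Var 2) (Var 1) (Var 0) \<^bold>: Arr (pullback (Var 4) (Var 3) (Var 2) (Var 1) (Var 0)) (Var 4)"
  "pb_ctx \<turnstile> pb_proj2 (Var 4) (Var 3) (Var 2) (Var 1) (Var 0) \<^bold>: Arr (pullback (Var 4) (Var 3) (Var 2) (Var 1) (Var 0)) (Var 3)"
  "pb_ctx \<turnstile> pb_htpy (Var 4) (Var 3) (Var 2) (Var 1) (Var 0) \<^bold>: pb_glue (Var 4) (Var 3) (Var 2) (Var 1) (Var 0) (Var 2) (Var 1) (Var 0)"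
  by (rule has_type_eval[OF _ pb_ctx], simp only: numeral_Suc judgment_eval cong: judgment_eval_congs)+

text \<open>The maps that form the pullback and those at the ends of the homotopy are separate
  variables, so that congruence can change the end points and keep the pullback.\<close>

lemma pb_ctx_glue: "Arr (Var 4) (Var 3) # Arr (Var 4) (Var 2) # pb_ctx \<turnstile> pb_glue (Var 6) (Var 5) (Var 4) (Var 3) (Var 2) (Var 4) (Var 1) (Var 0) \<^bold>: Ty"
  by (rule is_type_eval, simp only: numeral_Suc judgment_eval cong: judgment_eval_congs)
    (rule pb_ctx | rule ctx_eval, simp only: numeral_Suc judgment_eval cong: judgment_eval_congs)+

text \<open>Here \<open>f\<close> and \<open>g\<close> are variables besides \<open>j\<close>,
  \<open>l\<close> and \<open>r\<close>. Replacing them by the composites is then a change of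
  substitution, to which \<open>sub_cong\<close> applies.\<close>

abbreviation (input) "conv_ctx \<equiv> Arr (Var 6) (Var 5) # Arr (Var 6) (Var 4) # map_ctx"

lemma conv_ctx: "conv_ctx \<turnstile> \<^bold>\<surd>"
  by (rule map_ctx | rule ctx_eval, simp only: numeral_Suc judgment_eval cong: judgment_eval_congs)+

lemma conv_ctx_types:
  "conv_ctx \<turnstile> is_conn_map (Var 10) (Var 8) (Var 6) (Var 1) \<^bold>: Ty"
  "conv_ctx \<turnstile> is_conn_map (Var 9) (Var 7) (Var 6) (Var 0) \<^bold>: Ty"
  "conv_ctx \<turnstile> pb_glue (Var 8) (Var 7) (Var 6) (Var 1) (Var 0) (Var 5) (Var 3) (Var 2) \<^bold>: Ty"
  by (rule is_type_eval[OF _ conv_ctx], simp only: numeral_Suc judgment_eval cong: judgment_eval_congs)+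

abbreviation (input) "ind_ctx \<equiv> pb_glue (Var 8) (Var 7) (Var 6) (Var 1) (Var 0) (Var 5) (Var 3) (Var 2) # conv_ctx"

lemma ind_ctx: "ind_ctx \<turnstile> \<^bold>\<surd>"
  by (rule ctx_cons[OF conv_ctx_types(3)])

lemma ind_ctx_types:
  "ind_ctx \<turnstile> pb_ind (Var 9) (Var 8) (Var 7) (Var 2) (Var 1) (Var 6) (Var 4) (Var 3) (Var 0) \<^bold>: Ty"
  "ind_ctx \<turnstile> pb_glue (Var 9) (Var 8) (Var 7) (Var 2) (Var 1) (Var 7) (comp_map (Var 9) (Var 5) (Var 4)) (comp_map (Var 8) (Var 5) (Var 3)) \<^bold>: Ty"
  by (rule is_type_eval[OF _ ind_ctx], simp only: numeral_Suc judgment_eval cong: judgment_eval_congs)+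

text \<open>The homotopy is a variable as well. Its pullback is formed with \<open>f\<close> and
  \<open>g\<close>, while its end points are the composites, as \<open>glue_comp\<close> requires
  for its right-hand side to have the correct type.\<close>

abbreviation (input) "comp_ctx \<equiv>
  pb_glue (Var 9) (Var 8) (Var 7) (Var 2) (Var 1) (Var 7) (comp_map (Var 9) (Var 5) (Var 4)) (comp_map (Var 8) (Var 5) (Var 3)) # ind_ctx"

lemma comp_ctx: "comp_ctx \<turnstile> \<^bold>\<surd>"
  by (rule ctx_cons[OF ind_ctx_types(2)])

lemma comp_ctx_type: "comp_ctx \<turnstile> pb_comp (Var 10) (Var 9) (Var 8) (Var 3) (Var 2) (Var 5) (Var 4) (Var 1) (Var 6) (Var 0) \<^bold>: Ty"
  by (rule is_type_eval[OF _ comp_ctx]) (simp only: numeral_Suc judgment_eval cong: judgment_eval_congs)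

subsection \<open>Transfer to an arbitrary context\<close>

lemma lib_wsub: "\<Gamma> \<turnstile> \<^bold>\<surd> \<Longrightarrow> \<exists>\<sigma>. wsub \<Gamma> \<sigma> lib_join_over_connected"
  using inhabited_join_over_connected by (simp add: inhabited_def)

text \<open>The premises of \<open>sub_cong\<close> in one notion: two substitutions that agree
  judgmentally, typed by means of the first. Any term derived over \<open>\<Theta>\<close> then
  respects the change.\<close>

definition eqsub :: "tm list \<Rightarrow> (nat \<Rightarrow> tm) \<Rightarrow> (nat \<Rightarrow> tm) \<Rightarrow> tm list \<Rightarrow> bool"
  where "eqsub \<Gamma> \<sigma> \<tau> \<Theta> \<longleftrightarrow> wsub \<Gamma> \<sigma> \<Theta> \<and> (\<forall>i<length \<Theta>. \<Gamma> \<turnstile> \<sigma> i \<approx> \<tau> i \<^bold>: sub (\<Theta> ! i) (\<lambda>n. \<sigma> (n + Suc i)))"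

lemma eqsub_refl: "wsub \<Gamma> \<sigma> \<Theta> \<Longrightarrow> eqsub \<Gamma> \<sigma> \<sigma> \<Theta>"
  by (auto simp: eqsub_def wsub_def intro: eq_refl)

lemma eqsub_cons: "eqsub \<Gamma> \<sigma> \<tau> \<Theta> \<Longrightarrow> \<Gamma> \<turnstile> a \<^bold>: sub A \<sigma> \<Longrightarrow> \<Gamma> \<turnstile> a \<approx> b \<^bold>: sub A \<sigma> \<Longrightarrow> eqsub \<Gamma> (a \<cdot> \<sigma>) (b \<cdot> \<tau>) (A # \<Theta>)"
  unfolding eqsub_def by (auto intro: wsub_cons simp: nth_Cons split: nat.split)

lemma eqsub_const: "eqsub \<Gamma> \<sigma> \<tau> \<Theta> \<Longrightarrow> \<Gamma> \<turnstile> a \<^bold>: sub A \<sigma> \<Longrightarrow> eqsub \<Gamma> (a \<cdot> \<sigma>) (a \<cdot> \<tau>) (A # \<Theta>)"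
  by (rule eqsub_cons) (auto intro: eq_refl)

lemma eqsub_eq: "eqsub \<Gamma> \<sigma> \<tau> \<Theta> \<Longrightarrow> \<Theta> \<turnstile> t \<^bold>: T \<Longrightarrow> \<Gamma> \<turnstile> sub t \<sigma> \<approx> sub t \<tau> \<^bold>: sub T \<sigma>"
  unfolding eqsub_def by (blast intro: sub_cong')

lemma ex_sub: "\<exists>t. \<Theta> \<turnstile> t \<^bold>: T \<Longrightarrow> wsub \<Gamma> \<sigma> \<Theta> \<Longrightarrow> \<exists>t. \<Gamma> \<turnstile> t \<^bold>: sub T \<sigma>"
  by (blast intro: sub_typ')

lemma span_wsub:
  assumes "is_span \<Gamma> A B C f g" "wsub \<Gamma> \<sigma> lib_join_over_connected"
  shows "wsub \<Gamma> (g \<cdot> f \<cdot> C \<cdot> B \<cdot> A \<cdot> \<sigma>) span_ctx"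
  using assms by (intro wsub_cons) (simp_all add: is_span_def sub_simps)

lemma pushout_maps:
  assumes "is_span \<Gamma> A B C f g"
  shows "\<Gamma> \<turnstile> inl_map A f g \<^bold>: Arr A (Push f g)" "\<Gamma> \<turnstile> inr_map B f g \<^bold>: Arr B (Push f g)"
    "\<Gamma> \<turnstile> glue_map C f g \<^bold>: glue_htpy (Push f g) C f g (inl_map A f g) (inr_map B f g)"
    "\<exists>t. \<Gamma> \<turnstile> t \<^bold>: small_ind (Push f g) A B C f g (inl_map A f g) (inr_map B f g) (glue_map C f g)"
proof -
  obtain \<sigma> where "wsub \<Gamma> \<sigma> lib_join_over_connected" using lib_wsub typed_ctx[OF spanD(1)[OF assms]] by blast
  note w = span_wsub[OF assms this]
  show "\<Gamma> \<turnstile> inl_map A f g \<^bold>: Arr A (Push f g)" "\<Gamma> \<turnstile> inr_map B f g \<^bold>: Arr B (Push f g)"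
    "\<Gamma> \<turnstile> glue_map C f g \<^bold>: glue_htpy (Push f g) C f g (inl_map A f g) (inr_map B f g)"
    using span_ctx_maps[THEN sub_typ'[OF w]] by (simp_all add: sub_simps)
  show "\<exists>t. \<Gamma> \<turnstile> t \<^bold>: small_ind (Push f g) A B C f g (inl_map A f g) (inr_map B f g) (glue_map C f g)"
    using ex_sub[OF span_ctx_ind w] by (simp add: sub_simps)
qed

lemma cocone_maps:
  assumes s: "is_span \<Gamma> A B C f g" and X: "\<Gamma> \<turnstile> X \<^bold>: Univ" and h: "\<Gamma> \<turnstile> h \<^bold>: Arr A X" and k: "\<Gamma> \<turnstile> k \<^bold>: Arr B X"
    and H: "\<Gamma> \<turnstile> H \<^bold>: glue_htpy X C f g h k"
  shows "\<Gamma> \<turnstile> push_map X f g h k H \<^bold>: Arr (Push f g) X"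
    "\<Gamma> \<turnstile> h \<approx> comp_map A (push_map X f g h k H) (inl_map A f g) \<^bold>: Arr A X"
    "\<Gamma> \<turnstile> k \<approx> comp_map B (push_map X f g h k H) (inr_map B f g) \<^bold>: Arr B X"
    "\<exists>t. \<Gamma> \<turnstile> t \<^bold>: glue_comp X C f g (inl_map A f g) (inr_map B f g) (glue_map C f g) (push_map X f g h k H) H"
proof -
  obtain \<sigma> where \<sigma>: "wsub \<Gamma> \<sigma> lib_join_over_connected" using lib_wsub typed_ctx[OF X] by blast
  have w: "wsub \<Gamma> (H \<cdot> k \<cdot> h \<cdot> X \<cdot> g \<cdot> f \<cdot> C \<cdot> B \<cdot> A \<cdot> \<sigma>) cocone_ctx"
    by (intro wsub_cons \<sigma>) (use s X h k H in \<open>simp_all add: is_span_def sub_simps\<close>)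
  show "\<Gamma> \<turnstile> push_map X f g h k H \<^bold>: Arr (Push f g) X" using sub_typ'[OF w cocone_ctx_map] by (simp add: sub_simps)
  note eqs = cocone_ctx_points[THEN sub_eq'[OF w]]
  have "\<Gamma> \<turnstile> comp_map A (push_map X f g h k H) (inl_map A f g) \<approx> Lam A (App (wk 1 h) (Var 0)) \<^bold>: Arr A X"
    "\<Gamma> \<turnstile> comp_map B (push_map X f g h k H) (inr_map B f g) \<approx> Lam B (App (wk 1 k) (Var 0)) \<^bold>: Arr B X"
    using eqs by (simp_all add: sub_simps wk_Var up_simps)
  then show "\<Gamma> \<turnstile> h \<approx> comp_map A (push_map X f g h k H) (inl_map A f g) \<^bold>: Arr A X"
    "\<Gamma> \<turnstile> k \<approx> comp_map B (push_map X f g h k H) (inr_map B f g) \<^bold>: Arr B X"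
    using pi_eta[OF h[unfolded Arr_def]] pi_eta[OF k[unfolded Arr_def]] by (auto simp: Arr_def intro: eq_trans eq_sym)
  show "\<exists>t. \<Gamma> \<turnstile> t \<^bold>: glue_comp X C f g (inl_map A f g) (inr_map B f g) (glue_map C f g) (push_map X f g h k H) H"
    using ex_sub[OF cocone_ctx_comp w] by (simp add: sub_simps)
qed

lemma conn_of_pushout_data:
  assumes "\<Gamma> \<turnstile> M \<^bold>: Univ" "\<Gamma> \<turnstile> N \<^bold>: Univ" "\<Gamma> \<turnstile> A \<^bold>: Univ" "\<Gamma> \<turnstile> B \<^bold>: Univ" "\<Gamma> \<turnstile> X \<^bold>: Univ" "\<Gamma> \<turnstile> Y \<^bold>: Univ"
    "\<Gamma> \<turnstile> j \<^bold>: Arr Y X" "\<Gamma> \<turnstile> l \<^bold>: Arr A Y" "\<Gamma> \<turnstile> r \<^bold>: Arr B Y"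
    "\<Gamma> \<turnstile> q \<^bold>: pb_glue A B X (comp_map A j l) (comp_map B j r) Y l r"
    "\<Gamma> \<turnstile> W \<^bold>: pb_ind A B X (comp_map A j l) (comp_map B j r) Y l r q"
    "\<Gamma> \<turnstile> s \<^bold>: pb_comp A B X (comp_map A j l) (comp_map B j r) l r q j (pb_htpy A B X (comp_map A j l) (comp_map B j r))"
    "\<Gamma> \<turnstile> cf \<^bold>: is_conn_map M A X (comp_map A j l)" "\<Gamma> \<turnstile> cg \<^bold>: is_conn_map N B X (comp_map B j r)"
  shows "\<exists>t. \<Gamma> \<turnstile> t \<^bold>: is_conn_map (join_type M N) Y X j"
proof -
  obtain \<sigma> where \<sigma>: "wsub \<Gamma> \<sigma> lib_join_over_connected" using lib_wsub typed_ctx[OF assms(1)] by blast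
  have w: "wsub \<Gamma> (cg \<cdot> cf \<cdot> s \<cdot> W \<cdot> q \<cdot> r \<cdot> l \<cdot> j \<cdot> Y \<cdot> X \<cdot> B \<cdot> A \<cdot> N \<cdot> M \<cdot> \<sigma>) main_ctx"
    using assms by (intro wsub_cons \<sigma>) (simp_all add: sub_simps)
  show ?thesis using ex_sub[OF main_ctx_conn w] by (simp add: sub_simps)
qed

lemma pb_typ:
  assumes A: "\<Gamma> \<turnstile> A \<^bold>: Univ" and B: "\<Gamma> \<turnstile> B \<^bold>: Univ" and X: "\<Gamma> \<turnstile> X \<^bold>: Univ" and f: "\<Gamma> \<turnstile> f \<^bold>: Arr A X" and g: "\<Gamma> \<turnstile> g \<^bold>: Arr B X"
  shows "is_span \<Gamma> A B (pullback A B X f g) (pb_proj1 A B X f g) (pb_proj2 A B X f g)"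
    "\<Gamma> \<turnstile> pb_htpy A B X f g \<^bold>: pb_glue A B X f g X f g"
    and pb_htpy_cong: "\<lbrakk>\<Gamma> \<turnstile> f \<approx> f' \<^bold>: Arr A X; \<Gamma> \<turnstile> g \<approx> g' \<^bold>: Arr B X\<rbrakk> \<Longrightarrow>
      \<Gamma> \<turnstile> pb_htpy A B X f g \<approx> pb_htpy A B X f' g' \<^bold>: pb_glue A B X f g X f g"
    and pb_glue_cong: "\<lbrakk>\<Gamma> \<turnstile> f \<approx> f' \<^bold>: Arr A X; \<Gamma> \<turnstile> g \<approx> g' \<^bold>: Arr B X\<rbrakk> \<Longrightarrow>
      \<Gamma> \<turnstile> pb_glue A B X f g X f g \<approx> pb_glue A B X f g X f' g' \<^bold>: Ty"
proof -
  obtain \<sigma> where \<sigma>: "wsub \<Gamma> \<sigma> lib_join_over_connected" using lib_wsub typed_ctx[OF A] by blast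
  have w: "wsub \<Gamma> (g \<cdot> f \<cdot> X \<cdot> B \<cdot> A \<cdot> \<sigma>) pb_ctx"
    by (intro wsub_cons \<sigma>) (use assms in \<open>simp_all add: sub_simps\<close>)
  note T = pb_ctx_typ[THEN sub_typ'[OF w]]
  show "is_span \<Gamma> A B (pullback A B X f g) (pb_proj1 A B X f g) (pb_proj2 A B X f g)"
    using T(1-3) A B by (simp add: is_span_def sub_simps)
  show "\<Gamma> \<turnstile> pb_htpy A B X f g \<^bold>: pb_glue A B X f g X f g"
    using T(4) by (simp add: sub_simps)
  assume f': "\<Gamma> \<turnstile> f \<approx> f' \<^bold>: Arr A X" and g': "\<Gamma> \<turnstile> g \<approx> g' \<^bold>: Arr B X"
  have "eqsub \<Gamma> (g \<cdot> f \<cdot> X \<cdot> B \<cdot> A \<cdot> \<sigma>) (g' \<cdot> f' \<cdot> X \<cdot> B \<cdot> A \<cdot> \<sigma>) pb_ctx"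
    by (rule eqsub_cons eqsub_const eqsub_refl \<sigma>)+ (use assms f' g' in \<open>simp_all add: sub_simps\<close>)
  from eqsub_eq[OF this pb_ctx_typ(4)] show "\<Gamma> \<turnstile> pb_htpy A B X f g \<approx> pb_htpy A B X f' g' \<^bold>: pb_glue A B X f g X f g"
    by (simp add: sub_simps)
  have "eqsub \<Gamma> (g \<cdot> f \<cdot> g \<cdot> f \<cdot> X \<cdot> B \<cdot> A \<cdot> \<sigma>) (g' \<cdot> f' \<cdot> g \<cdot> f \<cdot> X \<cdot> B \<cdot> A \<cdot> \<sigma>) (Arr (Var 4) (Var 3) # Arr (Var 4) (Var 2) # pb_ctx)"
    by (intro eqsub_cons eqsub_refl w) (use assms f' g' in \<open>simp_all add: sub_simps\<close>)
  from eqsub_eq[OF this pb_ctx_glue] show "\<Gamma> \<turnstile> pb_glue A B X f g X f g \<approx> pb_glue A B X f g X f' g' \<^bold>: Ty"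
    by (simp add: sub_simps)
qed

text \<open>The generic result is about maps that are literally composites
  \<open>j \<circ> l\<close> and \<open>j \<circ> r\<close>, while \<open>f\<close> and
  \<open>g\<close> are only judgmentally equal to them. Every type that occurs among its premises is
  converted here.\<close>

lemma pushout_data_cong:
  fixes A B j l r
  defines "f' \<equiv> comp_map A j l" and "g' \<equiv> comp_map B j r"
  assumes M: "\<Gamma> \<turnstile> M \<^bold>: Univ" and N: "\<Gamma> \<turnstile> N \<^bold>: Univ" and A: "\<Gamma> \<turnstile> A \<^bold>: Univ" and B: "\<Gamma> \<turnstile> B \<^bold>: Univ" and X: "\<Gamma> \<turnstile> X \<^bold>: Univ" and Y: "\<Gamma> \<turnstile> Y \<^bold>: Univ"
    and j: "\<Gamma> \<turnstile> j \<^bold>: Arr Y X" and l: "\<Gamma> \<turnstile> l \<^bold>: Arr A Y" and r: "\<Gamma> \<turnstile> r \<^bold>: Arr B Y"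
    and f: "\<Gamma> \<turnstile> f \<^bold>: Arr A X" and g: "\<Gamma> \<turnstile> g \<^bold>: Arr B X" and ff: "\<Gamma> \<turnstile> f \<approx> f' \<^bold>: Arr A X" and gg: "\<Gamma> \<turnstile> g \<approx> g' \<^bold>: Arr B X"
    and q: "\<Gamma> \<turnstile> q \<^bold>: pb_glue A B X f g Y l r"
  shows "\<Gamma> \<turnstile> is_conn_map M A X f \<approx> is_conn_map M A X f' \<^bold>: Ty" "\<Gamma> \<turnstile> is_conn_map N B X g \<approx> is_conn_map N B X g' \<^bold>: Ty"
    "\<Gamma> \<turnstile> pb_glue A B X f g Y l r \<approx> pb_glue A B X f' g' Y l r \<^bold>: Ty"
    "\<Gamma> \<turnstile> pb_ind A B X f g Y l r q \<approx> pb_ind A B X f' g' Y l r q \<^bold>: Ty"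
    "\<Gamma> \<turnstile> pb_comp A B X f g l r q j (pb_htpy A B X f g) \<approx> pb_comp A B X f' g' l r q j (pb_htpy A B X f' g') \<^bold>: Ty"
proof -
  obtain \<sigma> where \<sigma>: "wsub \<Gamma> \<sigma> lib_join_over_connected" using lib_wsub typed_ctx[OF A] by blast
  let ?\<rho> = "r \<cdot> l \<cdot> j \<cdot> Y \<cdot> X \<cdot> B \<cdot> A \<cdot> N \<cdot> M \<cdot> \<sigma>"
  have m: "wsub \<Gamma> ?\<rho> map_ctx"
    by (intro wsub_cons \<sigma>) (use assms in \<open>simp_all add: sub_simps\<close>)
  have c: "eqsub \<Gamma> (g \<cdot> f \<cdot> ?\<rho>) (g' \<cdot> f' \<cdot> ?\<rho>) conv_ctx"
    by (intro eqsub_cons eqsub_refl m) (use f g ff gg in \<open>simp_all add: sub_simps\<close>)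
  note C = conv_ctx_types[THEN eqsub_eq[OF c]]
  show "\<Gamma> \<turnstile> is_conn_map M A X f \<approx> is_conn_map M A X f' \<^bold>: Ty" "\<Gamma> \<turnstile> is_conn_map N B X g \<approx> is_conn_map N B X g' \<^bold>: Ty"
    "\<Gamma> \<turnstile> pb_glue A B X f g Y l r \<approx> pb_glue A B X f' g' Y l r \<^bold>: Ty"
    using C by (simp_all add: sub_simps)
  have i: "eqsub \<Gamma> (q \<cdot> g \<cdot> f \<cdot> ?\<rho>) (q \<cdot> g' \<cdot> f' \<cdot> ?\<rho>) ind_ctx"
    by (rule eqsub_const[OF c]) (use q in \<open>simp add: sub_simps\<close>)
  show "\<Gamma> \<turnstile> pb_ind A B X f g Y l r q \<approx> pb_ind A B X f' g' Y l r q \<^bold>: Ty"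
    using eqsub_eq[OF i ind_ctx_types(1)] by (simp add: sub_simps)
  note G = pb_glue_cong[OF A B X f g ff gg]
  \<comment> \<open>The canonical homotopy ends at \<open>f\<close> and \<open>g\<close>, but the
    type in \<open>comp_ctx\<close> ends at the composites; \<open>G\<close> moves both the homotopy
    and its equation there.\<close>
  have H: "\<Gamma> \<turnstile> pb_htpy A B X f g \<^bold>: pb_glue A B X f g X f' g'"
    "\<Gamma> \<turnstile> pb_htpy A B X f g \<approx> pb_htpy A B X f' g' \<^bold>: pb_glue A B X f g X f' g'"
    using conv[OF pb_typ(2)[OF A B X f g] G] eq_conv[OF pb_htpy_cong[OF A B X f g ff gg] G] by auto
  have "eqsub \<Gamma> (pb_htpy A B X f g \<cdot> q \<cdot> g \<cdot> f \<cdot> ?\<rho>) (pb_htpy A B X f' g' \<cdot> q \<cdot> g' \<cdot> f' \<cdot> ?\<rho>) comp_ctx"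
    by (rule eqsub_cons[OF i]) (use H in \<open>simp_all add: sub_simps f'_def g'_def\<close>)
  from eqsub_eq[OF this comp_ctx_type]
  show "\<Gamma> \<turnstile> pb_comp A B X f g l r q j (pb_htpy A B X f g) \<approx> pb_comp A B X f' g' l r q j (pb_htpy A B X f' g') \<^bold>: Ty"
    by (simp add: sub_simps)
qed

text \<open>With \<open>j\<close> the join map and \<open>l\<close>, \<open>r\<close> the point
  constructors, the point rules and eta make \<open>f\<close> and \<open>g\<close> judgmentally
  equal to \<open>j \<circ> l\<close> and \<open>j \<circ> r\<close>. The pushout itself supplies
  induction and the equation on glueing paths, and after conversion all premises of
  \<open>conn_of_pushout_data\<close> are met.\<close>

theorem theorem6p9:
  fixes \<Gamma> :: "tm list" and M N A B X f g cf cg :: tm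
  assumes "\<Gamma> \<turnstile> M \<^bold>: Univ" and "\<Gamma> \<turnstile> N \<^bold>: Univ"
    and "\<Gamma> \<turnstile> A \<^bold>: Univ" and "\<Gamma> \<turnstile> B \<^bold>: Univ" and "\<Gamma> \<turnstile> X \<^bold>: Univ"
    and "\<Gamma> \<turnstile> f \<^bold>: Arr A X" and "\<Gamma> \<turnstile> g \<^bold>: Arr B X"
    and "\<Gamma> \<turnstile> cf \<^bold>: is_conn_map M A X f"
    and "\<Gamma> \<turnstile> cg \<^bold>: is_conn_map N B X g"
  shows "\<exists>t. \<Gamma> \<turnstile> t \<^bold>: is_conn_map (join_type M N) (join_over A B X f g) X (join_map A B X f g)"
proof -
  note U = assms(1-5) and fg = assms(6,7)
  let ?f1 = "pb_proj1 A B X f g" and ?g1 = "pb_proj2 A B X f g" and ?C = "pullback A B X f g" and ?H = "pb_htpy A B X f g"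
  let ?j = "join_map A B X f g" and ?l = "inl_map A ?f1 ?g1" and ?r = "inr_map B ?f1 ?g1" and ?q = "glue_map ?C ?f1 ?g1"
  note s = pb_typ(1)[OF U(3-5) fg]
  note P = pushout_maps[OF s] and Q = cocone_maps[OF s U(5) fg pb_typ(2)[OF U(3-5) fg], folded join_map_def]
  note C = pushout_data_cong[OF U spanD(6)[OF s] Q(1) P(1,2) fg Q(2,3) P(3)]
  obtain W S where W: "\<Gamma> \<turnstile> W \<^bold>: pb_ind A B X f g (Push ?f1 ?g1) ?l ?r ?q" and S: "\<Gamma> \<turnstile> S \<^bold>: pb_comp A B X f g ?l ?r ?q ?j ?H"
    using P(4) Q(4) by blast
  show ?thesis unfolding join_over_def
    by (rule conn_of_pushout_data[OF U spanD(6)[OF s] Q(1) P(1,2) conv[OF P(3) C(3)] conv[OF W C(4)] conv[OF S C(5)] conv[OF assms(8) C(1)] conv[OF assms(9) C(2)]])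
qed

end
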